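(* Brunella's very special foliation $\mathcal{F}_3$ can be represented in $\mathbb{P}^2$ (that is, it is birationally equivalent to a foliation on $\mathbb{P}^2$) as the degree-two foliation $\mathcal{J}$ defined, in homogeneous coordinates $(x:y:z)$, by the vanishing of $$\Omega=yz(x+y-2z)\,\mathrm{d}x+xz(y+z-2x)\,\mathrm{d}y+xy(z+x-2y)\,\mathrm{d}z.$$ The set of invariant algebraic curves of $\mathcal{J}$ is composed by the nodal cubic $xy^2+yz^2+zx^2-3xyz=0$, representing the link of $\mathcal{F}_3$, and by the three coordinate lines, which are tangent to this cubic. $\mathcal{J}$ is the only degree-two foliation of $\mathbb{P}^2$ leaving invariant this configuration of curves. The group of birational automorphisms of $\mathcal{J}$ is generated by the quartic de Jonquières involution $$J_4(x:y:z)=\bigl(y(y-z)(z-x)^2 : x(x-y)(y-z)^2 : z(z-x)(x-y)^2\bigr)$$ and by the cyclic permutation of the coordinates.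
   Context: All foliations are singular holomorphic foliations by curves with isolated singularities on complex surfaces. A foliation of degree $d$ on $\mathbb{P}^2$ is given by a homogeneous $1$-form $A\,\mathrm{d}x+B\,\mathrm{d}y+C\,\mathrm{d}z$ on $\mathbb{C}^3$ with $A,B,C$ homogeneous of degree $d+1$ without common factor and $xA+yB+zC=0$, up to multiplication by a nonzero constant. Two foliated surfaces are birationally equivalent if there is a birational map between them taking one foliation to the other; a birational automorphism of a foliation is a birational self-map of the surface preserving it. A birational map of $\mathbb{P}^2$ of degree $d$ is de Jonquières if its homaloidal system (the net of curves mapped to lines) has one base point of multiplicity $d-1$ and all other base points (possibly infinitely near) of multiplicity one. Brunella's very special foliation $\mathcal{F}_3$: let $\omega$ be a primitive cubic root of unity and $\mathcal{E}_3$ the foliation on $\mathbb{P}^2$ given by $\omega^2YZ\,\mathrm{d}X+\omega XZ\,\mathrm{d}Y+XY\,\mathrm{d}Z=0$. It is preserved by $T_3(X:Y:Z)=(Z:X:Y)$. Let $M_3$ be the minimal desingularization of $\mathbb{P}^2/\langle T_3\rangle$ (a rational surface); $\mathcal{F}_3$ is the foliation on $M_3$ induced by $\mathcal{E}_3$. The image in $M_3$ of the coordinate triangle $XYZ=0$ is the link $C$ of $\mathcal{F}_3$: an invariant one-nodal rational curve with $C^2=3$, whose node is the only singularity of $\mathcal{F}_3$ on it. That the cubic represents the link means that, under the birational equivalence, its strict transform is $C$. *)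

theory Defs
  imports
    Complex_Main
    "HOL-Library.Poly_Mapping"
    "HOL-Library.Function_Algebras"
    "HOL-Computational_Algebra.Factorial_Ring"
    "HOL-Algebra.Generated_Groups"
begin

type_synonym mpoly = "(nat \<Rightarrow>\<^sub>0 nat) \<Rightarrow>\<^sub>0 complex"

definition Var :: "nat \<Rightarrow> mpoly" where
  "Var i = Poly_Mapping.single (Poly_Mapping.single i 1) 1"

definition Const :: "complex \<Rightarrow> mpoly" where
  "Const c = Poly_Mapping.single 0 c"

definition pvars :: "mpoly \<Rightarrow> nat set" where
  "pvars f = (\<Union>m\<in>Poly_Mapping.keys f. Poly_Mapping.keys m)"

definition tdeg :: "(nat \<Rightarrow>\<^sub>0 nat) \<Rightarrow> nat" where
  "tdeg m = (\<Sum>i\<in>Poly_Mapping.keys m. Poly_Mapping.lookup m i)"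

definition homogeneous :: "nat \<Rightarrow> mpoly \<Rightarrow> bool" where
  "homogeneous d f \<longleftrightarrow> (\<forall>m\<in>Poly_Mapping.keys f. tdeg m = d)"

definition pderiv_wrt :: "nat \<Rightarrow> mpoly \<Rightarrow> mpoly" where
  "pderiv_wrt i f = (\<Sum>m\<in>Poly_Mapping.keys f.
     Poly_Mapping.single (m - Poly_Mapping.single i 1) (of_nat (Poly_Mapping.lookup m i) * Poly_Mapping.lookup f m))"

definition insertion :: "(complex \<Rightarrow> 'b::comm_semiring_1) \<Rightarrow> (nat \<Rightarrow> 'b) \<Rightarrow> mpoly \<Rightarrow> 'b" where
  "insertion h a f = (\<Sum>m\<in>Poly_Mapping.keys f. h (Poly_Mapping.lookup f m) * (\<Prod>i\<in>Poly_Mapping.keys m. a i ^ Poly_Mapping.lookup m i))"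

abbreviation peval :: "(nat \<Rightarrow> complex) \<Rightarrow> mpoly \<Rightarrow> complex" where
  "peval \<equiv> insertion (\<lambda>c. c)"

abbreviation psubst :: "(nat \<Rightarrow> mpoly) \<Rightarrow> mpoly \<Rightarrow> mpoly" where
  "psubst \<equiv> insertion Const"

definition dir_deriv :: "(nat \<Rightarrow> complex) \<Rightarrow> (nat \<Rightarrow> complex) \<Rightarrow> mpoly \<Rightarrow> complex" where
  "dir_deriv p v f = (\<Sum>i\<in>pvars f. peval p (pderiv_wrt i f) * v i)"

definition triple :: "mpoly \<Rightarrow> mpoly \<Rightarrow> mpoly \<Rightarrow> nat \<Rightarrow> mpoly" where
  "triple a b c = (\<lambda>_. 0)(0 := a, 1 := b, 2 := c)"

definition vdim :: "(nat \<Rightarrow> complex) set \<Rightarrow> nat" where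
  "vdim = vector_space.dim (\<lambda>(c::complex) v i. c * v i)"

text \<open>
  A point of projective \<open>n\<close>-space is represented by its unique vector of homogeneous
  coordinates whose first non-zero entry is 1; the coordinates with index above \<open>n\<close> are 0.
  All projective spaces thus live in the same type, so that one can quantify over all
  projective varieties.
\<close>

type_synonym point = "nat \<Rightarrow> complex"

definition proj_space :: "nat \<Rightarrow> point set" where
  "proj_space n = {p. (\<forall>i>n. p i = 0) \<and> (\<exists>k\<le>n. p k = 1 \<and> (\<forall>i<k. p i = 0))}"

abbreviation P2 :: "point set" where
  "P2 \<equiv> proj_space 2"

definition pivot :: "(nat \<Rightarrow> complex) \<Rightarrow> nat" where
  "pivot v = (LEAST k. v k \<noteq> 0)"

definition to_point :: "(nat \<Rightarrow> complex) \<Rightarrow> point" where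
  "to_point v = (\<lambda>i. v i / v (pivot v))"

definition proj_closed :: "point set \<Rightarrow> bool" where
  "proj_closed Z \<longleftrightarrow> (\<exists>n S. (\<forall>f\<in>S. \<exists>d. homogeneous d f) \<and>
     Z = {p \<in> proj_space n. \<forall>f\<in>S. peval p f = 0})"

definition zclosure :: "point set \<Rightarrow> point set" where
  "zclosure A = \<Inter>{Z. proj_closed Z \<and> A \<subseteq> Z}"

definition proj_variety :: "point set \<Rightarrow> bool" where
  "proj_variety X \<longleftrightarrow> proj_closed X \<and> X \<noteq> {} \<and>
     (\<forall>A B. proj_closed A \<longrightarrow> proj_closed B \<longrightarrow> X \<subseteq> A \<union> B \<longrightarrow> X \<subseteq> A \<or> X \<subseteq> B)"

definition vanishing_forms :: "point set \<Rightarrow> mpoly set" where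
  "vanishing_forms X = {f. (\<exists>d. homogeneous d f) \<and> (\<forall>p\<in>X. peval p f = 0)}"

text \<open>
  This is the Zariski tangent space of the affine cone over \<open>X\<close>; it contains the vector \<open>p\<close>
  and its dimension is one more than that of the tangent space of \<open>X\<close> at \<open>p\<close>.
\<close>

definition tangent :: "point set \<Rightarrow> point \<Rightarrow> (nat \<Rightarrow> complex) set" where
  "tangent X p = {v. \<forall>f\<in>vanishing_forms X. dir_deriv p v f = 0}"

definition smooth_surface :: "point set \<Rightarrow> bool" where
  "smooth_surface M \<longleftrightarrow> proj_variety M \<and> (\<forall>p\<in>M. vdim (tangent M p) = 3)"

definition evals :: "(nat \<Rightarrow> mpoly) \<Rightarrow> point \<Rightarrow> nat \<Rightarrow> complex" where
  "evals \<Phi> p = (\<lambda>i. peval p (\<Phi> i))"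

definition form_tuple :: "nat \<Rightarrow> (nat \<Rightarrow> mpoly) \<Rightarrow> bool" where
  "form_tuple d \<Phi> \<longleftrightarrow> (\<forall>i. homogeneous d (\<Phi> i))"

definition same_on :: "point set \<Rightarrow> (nat \<Rightarrow> mpoly) \<Rightarrow> (nat \<Rightarrow> mpoly) \<Rightarrow> bool" where
  "same_on X \<Phi> \<Psi> \<longleftrightarrow>
     (\<forall>p\<in>X. \<forall>i j. peval p (\<Phi> i) * peval p (\<Psi> j) = peval p (\<Phi> j) * peval p (\<Psi> i))"

definition regular_rep :: "point set \<Rightarrow> (nat \<Rightarrow> mpoly) \<Rightarrow> point \<Rightarrow> (nat \<Rightarrow> mpoly) \<Rightarrow> bool" where
  "regular_rep X \<Phi> p \<Psi> \<longleftrightarrow> (\<exists>e. form_tuple e \<Psi>) \<and> same_on X \<Phi> \<Psi> \<and> (\<exists>i. peval p (\<Psi> i) \<noteq> 0)"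

text \<open>
  A rational map is a partial function with its maximal domain of definition, so that equality
  of rational maps is equality of partial functions.
\<close>

definition rmap :: "point set \<Rightarrow> (nat \<Rightarrow> mpoly) \<Rightarrow> point \<rightharpoonup> point" where
  "rmap X \<Phi> p = (if p \<in> X \<and> (\<exists>\<Psi>. regular_rep X \<Phi> p \<Psi>)
     then Some (to_point (evals (SOME \<Psi>. regular_rep X \<Phi> p \<Psi>) p)) else None)"

definition map_tuple :: "point set \<Rightarrow> point set \<Rightarrow> (nat \<Rightarrow> mpoly) \<Rightarrow> bool" where
  "map_tuple X Y \<Phi> \<longleftrightarrow> (\<exists>d. form_tuple d \<Phi>) \<and> (\<exists>p\<in>X. \<exists>i. peval p (\<Phi> i) \<noteq> 0) \<and>
     (\<forall>p\<in>X. (\<exists>i. peval p (\<Phi> i) \<noteq> 0) \<longrightarrow> to_point (evals \<Phi> p) \<in> Y)"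

definition rational_maps :: "point set \<Rightarrow> point set \<Rightarrow> (point \<rightharpoonup> point) set" where
  "rational_maps X Y = {rmap X \<Phi> | \<Phi>. map_tuple X Y \<Phi>}"

definition regular_maps :: "point set \<Rightarrow> point set \<Rightarrow> (point \<rightharpoonup> point) set" where
  "regular_maps X Y = {f \<in> rational_maps X Y. dom f = X}"

definition rcomp :: "point set \<Rightarrow> point set \<Rightarrow> (point \<rightharpoonup> point) \<Rightarrow> (point \<rightharpoonup> point) \<Rightarrow> (point \<rightharpoonup> point)" where
  "rcomp X Z g f = (THE h. h \<in> rational_maps X Z \<and> (g \<circ>\<^sub>m f) \<subseteq>\<^sub>m h)"

definition birational_maps :: "point set \<Rightarrow> point set \<Rightarrow> (point \<rightharpoonup> point) set" where
  "birational_maps X Y = {f \<in> rational_maps X Y. \<exists>g \<in> rational_maps Y X.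
     dom (g \<circ>\<^sub>m f) \<noteq> {} \<and> (g \<circ>\<^sub>m f) \<subseteq>\<^sub>m Some \<and> dom (f \<circ>\<^sub>m g) \<noteq> {} \<and> (f \<circ>\<^sub>m g) \<subseteq>\<^sub>m Some}"

definition bir_group :: "point set \<Rightarrow> (point \<rightharpoonup> point) monoid" where
  "bir_group X = \<lparr>carrier = birational_maps X X, mult = rcomp X X, one = Some |` X\<rparr>"

text \<open>
  The closure of the image of the part of \<open>A\<close> where \<open>f\<close> is defined. For a birational map
  \<open>f\<close> and a curve \<open>A\<close> this is the strict transform of \<open>A\<close>.
\<close>

definition proper_image :: "(point \<rightharpoonup> point) \<Rightarrow> point set \<Rightarrow> point set" where
  "proper_image f A = zclosure {y. \<exists>p\<in>A. f p = Some y}"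

text \<open>
  The quotient is the categorical quotient in projective varieties: for the action of a finite
  group on a projective variety it exists and is the usual orbit space with the invariant
  functions. Invariance under a generator is invariance under the generated group.
\<close>

definition quotient_by :: "point set \<Rightarrow> (point \<rightharpoonup> point) \<Rightarrow> point set \<Rightarrow> (point \<rightharpoonup> point) \<Rightarrow> bool" where
  "quotient_by S T X q \<longleftrightarrow> proj_variety X \<and> q \<in> regular_maps S X \<and> q \<circ>\<^sub>m T = q \<and>
     (\<forall>Y f. proj_variety Y \<longrightarrow> f \<in> regular_maps S Y \<longrightarrow> f \<circ>\<^sub>m T = f \<longrightarrow>
        (\<exists>!g. g \<in> regular_maps X Y \<and> g \<circ>\<^sub>m q = f))"

definition desingularization :: "point set \<Rightarrow> point set \<Rightarrow> (point \<rightharpoonup> point) \<Rightarrow> bool" where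
  "desingularization X M r \<longleftrightarrow>
     smooth_surface M \<and> r \<in> regular_maps M X \<and> r \<in> birational_maps M X"

definition minimal_desingularization :: "point set \<Rightarrow> point set \<Rightarrow> (point \<rightharpoonup> point) \<Rightarrow> bool" where
  "minimal_desingularization X M r \<longleftrightarrow> desingularization X M r \<and>
     (\<forall>M' r'. desingularization X M' r' \<longrightarrow> (\<exists>h \<in> regular_maps M' M. r \<circ>\<^sub>m h = r'))"

text \<open>
  A 1-form with homogeneous coefficients \<open>A\<close> on the affine cone has a kernel in every tangent
  space of the cone over \<open>X\<close>. A foliation is represented by the field of these kernels: the
  fibre over a regular point is the (cone over the) tangent direction of the leaf, the fibre
  over a singular point is the whole tangent space.
\<close>

definition ker_form :: "point set \<Rightarrow> (nat \<Rightarrow> mpoly) \<Rightarrow> (point \<times> (nat \<Rightarrow> complex)) set" where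
  "ker_form X A = {(p, v). p \<in> X \<and> v \<in> tangent X p \<and> (\<Sum>i | v i \<noteq> 0. peval p (A i) * v i) = 0}"

definition fol_sing :: "point set \<Rightarrow> (point \<times> (nat \<Rightarrow> complex)) set \<Rightarrow> point set" where
  "fol_sing M F = {p \<in> M. F `` {p} = tangent M p}"

text \<open>
  The condition that \<open>(p, p)\<close> belongs to \<open>F\<close> says that the local 1-forms annihilate the Euler
  field, that is, descend from the cone to \<open>M\<close>.
\<close>

definition foliation :: "point set \<Rightarrow> (point \<times> (nat \<Rightarrow> complex)) set \<Rightarrow> bool" where
  "foliation M F \<longleftrightarrow> F \<subseteq> (SIGMA p:M. tangent M p) \<and> (\<forall>p\<in>M. (p, p) \<in> F) \<and>
     finite (fol_sing M F) \<and>
     (\<forall>p\<in>M. \<exists>d A Z. form_tuple d A \<and> proj_closed Z \<and> p \<notin> Z \<and>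
        (\<forall>s \<in> M - Z. F `` {s} = ker_form M A `` {s}))"

text \<open>
  \<open>f\<close> maps the foliation \<open>F\<close> of \<open>X\<close> to the foliation \<open>G\<close> of \<open>Y\<close> generically, that is,
  \<open>F\<close> is the pull-back of \<open>G\<close>. A foliation with isolated singularities is determined by its
  restriction to a non-empty Zariski open set.
\<close>

definition pulls_back ::
  "(point \<rightharpoonup> point) \<Rightarrow> point set \<Rightarrow> (point \<times> (nat \<Rightarrow> complex)) set \<Rightarrow>
   (point \<times> (nat \<Rightarrow> complex)) set \<Rightarrow> bool" where
  "pulls_back f X F G \<longleftrightarrow> (\<exists>d \<Phi> Z. form_tuple d \<Phi> \<and> f = rmap X \<Phi> \<and> proj_closed Z \<and> \<not> X \<subseteq> Z \<and>
     (\<forall>p \<in> X - Z. (\<exists>i. peval p (\<Phi> i) \<noteq> 0) \<and>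
        (\<forall>v \<in> tangent X p.
           (p, v) \<in> F \<longleftrightarrow> (to_point (evals \<Phi> p), \<lambda>j. dir_deriv p v (\<Phi> j)) \<in> G)))"

definition bir_aut :: "point set \<Rightarrow> (point \<times> (nat \<Rightarrow> complex)) set \<Rightarrow> (point \<rightharpoonup> point) set" where
  "bir_aut X F = {f \<in> birational_maps X X. pulls_back f X F F}"

definition plane_foliation_form :: "nat \<Rightarrow> (nat \<Rightarrow> mpoly) \<Rightarrow> bool" where
  "plane_foliation_form d A \<longleftrightarrow>
     (\<forall>i\<le>2. homogeneous (d + 1) (A i) \<and> pvars (A i) \<subseteq> {..2}) \<and> (\<forall>i>2. A i = 0) \<and>
     (\<forall>g. (\<forall>i\<le>2. g dvd A i) \<longrightarrow> g dvd 1) \<and>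
     (\<Sum>i\<le>2. Var i * A i) = 0"

definition plane_curve :: "mpoly \<Rightarrow> point set" where
  "plane_curve f = {p \<in> P2. peval p f = 0}"

definition curve_form :: "nat \<Rightarrow> mpoly \<Rightarrow> bool" where
  "curve_form d f \<longleftrightarrow> homogeneous d f \<and> pvars f \<subseteq> {..2} \<and> irreducible f"

definition irreducible_plane_curve :: "point set \<Rightarrow> bool" where
  "irreducible_plane_curve C \<longleftrightarrow> (\<exists>d f. curve_form d f \<and> C = plane_curve f)"

definition curve_smooth_at :: "point set \<Rightarrow> point \<Rightarrow> bool" where
  "curve_smooth_at C p \<longleftrightarrow> p \<in> C \<and> vdim (tangent C p) = 2"

definition invariant_curve :: "(point \<times> (nat \<Rightarrow> complex)) set \<Rightarrow> point set \<Rightarrow> bool" where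
  "invariant_curve F C \<longleftrightarrow> (\<forall>p. curve_smooth_at C p \<longrightarrow> tangent C p \<subseteq> F `` {p})"

definition tangent_curves :: "point set \<Rightarrow> point set \<Rightarrow> bool" where
  "tangent_curves C D \<longleftrightarrow>
     (\<exists>p. curve_smooth_at C p \<and> curve_smooth_at D p \<and> tangent C p = tangent D p)"

text \<open>
  The equation of a plane curve in the affine coordinates \<open>Var 0, Var 1\<close> centred at \<open>p\<close> of the
  standard chart where the first non-zero coordinate of \<open>p\<close> is 1.
\<close>

definition localize :: "point \<Rightarrow> mpoly \<Rightarrow> mpoly" where
  "localize p f = psubst (\<lambda>i. Const (p i) +
     (if i < pivot p then Var i else if i = pivot p then 0 else Var (i - 1))) f"

definition mult_origin :: "mpoly set \<Rightarrow> nat" where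
  "mult_origin L = (LEAST n. \<exists>f\<in>L. \<exists>m\<in>Poly_Mapping.keys f. tdeg m = n)"

definition node_at :: "mpoly \<Rightarrow> point \<Rightarrow> bool" where
  "node_at f p \<longleftrightarrow> (let g = localize p f;
       a = Poly_Mapping.lookup g (Poly_Mapping.single 0 2);
       b = Poly_Mapping.lookup g (Poly_Mapping.single 0 1 + Poly_Mapping.single 1 1);
       c = Poly_Mapping.lookup g (Poly_Mapping.single 1 2)
     in mult_origin {g} = 2 \<and> b\<^sup>2 \<noteq> 4 * a * c)"

definition nodal_cubic :: "mpoly \<Rightarrow> bool" where
  "nodal_cubic f \<longleftrightarrow> curve_form 3 f \<and>
     (\<exists>p \<in> plane_curve f. node_at f p \<and>
        (\<forall>p' \<in> plane_curve f. mult_origin {localize p' f} \<ge> 2 \<longrightarrow> p' = p))"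

text \<open>
  A list of directions encodes a point infinitely near to the origin of the affine plane with
  coordinates \<open>u = Var 0, v = Var 1\<close>: \<open>Some t\<close> is the point of the exceptional curve
  corresponding to \<open>v = t * u\<close>, \<open>None\<close> the one corresponding to \<open>u = 0\<close>, and the next entries
  are infinitely near to that point.
\<close>

definition blow_up :: "complex option \<Rightarrow> mpoly set \<Rightarrow> mpoly set" where
  "blow_up t L = (case t of
      Some c \<Rightarrow> {g. \<exists>f\<in>L. Var 0 ^ mult_origin L * g
                    = psubst (\<lambda>i. if i = 0 then Var 0 else Var 0 * (Var 1 + Const c)) f}
    | None \<Rightarrow> {g. \<exists>f\<in>L. Var 1 ^ mult_origin L * g
                    = psubst (\<lambda>i. if i = 0 then Var 0 * Var 1 else Var 1) f})"

definition homaloidal_net :: "(nat \<Rightarrow> mpoly) \<Rightarrow> mpoly set" where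
  "homaloidal_net \<Phi> = {(\<Sum>i\<le>2. Const (c i) * \<Phi> i) | c. True}"

text \<open>
  The multiplicity of a base point is that of a general member of the linear system, which is
  the minimum over all members.
\<close>

definition base_mult :: "(nat \<Rightarrow> mpoly) \<Rightarrow> point \<times> complex option list \<Rightarrow> nat" where
  "base_mult \<Phi> b = (case b of (p, ds) \<Rightarrow>
     mult_origin (fold blow_up ds (localize p ` homaloidal_net \<Phi>)))"

definition plane_birational_of_degree :: "nat \<Rightarrow> (nat \<Rightarrow> mpoly) \<Rightarrow> bool" where
  "plane_birational_of_degree d \<Phi> \<longleftrightarrow>
     (\<forall>i\<le>2. homogeneous d (\<Phi> i) \<and> pvars (\<Phi> i) \<subseteq> {..2}) \<and> (\<forall>i>2. \<Phi> i = 0) \<and>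
     (\<forall>g. (\<forall>i\<le>2. g dvd \<Phi> i) \<longrightarrow> g dvd 1) \<and>
     rmap P2 \<Phi> \<in> birational_maps P2 P2"

definition de_jonquieres :: "nat \<Rightarrow> (nat \<Rightarrow> mpoly) \<Rightarrow> bool" where
  "de_jonquieres d \<Phi> \<longleftrightarrow> plane_birational_of_degree d \<Phi> \<and>
     (\<exists>b \<in> P2 \<times> UNIV. base_mult \<Phi> b = d - 1 \<and>
        (\<forall>b' \<in> P2 \<times> UNIV. b' \<noteq> b \<longrightarrow> base_mult \<Phi> b' \<noteq> 0 \<longrightarrow> base_mult \<Phi> b' = 1))"

definition T3 :: "point \<rightharpoonup> point" where
  "T3 = rmap P2 (triple (Var 2) (Var 0) (Var 1))"

definition E3 :: "complex \<Rightarrow> (point \<times> (nat \<Rightarrow> complex)) set" where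
  "E3 \<omega> = (let X = Var 0; Y = Var 1; Z = Var 2 in
     ker_form P2 (triple (Const (\<omega>\<^sup>2) * Y * Z) (Const \<omega> * X * Z) (X * Y)))"

text \<open>
  \<open>M\<close> is the minimal desingularization of the quotient of the plane by \<open>T3\<close>, \<open>\<pi>\<close> the induced
  rational map from the plane to \<open>M\<close>, and \<open>F\<close> the foliation on \<open>M\<close> induced by \<open>E3\<close>.
\<close>

definition brunella_very_special ::
  "point set \<Rightarrow> (point \<rightharpoonup> point) \<Rightarrow> (point \<times> (nat \<Rightarrow> complex)) set \<Rightarrow> bool" where
  "brunella_very_special M \<pi> F \<longleftrightarrow> (\<exists>\<omega> X q r. \<omega> ^ 3 = 1 \<and> \<omega> \<noteq> 1 \<and>
     quotient_by P2 T3 X q \<and> minimal_desingularization X M r \<and>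
     \<pi> \<in> rational_maps P2 M \<and> (r \<circ>\<^sub>m \<pi>) \<subseteq>\<^sub>m q \<and>
     foliation M F \<and> pulls_back \<pi> P2 (E3 \<omega>) F)"

definition triangle :: "point set" where
  "triangle = plane_curve (Var 0 * Var 1 * Var 2)"

definition brunella_link :: "(point \<rightharpoonup> point) \<Rightarrow> point set" where
  "brunella_link \<pi> = proper_image \<pi> triangle"

definition Omega :: "nat \<Rightarrow> mpoly" where
  "Omega = (let x = Var 0; y = Var 1; z = Var 2 in
     triple (y * z * (x + y - 2 * z)) (x * z * (y + z - 2 * x)) (x * y * (z + x - 2 * y)))"

definition J_fol :: "(point \<times> (nat \<Rightarrow> complex)) set" where
  "J_fol = ker_form P2 Omega"

definition cubic :: mpoly where
  "cubic = (let x = Var 0; y = Var 1; z = Var 2 in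
     x * y\<^sup>2 + y * z\<^sup>2 + z * x\<^sup>2 - 3 * x * y * z)"

definition J_curves :: "point set set" where
  "J_curves = {plane_curve cubic, plane_curve (Var 0), plane_curve (Var 1), plane_curve (Var 2)}"

definition J4 :: "nat \<Rightarrow> mpoly" where
  "J4 = (let x = Var 0; y = Var 1; z = Var 2 in
     triple (y * (y - z) * (z - x)\<^sup>2) (x * (x - y) * (y - z)\<^sup>2) (z * (z - x) * (x - y)\<^sup>2))"

definition cyclic_perm :: "nat \<Rightarrow> mpoly" where
  "cyclic_perm = triple (Var 1) (Var 2) (Var 0)"

end

theory Submission
 imports
  Defs
  "HOL-Computational_Algebra.Computational_Algebra"
  "HOL-Computational_Algebra.Field_as_Ring"
begin

text \<open>Let a, b, c be linear forms diagonalizing the cyclic permutation of X, Y, Z, with eigenvalues 1, w, w^2 up to order. The map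
 (a^2 b : b^2 c : c^2 a) is the quotient by that permutation; it pulls the given foliation back to the linear one and the cubic back to the
 triangle XYZ = 0. Since 1, w, w^2 have distinct integral combinations in each degree, the linear foliation has no other invariant curves. A birational
 symmetry lifts to this triple cover because the cube of its cofactor is a first integral times an explicit form, hence a constant multiple of it.
 A lift preserves the logarithmic form with residues 1, w^2, w, so it is monomial with exponents given by an element of Z[w]; generic injectivity
 forces that element to be one of the six units, and commutation with the permutation leaves six maps downstairs.\<close>

text \<open>Why a symmetry lifts: the components a^2 b, b^2 c, c^2 a have product (abc)^3, so the
  cover adjoins a cube root of xyz, and what has to be shown is that the product of the components
  of a symmetry becomes, up to known cubes, a cube upstairs. The closed form obtained by dividing by
  the cubic and by a cube root of xyz delivers this: the lifted form vanishes on the linear field,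
  and its value on a transverse diagonal field is the root wanted. Brunella's surface is a second
  obstacle, since it is known only through the universal property of a quotient and a resolution. To
  compare it with the plane one needs a regular invariant map out of the covering plane; the cover
  has base points, but the cubics a^3, abc, b^3, c^3 have no common zero, and a projection recovers
  the cover from them. Two devices serve throughout: forms are moved to nested univariate
  polynomials to gain unique factorisation, and statements on dense open sets are handled by a
  filter, because rational maps carry maximal domains.\<close>

abbreviation "lookup \<equiv> Poly_Mapping.lookup"
abbreviation "single \<equiv> Poly_Mapping.single"
abbreviation "keys \<equiv> Poly_Mapping.keys"

section \<open>Evaluation and substitution of polynomials\<close>

definition coeff_hom :: "(complex => 'b::comm_semiring_1) => bool" where
 "coeff_hom h \<longleftrightarrow> h 0 = 0 \<and> h 1 = 1 \<and> (\<forall>x y. h (x + y) = h x + h y) \<and> (\<forall>x y. h (x * y) = h x * h y)"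

lemma coeff_homD:
 assumes "coeff_hom h"
 shows "h 0 = 0" "h 1 = 1" "h (x + y) = h x + h y" "h (x * y) = h x * h y"
 using assms by (auto simp: coeff_hom_def)

lemma coeff_hom_id [simp]: "coeff_hom (%c. c)"
 by (simp add: coeff_hom_def)

lemma coeff_hom_Const [simp]: "coeff_hom Const"
 by (simp add: coeff_hom_def Const_def single_add mult_single)

lemma coeff_hom_pConst [simp]: "coeff_hom h ==> coeff_hom (%c. [:h c:])"
 by (auto simp: coeff_hom_def mult.commute)

definition mon :: "(nat => 'b::comm_semiring_1) => (nat \<Rightarrow>\<^sub>0 nat) => 'b" where
 "mon a m = (\<Prod>i\<in>keys m. a i ^ lookup m i)"

lemma mon_superset:
 "finite A ==> keys m \<subseteq> A ==> mon a m = (\<Prod>i\<in>A. a i ^ lookup m i)"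
 unfolding mon_def by (rule prod.mono_neutral_left) (auto simp: in_keys_iff)

lemma mon_0 [simp]: "mon a 0 = 1"
 by (simp add: mon_def)

lemma mon_single [simp]: "mon a (single i k) = a i ^ k"
 by (simp add: mon_def)

lemma mon_add: "mon a (m + n) = mon a m * mon a n"
proof -
 let ?A = "keys m \<union> keys n"
 have "mon a (m + n) = (\<Prod>i\<in>?A. a i ^ lookup (m + n) i)"
  by (rule mon_superset) (auto dest: subsetD[OF keys_add])
 also have "\<dots> = (\<Prod>i\<in>?A. a i ^ lookup m i) * (\<Prod>i\<in>?A. a i ^ lookup n i)"
  by (simp add: lookup_add power_add prod.distrib)
 also have "\<dots> = mon a m * mon a n"
  by (simp add: mon_superset[of ?A])
 finally show ?thesis .
qed

lemma insertion_superset: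
 assumes "coeff_hom h" "finite A" "keys f \<subseteq> A"
 shows "insertion h a f = (\<Sum>m\<in>A. h (lookup f m) * mon a m)"
 unfolding insertion_def mon_def
 by (rule sum.mono_neutral_left) (use assms coeff_homD[OF assms(1)] in \<open>auto simp: in_keys_iff\<close>)

lemma insertion_0 [simp]: "insertion h a 0 = 0"
 by (simp add: insertion_def)

lemma insertion_single:
 "coeff_hom h ==> insertion h a (single m c) = h c * mon a m"
 by (subst insertion_superset[of _ "{m}"]) auto

lemma insertion_add [simp]:
 assumes "coeff_hom h"
 shows "insertion h a (f + g) = insertion h a f + insertion h a g"
proof -
 let ?A = "keys f \<union> keys g"
 show ?thesis
  by (simp add: insertion_superset[OF assms, of ?A] keys_add lookup_add coeff_homD[OF assms]
    distrib_right sum.distrib)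
qed

lemma insertion_sum [simp]:
 "coeff_hom h ==> insertion h a (sum F A) = (\<Sum>i\<in>A. insertion h a (F i))"
 by (induction A rule: infinite_finite_induct) auto

lemma mpoly_sum_single: "f = (\<Sum>m\<in>keys f. single m (lookup f m))"
 by (rule poly_mapping_eqI) (simp add: lookup_sum lookup_single when_def in_keys_iff)

lemma insertion_mult [simp]:
 assumes h: "coeff_hom h"
 shows "insertion h a (f * g) = insertion h a f * insertion h a g"
proof -
 let ?s = "%f m. single m (lookup f m)"
 have 1: "f * g = (\<Sum>m\<in>keys f. ?s f m) * (\<Sum>m\<in>keys g. ?s g m)"
  using mpoly_sum_single[of f] mpoly_sum_single[of g] by metis
 show ?thesis
  unfolding 1 sum_product insertion_sum[OF h]
  by (simp add: h insertion_single mult_single coeff_homD[OF h] mon_add insertion_superset[OF h finite_keys order.refl, of _ f]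
    insertion_superset[OF h finite_keys order.refl, of _ g] sum_product mult.assoc mult.left_commute)
qed

lemma Const_0 [simp]: "Const 0 = 0" and Const_1 [simp]: "Const 1 = 1"
 by (simp_all add: Const_def)

lemma insertion_Const [simp]: "coeff_hom h ==> insertion h a (Const c) = h c"
 by (simp add: Const_def insertion_single)

lemma insertion_Var [simp]: "coeff_hom h ==> insertion h a (Var i) = a i"
 by (simp add: Var_def insertion_single coeff_homD)

lemma insertion_1 [simp]: "coeff_hom h ==> insertion h a 1 = 1"
 using insertion_Const[of h a 1] by (simp add: coeff_homD del: insertion_Const)

lemma insertion_power [simp]: "coeff_hom h ==> insertion h a (f ^ n) = insertion h a f ^ n"
 by (induction n) auto

lemma insertion_of_nat [simp]: "coeff_hom h ==> insertion h a (of_nat n) = of_nat n"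
 by (induction n) auto

lemma insertion_numeral [simp]: "coeff_hom h ==> insertion h a (numeral k) = numeral k"
 using insertion_of_nat[of h a "numeral k"] by simp

lemma insertion_uminus [simp]:
 fixes h :: "complex => 'b::comm_ring_1"
 assumes "coeff_hom h" shows "insertion h a (- f) = - insertion h a f"
 using insertion_add[OF assms, of a f "- f"] by (simp add: eq_neg_iff_add_eq_0 add.commute)

lemma insertion_minus [simp]:
 fixes h :: "complex => 'b::comm_ring_1"
 assumes "coeff_hom h" shows "insertion h a (f - g) = insertion h a f - insertion h a g"
 using insertion_add[OF assms, of a f "- g"] assms by simp

lemma insertion_prod [simp]:
 "coeff_hom h ==> insertion h a (prod F A) = (\<Prod>i\<in>A. insertion h a (F i))"
 by (induction A rule: infinite_finite_induct) auto

lemma Const_add: "Const (a + b) = Const a + Const b"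
 and Const_mult: "Const (a * b) = Const a * Const b"
 by (simp_all add: Const_def single_add mult_single)

lemma Const_uminus: "Const (- a) = - Const a"
 by (simp add: Const_def single_uminus)

lemma Const_numeral [simp]: "Const (numeral k) = numeral k"
 by (simp add: Const_def)

lemma Const_of_nat [simp]: "Const (of_nat k) = of_nat k"
 by (simp add: Const_def)

lemma Const_power: "Const (a ^ n) = Const a ^ n"
 by (induction n) (simp_all add: Const_mult)

lemma Const_inject [simp]: "Const a = Const b \<longleftrightarrow> a = b"
 by (metis Const_def lookup_single_eq)

lemma Const_eq_0_iff [simp]: "Const a = 0 \<longleftrightarrow> a = 0"
 using Const_inject[of a 0] by simp

lemma Var_power: "Var i ^ n = single (single i n) 1"
proof (induction n)
 case (Suc n)
 then show ?case by (simp add: Var_def mult_single flip: single_add)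
qed simp

lemma mon_Var: "mon Var m = single m 1"
proof -
 have *: "(\<Prod>i\<in>A. single (e i) (1::complex)) = single (sum e A) 1"
  if "finite A" for A and e :: "nat => (nat \<Rightarrow>\<^sub>0 nat)"
  using that by (induction A) (simp_all add: mult_single)
 have "m = (\<Sum>i\<in>keys m. single i (lookup m i))"
  by (rule poly_mapping_eqI) (simp add: lookup_sum lookup_single when_def in_keys_iff)
 then show ?thesis
  unfolding mon_def by (simp add: Var_power *)
qed

lemma single_eq_Const_mon: "single m c = Const c * mon Var m"
 by (simp add: mon_Var Const_def mult_single)

text \<open>Constants and variables generate the polynomials under sums and products, so identities
  between ring homomorphisms or derivations need to be checked on generators only.\<close>

lemma mpoly_induct [case_names Const Var add mult]:
 assumes C: "!!c. P (Const c)" and V: "!!i. P (Var i)"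
  and A: "!!f g. P f ==> P g ==> P (f + g)" and M: "!!f g. P f ==> P g ==> P (f * g)"
 shows "P f"
proof -
 have 1: "P 1" using C[of 1] by simp
 have pw: "P (Var i ^ n)" for i n by (induction n) (auto intro: 1 V M)
 have pr: "P (prod F A)" if "!!i. i \<in> A ==> P (F i)" "finite A" for F and A :: "nat set"
  using that(2,1) by (induction A) (auto intro: 1 M)
 have sm: "P (sum F A)" if "!!i. i \<in> A ==> P (F i)" "finite A" for F and A :: "(nat \<Rightarrow>\<^sub>0 nat) set"
  using that(2,1) C[of 0] by (induction A) (auto intro: A)
 have "P (single m c)" for m c
  unfolding single_eq_Const_mon mon_def by (intro M C pr pw) auto
 then show ?thesis
  by (subst mpoly_sum_single) (intro sm, auto)
qed

text \<open>A ring homomorphism applied after an evaluation is again an evaluation. Composition of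
  substitutions, values of nested polynomials and the specialisations of an auxiliary variable T all
  come from this fact.\<close>

lemma insertion_hom_comp:
 assumes k: "coeff_hom k" and h: "coeff_hom h"
  and add: "!!x y. \<theta> (x + y) = \<theta> x + \<theta> y" and mult: "!!x y. \<theta> (x * y) = \<theta> x * \<theta> y"
  and c: "!!c. \<theta> (k c) = h c"
 shows "\<theta> (insertion k a f) = insertion h (%i. \<theta> (a i)) f"
 by (induction f rule: mpoly_induct) (simp_all add: k h add mult c)

lemma insertion_psubst [simp]:
 assumes "coeff_hom h"
 shows "insertion h a (psubst \<Phi> f) = insertion h (%i. insertion h a (\<Phi> i)) f"
 by (rule insertion_hom_comp) (use assms in auto)

lemma insertion_id [simp]: "psubst Var f = f"
 by (induction f rule: mpoly_induct) auto

lemma peval_insertion: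
 "coeff_hom h ==> (!!x y. \<theta> (x + y) = \<theta> x + \<theta> y) ==> (!!x y. \<theta> (x * y) = \<theta> x * \<theta> y) ==>
  (!!c. \<theta> (h c) = c) ==> \<theta> (insertion h a f) = peval (%i. \<theta> (a i)) f"
 by (rule insertion_hom_comp) auto

lemma insertion_cong:
 assumes "!!i. i \<in> pvars f ==> a i = b i"
 shows "insertion h a f = insertion h b f"
proof -
 have "(\<Prod>i\<in>keys m. a i ^ lookup m i) = (\<Prod>i\<in>keys m. b i ^ lookup m i)"
  if "m \<in> keys f" for m
  by (rule prod.cong) (use that assms in \<open>force simp: pvars_def\<close>)+
 then show ?thesis unfolding insertion_def by (intro sum.cong) auto
qed

subsection \<open>Variables and degrees\<close>

lemma finite_pvars [simp]: "finite (pvars f)"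
 by (simp add: pvars_def)

lemma pvars_add: "pvars (f + g) \<subseteq> pvars f \<union> pvars g"
 using keys_add[of f g] by (auto simp: pvars_def)

lemma pvars_mult: "pvars (f * g) \<subseteq> pvars f \<union> pvars g"
proof
 fix i assume "i \<in> pvars (f * g)"
 then obtain m where "m \<in> keys (f * g)" "i \<in> keys m" by (auto simp: pvars_def)
 then obtain a b where "a \<in> keys f" "b \<in> keys g" "i \<in> keys (a + b)"
  using keys_mult[of f g] by blast
 then show "i \<in> pvars f \<union> pvars g"
  using keys_add[of a b] by (auto simp: pvars_def)
qed

lemma pvars_uminus [simp]: "pvars (- f) = pvars f"
 by (auto simp: pvars_def in_keys_iff)

lemma pvars_Const [simp]: "pvars (Const c) = {}"
 by (auto simp: pvars_def Const_def split: if_splits)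

lemma pvars_0 [simp]: "pvars 0 = {}" and pvars_1 [simp]: "pvars 1 = {}"
 using pvars_Const[of 0] pvars_Const[of 1] by simp_all

lemma pvars_numeral [simp]: "pvars (numeral k) = {}"
 using pvars_Const[of "numeral k"] by simp

lemma pvars_Var [simp]: "pvars (Var i) = {i}"
 by (auto simp: pvars_def Var_def)

text \<open>The type \<open>mpoly\<close> has a variable for every natural number. Plane geometry
  uses the bound 2, and this form of the bound passes through ring operations by
  simplification.\<close>

definition vars_le :: "nat => mpoly => bool" where
 "vars_le n f \<longleftrightarrow> pvars f \<subseteq> {..n}"

lemma vars_le_simps [simp]:
 "vars_le n (Const c)" "vars_le n 0" "vars_le n 1" "vars_le n (numeral k)"
 "vars_le n (Var i) \<longleftrightarrow> i \<le> n" "vars_le n (- f) \<longleftrightarrow> vars_le n f"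
 by (auto simp: vars_le_def)

lemma vars_le_add [simp]: "vars_le n f ==> vars_le n g ==> vars_le n (f + g)"
 using pvars_add[of f g] by (auto simp: vars_le_def)

lemma vars_le_mult [simp]: "vars_le n f ==> vars_le n g ==> vars_le n (f * g)"
 using pvars_mult[of f g] by (auto simp: vars_le_def)

lemma vars_le_diff [simp]: "vars_le n f ==> vars_le n g ==> vars_le n (f - g)"
 using vars_le_add[of n f "- g"] by simp

lemma vars_le_power [simp]: "vars_le n f ==> vars_le n (f ^ k)"
 by (induction k) auto

lemma vars_le_sum [simp]: "(!!i. i \<in> A ==> vars_le n (F i)) ==> vars_le n (sum F A)"
 by (induction A rule: infinite_finite_induct) auto

lemma vars_le_prod [simp]: "(!!i. i \<in> A ==> vars_le n (F i)) ==> vars_le n (prod F A)"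
 by (induction A rule: infinite_finite_induct) auto

lemma vars_le_psubst:
 assumes "!!i. i \<in> pvars f ==> vars_le n (\<Phi> i)" shows "vars_le n (psubst \<Phi> f)"
 unfolding insertion_def by (intro vars_le_sum vars_le_mult vars_le_prod vars_le_power assms) (auto simp: pvars_def)

lemma vars_le_lookup: "vars_le n f ==> m \<in> keys f ==> n < i ==> lookup m i = 0"
 by (force simp: vars_le_def pvars_def in_keys_iff)

lemma tdeg_superset: "finite A ==> keys m \<subseteq> A ==> tdeg m = (\<Sum>i\<in>A. lookup m i)"
 unfolding tdeg_def by (rule sum.mono_neutral_left) (auto simp: in_keys_iff)

lemma tdeg_0 [simp]: "tdeg 0 = 0" and tdeg_single [simp]: "tdeg (single i k) = k"
 by (simp_all add: tdeg_def)

lemma tdeg_add [simp]: "tdeg (m + n) = tdeg m + tdeg n"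
proof -
 let ?A = "keys m \<union> keys n"
 show ?thesis
  by (simp add: tdeg_superset[of ?A] keys_add lookup_add sum.distrib)
qed

lemma homogeneous_0 [simp]: "homogeneous d 0"
 by (simp add: homogeneous_def)

lemma homogeneous_Const [simp]: "homogeneous 0 (Const c)"
 by (auto simp: homogeneous_def Const_def split: if_splits)

lemma homogeneous_1 [simp]: "homogeneous 0 1" and homogeneous_numeral [simp]: "homogeneous 0 (numeral k)"
 using homogeneous_Const[of 1] homogeneous_Const[of "numeral k"] by simp_all

lemma homogeneous_Var [simp]: "homogeneous (Suc 0) (Var i)"
 by (auto simp: homogeneous_def Var_def)

lemma homogeneous_add: "homogeneous d f ==> homogeneous d g ==> homogeneous d (f + g)"
 using keys_add[of f g] by (auto simp: homogeneous_def)

lemma homogeneous_uminus [simp]: "homogeneous d (- f) = homogeneous d f"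
 by (auto simp: homogeneous_def in_keys_iff)

lemma homogeneous_diff: "homogeneous d f ==> homogeneous d g ==> homogeneous d (f - g)"
 using homogeneous_add[of d f "- g"] by simp

lemma homogeneous_mult: "homogeneous d f ==> homogeneous e g ==> homogeneous (d + e) (f * g)"
 using keys_mult[of f g] by (fastforce simp: homogeneous_def)

lemma homogeneous_power: "homogeneous d f ==> homogeneous (n * d) (f ^ n)"
 by (induction n) (auto intro: homogeneous_mult)

lemma homogeneous_sum: "(!!i. i \<in> A ==> homogeneous d (F i)) ==> homogeneous d (sum F A)"
 by (induction A rule: infinite_finite_induct) (auto intro: homogeneous_add)

lemma homogeneous_prod:
 "finite A ==> (!!i. i \<in> A ==> homogeneous (e i) (F i)) ==> homogeneous (sum e A) (prod F A)"
 by (induction A rule: finite_induct) (auto intro: homogeneous_mult)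

lemma homogeneous_psubst:
 assumes "homogeneous d f" "!!i. i \<in> pvars f ==> homogeneous e (\<Phi> i)"
 shows "homogeneous (d * e) (psubst \<Phi> f)"
 unfolding insertion_def
proof (rule homogeneous_sum)
 fix m assume m: "m \<in> keys f"
 have "homogeneous (\<Sum>i\<in>keys m. lookup m i * e) (\<Prod>i\<in>keys m. \<Phi> i ^ lookup m i)"
  by (intro homogeneous_prod homogeneous_power assms) (use m in \<open>auto simp: pvars_def\<close>)
 also have "(\<Sum>i\<in>keys m. lookup m i * e) = d * e"
  using assms(1) m by (auto simp: homogeneous_def tdeg_def sum_distrib_right)
 finally have "homogeneous (d * e) (\<Prod>i\<in>keys m. \<Phi> i ^ lookup m i)" .
 then show "homogeneous (d * e) (Const (lookup f m) * (\<Prod>i\<in>keys m. \<Phi> i ^ lookup m i))"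
  using homogeneous_mult[OF homogeneous_Const] by fastforce
qed

lemma mon_scale: "mon (%i. c * p i) m = c ^ tdeg m * mon p m"
 by (simp add: mon_def tdeg_def power_mult_distrib prod.distrib power_sum)

lemma peval_scale: "homogeneous d f ==> peval (%i. c * p i) f = c ^ d * peval p f"
 by (simp add: insertion_superset[OF coeff_hom_id finite_keys order.refl] mon_scale homogeneous_def sum_distrib_left mult.left_commute)

lemma peval_zero_point: "homogeneous d f ==> 0 < d ==> peval (%_. 0) f = 0"
 using peval_scale[of d f 0 "%_. 0"] by (simp add: zero_power)

subsection \<open>Derivatives\<close>

lemma pderiv_wrt_superset:
 assumes "finite A" "keys f \<subseteq> A"
 shows "pderiv_wrt i f = (\<Sum>m\<in>A. single (m - single i 1)
  (of_nat (lookup m i) * lookup f m))"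
 unfolding pderiv_wrt_def by (rule sum.mono_neutral_left) (use assms in \<open>auto simp: in_keys_iff\<close>)

lemma pderiv_wrt_single:
 "pderiv_wrt i (single m c) = single (m - single i 1) (of_nat (lookup m i) * c)"
 by (subst pderiv_wrt_superset[of "{m}"]) auto

lemma pderiv_wrt_0 [simp]: "pderiv_wrt i 0 = 0"
 by (simp add: pderiv_wrt_def)

lemma pderiv_wrt_add [simp]: "pderiv_wrt i (f + g) = pderiv_wrt i f + pderiv_wrt i g"
proof -
 let ?A = "keys f \<union> keys g"
 show ?thesis
  by (simp add: pderiv_wrt_superset[of ?A] keys_add lookup_add distrib_left single_add sum.distrib)
qed

lemma pderiv_wrt_sum: "pderiv_wrt i (sum F A) = (\<Sum>x\<in>A. pderiv_wrt i (F x))"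
 by (induction A rule: infinite_finite_induct) auto

lemma pderiv_wrt_single_mult:
 "pderiv_wrt i (single m c * single n d) =
  pderiv_wrt i (single m c) * single n d + single m c * pderiv_wrt i (single n d)"
proof -
 have m: "m - single i 1 + n = m + n - single i 1" if "lookup m i ~= 0" for m n :: "nat \<Rightarrow>\<^sub>0 nat"
  using that by (intro poly_mapping_eqI) (auto simp: lookup_add lookup_minus lookup_single when_def)
 have n: "m + (n - single i 1) = m + n - single i 1" if "lookup n i ~= 0"
  using m[OF that, of m] by (simp add: add.commute)
 show ?thesis
  using m[of m n] n
  by (cases "lookup m i = 0"; cases "lookup n i = 0")
   (simp_all add: pderiv_wrt_single mult_single lookup_add algebra_simps flip: single_add)
qed

lemma pderiv_wrt_mult [simp]: "pderiv_wrt i (f * g) = pderiv_wrt i f * g + f * pderiv_wrt i g"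
proof -
 have *: "pderiv_wrt i (single m c * g) = pderiv_wrt i (single m c) * g + single m c * pderiv_wrt i g" for m c g
  by (subst (1 2 3) mpoly_sum_single[of g])
   (simp add: sum_distrib_left pderiv_wrt_sum pderiv_wrt_single_mult sum.distrib)
 show ?thesis
  by (subst (1 2 3) mpoly_sum_single[of f])
   (simp add: sum_distrib_right pderiv_wrt_sum * sum.distrib)
qed

lemma pderiv_wrt_Const [simp]: "pderiv_wrt i (Const c) = 0"
 by (simp add: Const_def pderiv_wrt_single)

lemma pderiv_wrt_Var: "pderiv_wrt i (Var j) = (if i = j then 1 else 0)"
 by (auto simp: Var_def pderiv_wrt_single lookup_single when_def)

lemma pderiv_wrt_notin: "i \<notin> pvars f ==> pderiv_wrt i f = 0"
 unfolding pderiv_wrt_def by (rule sum.neutral) (auto simp: pvars_def in_keys_iff)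

lemma dir_deriv_superset:
 assumes "finite A" "pvars f \<subseteq> A"
 shows "dir_deriv p v f = (\<Sum>i\<in>A. peval p (pderiv_wrt i f) * v i)"
 unfolding dir_deriv_def by (rule sum.mono_neutral_left) (use assms in \<open>auto simp: pderiv_wrt_notin\<close>)

lemma dir_deriv_add [simp]: "dir_deriv p v (f + g) = dir_deriv p v f + dir_deriv p v g"
proof -
 let ?A = "pvars f \<union> pvars g"
 show ?thesis
  by (simp add: dir_deriv_superset[of ?A] pvars_add distrib_right sum.distrib)
qed

lemma dir_deriv_mult [simp]: "dir_deriv p v (f * g) = dir_deriv p v f * peval p g + peval p f * dir_deriv p v g"
proof -
 let ?A = "pvars f \<union> pvars g"
 show ?thesis
  by (simp add: dir_deriv_superset[of ?A] pvars_mult algebra_simps sum_distrib_left sum.distrib)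
qed

lemma dir_deriv_Const [simp]: "dir_deriv p v (Const c) = 0"
 by (simp add: dir_deriv_def)

lemma dir_deriv_0 [simp]: "dir_deriv p v 0 = 0" and dir_deriv_1 [simp]: "dir_deriv p v 1 = 0"
 and dir_deriv_numeral [simp]: "dir_deriv p v (numeral k) = 0"
 by (simp_all add: dir_deriv_def)

lemma dir_deriv_Var [simp]: "dir_deriv p v (Var i) = v i"
 by (simp add: dir_deriv_def pderiv_wrt_Var)

lemma dir_deriv_uminus [simp]: "dir_deriv p v (- f) = - dir_deriv p v f"
 using dir_deriv_add[of p v f "- f"] by (simp add: eq_neg_iff_add_eq_0 add.commute)

lemma dir_deriv_diff [simp]: "dir_deriv p v (f - g) = dir_deriv p v f - dir_deriv p v g"
 using dir_deriv_add[of p v f "- g"] by simp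

lemma dir_deriv_sum [simp]: "dir_deriv p v (sum F A) = (\<Sum>x\<in>A. dir_deriv p v (F x))"
 by (induction A rule: infinite_finite_induct) auto

lemma dir_deriv_power [simp]: "dir_deriv p v (f ^ Suc n) = of_nat (Suc n) * peval p f ^ n * dir_deriv p v f"
 by (induction n) (auto simp: algebra_simps)

lemma dir_deriv_power2 [simp]: "dir_deriv p v (f\<^sup>2) = 2 * peval p f * dir_deriv p v f"
 by (simp add: power2_eq_square)

lemma dir_deriv_psubst [simp]:
 "dir_deriv p v (psubst \<Phi> f) = dir_deriv (%i. peval p (\<Phi> i)) (%i. dir_deriv p v (\<Phi> i)) f"
 by (induction f rule: mpoly_induct) auto

lemma dir_deriv_lin: "dir_deriv p (%i. a * v i + b * w i) f = a * dir_deriv p v f + b * dir_deriv p w f"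
 by (simp add: dir_deriv_def sum_distrib_left sum.distrib algebra_simps)

lemma dir_deriv_Euler: "homogeneous d f ==> dir_deriv p p f = of_nat d * peval p f"
proof -
 have s: "dir_deriv p p (single m c) = of_nat (tdeg m) * peval p (single m c)" for m c
 proof -
  have v: "dir_deriv p p (Var i ^ k) = of_nat k * p i ^ k" for i k
   by (induction k) (auto simp: algebra_simps)
  have "dir_deriv p p (\<Prod>i\<in>A. Var i ^ e i) = of_nat (sum e A) * (\<Prod>i\<in>A. p i ^ e i)" if "finite A" for A e
   using that by (induction A) (auto simp: v algebra_simps)
  then show ?thesis
   by (simp add: single_eq_Const_mon mon_def tdeg_def)
 qed
 assume "homogeneous d f"
 then show ?thesis
  by (subst (1 2) mpoly_sum_single[of f]) (simp add: s homogeneous_def sum_distrib_left)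
qed

text \<open>Partial derivatives of a form have degree d - 1. The extra factor c on the left replaces
  the exponent d - 1 by d, which also covers d = 0.\<close>

lemma dir_deriv_scale_point:
 assumes "homogeneous d f"
 shows "c * dir_deriv (%i. c * p i) v f = c ^ d * dir_deriv p v f"
proof -
 have "homogeneous d f ==> c * peval (%i. c * p i) (pderiv_wrt j f) = c ^ d * peval p (pderiv_wrt j f)" for j f
 proof -
  assume "homogeneous d f"
  have "c * peval (%i. c * p i) (pderiv_wrt j (single m x)) = c ^ tdeg m * peval p (pderiv_wrt j (single m x))" for m x
  proof (cases "lookup m j = 0")
   case False
   have "m = (m - single j 1) + single j 1"
    using False by (intro poly_mapping_eqI) (auto simp: lookup_add lookup_minus lookup_single when_def)
   then have "tdeg m = Suc (tdeg (m - single j 1))"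
    by (metis tdeg_add tdeg_single Suc_eq_plus1)
   then show ?thesis by (simp add: pderiv_wrt_single insertion_single mon_scale)
  qed (simp add: pderiv_wrt_single)
  then show ?thesis using \<open>homogeneous d f\<close>
   by (subst (1 2) mpoly_sum_single[of f]) (simp add: pderiv_wrt_sum homogeneous_def sum_distrib_left)
 qed
 from this[OF assms] show ?thesis by (simp add: dir_deriv_def sum_distrib_left flip: mult.assoc)
qed

subsection \<open>Evaluations of iterated polynomial rings\<close>

definition ring_hom_fun :: "('a::comm_ring_1 => 'b::comm_ring_1) => bool" where
 "ring_hom_fun h \<longleftrightarrow> h 0 = 0 \<and> h 1 = 1 \<and> (\<forall>x y. h (x + y) = h x + h y) \<and> (\<forall>x y. h (x * y) = h x * h y)"

lemma ring_hom_funD: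
 assumes "ring_hom_fun h"
 shows "h 0 = 0" "h 1 = 1" "h (x + y) = h x + h y" "h (x * y) = h x * h y"
 using assms by (auto simp: ring_hom_fun_def)

definition eval_poly :: "('a::comm_ring_1 => 'b::comm_ring_1) => 'b => 'a poly => 'b" where
 "eval_poly h v p = poly (map_poly h p) v"

lemma eval_poly_0 [simp]: "eval_poly h v 0 = 0"
 by (simp add: eval_poly_def)

lemma eval_poly_pCons [simp]: "ring_hom_fun h ==> eval_poly h v (pCons a p) = h a + v * eval_poly h v p"
 by (simp add: eval_poly_def map_poly_pCons ring_hom_funD)

lemma eval_poly_add [simp]:
 assumes h: "ring_hom_fun h" shows "eval_poly h v (p + q) = eval_poly h v p + eval_poly h v q"
proof (induction p arbitrary: q)
 case (pCons a p)
 show ?case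
 proof (cases q rule: pCons_cases)
  case (pCons b q')
  have "eval_poly h v (p + q') = eval_poly h v p + eval_poly h v q'" by (rule pCons.IH)
  then show ?thesis by (simp add: pCons h ring_hom_funD[OF h] algebra_simps)
 qed
qed simp

lemma eval_poly_1 [simp]: "ring_hom_fun h ==> eval_poly h v 1 = 1"
 by (simp add: one_pCons ring_hom_funD)

lemma eval_poly_smult [simp]: "ring_hom_fun h ==> eval_poly h v (smult a p) = h a * eval_poly h v p"
 by (induction p) (simp_all add: ring_hom_funD algebra_simps)

lemma eval_poly_mult [simp]: "ring_hom_fun h ==> eval_poly h v (p * q) = eval_poly h v p * eval_poly h v q"
 by (induction p) (simp_all add: ring_hom_funD algebra_simps)

lemma ring_hom_eval_poly [simp]: "ring_hom_fun h ==> ring_hom_fun (eval_poly h v)"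
 unfolding ring_hom_fun_def[of "eval_poly h v"] by (simp add: one_pCons ring_hom_funD)

lemma ring_hom_id [simp]: "ring_hom_fun (%x. x)"
 by (simp add: ring_hom_fun_def)

text \<open>Families of evaluations are kept abstract so that separation of elements and the
  Nullstellensatz can be carried from a ring to its polynomial ring, one variable at a time.\<close>

definition separating :: "('a::comm_ring_1 => complex) set => bool" where
 "separating E \<longleftrightarrow> (\<forall>e\<in>E. ring_hom_fun e) \<and> (\<forall>x. (\<forall>e\<in>E. e x = 0) \<longrightarrow> x = 0)"

text \<open>The Nullstellensatz for principal prime ideals: this case is elementary and suffices for
  plane curves.\<close>

definition nullstellensatz :: "('a::comm_ring_1 => complex) set => bool" where
 "nullstellensatz E \<longleftrightarrow> (\<forall>f g. prime_elem f \<longrightarrow> (\<forall>e\<in>E. e f = 0 \<longrightarrow> e g = 0) \<longrightarrow> f dvd g)"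

definition poly_evals :: "('a::comm_ring_1 => complex) set => ('a poly => complex) set" where
 "poly_evals E = {eval_poly e v |e v. e \<in> E}"

lemma eval_poly_all_0:
 assumes "!!v. eval_poly (e :: 'a::comm_ring_1 => complex) v p = 0" "ring_hom_fun e"
 shows "e (coeff p k) = 0"
proof -
 have "map_poly e p = 0"
  using assms(1) by (simp add: eval_poly_def flip: poly_all_0_iff_0)
 then have "coeff (map_poly e p) k = 0" by simp
 then show ?thesis by (simp add: coeff_map_poly ring_hom_funD[OF assms(2)])
qed

lemma separating_poly_evals: "separating E ==> separating (poly_evals E)"
 unfolding separating_def
proof (intro conjI allI impI ballI, goal_cases)
 case (2 p)
 show ?case
 proof (rule poly_eqI)
  fix k
  have "e (coeff p k) = 0" if "e \<in> E" for e
   by (rule eval_poly_all_0) (use that 2 in \<open>auto simp: poly_evals_def\<close>)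
  then show "coeff p k = coeff 0 k" using 2(1) by auto
 qed
qed (auto simp: poly_evals_def)

text \<open>If a prime f of positive degree does not divide g, the ideal of f and g contains a
  nonzero constant polynomial. Choose an evaluation of the coefficients at which neither this
  constant nor the leading coefficient of f vanishes; f then has a root by the fundamental theorem
  of algebra, g vanishes there by hypothesis, and so does the constant, a contradiction. For a
  constant f the coefficients of g are treated one by one.\<close>

lemma nullstellensatz_poly_evals:
 fixes E :: "('a::{factorial_ring_gcd, semiring_gcd_mult_normalize} => complex) set"
 assumes E: "separating E" "nullstellensatz E"
 shows "nullstellensatz (poly_evals E)"
 unfolding nullstellensatz_def
proof (intro allI impI)
 fix f g :: "'a poly" assume f: "prime_elem f" and fg: "\<forall>e\<in>poly_evals E. e f = 0 \<longrightarrow> e g = 0"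
 have hom: "ring_hom_fun e" if "e \<in> E" for e using E that by (auto simp: separating_def)
 have fg': "eval_poly e v g = 0" if "e \<in> E" "eval_poly e v f = 0" for e v
  using fg that by (auto simp: poly_evals_def)
 show "f dvd g"
 proof (cases "degree f = 0")
  case True
  then obtain c where c: "f = [:c:]" by (metis degree_eq_zeroE)
  have pc: "prime_elem c" using f c by (simp add: prime_elem_const_poly_iff)
  have "c dvd coeff g k" for k
  proof -
   have "e (coeff g k) = 0" if "e \<in> E" "e c = 0" for e
    by (rule eval_poly_all_0[OF _ hom]) (use that fg' hom in \<open>auto simp: c\<close>)
   then show ?thesis using E(2) pc by (auto simp: nullstellensatz_def)
  qed
  then show ?thesis by (simp add: c const_poly_dvd_iff)
 next
  case False
  show ?thesis
  proof (rule ccontr)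
   assume nd: "\<not> f dvd g"
   define I where "I = {u * f + v * g |u v. True}"
   define W where "W = {w \<in> I. w ~= 0}"
   have I_diff: "a - b * c \<in> I" if ab: "a \<in> I" "b \<in> I" for a b c
   proof -
    obtain u v where "a = u * f + v * g" using ab(1) by (auto simp: I_def)
    moreover obtain u' v' where "b = u' * f + v' * g" using ab(2) by (auto simp: I_def)
    ultimately
    have "a - b * c = (u - u' * c) * f + (v - v' * c) * g" by (simp add: algebra_simps)
    then show ?thesis unfolding I_def by blast
   qed
   have I_smult: "smult c a \<in> I" if a: "a \<in> I" for a c
   proof -
    obtain u v where "a = u * f + v * g" using a by (auto simp: I_def)
    then have "smult c a = smult c u * f + smult c v * g" by (simp add: smult_add_right)
    then show ?thesis unfolding I_def by blast
   qed
   have fI: "f \<in> I" unfolding I_def by (rule CollectI) (rule exI[of _ 1], rule exI[of _ 0], simp)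
   have gI: "g \<in> I" unfolding I_def by (rule CollectI) (rule exI[of _ 0], rule exI[of _ 1], simp)
   have "f \<in> W" using fI f by (auto simp: W_def)
   then obtain w where w: "w \<in> W" and wmin: "!!w'. w' \<in> W ==> degree w \<le> degree w'"
    using ex_has_least_nat[of "%w. w \<in> W" f degree] by auto
   have w0: "w ~= 0" and wI: "w \<in> I" using w by (auto simp: W_def)
   \<comment> \<open>Pseudo-division by an element w of least degree stays in the ideal, so the
     remainder must be zero. This replaces the Euclidean algorithm over the fraction field.\<close>
   have div: "\<exists>c q. c ~= 0 \<and> smult c h = w * q" if h: "h \<in> I" for h
   proof -
    obtain q r where qr: "pseudo_divmod h w = (q, r)" by fastforce
    define c where "c = coeff w (degree w) ^ (Suc (degree h) - degree w)"
    have *: "smult c h = w * q + r" "r = 0 \<or> degree r < degree w"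
     using pseudo_divmod[OF w0 qr] by (auto simp: c_def)
    have "r = smult c h - w * q" using *(1) by simp
    then have "r \<in> I" using I_diff[OF I_smult[OF h] wI] by simp
    then have "r = 0" using *(2) wmin[of r] by (force simp: W_def)
    moreover have "c ~= 0" using w0 by (simp add: c_def)
    ultimately show ?thesis using *(1) by auto
   qed
   obtain c q where cq: "c ~= 0" "smult c f = w * q" using div[OF fI] by blast
   obtain c' q' where cq': "c' ~= 0" "smult c' g = w * q'" using div[OF gI] by blast
   \<comment> \<open>The prime f divides w or q. If it divided w, it would divide a constant
     multiple of g, hence g. So it divides q, and cancelling f leaves w as a divisor of a
     constant.\<close>
   have "f dvd w * q" using cq(2) by (metis dvd_smult dvd_refl)
   then have "f dvd w \<or> f dvd q" using f by (simp add: prime_elem_dvd_mult_iff)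
   moreover have "\<not> f dvd w"
   proof
    assume "f dvd w"
    then have "f dvd [:c':] * g" using cq'(2) by simp
    then have "f dvd [:c':]" using f nd by (auto simp: prime_elem_dvd_mult_iff simp del: mult_pCons_left)
    then show False using cq'(1) False by (metis degree_pCons_0 dvd_imp_degree_le le_zero_eq pCons_eq_0_iff)
   qed
   ultimately obtain s where s: "q = f * s" by (auto elim: dvdE)
   have "f * [:c:] = f * (w * s)" using cq(2) s by (simp add: algebra_simps)
   then have "[:c:] = w * s" using f by (simp only: mult_cancel_left) auto
   then have "degree w = 0" using cq(1)
    by (metis degree_pCons_0 degree_mult_eq_0 mult_zero_right pCons_eq_0_iff w0 mult_eq_0_iff)
   then obtain r0 where r0: "w = [:r0:]" by (metis degree_eq_zeroE)
   \<comment> \<open>Requiring the leading coefficient to survive keeps the degree of f positive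
     after evaluation, so a root exists.\<close>
   have "r0 * lead_coeff f ~= 0" using w0 r0 f by auto
   then obtain e where e: "e \<in> E" "e (r0 * lead_coeff f) ~= 0"
    using E(1) unfolding separating_def by metis
   have e': "e r0 ~= 0" "e (lead_coeff f) ~= 0" using e(2) ring_hom_funD(4)[OF hom[OF e(1)], of r0 "lead_coeff f"] by auto
   have "degree f \<le> degree (map_poly e f)"
    using e'(2) by (intro le_degree) (simp add: coeff_map_poly ring_hom_funD[OF hom[OF e(1)]])
   then have "\<not> constant (poly (map_poly e f))"
    using False by (simp add: constant_degree)
   then obtain z where "poly (map_poly e f) z = 0" using fundamental_theorem_of_algebra by blast
   then have z: "eval_poly e z f = 0" by (simp add: eval_poly_def)
   obtain u v where "w = u * f + v * g" using wI by (auto simp: I_def)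
   then have "eval_poly e z w = 0" using z fg'[OF e(1) z] hom[OF e(1)] by simp
   then show False using e' r0 hom[OF e(1)] by simp
  qed
 qed
qed

lemma separating_complex: "separating {%x::complex. x}"
 by (auto simp: separating_def)

lemma nullstellensatz_complex: "nullstellensatz {%x::complex. x}"
 by (auto simp: nullstellensatz_def prime_elem_def dvd_field_iff)

subsection \<open>Polynomials in three variables\<close>

text \<open>Nested univariate polynomials inherit unique factorisation and gcds. Polynomials in the
  first three variables are carried back and forth between this ring and
  \<open>mpoly\<close>.\<close>

type_synonym poly3 = "complex poly poly poly"

definition const3 :: "complex => poly3" where "const3 c = [:[:[:c:]:]:]"

definition var3 :: "nat => poly3" where
 "var3 = (%_. 0)(0 := [:[:[:0, 1:]:]:], 1 := [:[:0, 1:]:], 2 := [:0, 1:])"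

definition to_poly3 :: "mpoly => poly3" where "to_poly3 = insertion const3 var3"

definition of_poly3 :: "poly3 => mpoly" where
 "of_poly3 = eval_poly (eval_poly (eval_poly Const (Var 0)) (Var 1)) (Var 2)"

definition ev3 :: "(nat => complex) => poly3 => complex" where
 "ev3 p = eval_poly (eval_poly (eval_poly (%x. x) (p 0)) (p 1)) (p 2)"

text \<open>Applied to \<open>Var\<close> this is the substitution projecting onto polynomials in
  three variables; applied to a vector it drops the coordinates beyond the plane.\<close>

definition trunc3 :: "(nat => 'a::zero) => nat => 'a" where
 "trunc3 p = (%i. if i \<le> 2 then p i else 0)"

lemma coeff_hom_const3 [simp]: "coeff_hom const3"
 by (auto simp: coeff_hom_def const3_def mult.commute one_pCons)

lemma ring_hom_Const [simp]: "ring_hom_fun Const"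
 by (simp add: ring_hom_fun_def Const_add Const_mult)

lemma ring_hom_of_poly3 [simp]: "ring_hom_fun of_poly3"
 by (simp add: of_poly3_def)

lemma ring_hom_ev3 [simp]: "ring_hom_fun (ev3 p)"
 by (simp add: ev3_def)

lemma to_poly3_hom [simp]:
 "to_poly3 0 = 0" "to_poly3 1 = 1" "to_poly3 (f + g) = to_poly3 f + to_poly3 g"
 "to_poly3 (f * g) = to_poly3 f * to_poly3 g" "to_poly3 (Const c) = const3 c" "to_poly3 (Var i) = var3 i"
 "to_poly3 (f - g) = to_poly3 f - to_poly3 g" "to_poly3 (- f) = - to_poly3 f"
 "to_poly3 (f ^ n) = to_poly3 f ^ n"
 by (simp_all add: to_poly3_def)

lemma of_poly3_hom [simp]:
 "of_poly3 0 = 0" "of_poly3 1 = 1" "of_poly3 (f + g) = of_poly3 f + of_poly3 g"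
 "of_poly3 (f * g) = of_poly3 f * of_poly3 g"
 using ring_hom_funD[OF ring_hom_of_poly3] by simp_all

lemma of_poly3_const3 [simp]: "of_poly3 (const3 c) = Const c"
 by (simp add: of_poly3_def const3_def)

lemma cases_le2: "(i::nat) \<le> 2 ==> i = 0 \<or> i = 1 \<or> i = 2"
 by auto

lemma of_poly3_var3: "of_poly3 (var3 i) = trunc3 Var i"
proof (cases "i \<le> 2")
 case True
 then show ?thesis using cases_le2[of i] by (auto simp: of_poly3_def var3_def trunc3_def)
qed (auto simp: of_poly3_def var3_def trunc3_def)

lemma ev3_var3: "ev3 p (var3 i) = trunc3 p i"
proof (cases "i \<le> 2")
 case True
 then show ?thesis using cases_le2[of i] by (auto simp: ev3_def var3_def trunc3_def)
qed (auto simp: ev3_def var3_def trunc3_def)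

lemma of_poly3_to_poly3: "of_poly3 (to_poly3 f) = psubst (trunc3 Var) f"
 unfolding to_poly3_def
 by (subst insertion_hom_comp[where h = Const]) (simp_all add: of_poly3_var3)

lemma psubst_trunc3 [simp]: "vars_le 2 f ==> psubst (trunc3 Var) f = f"
 using insertion_cong[of f "trunc3 Var" Var Const] by (force simp: vars_le_def trunc3_def subset_eq)

lemma of_to_poly3 [simp]: "vars_le 2 f ==> of_poly3 (to_poly3 f) = f"
 by (simp add: of_poly3_to_poly3)

lemma to_of_poly3 [simp]: "to_poly3 (of_poly3 P) = P"
proof -
 have 1: "to_poly3 (eval_poly Const (Var 0) q) = [:[:q:]:]" for q
  by (induction q) (auto simp: const3_def var3_def)
 have 2: "to_poly3 (eval_poly (eval_poly Const (Var 0)) (Var 1) q) = [:q:]" for q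
  by (induction q) (auto simp: var3_def 1)
 show ?thesis unfolding of_poly3_def
  by (induction P) (auto simp: var3_def 2 simp del: One_nat_def)
qed

lemma ev3_to_poly3: "ev3 p (to_poly3 f) = peval (trunc3 p) f"
 unfolding to_poly3_def
 by (subst peval_insertion[where \<theta> = "ev3 p"])
  (simp_all add: ev3_var3 ring_hom_funD[OF ring_hom_ev3], simp add: ev3_def const3_def)

lemma peval_trunc3: "vars_le 2 f ==> peval (trunc3 p) f = peval p f"
 by (rule insertion_cong) (auto simp: vars_le_def trunc3_def)

lemma vars_le_trunc3 [simp]: "vars_le 2 (psubst (trunc3 Var) f)"
 by (rule vars_le_psubst) (auto simp: trunc3_def)

lemma vars_le_of_poly3 [simp]: "vars_le 2 (of_poly3 P)"
 by (metis of_poly3_to_poly3 to_of_poly3 vars_le_trunc3)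

definition evs3 :: "(poly3 => complex) set" where
 "evs3 = poly_evals (poly_evals (poly_evals {%x. x}))"

lemma evs3_eq: "evs3 = range ev3"
proof -
 have "\<exists>p. eval_poly (eval_poly (eval_poly (%x. x) a) b) c = ev3 p" for a b c
  by (rule exI[of _ "%i. if i = 0 then a else if i = 1 then b else c"]) (simp add: ev3_def)
 then show ?thesis by (fastforce simp: evs3_def poly_evals_def ev3_def simp del: One_nat_def)
qed

lemma separating_evs3: "separating evs3" and nullstellensatz_evs3: "nullstellensatz evs3"
 unfolding evs3_def
 by (intro separating_poly_evals separating_complex nullstellensatz_poly_evals nullstellensatz_complex)+

lemma mpoly3_eq_0I:
 assumes "vars_le 2 f" "!!p. peval p f = 0" shows "f = 0"
proof -
 have "to_poly3 f = 0"
  using separating_evs3 assms(2) by (auto simp: separating_def evs3_eq ev3_to_poly3)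
 then show ?thesis using of_to_poly3[OF assms(1)] by simp
qed

lemma mpoly3_eqI:
 assumes "vars_le 2 f" "vars_le 2 g" "!!p. peval p f = peval p g" shows "f = g"
 using mpoly3_eq_0I[of "f - g"] assms by simp

lemma prime_elem_to_poly3:
 assumes "irreducible f" "vars_le 2 f" shows "prime_elem (to_poly3 f)"
proof -
 have "irreducible (to_poly3 f)"
 proof (rule irreducibleI)
  show "to_poly3 f ~= 0" using assms of_to_poly3 by (metis irreducible_def of_poly3_hom(1))
  have unit: "of_poly3 P dvd 1 \<longleftrightarrow> P dvd 1" for P
   by (metis dvdE dvdI of_poly3_hom(2,4) to_of_poly3 to_poly3_hom(2,4))
  show "\<not> to_poly3 f dvd 1" using unit[of "to_poly3 f"] assms by (auto simp: irreducible_def)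
  fix P Q assume "to_poly3 f = P * Q"
  then have "f = of_poly3 P * of_poly3 Q" using assms(2) by (metis of_poly3_hom(4) of_to_poly3)
  then show "P dvd 1 \<or> Q dvd 1" using assms(1) unit by (auto simp: irreducible_def)
 qed
 then show ?thesis by (rule irreducible_imp_prime_elem)
qed

lemma to_poly3_dvdD: "to_poly3 f dvd to_poly3 g ==> vars_le 2 f ==> vars_le 2 g ==> f dvd g"
 by (metis dvdE dvdI of_poly3_hom(4) of_to_poly3)

lemma to_poly3_dvdI: "f dvd g ==> to_poly3 f dvd to_poly3 g"
 by (metis dvdE dvdI to_poly3_hom(4))

lemma mpoly3_nullstellensatz:
 assumes "irreducible f" "vars_le 2 f" "vars_le 2 g" "!!p. peval p f = 0 ==> peval p g = 0"
 shows "f dvd g"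
proof (rule to_poly3_dvdD)
 show "to_poly3 f dvd to_poly3 g"
  using nullstellensatz_evs3 prime_elem_to_poly3[OF assms(1,2)] assms(4)
  by (auto simp: nullstellensatz_def evs3_eq ev3_to_poly3)
qed fact+

lemma mpoly3_prime:
 assumes "irreducible f" "vars_le 2 f" "vars_le 2 g" "vars_le 2 h" "f dvd g * h"
 shows "f dvd g \<or> f dvd h"
proof -
 have "to_poly3 f dvd to_poly3 g * to_poly3 h" using to_poly3_dvdI[OF assms(5)] by simp
 then have "to_poly3 f dvd to_poly3 g \<or> to_poly3 f dvd to_poly3 h"
  using prime_elem_to_poly3[OF assms(1,2)] by (simp add: prime_elem_dvd_mult_iff)
 then show ?thesis using to_poly3_dvdD assms by blast
qed

subsection \<open>Homogeneous factors\<close>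

text \<open>Each variable X becomes X T with an auxiliary T, so the coefficient of T^n is the
  homogeneous component of degree n, and forms of degree d are the polynomials sent to monomials in
  T of degree d.\<close>

definition grade_poly :: "mpoly => mpoly poly" where
 "grade_poly = insertion (%c. [:Const c:]) (%i. [:0, Var i:])"

lemma grade_poly_hom [simp]:
 "grade_poly 0 = 0" "grade_poly (f + g) = grade_poly f + grade_poly g"
 "grade_poly (f * g) = grade_poly f * grade_poly g" "grade_poly (sum F A) = (\<Sum>x\<in>A. grade_poly (F x))"
 by (simp_all add: grade_poly_def)

lemma poly_grade_poly_1: "poly (grade_poly f) 1 = f"
 unfolding grade_poly_def
 by (subst insertion_hom_comp[where h = Const and \<theta> = "%q. poly q 1"]) simp_all

lemma grade_poly_eq_0_iff [simp]: "grade_poly f = 0 \<longleftrightarrow> f = 0"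
 using poly_grade_poly_1[of f] by auto

lemma grade_poly_single: "grade_poly (single m c) = monom (single m c) (tdeg m)"
proof -
 have "mon (%i. [:0, Var i:]) m = monom (mon Var m) (tdeg m)"
 proof -
  have m: "[:0, Var i:] = monom (Var i) (Suc 0)" for i by (simp add: monom_Suc monom_0)
  have "(\<Prod>i\<in>A. monom (Var i) (Suc 0) ^ e i) = monom (\<Prod>i\<in>A. Var i ^ e i) (sum e A)" if "finite A" for A e
   using that by (induction A) (simp_all add: monom_power mult_monom)
  then show ?thesis by (simp add: mon_def tdeg_def m)
 qed
 then show ?thesis
  by (simp add: grade_poly_def insertion_single smult_monom) (simp add: single_eq_Const_mon)
qed

lemma grade_poly_sum: "grade_poly f = (\<Sum>m\<in>keys f. monom (single m (lookup f m)) (tdeg m))"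
 by (subst mpoly_sum_single[of f]) (simp add: grade_poly_single)

lemma lookup_coeff_grade_poly:
 "lookup (coeff (grade_poly f) n) m = (if tdeg m = n then lookup f m else 0)"
proof -
 have "lookup (coeff (grade_poly f) n) m =
   (\<Sum>k\<in>keys f. if k = m then (if tdeg m = n then lookup f m else 0) else 0)"
  unfolding grade_poly_sum coeff_sum lookup_sum
  by (rule sum.cong) (auto simp: lookup_single when_def)
 then show ?thesis by (simp add: in_keys_iff)
qed

lemma homogeneous_iff_grade_poly: "homogeneous d f \<longleftrightarrow> grade_poly f = monom f d"
proof
 assume h: "homogeneous d f"
 show "grade_poly f = monom f d"
 proof (rule poly_eqI, rule poly_mapping_eqI)
  fix n m
  show "lookup (coeff (grade_poly f) n) m = lookup (coeff (monom f d) n) m"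
   using h by (auto simp: lookup_coeff_grade_poly homogeneous_def in_keys_iff)
 qed
next
 assume g: "grade_poly f = monom f d"
 show "homogeneous d f"
  unfolding homogeneous_def
 proof
  fix m assume "m \<in> keys f"
  then show "tdeg m = d"
   using lookup_coeff_grade_poly[of f "tdeg m" m] by (auto simp: g in_keys_iff split: if_splits)
 qed
qed

text \<open>The order at 0 and the degree are both additive and agree on a monomial. Since the order
  never exceeds the degree, they agree on each factor.\<close>

lemma monom_factor:
 fixes P Q :: "'a::idom poly"
 assumes "P * Q = monom c d" "c ~= 0"
 shows "\<exists>a i. P = monom a i"
proof -
 have n0: "P * Q ~= 0" using assms by simp
 then have n: "P ~= 0" "Q ~= 0" by auto
 have "order 0 P + order 0 Q = order 0 (monom c d)"
  using order_mult[OF n0, of 0] assms(1) by simp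
 also have "order 0 (monom c d) = d"
 proof (rule order_unique_lemma)
  have m: "monom c d = [:- 0, 1:] ^ d * [:c:]" by (simp add: monom_altdef)
  show "[:- 0, 1:] ^ d dvd monom c d" unfolding m by (rule dvd_triv_left)
  show "\<not> [:- 0, 1:] ^ Suc d dvd monom c d"
  proof
   assume "[:- 0, 1:] ^ Suc d dvd monom c d"
   then have "degree ([:- 0, 1:] ^ Suc d :: 'a poly) \<le> degree (monom c d)"
    by (rule dvd_imp_degree_le) (use assms in simp)
   then show False using assms by (simp add: degree_power_eq degree_monom_eq del: power_Suc)
  qed
 qed
 also have "d = degree P + degree Q"
  using assms n by (metis degree_monom_eq degree_mult_eq)
 finally have "order 0 P = degree P" using order_degree[OF n(1), of 0] order_degree[OF n(2), of 0] by linarith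
 then have "[:- 0, 1:] ^ degree P dvd P" using order_1[of 0 P] by simp
 then obtain R where R: "P = [:- 0, 1:] ^ degree P * R" by (elim dvdE)
 then have "R ~= 0" using n by auto
 then have "degree P = degree P + degree R"
  by (subst R, subst degree_mult_eq) (simp_all add: degree_power_eq)
 then obtain a where "R = [:a:]" using degree_eq_zeroE by (metis add_cancel_right_right)
 then have "P = monom a (degree P)" using R by (simp add: monom_altdef)
 then show ?thesis by blast
qed

lemma homogeneous_factor:
 assumes "homogeneous d (f * g)" "f * g ~= 0"
 obtains e where "homogeneous e f"
proof -
 have "grade_poly f * grade_poly g = monom (f * g) d"
  using assms(1) by (simp add: homogeneous_iff_grade_poly)
 then obtain a i where ai: "grade_poly f = monom a i" using monom_factor assms(2) by blast
 then have "f = a" using poly_grade_poly_1[of f] by (simp add: poly_monom)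
 then show ?thesis using that ai by (simp add: homogeneous_iff_grade_poly)
qed

lemma homogeneous_degree_unique: "homogeneous d f ==> homogeneous e f ==> f ~= 0 ==> d = e"
 by (metis degree_monom_eq homogeneous_iff_grade_poly)

lemma homogeneous_cancel_left:
 assumes "homogeneous d f" "homogeneous (d + e) (f * g)" "f ~= 0"
 shows "homogeneous e g"
proof (cases "g = 0")
 case False
 then obtain e' where e': "homogeneous e' g"
  using homogeneous_factor[of "d + e" g f] assms by (auto simp: mult.commute)
 then have "d + e' = d + e"
  using homogeneous_degree_unique[OF homogeneous_mult[OF assms(1) e'] assms(2)] assms(3) False by simp
 then show ?thesis using e' by simp
qed simp

lemma homogeneous_0_iff: "homogeneous 0 f \<longleftrightarrow> (\<exists>c. f = Const c)"
proof
 assume h: "homogeneous 0 f"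
 have "f = Const (lookup f 0)"
 proof (rule poly_mapping_eqI)
  fix m
  have "m = 0" if "tdeg m = 0" using that by (intro poly_mapping_eqI) (auto simp: tdeg_def in_keys_iff)
  then show "lookup f m = lookup (Const (lookup f 0)) m"
   using h by (cases "m \<in> keys f")
    (auto simp: Const_def lookup_single when_def homogeneous_def in_keys_iff)
 qed
 then show "\<exists>c. f = Const c" by blast
qed auto

lemma Const_unit: "c ~= 0 ==> Const c dvd 1"
 by (rule dvdI[of _ _ "Const (1 / c)"]) (simp flip: Const_mult)

lemma homogeneous_1_form:
 assumes "homogeneous (Suc 0) f" "vars_le 2 f"
 obtains a b c where "f = Const a * Var 0 + Const b * Var 1 + Const c * Var 2"
proof -
 let ?e = "%i. single i (Suc 0) :: nat \<Rightarrow>\<^sub>0 nat"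
 have k: "keys f \<subseteq> {?e 0, ?e 1, ?e 2}"
 proof
  fix m assume m: "m \<in> keys f"
  then have t: "(\<Sum>i\<in>keys m. lookup m i) = 1"
   using assms(1) by (simp add: homogeneous_def tdeg_def)
  then obtain i where i: "i \<in> keys m" "lookup m i = 1" "\<forall>j\<in>keys m. i ~= j \<longrightarrow> lookup m j = 0"
   using sum_eq_1_iff[OF finite_keys] by (metis One_nat_def)
  then have "m = ?e i" by (intro poly_mapping_eqI) (auto simp: lookup_single when_def in_keys_iff)
  moreover have "i \<le> 2" using vars_le_lookup[OF assms(2) m, of i] i by (cases "i \<le> 2") auto
  ultimately show "m \<in> {?e 0, ?e 1, ?e 2}" using cases_le2 by auto
 qed
 have "?e i ~= ?e j" if "i ~= j" for i j
  using that by (auto dest!: arg_cong[where f = "%m. lookup m i"] simp: lookup_single when_def)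
 then have ne: "?e 0 ~= ?e 1" "?e 0 ~= ?e 2" "?e 1 ~= ?e 2"
  by simp_all
 have "f = (\<Sum>m\<in>{?e 0, ?e 1, ?e 2}. single m (lookup f m))"
  by (subst (1) mpoly_sum_single, rule sum.mono_neutral_left) (use k in \<open>auto simp: in_keys_iff\<close>)
 also have "\<dots> = single (?e 0) (lookup f (?e 0)) + single (?e 1) (lookup f (?e 1)) + single (?e 2) (lookup f (?e 2))"
  using ne by (simp add: add.assoc)
 also have "\<dots> = Const (lookup f (?e 0)) * Var 0 + Const (lookup f (?e 1)) * Var 1 + Const (lookup f (?e 2)) * Var 2"
  by (simp add: Const_def Var_def mult_single)
 finally show ?thesis using that by blast
qed

text \<open>Multiply every variable beyond n by an auxiliary T. Then f has T-degree 0, hence so has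
  its factor g, and the specialisations T = 1 and T = 0 of g coincide; the latter contains no
  variable beyond n.\<close>

lemma vars_le_dvd:
 assumes "g dvd f" "f ~= 0" "vars_le n f"
 shows "vars_le n g"
proof -
 obtain h where h: "f = g * h" using assms by (elim dvdE)
 define W where "W = insertion (%c. [:Const c:]) (%i. if i \<le> n then [:Var i:] else [:0, Var i:])"
 have Wm: "W (a * b) = W a * W b" for a b by (simp add: W_def)
 have W1: "poly (W a) 1 = a" for a
 proof -
  have 1: "(%i. poly (if i \<le> n then [:Var i:] else [:0, Var i:]) 1) = Var" by auto
  show ?thesis unfolding W_def
   by (subst insertion_hom_comp[where h = Const and \<theta> = "%q. poly q 1"]) (simp_all add: 1)
 qed
 have W0: "poly (W a) 0 = psubst (%i. if i \<le> n then Var i else 0) a" for a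
 proof -
  have 1: "(%i. poly (if i \<le> n then [:Var i:] else [:0, Var i:]) 0) = (%i. if i \<le> n then Var i else 0)" by auto
  show ?thesis unfolding W_def
   by (subst insertion_hom_comp[where h = Const and \<theta> = "%q. poly q 0"]) (simp_all add: 1)
 qed
 have Wne: "W a ~= 0" if "a ~= 0" for a using W1[of a] that by auto
 have "W f = [:f:]"
 proof -
  have "W f = insertion (%c. [:Const c:]) (%i. [:Var i:]) f"
   unfolding W_def by (rule insertion_cong) (use assms in \<open>auto simp: vars_le_def\<close>)
  also have "\<dots> = [:psubst Var f:]"
   by (rule insertion_hom_comp[where \<theta> = "%c. [:c:]", symmetric]) (simp_all add: mult.commute)
  finally show ?thesis by simp
 qed
 moreover have "degree (W f) = degree (W g) + degree (W h)"
  unfolding h Wm by (rule degree_mult_eq) (use assms h Wne in auto)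
 ultimately have "degree (W g) = 0" by simp
 then obtain g0 where "W g = [:g0:]" by (metis degree_eq_zeroE)
 then have "g = psubst (%i. if i \<le> n then Var i else 0) g" using W0[of g] W1[of g] by simp
 moreover have "vars_le n (psubst (%i. if i \<le> n then Var i else 0) g)"
  by (rule vars_le_psubst) auto
 ultimately show ?thesis by simp
qed

lemma irreducible_linear:
 assumes "homogeneous (Suc 0) f" "f ~= 0" shows "irreducible f"
proof (rule irreducibleI)
 show "\<not> f dvd 1"
 proof
  assume "f dvd 1"
  then obtain g where "1 = f * g" by (elim dvdE)
  then have *: "homogeneous 0 (f * g)" by (metis homogeneous_1)
  then obtain e where "homogeneous e g" using homogeneous_factor[of 0 g f] \<open>1 = f * g\<close> by (metis mult.commute zero_neq_one)
  then have "homogeneous (Suc 0 + e) (f * g)" using assms by (intro homogeneous_mult)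
  then show False using homogeneous_degree_unique[OF *] \<open>1 = f * g\<close> by (metis Zero_not_Suc add_Suc zero_neq_one)
 qed
 fix g h assume f: "f = g * h"
 obtain d where d: "homogeneous d g" using homogeneous_factor[of "Suc 0" g h] assms f by auto
 obtain e where e: "homogeneous e h" using homogeneous_factor[of "Suc 0" h g] assms f by (auto simp: mult.commute)
 have "d + e = Suc 0"
  using homogeneous_degree_unique[OF homogeneous_mult[OF d e]] assms f by auto
 then have "d = 0 \<or> e = 0" by auto
 then show "g dvd 1 \<or> h dvd 1"
  using d e assms f Const_unit by (auto simp: homogeneous_0_iff)
qed fact

subsection \<open>Homogeneous coordinates\<close>

text \<open>Proportionality by vanishing minors. The zero vector is proportional to everything,
  which is why transitivity asks for a nonzero middle vector.\<close>

definition par :: "(nat => complex) => (nat => complex) => bool" where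
 "par u v \<longleftrightarrow> (\<forall>i j. u i * v j = u j * v i)"

lemma par_sym: "par u v ==> par v u"
 by (simp add: par_def mult.commute)

lemma par_obtain:
 assumes "par u v" "u i ~= 0"
 obtains c where "v = (%j. c * u j)"
proof
 show "v = (%j. v i / u i * u j)"
  using assms by (auto simp: par_def field_simps)
qed

lemma par_scale [simp]: "par u (%i. c * u i)" "par (%i. c * u i) u"
 by (simp_all add: par_def mult.left_commute mult.commute)

lemma par_refl [simp]: "par u u"
 by (simp add: par_def)

lemma par_trans: "par u v ==> par v w ==> v i ~= 0 ==> par u w"
proof -
 assume a: "par u v" "par v w" "v i ~= 0"
 obtain c where "u = (%j. c * v j)" using par_obtain[OF par_sym[OF a(1)] a(3)] .
 moreover obtain d where "w = (%j. d * v j)" using par_obtain[OF a(2,3)] .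
 ultimately show ?thesis by (simp add: par_def algebra_simps)
qed

lemma pivot_nz: "v k ~= 0 ==> v (pivot v) ~= 0"
 unfolding pivot_def by (rule LeastI)

lemma pivot_less: "i < pivot v ==> v i = 0"
 unfolding pivot_def by (metis not_less_Least)

lemma pivot_eqI: "v k ~= 0 ==> (!!i. i < k ==> v i = 0) ==> pivot v = k"
 unfolding pivot_def by (rule Least_equality) (auto simp: not_less[symmetric])

lemma to_point_scaled: "to_point v = (%i. (1 / v (pivot v)) * v i)"
 by (simp add: to_point_def)

lemma to_point_obtain:
 assumes "v k ~= 0"
 obtains c where "c ~= 0" "to_point v = (%i. c * v i)"
 using pivot_nz[of v k] assms that[of "1 / v (pivot v)"] by (simp add: to_point_scaled)

lemma to_point_obtain':
 assumes "v k ~= 0"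
 obtains c where "c ~= 0" "v = (%i. c * to_point v i)"
 using pivot_nz[of v k] assms that[of "v (pivot v)"] by (simp add: to_point_def)

lemma pivot_scale [simp]: "c ~= 0 ==> pivot (%i. c * v i) = pivot v"
 by (simp add: pivot_def)

lemma to_point_scale [simp]: "c ~= 0 ==> to_point (%i. c * v i) = to_point v"
 by (simp add: to_point_def fun_eq_iff)

lemma to_point_par:
 assumes "par u v" "u i ~= 0" "v j ~= 0" shows "to_point u = to_point v"
proof -
 obtain c where c: "v = (%j. c * u j)" by (rule par_obtain[OF assms(1,2)])
 with assms(3) have "c ~= 0" by auto
 then show ?thesis by (simp add: c)
qed

lemma par_to_point [simp]: "par v (to_point v)" "par (to_point v) v"
 unfolding to_point_scaled by (simp_all only: par_scale)

lemma to_point_nz: "v k ~= 0 ==> to_point v k ~= 0"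
 using pivot_nz[of v k] by (simp add: to_point_def)

lemma to_point_in_proj_space: "v k ~= 0 ==> (!!i. n < i ==> v i = 0) ==> to_point v \<in> proj_space n"
 unfolding proj_space_def to_point_def
 using pivot_nz[of v k] pivot_less[of _ v] by (auto intro!: exI[of _ "pivot v"] simp: not_less[symmetric])

lemma proj_space_nz: "p \<in> proj_space n ==> \<exists>k. p k ~= 0"
proof -
 assume "p \<in> proj_space n"
 then obtain k where "p k = 1" unfolding proj_space_def by blast
 then show ?thesis by (intro exI[of _ k]) simp
qed

lemma proj_space_beyond: "p \<in> proj_space n ==> n < i ==> p i = 0"
 by (simp add: proj_space_def)

lemma to_point_id [simp]: "p \<in> proj_space n ==> to_point p = p"
proof -
 assume "p \<in> proj_space n"
 then obtain k where k: "p k = 1" "\<forall>i<k. p i = 0" by (auto simp: proj_space_def)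
 then have "pivot p = k" by (intro pivot_eqI) auto
 then show ?thesis using k by (simp add: to_point_def)
qed

lemma peval_to_point_eq_0: "homogeneous d f ==> v k ~= 0 ==> peval (to_point v) f = 0 \<longleftrightarrow> peval v f = 0"
 by (rule to_point_obtain[of v k]) (simp_all add: peval_scale)

lemma evals_scale: "form_tuple d \<Phi> ==> evals \<Phi> (%i. c * p i) = (%i. c ^ d * evals \<Phi> p i)"
 by (auto simp: evals_def form_tuple_def intro!: ext peval_scale)

lemma evals_to_point:
 assumes "form_tuple d \<Phi>" "v k ~= 0" obtains c where "c ~= 0" "evals \<Phi> (to_point v) = (%i. c * evals \<Phi> v i)"
 using to_point_obtain[of v k] evals_scale[OF assms(1)] assms(2) by (metis power_not_zero)

subsection \<open>Closed sets and generic points\<close>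

lemma proj_closedI: "(!!f. f \<in> S ==> \<exists>d. homogeneous d f) ==> proj_closed {p \<in> proj_space n. \<forall>f\<in>S. peval p f = 0}"
 unfolding proj_closed_def by blast

lemma proj_closed_form: "homogeneous d f ==> proj_closed {p \<in> proj_space n. peval p f = 0}"
 using proj_closedI[of "{f}" n] by auto

lemma proj_closed_subset: "proj_closed Z ==> \<exists>n. Z \<subseteq> proj_space n"
 by (auto simp: proj_closed_def)

lemma proj_closed_separate:
 assumes "proj_closed Z" "v k ~= 0" "to_point v \<notin> Z"
 obtains s d where "homogeneous d s" "!!z. z \<in> Z ==> peval z s = 0" "peval v s ~= 0"
proof -
 obtain n S where S: "\<forall>f\<in>S. \<exists>d. homogeneous d f" and Z: "Z = {p \<in> proj_space n. \<forall>f\<in>S. peval p f = 0}"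
  using assms(1) unfolding proj_closed_def by blast
 show ?thesis
 proof (cases "\<exists>i>n. v i ~= 0")
  \<comment> \<open>The set \<open>Z\<close> lies in a projective space of some dimension n, whereas
    v may have further nonzero coordinates. Such a coordinate is itself a separating form.\<close>
  case True
  then obtain i where "i > n" "v i ~= 0" by blast
  then show ?thesis using that[of "Suc 0" "Var i"] by (auto simp: Z proj_space_def)
 next
  case False
  then have "to_point v \<in> proj_space n" using to_point_in_proj_space[of v k] assms(2) by blast
  then obtain f where "f \<in> S" "peval (to_point v) f ~= 0" using assms(3) Z by blast
  then show ?thesis using S that peval_to_point_eq_0[of _ f v k] assms(2) by (auto simp: Z)
 qed
qed

lemma proj_closed_separate':
 assumes "proj_closed Z" "p \<in> proj_space m" "p \<notin> Z"
 obtains s d where "homogeneous d s" "!!z. z \<in> Z ==> peval z s = 0" "peval p s ~= 0"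
 using proj_closed_separate[of Z p] proj_space_nz[OF assms(2)] assms by (metis to_point_id)

text \<open>Irreducibility tested on products of forms instead of unions of closed sets. This is
  what makes two nonempty open conditions compatible, and closedness enters separately where values
  of maps are concerned.\<close>

definition irr :: "point set => bool" where
 "irr X \<longleftrightarrow> X ~= {} \<and> (\<exists>n. X \<subseteq> proj_space n) \<and>
  (\<forall>a b d e. homogeneous d a \<longrightarrow> homogeneous e b \<longrightarrow> (\<forall>p\<in>X. peval p a * peval p b = 0) \<longrightarrow>
   (\<forall>p\<in>X. peval p a = 0) \<or> (\<forall>p\<in>X. peval p b = 0))"

lemma irr_space: "irr X ==> \<exists>n. X \<subseteq> proj_space n"
 by (simp add: irr_def)

lemma irr_nz: "irr X ==> p \<in> X ==> \<exists>k. p k ~= 0"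
 using irr_space proj_space_nz by blast

lemma irr_to_point [simp]: "irr X ==> p \<in> X ==> to_point p = p"
 using irr_space to_point_id by blast

lemma proj_variety_irr:
 assumes "proj_variety X" shows "irr X"
proof -
 obtain n where n: "X \<subseteq> proj_space n" using assms proj_closed_subset[of X] unfolding proj_variety_def by blast
 show ?thesis
  unfolding irr_def
 proof (intro conjI allI impI exI[of _ n])
  fix a b d e assume a: "homogeneous d a" and b: "homogeneous e b" and ab: "\<forall>p\<in>X. peval p a * peval p b = 0"
  let ?Z = "%a. {p \<in> proj_space n. peval p a = 0}"
  have "X \<subseteq> ?Z a \<union> ?Z b" using ab n by auto
  then have "X \<subseteq> ?Z a \<or> X \<subseteq> ?Z b"
   using assms proj_closed_form[OF a] proj_closed_form[OF b] unfolding proj_variety_def by blast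
  then show "(\<forall>p\<in>X. peval p a = 0) \<or> (\<forall>p\<in>X. peval p b = 0)" by auto
 qed (use assms n in \<open>auto simp: proj_variety_def\<close>)
qed

lemma irr_proj_variety:
 assumes "irr X" "proj_closed X" shows "proj_variety X"
 unfolding proj_variety_def
proof (intro conjI allI impI)
 fix A B assume A: "proj_closed A" and B: "proj_closed B" and sub: "X \<subseteq> A \<union> B"
 obtain n where n: "X \<subseteq> proj_space n" using assms irr_space by blast
 show "X \<subseteq> A \<or> X \<subseteq> B"
 proof (rule ccontr)
  assume "\<not> (X \<subseteq> A \<or> X \<subseteq> B)"
  then obtain p q where p: "p \<in> X" "p \<notin> A" and q: "q \<in> X" "q \<notin> B" by blast
  obtain a d where a: "homogeneous d a" "!!z. z \<in> A ==> peval z a = 0" "peval p a ~= 0"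
   using proj_closed_separate'[OF A subsetD[OF n p(1)] p(2)] by blast
  obtain b e where b: "homogeneous e b" "!!z. z \<in> B ==> peval z b = 0" "peval q b ~= 0"
   using proj_closed_separate'[OF B subsetD[OF n q(1)] q(2)] by blast
  have "\<forall>p\<in>X. peval p a * peval p b = 0" using sub a(2) b(2) by auto
  then show False using assms(1) a b p q unfolding irr_def by blast
 qed
qed (use assms in \<open>auto simp: irr_def\<close>)

text \<open>The filter of nonempty Zariski open subsets of X, given by the complements of zeros of
  single forms. Irreducibility closes it under intersection and keeps it proper, so generic
  statements combine by \<open>eventually_elim\<close>.\<close>

definition generic :: "point set => point filter" where
 "generic X = Abs_filter (%P. \<exists>d s. homogeneous d s \<and> (\<exists>p\<in>X. peval p s ~= 0) \<and> (\<forall>p\<in>X. peval p s ~= 0 \<longrightarrow> P p))"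

lemma eventually_generic:
 assumes "irr X"
 shows "eventually P (generic X) \<longleftrightarrow>
  (\<exists>d s. homogeneous d s \<and> (\<exists>p\<in>X. peval p s ~= 0) \<and> (\<forall>p\<in>X. peval p s ~= 0 \<longrightarrow> P p))"
 unfolding generic_def
proof (rule eventually_Abs_filter, rule is_filter.intro, goal_cases)
 case 1
 show ?case using assms by (intro exI[of _ 0] exI[of _ 1]) (auto simp: irr_def)
next
 case (2 P Q)
 then obtain d s e t where s: "homogeneous d s" "\<exists>p\<in>X. peval p s ~= 0" "\<forall>p\<in>X. peval p s ~= 0 \<longrightarrow> P p"
  and t: "homogeneous e t" "\<exists>p\<in>X. peval p t ~= 0" "\<forall>p\<in>X. peval p t ~= 0 \<longrightarrow> Q p" by blast
 have "\<exists>p\<in>X. peval p (s * t) ~= 0"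
  using assms s(1,2) t(1,2) unfolding irr_def by (metis coeff_hom_id insertion_mult)
 then show ?case using homogeneous_mult[OF s(1) t(1)] s(3) t(3)
  by (intro exI[of _ "d + e"] exI[of _ "s * t"]) auto
next
 case (3 P Q)
 then show ?case by blast
qed

lemma generic_form:
 "irr X ==> homogeneous d s ==> p \<in> X ==> peval p s ~= 0 ==> eventually (%p. peval p s ~= 0) (generic X)"
 by (auto simp: eventually_generic)

lemma generic_in: "irr X ==> eventually (%p. p \<in> X) (generic X)"
 unfolding eventually_generic by (intro exI[of _ 0] exI[of _ 1]) (auto simp: irr_def)

lemma generic_ex: "irr X ==> eventually P (generic X) ==> \<exists>p\<in>X. P p"
 by (auto simp: eventually_generic)

lemma generic_const [simp]: "irr X ==> eventually (%p. c) (generic X) \<longleftrightarrow> c"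
 using generic_ex[of X "%_. c"] by auto

lemma generic_identity:
 assumes "irr X" "homogeneous d s" "eventually (%p. peval p s = 0) (generic X)" "p \<in> X"
 shows "peval p s = 0"
proof (rule ccontr)
 assume "peval p s ~= 0"
 then have "eventually (%p. peval p s ~= 0) (generic X)" using generic_form assms by blast
 with assms(3) have "eventually (%p. False) (generic X)" by eventually_elim simp
 then show False using assms(1) by simp
qed

lemma generic_not_closed:
 assumes "irr X" "proj_closed Z" "\<not> X \<subseteq> Z" shows "eventually (%p. p \<notin> Z) (generic X)"
proof -
 obtain p n where "p \<in> X" "p \<notin> Z" "X \<subseteq> proj_space n" using assms irr_space by blast
 then obtain s d where "homogeneous d s" "!!z. z \<in> Z ==> peval z s = 0" "peval p s ~= 0"
  using proj_closed_separate'[OF assms(2)] by blast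
 then show ?thesis unfolding eventually_generic[OF assms(1)] using \<open>p \<in> X\<close> by blast
qed

lemma homogeneous_comp: "homogeneous d s ==> form_tuple e \<Phi> ==> homogeneous (d * e) (psubst \<Phi> s)"
 by (rule homogeneous_psubst) (auto simp: form_tuple_def)

lemma form_tuple_comp: "form_tuple d \<Psi> ==> form_tuple e \<Phi> ==> form_tuple (d * e) (%i. psubst \<Phi> (\<Psi> i))"
 by (auto simp: form_tuple_def homogeneous_comp)

lemma peval_comp: "peval p (psubst \<Phi> s) = peval (evals \<Phi> p) s"
 by (simp add: evals_def)

lemma evals_comp: "evals (%i. psubst \<Phi> (\<Psi> i)) p = evals \<Psi> (evals \<Phi> p)"
 by (simp add: evals_def)

subsection \<open>Rational maps\<close>

definition tuple_on :: "point set => (nat => mpoly) => bool" where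
 "tuple_on X \<Phi> \<longleftrightarrow> (\<exists>d. form_tuple d \<Phi>) \<and> (\<exists>p\<in>X. \<exists>i. peval p (\<Phi> i) ~= 0)"

lemma map_tuple_tuple_on: "map_tuple X Y \<Phi> ==> tuple_on X \<Phi>"
 by (auto simp: map_tuple_def tuple_on_def)

lemma same_on_par: "same_on X \<Phi> \<Psi> \<longleftrightarrow> (\<forall>p\<in>X. par (evals \<Phi> p) (evals \<Psi> p))"
 by (auto simp: same_on_def par_def evals_def)

lemma same_on_sym: "same_on X \<Phi> \<Psi> ==> same_on X \<Psi> \<Phi>"
 by (auto simp: same_on_par par_sym)

lemma generic_tuple_nz:
 assumes "irr X" "tuple_on X \<Phi>" shows "\<exists>i. eventually (%p. evals \<Phi> p i ~= 0) (generic X)"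
 using assms generic_form unfolding tuple_on_def form_tuple_def evals_def by blast

text \<open>Proportionality of two tuples is a system of equations between forms, so it extends from
  a dense open set to all of X. It is thus enough to compare tuples where they do not
  vanish.\<close>

lemma generic_par_same_on:
 assumes "irr X" "form_tuple d \<Phi>" "form_tuple e \<Psi>" "eventually (%p. par (evals \<Phi> p) (evals \<Psi> p)) (generic X)"
 shows "same_on X \<Phi> \<Psi>"
 unfolding same_on_def
proof (intro ballI allI)
 fix p i j assume p: "p \<in> X"
 let ?s = "\<Phi> i * \<Psi> j - \<Phi> j * \<Psi> i"
 have h: "homogeneous (d + e) ?s"
  using assms by (intro homogeneous_diff homogeneous_mult) (auto simp: form_tuple_def)
 have "eventually (%p. peval p ?s = 0) (generic X)"
  using assms(4) by eventually_elim (simp add: par_def evals_def)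
 then have "peval p ?s = 0" by (rule generic_identity[OF assms(1) h _ p])
 then show "peval p (\<Phi> i) * peval p (\<Psi> j) = peval p (\<Phi> j) * peval p (\<Psi> i)" by simp
qed

lemma same_on_trans:
 assumes "irr X" "tuple_on X \<Phi>" "form_tuple d \<Psi>" "form_tuple e \<Psi>'" "same_on X \<Psi> \<Phi>" "same_on X \<Phi> \<Psi>'"
 shows "same_on X \<Psi> \<Psi>'"
proof (rule generic_par_same_on[OF assms(1,3,4)])
 obtain i where "eventually (%p. evals \<Phi> p i ~= 0) (generic X)" using generic_tuple_nz assms by blast
 with generic_in[OF assms(1)] show "eventually (%p. par (evals \<Psi> p) (evals \<Psi>' p)) (generic X)"
  by eventually_elim (use assms(5,6) in \<open>auto simp: same_on_par intro: par_trans\<close>)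
qed

text \<open>Any two regular representatives at p are proportional on X through the generically
  nonzero \<Phi>, so the choice made in \<open>rmap\<close> has no effect on the value.\<close>

lemma rmap_SomeI:
 assumes "irr X" "tuple_on X \<Phi>" "p \<in> X" "regular_rep X \<Phi> p \<Psi>"
 shows "rmap X \<Phi> p = Some (to_point (evals \<Psi> p))"
proof -
 define \<Psi>' where "\<Psi>' = (SOME \<Psi>. regular_rep X \<Phi> p \<Psi>)"
 have r: "regular_rep X \<Phi> p \<Psi>'" unfolding \<Psi>'_def by (rule someI[of _ \<Psi>]) fact
 have "same_on X \<Psi>' \<Psi>"
  using same_on_trans[OF assms(1,2)] assms(4) r by (meson regular_rep_def same_on_sym)
 then have "to_point (evals \<Psi>' p) = to_point (evals \<Psi> p)"
  using assms(3,4) r by (auto simp: regular_rep_def same_on_par evals_def intro: to_point_par)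
 then show ?thesis using assms by (auto simp: rmap_def \<Psi>'_def)
qed

lemma rmap_SomeD:
 assumes "rmap X \<Phi> p = Some y"
 obtains \<Psi> where "p \<in> X" "regular_rep X \<Phi> p \<Psi>" "y = to_point (evals \<Psi> p)"
proof -
 have *: "p \<in> X" "\<exists>\<Psi>. regular_rep X \<Phi> p \<Psi>" "y = to_point (evals (SOME \<Psi>. regular_rep X \<Phi> p \<Psi>) p)"
  using assms by (auto simp: rmap_def split: if_splits)
 show ?thesis by (rule that[OF *(1) someI_ex[OF *(2)] *(3)])
qed

lemma regular_rep_self: "form_tuple d \<Phi> ==> evals \<Phi> p i ~= 0 ==> regular_rep X \<Phi> p \<Phi>"
 by (auto simp: regular_rep_def same_on_par evals_def)

lemma rmap_eval:
 "irr X ==> tuple_on X \<Phi> ==> p \<in> X ==> evals \<Phi> p i ~= 0 ==> rmap X \<Phi> p = Some (to_point (evals \<Phi> p))"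
 by (rule rmap_SomeI) (auto simp: tuple_on_def intro: regular_rep_self)

lemma generic_rmap:
 assumes "irr X" "tuple_on X \<Phi>"
 shows "eventually (%p. p \<in> X \<and> (\<exists>i. evals \<Phi> p i ~= 0) \<and> rmap X \<Phi> p = Some (to_point (evals \<Phi> p))) (generic X)"
proof -
 obtain i where "eventually (%p. evals \<Phi> p i ~= 0) (generic X)" using generic_tuple_nz assms by blast
 with generic_in[OF assms(1)] show ?thesis by eventually_elim (use assms rmap_eval in blast)
qed

lemma rmap_cong:
 assumes "irr X" "tuple_on X \<Phi>" "tuple_on X \<Psi>" "eventually (%p. par (evals \<Phi> p) (evals \<Psi> p)) (generic X)"
 shows "rmap X \<Phi> = rmap X \<Psi>"
proof -
 have s: "same_on X \<Phi> \<Psi>" using generic_par_same_on assms unfolding tuple_on_def by blast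
 have "regular_rep X \<Phi> = regular_rep X \<Psi>"
  unfolding regular_rep_def fun_eq_iff
  using same_on_trans[OF assms(1,2)] same_on_trans[OF assms(1,3)] s same_on_sym assms(2,3)
  unfolding tuple_on_def by blast
 then show ?thesis unfolding rmap_def by (intro ext) (simp only:)
qed

lemma rational_mapsE:
 assumes "f \<in> rational_maps X Y" obtains \<Phi> d where "f = rmap X \<Phi>" "map_tuple X Y \<Phi>" "tuple_on X \<Phi>" "form_tuple d \<Phi>"
proof -
 obtain \<Phi> where *: "f = rmap X \<Phi>" "map_tuple X Y \<Phi>" using assms unfolding rational_maps_def by blast
 then obtain d where "form_tuple d \<Phi>" by (auto simp: map_tuple_def)
 then show ?thesis using that * map_tuple_tuple_on by blast
qed

lemma generic_rational:
 assumes "irr X" "f \<in> rational_maps X Y" shows "eventually (%p. \<exists>y\<in>Y. f p = Some y) (generic X)"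
proof -
 obtain \<Phi> d where "f = rmap X \<Phi>" "map_tuple X Y \<Phi>" "tuple_on X \<Phi>" by (rule rational_mapsE[OF assms(2)])
 then show ?thesis
  by (intro eventually_mono[OF generic_rmap[OF assms(1)]]) (auto simp: map_tuple_def evals_def)
qed

lemma rational_maps_eqI:
 assumes "irr X" "f \<in> rational_maps X Y" "g \<in> rational_maps X Y'" "eventually (%p. f p = g p) (generic X)"
 shows "f = g"
proof -
 obtain \<Phi> d where f: "f = rmap X \<Phi>" "tuple_on X \<Phi>" "form_tuple d \<Phi>" by (rule rational_mapsE[OF assms(2)])
 obtain \<Psi> e where g: "g = rmap X \<Psi>" "tuple_on X \<Psi>" "form_tuple e \<Psi>" by (rule rational_mapsE[OF assms(3)])
 have "eventually (%p. par (evals \<Phi> p) (evals \<Psi> p)) (generic X)"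
  using assms(4) generic_rmap[OF assms(1) f(2)] generic_rmap[OF assms(1) g(2)]
 proof eventually_elim
  case (elim p)
  then obtain j where j: "evals \<Psi> p j ~= 0" and eq: "to_point (evals \<Phi> p) = to_point (evals \<Psi> p)"
   using f g by auto
  have "par (evals \<Phi> p) (to_point (evals \<Psi> p))" unfolding eq[symmetric] by (rule par_to_point)
  then show ?case by (rule par_trans[OF _ par_to_point(2) to_point_nz[of "evals \<Psi> p" j, OF j]])
 qed
 then show ?thesis unfolding f(1) g(1) by (rule rmap_cong[OF assms(1) f(2) g(2)])
qed

text \<open>At p the tuple \<Phi> may vanish and the value comes from another representative \<Psi>.
  An equation of W composed with \<Psi> is a form that vanishes generically, hence at p as
  well.\<close>

lemma rational_value_closed:
 assumes "irr X" "tuple_on X \<Phi>" "proj_closed W" "eventually (%p. to_point (evals \<Phi> p) \<in> W) (generic X)"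
  "rmap X \<Phi> p = Some y"
 shows "y \<in> W"
proof (rule ccontr)
 assume y: "y \<notin> W"
 obtain \<Psi> where \<Psi>: "p \<in> X" "regular_rep X \<Phi> p \<Psi>" "y = to_point (evals \<Psi> p)"
  by (rule rmap_SomeD[OF assms(5)])
 then obtain i e where i: "evals \<Psi> p i ~= 0" "form_tuple e \<Psi>" "same_on X \<Phi> \<Psi>" by (auto simp: regular_rep_def evals_def)
 obtain s d where s: "homogeneous d s" "!!z. z \<in> W ==> peval z s = 0" "peval (evals \<Psi> p) s ~= 0"
  using proj_closed_separate[OF assms(3), of "evals \<Psi> p" i] i(1) y \<Psi>(3) by blast
 have "eventually (%p. evals \<Psi> p i ~= 0) (generic X)"
  using generic_form[OF assms(1) _ \<Psi>(1), of e "\<Psi> i"] i(1,2) by (auto simp: evals_def form_tuple_def)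
 with assms(4) generic_rmap[OF assms(1,2)]
 have "eventually (%p. peval p (psubst \<Psi> s) = 0) (generic X)"
 proof eventually_elim
  case (elim q)
  have "par (evals \<Psi> q) (to_point (evals \<Phi> q))"
   using elim i(3) by (metis par_sym par_to_point(1) par_trans same_on_par)
  moreover obtain j where "evals \<Phi> q j ~= 0" using elim by blast
  ultimately have "to_point (evals \<Psi> q) = to_point (to_point (evals \<Phi> q))"
   using to_point_par[of "evals \<Psi> q" "to_point (evals \<Phi> q)" i j] to_point_nz[of "evals \<Phi> q" j] elim(3) by blast
  also have "\<dots> = to_point (evals \<Phi> q)"
   using to_point_par[OF par_to_point(2), of "evals \<Phi> q" j j] to_point_nz[of "evals \<Phi> q" j] \<open>evals \<Phi> q j ~= 0\<close> by blast
  finally show ?case unfolding peval_comp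
   using elim(1) s(2) peval_to_point_eq_0[OF s(1), of "evals \<Psi> q" i] elim(3) by metis
 qed
 then have "peval p (psubst \<Psi> s) = 0" by (rule generic_identity[OF assms(1) homogeneous_comp[OF s(1) i(2)] _ \<Psi>(1)])
 then show False using s(3) by (simp add: evals_def)
qed

lemma map_tupleI:
 assumes "irr X" "tuple_on X \<Phi>" "proj_closed W" "eventually (%p. to_point (evals \<Phi> p) \<in> W) (generic X)"
 shows "map_tuple X W \<Phi>"
 unfolding map_tuple_def
 using assms rational_value_closed[OF assms] rmap_eval[OF assms(1,2)]
 by (auto simp: tuple_on_def evals_def)

lemma rational_value:
 assumes "irr X" "proj_closed Y" "f \<in> rational_maps X Y" "f p = Some y"
 shows "p \<in> X" "y \<in> Y"
proof -
 obtain \<Phi> d where f: "f = rmap X \<Phi>" "map_tuple X Y \<Phi>" "tuple_on X \<Phi>" by (rule rational_mapsE[OF assms(3)])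
 show "p \<in> X" using assms(4) f by (auto elim: rmap_SomeD)
 have "eventually (%p. to_point (evals \<Phi> p) \<in> Y) (generic X)"
  using generic_rmap[OF assms(1) f(3)] by eventually_elim (use f(2) in \<open>auto simp: map_tuple_def evals_def\<close>)
 then show "y \<in> Y" using rational_value_closed[OF assms(1) f(3) assms(2)] assms(4) f by blast
qed

lemma rational_value_form:
 assumes "irr X" "f \<in> rational_maps X Y" "homogeneous d s" "eventually (%p. peval (the (f p)) s = 0) (generic X)" "f p = Some y"
 shows "peval y s = 0"
proof -
 obtain \<Phi> e where f: "f = rmap X \<Phi>" "tuple_on X \<Phi>" "form_tuple e \<Phi>" by (rule rational_mapsE[OF assms(2)])
 obtain \<Psi> where \<Psi>: "p \<in> X" "regular_rep X \<Phi> p \<Psi>" "y = to_point (evals \<Psi> p)"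
  using rmap_SomeD assms(5) f by metis
 then obtain i e' where i: "evals \<Psi> p i ~= 0" "form_tuple e' \<Psi>" "same_on X \<Phi> \<Psi>" by (auto simp: regular_rep_def evals_def)
 have "eventually (%q. peval q (psubst \<Psi> s) * peval q (\<Psi> i) = 0) (generic X)"
  using assms(4) generic_rmap[OF assms(1) f(2)]
 proof eventually_elim
  case (elim q)
  then have q: "q \<in> X" "peval (to_point (evals \<Phi> q)) s = 0" by (auto simp: f)
  obtain j where j: "evals \<Phi> q j ~= 0" using elim by blast
  have "par (evals \<Phi> q) (evals \<Psi> q)" using i(3) q by (auto simp: same_on_par)
  then obtain c where "evals \<Psi> q = (%i. c * evals \<Phi> q i)" using par_obtain j by blast
  then have "peval (evals \<Psi> q) s = 0" using q(2) j by (simp add: peval_scale[OF assms(3)] peval_to_point_eq_0[OF assms(3), of "evals \<Phi> q" j])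
  then show ?case by (simp add: evals_def)
 qed
 then have "peval p (psubst \<Psi> s * \<Psi> i) = 0"
  using generic_identity[OF assms(1) homogeneous_mult[OF homogeneous_comp[OF assms(3) i(2)]] _ \<Psi>(1), of e' "\<Psi> i"] i(2)
  by (auto simp: form_tuple_def)
 then have "peval (evals \<Psi> p) s = 0" using i by (simp add: evals_def)
 then show ?thesis using \<Psi>(3) i(1) peval_to_point_eq_0[OF assms(3), of "evals \<Psi> p" i] by simp
qed

text \<open>One point in the domain of the composite is enough. Representatives regular there
  compose to a tuple \<Theta> that is nonzero at that point, hence generically; at any other point
  of the domain the composed local representatives are proportional to \<Theta>, so the rational map
  of \<Theta> extends the composite.\<close>

lemma rational_comp:
 assumes X: "irr X" and Y: "irr Y" "proj_closed Y" and Z: "proj_closed Z" and f: "f \<in> rational_maps X Y" and g: "g \<in> rational_maps Y Z"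
  and p0: "(g \<circ>\<^sub>m f) p0 = Some z0"
 shows "\<exists>h \<in> rational_maps X Z. (g \<circ>\<^sub>m f) \<subseteq>\<^sub>m h \<and> eventually (%p. p \<in> dom (g \<circ>\<^sub>m f)) (generic X)"
proof -
 obtain \<Phi> d where \<Phi>: "f = rmap X \<Phi>" "tuple_on X \<Phi>" by (rule rational_mapsE[OF f])
 obtain \<Psi> e where \<Psi>: "g = rmap Y \<Psi>" "tuple_on Y \<Psi>" by (rule rational_mapsE[OF g])
 have local: "\<exists>\<Phi>' \<Psi>' d e. form_tuple d \<Phi>' \<and> form_tuple e \<Psi>' \<and> same_on X \<Phi> \<Phi>' \<and> same_on Y \<Psi> \<Psi>' \<and> p \<in> X \<and>
   (\<exists>i. evals \<Phi>' p i ~= 0) \<and> (\<exists>i. evals \<Psi>' (evals \<Phi>' p) i ~= 0) \<and> z = to_point (evals \<Psi>' (evals \<Phi>' p))"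
  if fg: "(g \<circ>\<^sub>m f) p = Some z" for p z
 proof -
  obtain y where y: "f p = Some y" "g y = Some z" using fg by (auto simp: map_comp_def split: option.splits)
  obtain \<Phi>' where \<Phi>': "p \<in> X" "regular_rep X \<Phi> p \<Phi>'" "y = to_point (evals \<Phi>' p)" using rmap_SomeD y(1) \<Phi> by metis
  obtain \<Psi>' where \<Psi>': "y \<in> Y" "regular_rep Y \<Psi> y \<Psi>'" "z = to_point (evals \<Psi>' y)" using rmap_SomeD y(2) \<Psi> by metis
  obtain d i where d: "form_tuple d \<Phi>'" "same_on X \<Phi> \<Phi>'" "evals \<Phi>' p i ~= 0" using \<Phi>' by (auto simp: regular_rep_def evals_def)
  obtain e j where e: "form_tuple e \<Psi>'" "same_on Y \<Psi> \<Psi>'" "evals \<Psi>' y j ~= 0" using \<Psi>' by (auto simp: regular_rep_def evals_def)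
  obtain c where c: "c ~= 0" "evals \<Psi>' y = (%i. c * evals \<Psi>' (evals \<Phi>' p) i)"
   using evals_to_point[OF e(1), of "evals \<Phi>' p" i] d(3) \<Phi>'(3) by metis
  have "evals \<Psi>' (evals \<Phi>' p) j ~= 0" using e(3) c by simp
  moreover have "z = to_point (evals \<Psi>' (evals \<Phi>' p))" using c \<Psi>'(3) by simp
  ultimately show ?thesis using d e \<Phi>' by blast
 qed
 obtain \<Phi>0 \<Psi>0 d0 e0 i0 j0 where 0: "form_tuple d0 \<Phi>0" "form_tuple e0 \<Psi>0" "same_on X \<Phi> \<Phi>0" "same_on Y \<Psi> \<Psi>0" "p0 \<in> X"
   "evals \<Phi>0 p0 i0 ~= 0" "evals \<Psi>0 (evals \<Phi>0 p0) j0 ~= 0" using local[OF p0] by blast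
 define \<Theta> where "\<Theta> = (%i. psubst \<Phi>0 (\<Psi>0 i))"
 have \<Theta>: "form_tuple (e0 * d0) \<Theta>" "!!p. evals \<Theta> p = evals \<Psi>0 (evals \<Phi>0 p)"
  unfolding \<Theta>_def using form_tuple_comp[OF 0(2,1)] by (simp_all add: evals_comp)
 have \<Theta>X: "tuple_on X \<Theta>" unfolding tuple_on_def using \<Theta> 0(5,7) by (metis evals_def)
 have tX: "tuple_on X \<Phi>0" unfolding tuple_on_def using 0 by (auto simp: evals_def)
 have fX: "f = rmap X \<Phi>0" unfolding \<Phi>(1)
  by (rule rmap_cong[OF X \<Phi>(2) tX]) (use 0(3) generic_in[OF X] in \<open>auto simp: same_on_par elim!: eventually_mono\<close>)
 have inY: "to_point (evals \<Phi>0 q) \<in> Y" if "q \<in> X" "evals \<Phi>0 q i ~= 0" for q i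
  using rational_value(2)[OF X Y(2) f] rmap_eval[OF X tX that] fX by metis
 have \<Psi>Y: "evals \<Psi> (to_point (evals \<Phi>0 q)) = evals \<Psi> (to_point (evals \<Phi>0 q))" for q ..
 have nzgen: "eventually (%q. q \<in> X \<and> evals \<Theta> q j0 ~= 0 \<and> evals \<Phi>0 q i0 ~= 0) (generic X)"
 proof -
  have "eventually (%q. peval q (\<Theta> j0) ~= 0) (generic X)" "eventually (%q. peval q (\<Phi>0 i0) ~= 0) (generic X)"
   by (rule generic_form[OF X _ 0(5)], use \<Theta> 0 in \<open>auto simp: form_tuple_def evals_def fun_eq_iff\<close>)+
  with generic_in[OF X] show ?thesis by eventually_elim (simp add: evals_def)
 qed
 have tY: "tuple_on Y \<Psi>0"
 proof -
  obtain c where "c ~= 0" "evals \<Psi>0 (to_point (evals \<Phi>0 p0)) = (%i. c * evals \<Psi>0 (evals \<Phi>0 p0) i)"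
   using evals_to_point[OF 0(2), of "evals \<Phi>0 p0" i0] 0(6) by metis
  then have "evals \<Psi>0 (to_point (evals \<Phi>0 p0)) j0 ~= 0" using 0(7) by simp
  then show ?thesis unfolding tuple_on_def using 0(2) inY[OF 0(5,6)] by (auto simp: evals_def)
 qed
 have gY: "g = rmap Y \<Psi>0" unfolding \<Psi>(1)
  by (rule rmap_cong[OF Y(1) \<Psi>(2) tY]) (use 0(4) generic_in[OF Y(1)] in \<open>auto simp: same_on_par elim!: eventually_mono\<close>)
 have val: "(g \<circ>\<^sub>m f) q = Some (to_point (evals \<Theta> q))" if q: "q \<in> X" "evals \<Theta> q j ~= 0" "evals \<Phi>0 q i ~= 0" for q i j
 proof -
  obtain c where c: "c ~= 0" "evals \<Psi>0 (to_point (evals \<Phi>0 q)) = (%i. c * evals \<Theta> q i)"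
   using evals_to_point[OF 0(2), of "evals \<Phi>0 q" i] q(3) by (metis \<Theta>(2))
  have "g (to_point (evals \<Phi>0 q)) = Some (to_point (evals \<Psi>0 (to_point (evals \<Phi>0 q))))"
   unfolding gY by (rule rmap_eval[OF Y(1) tY inY[OF q(1,3)], of j]) (use c q in simp)
  moreover have "f q = Some (to_point (evals \<Phi>0 q))" unfolding fX by (rule rmap_eval[OF X tX q(1,3)])
  ultimately show ?thesis using c by simp
 qed
 have ev: "eventually (%p. (g \<circ>\<^sub>m f) p = Some (to_point (evals \<Theta> p))) (generic X)"
  using nzgen by eventually_elim (use val in blast)
 have "eventually (%p. to_point (evals \<Theta> p) \<in> Z) (generic X)"
  using ev
 proof eventually_elim
  case (elim p)
  then obtain y where "f p = Some y" "g y = Some (to_point (evals \<Theta> p))" by (auto simp: map_comp_def split: option.splits)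
  then show ?case using rational_value(2)[OF Y(1) Z g] by blast
 qed
 then have mt: "map_tuple X Z \<Theta>" by (rule map_tupleI[OF X \<Theta>X Z])
 have "(g \<circ>\<^sub>m f) \<subseteq>\<^sub>m rmap X \<Theta>"
 proof (clarsimp simp only: map_le_def dom_def mem_Collect_eq)
  fix p z assume pz: "(g \<circ>\<^sub>m f) p = Some z"
  obtain \<Phi>1 \<Psi>1 d1 e1 i1 j1 where 1: "form_tuple d1 \<Phi>1" "form_tuple e1 \<Psi>1" "same_on X \<Phi> \<Phi>1" "same_on Y \<Psi> \<Psi>1" "p \<in> X"
   "evals \<Phi>1 p i1 ~= 0" "evals \<Psi>1 (evals \<Phi>1 p) j1 ~= 0" "z = to_point (evals \<Psi>1 (evals \<Phi>1 p))" using local[OF pz] by blast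
  define \<Theta>1 where "\<Theta>1 = (%i. psubst \<Phi>1 (\<Psi>1 i))"
  have \<Theta>1: "form_tuple (e1 * d1) \<Theta>1" "!!p. evals \<Theta>1 p = evals \<Psi>1 (evals \<Phi>1 p)"
   unfolding \<Theta>1_def using form_tuple_comp[OF 1(2,1)] by (simp_all add: evals_comp)
  have "same_on X \<Phi>0 \<Phi>1" using same_on_trans[OF X \<Phi>(2) 0(1) 1(1)] 0(3) 1(3) same_on_sym by blast
  have "same_on Y \<Psi>0 \<Psi>1" using same_on_trans[OF Y(1) \<Psi>(2) 0(2) 1(2)] 0(4) 1(4) same_on_sym by blast
  have "same_on X \<Theta> \<Theta>1"
  proof (rule generic_par_same_on[OF X \<Theta>(1) \<Theta>1(1)])
   show "eventually (%p. par (evals \<Theta> p) (evals \<Theta>1 p)) (generic X)"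
    using nzgen
   proof eventually_elim
    case (elim q)
    then obtain c where c: "evals \<Phi>1 q = (%i. c * evals \<Phi>0 q i)"
     using par_obtain \<open>same_on X \<Phi>0 \<Phi>1\<close> unfolding same_on_par by metis
    obtain k where k: "k ~= 0" "evals \<Phi>0 q = (%i. k * to_point (evals \<Phi>0 q) i)"
     using to_point_obtain' elim by blast
    let ?y = "to_point (evals \<Phi>0 q)"
    have "par (evals \<Psi>0 ?y) (evals \<Psi>1 ?y)" using \<open>same_on Y \<Psi>0 \<Psi>1\<close> inY elim unfolding same_on_par by blast
    moreover have "evals \<Theta> q = (%i. k ^ e0 * evals \<Psi>0 ?y i)"
     unfolding \<Theta>(2) by (subst k(2)) (rule evals_scale[OF 0(2)])
    moreover have "evals \<Theta>1 q = (%i. (c * k) ^ e1 * evals \<Psi>1 ?y i)"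
     unfolding \<Theta>1(2) c by (subst k(2)) (simp add: evals_scale[OF 1(2)] flip: mult.assoc)
    ultimately show ?case by (simp add: par_def)
   qed
  qed
  then have "regular_rep X \<Theta> p \<Theta>1" unfolding regular_rep_def using \<Theta>1 1(7) by (metis evals_def)
  then show "Some z = rmap X \<Theta> p" using rmap_SomeI[OF X \<Theta>X 1(5)] 1(8) \<Theta>1(2) by simp
 qed
 moreover have "rmap X \<Theta> \<in> rational_maps X Z" unfolding rational_maps_def using mt by blast
 moreover have "eventually (%p. p \<in> dom (g \<circ>\<^sub>m f)) (generic X)" using ev by eventually_elim auto
 ultimately show ?thesis by blast
qed

lemma rcomp_props:
 assumes X: "irr X" and Y: "irr Y" "proj_closed Y" and Z: "proj_closed Z" and f: "f \<in> rational_maps X Y" and g: "g \<in> rational_maps Y Z"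
  and p0: "(g \<circ>\<^sub>m f) p0 = Some z0"
 shows "rcomp X Z g f \<in> rational_maps X Z" "(g \<circ>\<^sub>m f) \<subseteq>\<^sub>m rcomp X Z g f"
  "eventually (%p. (g \<circ>\<^sub>m f) p ~= None \<and> rcomp X Z g f p = (g \<circ>\<^sub>m f) p) (generic X)"
proof -
 obtain h where h: "h \<in> rational_maps X Z" "(g \<circ>\<^sub>m f) \<subseteq>\<^sub>m h" "eventually (%p. p \<in> dom (g \<circ>\<^sub>m f)) (generic X)"
  using rational_comp[OF assms] by blast
 have "h' = h" if "h' \<in> rational_maps X Z" "(g \<circ>\<^sub>m f) \<subseteq>\<^sub>m h'" for h'
  by (rule rational_maps_eqI[OF X that(1) h(1)], rule eventually_mono[OF h(3)])
   (use that(2) h(2) in \<open>auto simp: map_le_def\<close>)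
 then have eq: "rcomp X Z g f = h" unfolding rcomp_def using h by blast
 show "rcomp X Z g f \<in> rational_maps X Z" "(g \<circ>\<^sub>m f) \<subseteq>\<^sub>m rcomp X Z g f" using eq h by auto
 show "eventually (%p. (g \<circ>\<^sub>m f) p ~= None \<and> rcomp X Z g f p = (g \<circ>\<^sub>m f) p) (generic X)"
  using h(3) by eventually_elim (use h(2) eq in \<open>auto simp: map_le_def dom_def\<close>)
qed

lemma tuple_on_Var:
 assumes X: "irr X" shows "tuple_on X Var"
proof -
 obtain p where "p \<in> X" using X by (auto simp: irr_def)
 then obtain k where "p k ~= 0" using irr_nz[OF X] by blast
 moreover have "form_tuple (Suc 0) Var" by (simp add: form_tuple_def)
 ultimately show ?thesis using \<open>p \<in> X\<close> by (auto simp: tuple_on_def)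
qed

lemma rmap_Var: "irr X ==> rmap X Var = Some |` X"
proof
 fix p assume X: "irr X"
 have t: "tuple_on X Var" by (rule tuple_on_Var[OF X])
 have ev: "evals Var p = p" by (simp add: evals_def)
 show "rmap X Var p = (Some |` X) p"
 proof (cases "p \<in> X")
  case True
  then show ?thesis using rmap_eval[OF X t True] irr_nz[OF X True] X by (auto simp: ev)
 next
  case False
  then show ?thesis by (simp add: rmap_def)
 qed
qed

lemma id_rational:
 assumes X: "irr X" shows "Some |` X \<in> rational_maps X X"
proof -
 have "map_tuple X X Var"
  using tuple_on_Var[OF X] X by (auto simp: map_tuple_def tuple_on_def evals_def)
 then show ?thesis unfolding rmap_Var[OF X, symmetric] rational_maps_def by blast
qed

subsection \<open>Dominant and birational maps\<close>

text \<open>Dominance as convergence of generic filters: a dominant map sends generic points to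
  generic points, and composites are handled by composition of limits.\<close>

abbreviation dominant :: "(point \<rightharpoonup> point) => point set => point set => bool" where
 "dominant f X Y \<equiv> filterlim (%p. the (f p)) (generic Y) (generic X)"

lemma generic_ne_bot: "irr X ==> generic X ~= bot"
 by (metis eventually_bot generic_const)

lemma dominantI:
 assumes X: "irr X" and Y: "irr Y" and f: "f \<in> rational_maps X Y"
  and dom: "!!s d. homogeneous d s ==> eventually (%p. peval (the (f p)) s = 0) (generic X) ==> \<forall>y\<in>Y. peval y s = 0"
 shows "dominant f X Y"
 unfolding filterlim_iff
proof (intro allI impI)
 fix P assume "eventually P (generic Y)"
 then obtain d s where s: "homogeneous d s" "\<exists>p\<in>Y. peval p s ~= 0" "\<forall>p\<in>Y. peval p s ~= 0 \<longrightarrow> P p"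
  by (auto simp: eventually_generic[OF Y])
 obtain \<Phi> e where \<Phi>: "f = rmap X \<Phi>" "map_tuple X Y \<Phi>" "tuple_on X \<Phi>" "form_tuple e \<Phi>" by (rule rational_mapsE[OF f])
 have g: "eventually (%p. p \<in> X \<and> the (f p) \<in> Y \<and> (peval (the (f p)) s = 0 \<longleftrightarrow> peval p (psubst \<Phi> s) = 0)) (generic X)"
  using generic_rmap[OF X \<Phi>(3)]
 proof eventually_elim
  case (elim p)
  then obtain i where i: "evals \<Phi> p i ~= 0" by blast
  show ?case using elim \<Phi>(2) i peval_to_point_eq_0[OF s(1), of "evals \<Phi> p" i]
   by (auto simp: \<Phi>(1) peval_comp map_tuple_def simp flip: evals_def) (auto simp: evals_def)
 qed
 have "\<exists>p\<in>X. peval p (psubst \<Phi> s) ~= 0"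
 proof (rule ccontr)
  assume "\<not> ?thesis"
  with g have "eventually (%p. peval (the (f p)) s = 0) (generic X)" by (auto elim!: eventually_mono)
  then show False using dom s by blast
 qed
 then have "eventually (%p. peval p (psubst \<Phi> s) ~= 0) (generic X)"
  using generic_form[OF X homogeneous_comp[OF s(1) \<Phi>(4)]] by blast
 with g show "eventually (%p. P (the (f p))) (generic X)"
  by eventually_elim (use s in auto)
qed

lemma dominant_form:
 assumes "irr X" "irr Y" "filterlim f (generic Y) (generic X)" "homogeneous d s" "eventually (%p. peval (f p) s = 0) (generic X)" "y \<in> Y"
 shows "peval y s = 0"
proof (rule ccontr)
 assume "peval y s ~= 0"
 then have "eventually (%y. peval y s ~= 0) (generic Y)" using generic_form assms by blast
 then have "eventually (%p. peval (f p) s ~= 0) (generic X)" using assms(3) unfolding filterlim_iff by blast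
 with assms(5) have "eventually (%p. False) (generic X)" by eventually_elim simp
 then show False using assms(1) by simp
qed

text \<open>The minors of the components of h against the coordinates are forms vanishing along the
  dominant family f. They therefore vanish on Y, which makes h the identity.\<close>

lemma dominant_id:
 assumes X: "irr X" and Y: "irr Y" and h: "h \<in> rational_maps Y Y" and f: "filterlim f (generic Y) (generic X)"
  and hf: "eventually (%p. h (f p) = Some (f p)) (generic X)"
 shows "h = Some |` Y"
proof -
 obtain \<Phi> e where \<Phi>: "h = rmap Y \<Phi>" "map_tuple Y Y \<Phi>" "tuple_on Y \<Phi>" "form_tuple e \<Phi>" by (rule rational_mapsE[OF h])
 have "eventually (%y. par (evals \<Phi> y) (evals Var y)) (generic Y)"
 proof -
  have "par (evals \<Phi> y) (evals Var y)" if y: "y \<in> Y" for y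
   unfolding par_def
  proof (intro allI)
   fix i j
   have "peval y (\<Phi> i * Var j - \<Phi> j * Var i) = 0"
   proof (rule dominant_form[OF X Y f _ _ y])
    show "homogeneous (e + 1) (\<Phi> i * Var j - \<Phi> j * Var i)"
     by (intro homogeneous_diff homogeneous_mult) (use \<Phi>(4) in \<open>auto simp: form_tuple_def\<close>)
    have "eventually (%p. f p \<in> Y) (generic X)"
     by (rule f[unfolded filterlim_iff, rule_format, OF generic_in[OF Y]])
    moreover have "eventually (%p. \<exists>i. evals \<Phi> (f p) i ~= 0) (generic X)"
     by (rule eventually_mono[OF f[unfolded filterlim_iff, rule_format, OF generic_rmap[OF Y \<Phi>(3)]]]) simp
    ultimately show "eventually (%p. peval (f p) (\<Phi> i * Var j - \<Phi> j * Var i) = 0) (generic X)"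
     using hf
    proof eventually_elim
     case (elim p)
     then have "to_point (evals \<Phi> (f p)) = f p" using rmap_eval[OF Y \<Phi>(3)] \<Phi>(1) by (metis option.inject)
     then have "par (evals \<Phi> (f p)) (f p)" by (metis par_to_point(1))
     then show ?case by (simp add: par_def evals_def)
    qed
   qed
   then show "evals \<Phi> y i * evals Var y j = evals \<Phi> y j * evals Var y i" by (simp add: evals_def)
  qed
  then show ?thesis using generic_in[OF Y] by (auto elim: eventually_mono)
 qed
 moreover have "tuple_on Y Var" by (rule tuple_on_Var[OF Y])
 ultimately have "rmap Y \<Phi> = rmap Y Var" by (intro rmap_cong[OF Y \<Phi>(3)])
 then show ?thesis by (simp add: \<Phi>(1) rmap_Var[OF Y])
qed

lemma birational_inverse:
 assumes X: "irr X" "proj_closed X" and Y: "irr Y" "proj_closed Y" and f: "f \<in> birational_maps X Y"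
 obtains g where "g \<in> birational_maps Y X" "(g \<circ>\<^sub>m f) \<subseteq>\<^sub>m Some" "(f \<circ>\<^sub>m g) \<subseteq>\<^sub>m Some"
  "eventually (%p. \<exists>y. f p = Some y \<and> g y = Some p) (generic X)"
  "eventually (%y. \<exists>p. g y = Some p \<and> f p = Some y) (generic Y)"
  "dominant f X Y" "dominant g Y X"
proof -
 have fr: "f \<in> rational_maps X Y" using f by (simp add: birational_maps_def)
 obtain g where g: "g \<in> rational_maps Y X" "dom (g \<circ>\<^sub>m f) ~= {}" "(g \<circ>\<^sub>m f) \<subseteq>\<^sub>m Some"
   "dom (f \<circ>\<^sub>m g) ~= {}" "(f \<circ>\<^sub>m g) \<subseteq>\<^sub>m Some" using f by (auto simp: birational_maps_def)
 have 1: "eventually (%p. \<exists>y. f p = Some y \<and> g y = Some p) (generic X)"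
  if X: "irr X" "proj_closed X" and Y: "irr Y" "proj_closed Y"
   and fr: "f \<in> rational_maps X Y" and g: "g \<in> rational_maps Y X" "dom (g \<circ>\<^sub>m f) ~= {}" "(g \<circ>\<^sub>m f) \<subseteq>\<^sub>m Some" for X Y f g
 proof -
  obtain p0 z0 where p0: "(g \<circ>\<^sub>m f) p0 = Some z0" using g(2) by fastforce
  have "eventually (%p. p \<in> dom (g \<circ>\<^sub>m f)) (generic X)" using rational_comp[OF X(1) Y X(2) fr g(1) p0] by blast
  then show ?thesis
  proof eventually_elim
   case (elim p)
   then have "(g \<circ>\<^sub>m f) p = Some p" using g(3) by (auto simp: map_le_def)
   then show ?case by (auto simp: map_comp_def split: option.splits)
  qed
 qed
 have 2: "dominant f X Y"
  if X: "irr X" "proj_closed X" and Y: "irr Y" "proj_closed Y"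
   and fr: "f \<in> rational_maps X Y" and gf: "eventually (%y. \<exists>p. g y = Some p \<and> f p = Some y) (generic Y)" for X Y f g
 proof (rule dominantI[OF X(1) Y(1) fr])
  fix s d assume s: "homogeneous d s" "eventually (%p. peval (the (f p)) s = 0) (generic X)"
  have "eventually (%y. peval y s = 0) (generic Y)"
   using gf by eventually_elim (use rational_value_form[OF X(1) fr s] in blast)
  then show "\<forall>y\<in>Y. peval y s = 0" using generic_identity[OF Y(1) s(1)] by blast
 qed
 have a: "eventually (%p. \<exists>y. f p = Some y \<and> g y = Some p) (generic X)" by (rule 1[OF X Y fr g(1,2,3)])
 have b: "eventually (%y. \<exists>p. g y = Some p \<and> f p = Some y) (generic Y)" by (rule 1[OF Y X g(1) fr g(4,5)])
 have "g \<in> birational_maps Y X" using g fr by (auto simp: birational_maps_def)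
 then show ?thesis using that[OF _ g(3,5) a b 2[OF X Y fr b] 2[OF Y X g(1) a]] by blast
qed

text \<open>The two composites may be tested along dominant parametrisations u and v by other
  varieties. This is the form in which the covering plane is used to compare its quotient with
  Brunella's surface.\<close>

lemma birational_mapsI:
 assumes X: "irr X" "proj_closed X" and Y: "irr Y" "proj_closed Y" and f: "f \<in> rational_maps X Y" and g: "g \<in> rational_maps Y X"
  and X': "irr X'" and u: "filterlim u (generic X) (generic X')" "eventually (%p. \<exists>y. f (u p) = Some y \<and> g y = Some (u p)) (generic X')"
  and Y': "irr Y'" and v: "filterlim v (generic Y) (generic Y')" "eventually (%p. \<exists>x. g (v p) = Some x \<and> f x = Some (v p)) (generic Y')"
 shows "f \<in> birational_maps X Y"
proof -
 have 1: "dom (g \<circ>\<^sub>m f) ~= {} \<and> (g \<circ>\<^sub>m f) \<subseteq>\<^sub>m Some"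
  if X: "irr X" "proj_closed X" and Y: "irr Y" "proj_closed Y" and f: "f \<in> rational_maps X Y" and g: "g \<in> rational_maps Y X"
  and X': "irr X'" and u: "filterlim u (generic X) (generic X')" "eventually (%p. \<exists>y. f (u p) = Some y \<and> g y = Some (u p)) (generic X')"
  for X Y X' f g u
 proof -
  obtain p y where "f (u p) = Some y" "g y = Some (u p)" using generic_ex[OF X' u(2)] by blast
  then have "(g \<circ>\<^sub>m f) (u p) = Some (u p)" by simp
  then obtain h where h: "h \<in> rational_maps X X" "(g \<circ>\<^sub>m f) \<subseteq>\<^sub>m h" "dom (g \<circ>\<^sub>m f) ~= {}"
   using rational_comp[OF X(1) Y X(2) f g] by blast
  have "eventually (%p. h (u p) = Some (u p)) (generic X')"
   using u(2) by eventually_elim (use h(2) in \<open>force simp: map_le_def map_comp_def dom_def\<close>)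
  then have "h = Some |` X" by (rule dominant_id[OF X' X(1) h(1) u(1)])
  then have "(g \<circ>\<^sub>m f) \<subseteq>\<^sub>m Some" using h(2) by (auto simp: map_le_def restrict_map_def split: if_splits)
  then show ?thesis using h(3) by blast
 qed
 show ?thesis using 1[OF X Y f g X' u] 1[OF Y X g f Y' v] f g by (auto simp: birational_maps_def)
qed

lemma zclosure_eq:
 assumes "A \<subseteq> proj_space n"
 shows "zclosure A = {p \<in> proj_space n. \<forall>s\<in>vanishing_forms A. peval p s = 0}"
proof
 have cl: "proj_closed {p \<in> proj_space n. \<forall>s\<in>vanishing_forms A. peval p s = 0}"
  by (rule proj_closedI) (auto simp: vanishing_forms_def)
 then show "zclosure A \<subseteq> {p \<in> proj_space n. \<forall>s\<in>vanishing_forms A. peval p s = 0}"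
  unfolding zclosure_def using assms cl by (intro Inter_lower CollectI conjI) (auto simp: vanishing_forms_def)
 show "{p \<in> proj_space n. \<forall>s\<in>vanishing_forms A. peval p s = 0} \<subseteq> zclosure A"
  unfolding zclosure_def
 proof (intro subsetI InterI, clarify)
  fix p Z assume p: "p \<in> proj_space n" "\<forall>s\<in>vanishing_forms A. peval p s = 0" and Z: "proj_closed Z" "A \<subseteq> Z"
  show "p \<in> Z"
  proof (rule ccontr)
   assume "p \<notin> Z"
   then obtain s d where "homogeneous d s" "!!z. z \<in> Z ==> peval z s = 0" "peval p s ~= 0"
    using proj_closed_separate'[OF Z(1) p(1)] by blast
   then show False using p(2) Z(2) by (auto simp: vanishing_forms_def)
  qed
 qed
qed

lemma zclosure_eqI:
 assumes "A \<subseteq> proj_space n" "B \<subseteq> proj_space n"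
  "!!d s. homogeneous d s ==> (\<forall>p\<in>A. peval p s = 0) \<longleftrightarrow> (\<forall>p\<in>B. peval p s = 0)"
 shows "zclosure A = zclosure B"
proof -
 have "vanishing_forms A = vanishing_forms B" using assms(3) by (auto simp: vanishing_forms_def)
 then show ?thesis using assms by (simp add: zclosure_eq)
qed

subsection \<open>The projective plane\<close>

definition vec3 :: "'a::zero => 'a => 'a => nat => 'a" where
 "vec3 a b c = (%_. 0)(0 := a, 1 := b, 2 := c)"

lemma vec3_simps [simp]:
 "vec3 a b c 0 = a" "vec3 a b c (Suc 0) = b" "vec3 a b c 1 = b" "vec3 a b c 2 = c" "2 < i ==> vec3 a b c i = 0"
 by (auto simp: vec3_def)

lemma triple_vec3: "triple = vec3"
 by (simp add: fun_eq_iff triple_def vec3_def)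

lemma atMost_2: "{..2::nat} = {0, 1, 2}"
 by auto

lemma vec3_eqI: "p 0 = a ==> p (Suc 0) = b ==> p 2 = c ==> (!!i. i > 2 ==> p i = 0) ==> p = vec3 a b c"
proof
 fix i assume "p 0 = a" "p (Suc 0) = b" "p 2 = c" "!!i. i > 2 ==> p i = 0"
 then show "p i = vec3 a b c i"
  using cases_le2[of i] by (cases "i \<le> 2") auto
qed

lemma vec3_eq_iff [simp]: "vec3 a b c = vec3 a' b' c' \<longleftrightarrow> a = a' \<and> b = b' \<and> c = c'"
 by (metis vec3_simps(1,2,4))

lemma vec3_0 [simp]: "vec3 0 0 0 = (%_. 0)"
 by (rule vec3_eqI[symmetric]) auto

lemma scale_vec3 [simp]: "(%i. c * vec3 x y z i) = vec3 (c * x) (c * y) (c * z :: 'a::mult_zero)"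
 by (rule vec3_eqI) auto

lemma trunc3_vec3: "trunc3 p = vec3 (p 0) (p 1) (p 2)"
 by (rule vec3_eqI) (auto simp: trunc3_def)

lemma trunc3_id: "(!!i. 2 < i ==> p i = 0) ==> trunc3 p = p"
 by (auto simp: trunc3_def)

lemma trunc3_of_vec3 [simp]: "trunc3 (vec3 a b c) = vec3 a b c"
 by (simp add: trunc3_vec3)

lemma vec3_cases: "(!!i. 2 < i ==> p i = 0) ==> (!!a b c. p = vec3 a b c ==> thesis) ==> thesis"
 by (metis trunc3_id trunc3_vec3)

lemma P2_beyond [simp]: "p \<in> P2 ==> 2 < i ==> p i = 0"
 by (rule proj_space_beyond)

lemma P2_trunc3: "p \<in> P2 ==> trunc3 p = p"
 by (rule trunc3_id) simp

lemma to_point_P2: "v k ~= 0 ==> (!!i. i > 2 ==> v i = 0) ==> to_point v \<in> P2"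
 by (rule to_point_in_proj_space)

lemma proj_closed_P2: "proj_closed (proj_space n)"
 using proj_closedI[of "{}" n] by simp

lemma vec3_in_P2: "vec3 1 0 0 \<in> P2" "vec3 0 1 0 \<in> P2" "vec3 0 0 1 \<in> P2" "vec3 1 b c \<in> P2" "vec3 0 1 c \<in> P2"
proof -
 have *: "vec3 a b c \<in> P2" if "vec3 a b c k = 1" "k \<le> 2" "!!i. i < k ==> vec3 a b c i = 0" for a b c k
  unfolding proj_space_def using that by auto
 show "vec3 1 0 0 \<in> P2" "vec3 0 1 0 \<in> P2" "vec3 0 0 1 \<in> P2" "vec3 1 b c \<in> P2" "vec3 0 1 c \<in> P2"
  using *[of 1 0 0 0] *[of 0 1 0 1] *[of 1 b c 0] *[of 0 1 c 1] *[of 0 0 1 2]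
  by (simp_all add: less_2_cases_iff) (metis less_2_cases_iff vec3_simps(1,2))+
qed

lemma P2_cases:
 assumes "p \<in> P2"
 obtains b c where "p = vec3 1 b c" | c where "p = vec3 0 1 c" | "p = vec3 0 0 1"
proof -
 obtain k where k: "k \<le> 2" "p k = 1" "\<forall>i<k. p i = 0" using assms unfolding proj_space_def by blast
 have p: "p = vec3 (p 0) (p 1) (p 2)" by (rule trans[OF P2_trunc3[OF assms, symmetric] trunc3_vec3])
 consider "k = 0" | "k = 1" | "k = 2" using k(1) by linarith
 then show ?thesis
 proof cases
  case 1
  then have "p = vec3 1 (p 1) (p 2)" using p k(2) by simp
  then show ?thesis by (rule that(1))
 next
  case 2
  then have "p = vec3 0 1 (p 2)" using p k(2) k(3)[rule_format, of 0] by simp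
  then show ?thesis by (rule that(2))
 next
  case 3
  then have "p = vec3 0 0 1" using p k(2) k(3)[rule_format, of 0] k(3)[rule_format, of 1] by simp
  then show ?thesis by (rule that(3))
 qed
qed

lemma vec3_nz_P2: "p \<in> P2 ==> p 0 ~= 0 \<or> p 1 ~= 0 \<or> p 2 ~= 0"
 by (erule P2_cases) auto

text \<open>A nonzero vector is a multiple of a point of the plane. At the zero vector a form of
  positive degree vanishes anyway, and a constant form vanishes because it does so at some
  point.\<close>

lemma P2_vanish:
 assumes "homogeneous d s" "!!p. p \<in> P2 ==> peval p s = 0"
 shows "peval (trunc3 q) s = 0"
proof (cases "trunc3 q = (%_. 0)")
 case True
 show ?thesis
 proof (cases d)
  case 0
  then obtain c where "s = Const c" using assms(1) by (auto simp: homogeneous_0_iff)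
  then show ?thesis using assms(2)[OF vec3_in_P2(1)] by simp
 next
  case (Suc n)
  then show ?thesis using peval_zero_point[OF assms(1)] True by simp
 qed
next
 case False
 then obtain k where k: "trunc3 q k ~= 0" by auto
 then have "to_point (trunc3 q) \<in> P2" by (rule to_point_P2) (simp add: trunc3_def)
 then show ?thesis using assms peval_to_point_eq_0[OF assms(1), of "trunc3 q" k] k by auto
qed

lemma peval_psubst_trunc3 [simp]: "peval p (psubst (trunc3 Var) f) = peval (trunc3 p) f"
proof -
 have "(%i. peval p (trunc3 Var i)) = trunc3 p" by (auto simp: trunc3_def)
 then show ?thesis by simp
qed

lemma psubst_trunc3_eq_0: "(!!q. peval (trunc3 q) s = 0) ==> psubst (trunc3 Var) s = 0"
 by (rule mpoly3_eq_0I) (auto simp: peval_psubst_trunc3 simp del: insertion_psubst)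

lemma homogeneous_trunc3: "homogeneous d s ==> homogeneous d (psubst (trunc3 Var) s)"
 using homogeneous_psubst[of d s "Suc 0" "trunc3 Var"] by (auto simp: trunc3_def)

lemma irr_P2: "irr P2"
 unfolding irr_def
proof (intro conjI allI impI)
 show "P2 ~= {}" using vec3_in_P2 by blast
 fix a b d e assume a: "homogeneous d a" and b: "homogeneous e b" and ab: "\<forall>p\<in>P2. peval p a * peval p b = 0"
 have "peval (trunc3 q) (a * b) = 0" for q
  by (rule P2_vanish[OF homogeneous_mult[OF a b]]) (use ab in auto)
 then have "psubst (trunc3 Var) (a * b) = 0" by (rule psubst_trunc3_eq_0)
 then have "psubst (trunc3 Var) a = 0 \<or> psubst (trunc3 Var) b = 0" by simp
 then show "(\<forall>p\<in>P2. peval p a = 0) \<or> (\<forall>p\<in>P2. peval p b = 0)"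
  by (metis P2_trunc3 insertion_0 peval_psubst_trunc3)
qed blast

lemma generic_P2I: "homogeneous d s ==> peval (trunc3 q) s ~= 0 ==> eventually (%p. peval p s ~= 0) (generic P2)"
 using P2_vanish generic_form[OF irr_P2] by blast

lemma generic_P2_nz:
 assumes "homogeneous d s" "vars_le 2 s" "s ~= 0" shows "eventually (%p. peval p s ~= 0) (generic P2)"
proof -
 obtain q where "peval q s ~= 0" using mpoly3_eq_0I assms by blast
 then show ?thesis using generic_P2I[OF assms(1), of q] peval_trunc3[OF assms(2)] by simp
qed

lemma generic_P2_zero:
 assumes "homogeneous d s" "vars_le 2 s" "eventually (%p. peval p s = 0) (generic P2)" shows "s = 0"
proof -
 have "peval (trunc3 q) s = 0" for q
  by (rule P2_vanish[OF assms(1) generic_identity[OF irr_P2 assms(1,3)]])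
 then show ?thesis using assms(2) psubst_trunc3_eq_0 psubst_trunc3 by metis
qed

lemma tangent_P2:
 assumes "p \<in> P2" shows "tangent P2 p = {v. \<forall>i>2. v i = 0}"
proof (intro Set.set_eqI iffI CollectI)
 fix v assume v: "v \<in> tangent P2 p"
 show "\<forall>i>2. v i = 0"
 proof (intro allI impI)
  fix i :: nat assume "i > 2"
  then have "Var i \<in> vanishing_forms P2" by (auto simp: vanishing_forms_def intro!: exI[of _ "Suc 0"])
  then show "v i = 0" using v by (force simp: tangent_def)
 qed
next
 fix v :: "nat => complex" assume v: "v \<in> {v. \<forall>i>2. v i = 0}"
 show "v \<in> tangent P2 p"
  unfolding tangent_def
 proof (intro CollectI ballI)
  fix f assume "f \<in> vanishing_forms P2"
  then obtain d where "homogeneous d f" "!!p. p \<in> P2 ==> peval p f = 0" by (auto simp: vanishing_forms_def)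
  then have "psubst (trunc3 Var) f = 0" using P2_vanish psubst_trunc3_eq_0 by blast
  then have "dir_deriv p v (psubst (trunc3 Var) f) = 0" by simp
  moreover have "(%i. peval p (trunc3 Var i)) = p" "(%i. dir_deriv p v (trunc3 Var i)) = v"
   using assms v by (auto simp: trunc3_def)
  ultimately show "dir_deriv p v f = 0" by simp
 qed
qed

lemma dir_deriv_trunc3:
 assumes "!!i. 2 < i ==> p i = 0" "!!i. 2 < i ==> v i = 0"
 shows "dir_deriv p v (psubst (trunc3 Var) f) = dir_deriv p v f"
proof -
 have "(%i. peval p (trunc3 Var i)) = p" "(%i. dir_deriv p v (trunc3 Var i)) = v"
  using assms by (auto simp: trunc3_def)
 then show ?thesis by simp
qed

lemma sum_support3:
 fixes v g :: "nat => complex"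
 assumes "!!i. i > 2 ==> v i = 0"
 shows "(\<Sum>i | v i ~= 0. g i * v i) = g 0 * v 0 + g 1 * v 1 + g 2 * v 2"
proof -
 have "(\<Sum>i | v i ~= 0. g i * v i) = (\<Sum>i\<in>{0,1,2}. g i * v i)"
 proof (rule sum.mono_neutral_left)
  show "{i. v i ~= 0} \<subseteq> {0, 1, 2}"
  proof
   fix i assume "i \<in> {i. v i ~= 0}"
   then have "i \<le> 2" using assms[of i] by (cases "i \<le> 2") auto
   then show "i \<in> {0, 1, 2}" by auto
  qed
 qed auto
 then show ?thesis by simp
qed

lemma ker_form_P2:
 "(p, v) \<in> ker_form P2 A \<longleftrightarrow> p \<in> P2 \<and> (\<forall>i>2. v i = 0) \<and>
   peval p (A 0) * v 0 + peval p (A 1) * v 1 + peval p (A 2) * v 2 = 0"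
 by (auto simp: ker_form_def tangent_P2 sum_support3)

subsection \<open>Plane curves and their tangent lines\<close>

definition grad :: "mpoly => point => nat => complex" where
 "grad f p i = peval p (pderiv_wrt i f)"

lemma dir_deriv_grad: "vars_le 2 f ==> dir_deriv p v f = grad f p 0 * v 0 + grad f p 1 * v 1 + grad f p 2 * v 2"
 by (subst dir_deriv_superset[of "{..2}"]) (auto simp: vars_le_def grad_def atMost_2)

lemma irreducible_homogeneous_degree:
 assumes "homogeneous d f" "irreducible f" shows "0 < d"
proof (rule ccontr)
 assume "\<not> 0 < d"
 then obtain c where "f = Const c" using assms(1) by (auto simp: homogeneous_0_iff)
 then show False using assms(2) Const_unit[of c] by (cases "c = 0") (auto simp: irreducible_def)
qed

lemma Var_not_dvd: "i ~= j ==> \<not> Var i dvd Var j"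
proof
 assume "i ~= j" "Var i dvd Var j"
 then obtain g where "Var j = Var i * g" by (elim dvdE)
 then have "peval ((%_. 0)(j := 1)) (Var j) = peval ((%_. 0)(j := 1)) (Var i * g)" by simp
 then show False using \<open>i ~= j\<close> by simp
qed

lemma Var_nz [simp]: "Var i ~= 0"
proof
 assume "Var i = 0"
 then have "peval (%_. 1) (Var i) = 0" by simp
 then show False by simp
qed

lemma irreducible_Var: "irreducible (Var i)"
 by (rule irreducible_linear) auto

lemma dvd_irreducible: "irreducible g ==> irreducible f ==> f dvd g ==> g dvd f" for f g :: mpoly
proof -
 assume g: "irreducible g" and f: "irreducible f" and "f dvd g"
 then obtain h where h: "g = f * h" by (elim dvdE)
 then have "h dvd 1" using g f by (auto simp: irreducible_def)
 then obtain k where "1 = h * k" by (elim dvdE)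
 then have "g * k = f" by (simp add: h mult.assoc)
 then show "g dvd f" by (metis dvd_triv_left)
qed

text \<open>The Nullstellensatz needs vanishing on the whole affine cone, including its vertex,
  where g may fail to vanish if its degree is 0. So it is applied to g times a variable; f cannot
  divide two different variables, hence it divides g.\<close>

lemma plane_curve_dvd:
 assumes f: "curve_form d f" and g: "homogeneous e g" "!!p. p \<in> plane_curve f ==> peval p g = 0"
 shows "f dvd psubst (trunc3 Var) g"
proof -
 have fi: "irreducible f" "vars_le 2 f" "homogeneous d f" using f by (auto simp: curve_form_def vars_le_def)
 let ?g = "psubst (trunc3 Var) g"
 have d: "0 < d" by (rule irreducible_homogeneous_degree[OF fi(3,1)])
 have *: "f dvd Var i \<or> f dvd ?g" if "i \<le> 2" for i
 proof (rule mpoly3_prime[OF fi(1,2)])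
  show "f dvd Var i * ?g"
  proof (rule mpoly3_nullstellensatz[OF fi(1,2)])
   show "vars_le 2 (Var i * ?g)" using that by simp
   fix p assume p: "peval p f = 0"
   show "peval p (Var i * ?g) = 0"
   proof (cases "trunc3 p = (%_. 0)")
    case True
    then have "p i = 0" using that by (metis trunc3_def)
    then show ?thesis by simp
   next
    case False
    then obtain k where k: "trunc3 p k ~= 0" by auto
    then have "to_point (trunc3 p) \<in> P2" by (rule to_point_P2) (simp add: trunc3_def)
    moreover have "peval (trunc3 p) f = 0" using p fi(2) peval_trunc3 by simp
    ultimately have "to_point (trunc3 p) \<in> plane_curve f"
     using k peval_to_point_eq_0[OF fi(3), of "trunc3 p" k] by (simp add: plane_curve_def)
    then have "peval (trunc3 p) g = 0"
     using g k peval_to_point_eq_0[OF g(1), of "trunc3 p" k] by auto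
    then show ?thesis by (simp del: insertion_psubst add: peval_psubst_trunc3)
   qed
  qed
 qed (use that in auto)
 show ?thesis
 proof (rule ccontr)
  assume "\<not> ?thesis"
  then have "f dvd Var 0" "f dvd Var 1" using * by auto
  then have "Var 0 dvd f" using dvd_irreducible irreducible_Var fi(1) by blast
  then have "Var 0 dvd Var 1" using \<open>f dvd Var 1\<close> by (rule dvd_trans)
  then show False using Var_not_dvd[of 0 1] by simp
 qed
qed

lemma tangent_plane_curve:
 assumes f: "curve_form d f" and p: "p \<in> plane_curve f"
 shows "tangent (plane_curve f) p = {v. (\<forall>i>2. v i = 0) \<and> grad f p 0 * v 0 + grad f p 1 * v 1 + grad f p 2 * v 2 = 0}"
proof (intro Set.set_eqI iffI)
 have fi: "irreducible f" "vars_le 2 f" "homogeneous d f" using f by (auto simp: curve_form_def vars_le_def)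
 have p2: "p \<in> P2" "peval p f = 0" using p by (auto simp: plane_curve_def)
 {
  fix v assume v: "v \<in> tangent (plane_curve f) p"
  have "Var i \<in> vanishing_forms (plane_curve f)" if "i > 2" for i
   using that by (auto simp: vanishing_forms_def plane_curve_def intro!: exI[of _ "Suc 0"])
  then have "\<forall>i>2. v i = 0" using v by (force simp: tangent_def)
  moreover have "f \<in> vanishing_forms (plane_curve f)" using fi by (auto simp: vanishing_forms_def plane_curve_def)
  then have "dir_deriv p v f = 0" using v by (simp add: tangent_def)
  ultimately show "v \<in> {v. (\<forall>i>2. v i = 0) \<and> grad f p 0 * v 0 + grad f p 1 * v 1 + grad f p 2 * v 2 = 0}"
   by (simp add: dir_deriv_grad[OF fi(2)])
 }
 fix v :: "nat => complex"
 assume "v \<in> {v. (\<forall>i>2. v i = 0) \<and> grad f p 0 * v 0 + grad f p 1 * v 1 + grad f p 2 * v 2 = 0}"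
 then have v: "!!i. i > 2 ==> v i = 0" "dir_deriv p v f = 0" by (auto simp: dir_deriv_grad[OF fi(2)])
 show "v \<in> tangent (plane_curve f) p"
  unfolding tangent_def
 proof (intro CollectI ballI)
  fix g assume "g \<in> vanishing_forms (plane_curve f)"
  then obtain e where "homogeneous e g" "!!p. p \<in> plane_curve f ==> peval p g = 0" by (auto simp: vanishing_forms_def)
  then have "f dvd psubst (trunc3 Var) g" by (rule plane_curve_dvd[OF f])
  then obtain h where "psubst (trunc3 Var) g = f * h" by (elim dvdE)
  then have "dir_deriv p v (psubst (trunc3 Var) g) = 0" using v(2) p2 by simp
  then show "dir_deriv p v g = 0" using dir_deriv_trunc3[of p v g] v(1) p2 by simp
 qed
qed

lemma mem_plane_curve: "p \<in> plane_curve f \<longleftrightarrow> p \<in> P2 \<and> peval p f = 0"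
 by (simp add: plane_curve_def)

interpretation fun_space: vector_space "%(c::complex) v (i::nat). c * v i"
 by unfold_locales (auto simp: algebra_simps fun_eq_iff)

lemma vdim_two:
 assumes S: "S = {%i. s * u i + t * w i |s t. True}" and ind: "!!s t. (!!i. s * u i + t * w i = 0) ==> s = 0 \<and> t = 0"
 shows "vdim S = 2"
proof -
 have "u ~= (%i. c * w i)" for c
 proof
  assume "u = (%i. c * w i)"
  then have "1 * u i + (- c) * w i = 0" for i by simp
  then show False using ind[of 1 "- c"] by simp
 qed
 then have u: "u \<notin> fun_space.span {w}" by (auto simp: fun_space.span_singleton)
 have "w ~= 0" using ind[of 0 1] by auto
 then have i: "fun_space.independent {u, w}" using u
  by (auto simp: fun_space.independent_insert fun_space.span_base)
 have un: "u ~= w" using u fun_space.span_base by blast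
 have "S = fun_space.span {u, w}"
 proof (intro Set.set_eqI iffI)
  fix x assume "x \<in> S"
  then obtain s t where x: "x = (%i. s * u i) + (%i. t * w i)" by (auto simp: S plus_fun_def)
  show "x \<in> fun_space.span {u, w}" unfolding x
   by (intro fun_space.span_add fun_space.span_scale fun_space.span_base) auto
 next
  fix x assume "x \<in> fun_space.span {u, w}"
  then obtain s t where "x - (%i. s * u i) = (%i. t * w i)"
   by (auto simp: fun_space.span_insert fun_space.span_singleton)
  then have "x = (%i. s * u i + t * w i)" by (auto simp: fun_eq_iff algebra_simps)
  then show "x \<in> S" unfolding S by blast
 qed
 then have "fun_space.dim S = card {u, w}"
  using i fun_space.dim_span_eq_card_independent by metis
 then show ?thesis using un by (simp add: vdim_def)
qed

text \<open>At a singular point of a plane curve the tangent space of the cone is this whole space,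
  so the dimension must be told apart from the value 2 that defines smoothness.\<close>

lemma vdim_plane: "vdim {v. \<forall>i>2. v i = 0} ~= 2"
proof
 let ?S = "{v :: nat => complex. \<forall>i>2. v i = 0}"
 assume d: "vdim ?S = 2"
 have i: "fun_space.independent {vec3 1 0 0, vec3 0 1 0, vec3 0 0 1}"
  by (auto simp: fun_space.independent_insert fun_space.span_insert fun_space.span_singleton fun_space.span_empty fun_eq_iff)
    (metis vec3_simps mult_zero_right zero_neq_one diff_zero mult_1_right eq_iff_diff_eq_0)+
 have sub: "{vec3 1 0 0, vec3 0 1 0, vec3 0 0 1} \<subseteq> ?S" by auto
 have sp: "?S \<subseteq> fun_space.span {vec3 1 0 0, vec3 0 1 0, vec3 0 0 1}"
 proof
  fix v :: "nat => complex" assume "v \<in> ?S"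
  then have "v = (%i. v 0 * vec3 1 0 0 i) + ((%i. v 1 * vec3 0 1 0 i) + (%i. v 2 * vec3 0 0 1 i))"
   using \<open>v \<in> ?S\<close> by (intro trans[OF vec3_eqI[of v "v 0" "v 1" "v 2"] vec3_eqI[symmetric]]) auto
  moreover have "\<dots> \<in> fun_space.span {vec3 1 0 0, vec3 0 1 0, vec3 0 0 1}"
   by (intro fun_space.span_add fun_space.span_scale fun_space.span_base) auto
  ultimately show "v \<in> fun_space.span {vec3 1 0 0, vec3 0 1 0, vec3 0 0 1}" by simp
 qed
 have "fun_space.dim ?S = card {vec3 1 0 0, vec3 0 1 0, vec3 0 0 (1::complex)}"
  by (rule fun_space.dim_unique[OF sub sp i refl])
 then show False using d by (simp add: vdim_def)
qed

lemma vdim_line: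
 fixes a :: "nat => complex"
 assumes "a 0 ~= 0 \<or> a 1 ~= 0 \<or> a 2 ~= 0"
 shows "vdim {v. (\<forall>i>2. v i = 0) \<and> a 0 * v 0 + a 1 * v 1 + a 2 * v 2 = 0} = 2" (is "vdim ?S = 2")
proof -
 \<comment> \<open>The kernel vectors u and w are triangular at the positions k and l, so the
   coefficients of a vector of the kernel can be read off from its coordinates there.\<close>
 have main: "vdim ?S = 2" if u: "!!i. 2 < i ==> u i = 0" "a 0 * u 0 + a 1 * u 1 + a 2 * u 2 = 0"
   "!!i. 2 < i ==> w i = 0" "a 0 * w 0 + a 1 * w 1 + a 2 * w 2 = 0"
   and k: "k \<le> 2" "l \<le> 2" "u k ~= 0" "w k = 0" "u l = 0" "w l ~= 0"
   and det: "!!v. v \<in> ?S ==> v = (%i. v k / u k * u i + v l / w l * w i)" for u w :: "nat => complex" and k l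
 proof (rule vdim_two[of _ u w])
  show "?S = {%i. s * u i + t * w i |s t. True}"
  proof (intro Set.set_eqI iffI)
   fix v assume "v \<in> ?S"
   from det[OF this] show "v \<in> {%i. s * u i + t * w i |s t. True}" by blast
  next
   fix v assume "v \<in> {%i. s * u i + t * w i |s t. True}"
   then obtain s t where v: "v = (%i. s * u i + t * w i)" by blast
   have "a 0 * v 0 + a 1 * v 1 + a 2 * v 2 = s * (a 0 * u 0 + a 1 * u 1 + a 2 * u 2) + t * (a 0 * w 0 + a 1 * w 1 + a 2 * w 2)"
    by (simp add: v algebra_simps)
   then show "v \<in> ?S" using u by (simp add: v)
  qed
  fix s t assume "!!i. s * u i + t * w i = 0"
  from this[of k] this[of l] show "s = 0 \<and> t = 0" using k by auto
 qed
 have ext: "v = (%i. f i)" if "!!i. i > 2 ==> v i = 0 \<and> f i = 0" "v 0 = f 0" "v 1 = f 1" "v 2 = f 2" for v f :: "nat => complex"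
 proof
  fix i show "v i = f i" using that cases_le2[of i] by (cases "i \<le> 2") auto
 qed
 consider "a 0 ~= 0" | "a 1 ~= 0" | "a 2 ~= 0" using assms by blast
 then show ?thesis
 proof cases
  case 1
  show ?thesis
   by (rule main[of "vec3 (- a 1) (a 0) 0" "vec3 (- a 2) 0 (a 0)" 1 2])
    (use 1 in \<open>auto intro!: ext simp: field_simps add_eq_0_iff2\<close>)
 next
  case 2
  have e: "v (Suc 0) = (- (a 0 * v 0) - a 2 * v 2) / a (Suc 0)" if "a 0 * v 0 + a 1 * v 1 + a 2 * v 2 = 0" for v :: "nat => complex"
   using 2 that by (simp add: eq_divide_eq eq_neg_iff_add_eq_0 algebra_simps)
  show ?thesis
  proof (rule main[of "vec3 (a 1) (- a 0) 0" "vec3 0 (- a 2) (a 1)" 0 2])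
   fix v assume "v \<in> ?S"
   then have v: "\<forall>i>2. v i = 0" "a 0 * v 0 + a 1 * v 1 + a 2 * v 2 = 0" by auto
   show "v = (%i. v 0 / vec3 (a 1) (- a 0) 0 0 * vec3 (a 1) (- a 0) 0 i + v 2 / vec3 0 (- a 2) (a 1) 2 * vec3 0 (- a 2) (a 1) i)"
   proof (rule ext)
    show "v 1 = v 0 / vec3 (a 1) (- a 0) 0 0 * vec3 (a 1) (- a 0) 0 1 + v 2 / vec3 0 (- a 2) (a 1) 2 * vec3 0 (- a 2) (a 1) 1"
     using e[OF v(2)] 2 by (simp add: diff_divide_distrib mult.commute)
   qed (use 2 v(1) in auto)
  qed (use 2 in auto)
 next
  case 3
  have e: "v 2 = (- (a 0 * v 0) - a 1 * v 1) / a 2" if "a 0 * v 0 + a 1 * v 1 + a 2 * v 2 = 0" for v :: "nat => complex"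
   using 3 that by (simp add: eq_divide_eq eq_neg_iff_add_eq_0 algebra_simps)
  show ?thesis
  proof (rule main[of "vec3 (a 2) 0 (- a 0)" "vec3 0 (a 2) (- a 1)" 0 1])
   fix v assume "v \<in> ?S"
   then have v: "\<forall>i>2. v i = 0" "a 0 * v 0 + a 1 * v 1 + a 2 * v 2 = 0" by auto
   show "v = (%i. v 0 / vec3 (a 2) 0 (- a 0) 0 * vec3 (a 2) 0 (- a 0) i + v 1 / vec3 0 (a 2) (- a 1) 1 * vec3 0 (a 2) (- a 1) i)"
   proof (rule ext)
    show "v 2 = v 0 / vec3 (a 2) 0 (- a 0) 0 * vec3 (a 2) 0 (- a 0) 2 + v 1 / vec3 0 (a 2) (- a 1) 1 * vec3 0 (a 2) (- a 1) 2"
     using e[OF v(2)] 3 by (simp add: diff_divide_distrib mult.commute)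
   qed (use 3 v(1) in auto)
  qed (use 3 in auto)
 qed
qed

lemma curve_smooth_at_iff:
 assumes f: "curve_form d f"
 shows "curve_smooth_at (plane_curve f) p \<longleftrightarrow> p \<in> plane_curve f \<and> (grad f p 0 ~= 0 \<or> grad f p 1 ~= 0 \<or> grad f p 2 ~= 0)"
 using vdim_line[of "grad f p"] vdim_plane tangent_plane_curve[OF f, of p]
 by (cases "grad f p 0 ~= 0 \<or> grad f p 1 ~= 0 \<or> grad f p 2 ~= 0") (auto simp: curve_smooth_at_def)

lemma covectors_parallel:
 fixes g A :: "nat => complex"
 assumes "g 0 ~= 0 \<or> g 1 ~= 0 \<or> g 2 ~= 0"
 shows "(\<forall>v::nat => complex. (\<forall>i>2. v i = 0) \<and> g 0 * v 0 + g 1 * v 1 + g 2 * v 2 = 0 \<longrightarrow> A 0 * v 0 + A 1 * v 1 + A 2 * v 2 = 0) \<longleftrightarrow>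
  A 0 * g 1 = A 1 * g 0 \<and> A 0 * g 2 = A 2 * g 0 \<and> A 1 * g 2 = A 2 * g 1" (is "?L \<longleftrightarrow> ?R")
proof
 assume ?L
 from this[THEN spec[of _ "vec3 (g 1) (- g 0) 0"]] this[THEN spec[of _ "vec3 (g 2) 0 (- g 0)"]]
  this[THEN spec[of _ "vec3 0 (g 2) (- g 1)"]]
 show ?R by (simp add: mult.commute)
next
 assume R: ?R
 show ?L
 proof (intro allI impI)
  fix v :: "nat => complex" assume v: "(\<forall>i>2. v i = 0) \<and> g 0 * v 0 + g 1 * v 1 + g 2 * v 2 = 0"
  let ?a = "A 0 * v 0 + A 1 * v 1 + A 2 * v 2" and ?g = "g 0 * v 0 + g 1 * v 1 + g 2 * v 2"
  have "?a * g 0 = A 0 * ?g" "?a * g 1 = A 1 * ?g" "?a * g 2 = A 2 * ?g"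
   using R by algebra+
  then show "?a = 0" using assms v by auto
 qed
qed

text \<open>Invariance says that the 1-form is proportional to the gradient at smooth points. At
  singular points the gradient is zero and the minors vanish by themselves, so the equations may be
  required on the whole curve.\<close>

lemma invariant_curve_iff:
 assumes f: "curve_form d f"
 shows "invariant_curve (ker_form P2 A) (plane_curve f) \<longleftrightarrow>
  (\<forall>p\<in>plane_curve f. peval p (A 0) * grad f p 1 = peval p (A 1) * grad f p 0 \<and>
   peval p (A 0) * grad f p 2 = peval p (A 2) * grad f p 0 \<and> peval p (A 1) * grad f p 2 = peval p (A 2) * grad f p 1)"
proof -
 have "(curve_smooth_at (plane_curve f) p \<longrightarrow> tangent (plane_curve f) p \<subseteq> ker_form P2 A `` {p}) \<longleftrightarrow>
  (p \<in> plane_curve f \<longrightarrow> peval p (A 0) * grad f p 1 = peval p (A 1) * grad f p 0 \<and>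
   peval p (A 0) * grad f p 2 = peval p (A 2) * grad f p 0 \<and> peval p (A 1) * grad f p 2 = peval p (A 2) * grad f p 1)" for p
 proof (cases "p \<in> plane_curve f \<and> (grad f p 0 ~= 0 \<or> grad f p 1 ~= 0 \<or> grad f p 2 ~= 0)")
  case True
  then have "tangent (plane_curve f) p \<subseteq> ker_form P2 A `` {p} \<longleftrightarrow>
   (\<forall>v::nat => complex. (\<forall>i>2. v i = 0) \<and> grad f p 0 * v 0 + grad f p 1 * v 1 + grad f p 2 * v 2 = 0 \<longrightarrow>
    peval p (A 0) * v 0 + peval p (A 1) * v 1 + peval p (A 2) * v 2 = 0)"
   unfolding tangent_plane_curve[OF f conjunct1[OF True]] by (auto simp: ker_form_P2 plane_curve_def)
  then show ?thesis using True covectors_parallel[of "grad f p" "%i. peval p (A i)"] by (simp add: curve_smooth_at_iff[OF f])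
 qed (auto simp: curve_smooth_at_iff[OF f])
 then show ?thesis unfolding invariant_curve_def by blast
qed

lemma pderiv_wrt_uminus [simp]: "pderiv_wrt i (- f) = - pderiv_wrt i f"
 using pderiv_wrt_add[of i f "- f"] by (simp add: eq_neg_iff_add_eq_0 add.commute)

lemma pderiv_wrt_diff [simp]: "pderiv_wrt i (f - g) = pderiv_wrt i f - pderiv_wrt i g"
 using pderiv_wrt_add[of i f "- g"] by simp

lemma pderiv_wrt_numeral [simp]: "pderiv_wrt i (numeral k) = 0" "pderiv_wrt i 1 = 0"
 using pderiv_wrt_Const[of i "numeral k"] pderiv_wrt_Const[of i 1] by simp_all

lemma pderiv_wrt_power2 [simp]: "pderiv_wrt i (f\<^sup>2) = 2 * f * pderiv_wrt i f"
 by (simp add: power2_eq_square algebra_simps)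

section \<open>Explicit formulas for the foliation and the cubic; irreducibility of the
  cubic\<close>

lemma Omega_simps:
 "Omega 0 = Var 1 * Var 2 * (Var 0 + Var 1 - 2 * Var 2)"
 "Omega (Suc 0) = Var 0 * Var 2 * (Var 1 + Var 2 - 2 * Var 0)"
 "Omega 2 = Var 0 * Var 1 * (Var 2 + Var 0 - 2 * Var 1)"
 "2 < i ==> Omega i = 0"
 by (simp_all add: Omega_def Let_def triple_vec3)

lemma cubic_eq: "cubic = Var 0 * (Var 1)\<^sup>2 + Var 1 * (Var 2)\<^sup>2 + Var 2 * (Var 0)\<^sup>2 - 3 * Var 0 * Var 1 * Var 2"
 by (simp add: cubic_def Let_def)

lemma peval_cubic: "peval p cubic = p 0 * (p 1)\<^sup>2 + p 1 * (p 2)\<^sup>2 + p 2 * (p 0)\<^sup>2 - 3 * p 0 * p 1 * p 2"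
 by (simp add: cubic_eq)

lemma peval_Omega:
 "peval p (Omega 0) = p 1 * p 2 * (p 0 + p 1 - 2 * p 2)"
 "peval p (Omega (Suc 0)) = p 0 * p 2 * (p 1 + p 2 - 2 * p 0)"
 "peval p (Omega 2) = p 0 * p 1 * (p 2 + p 0 - 2 * p 1)"
 by (simp_all add: Omega_simps)

lemma grad_cubic:
 "grad cubic p 0 = (p 1)\<^sup>2 + 2 * p 2 * p 0 - 3 * p 1 * p 2"
 "grad cubic p (Suc 0) = 2 * p 0 * p 1 + (p 2)\<^sup>2 - 3 * p 0 * p 2"
 "grad cubic p 2 = 2 * p 1 * p 2 + (p 0)\<^sup>2 - 3 * p 0 * p 1"
 by (simp_all add: cubic_eq grad_def pderiv_wrt_Var algebra_simps)

lemma grad_Var: "grad (Var i) p j = (if i = j then 1 else 0)"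
 by (simp add: grad_def pderiv_wrt_Var)

lemma homogeneous_cubic: "homogeneous 3 cubic"
proof -
 have h: "homogeneous 3 (Var i * (Var j)\<^sup>2)" for i j
  using homogeneous_mult[OF homogeneous_Var homogeneous_power[OF homogeneous_Var, of 2 j], of i] by (simp add: numeral_3_eq_3)
 have "homogeneous (0 + 1 + 1 + 1) (3 * Var 0 * Var 1 * Var 2)"
  by (intro homogeneous_mult) auto
 then show ?thesis unfolding cubic_eq
  by (intro homogeneous_diff homogeneous_add h) (simp add: numeral_3_eq_3)
qed

lemma vars_le_cubic [simp]: "vars_le 2 cubic"
 by (simp add: cubic_eq)

lemma cubic_nz [simp]: "cubic ~= 0"
proof
 assume "cubic = 0"
 then have "peval (vec3 1 1 0) cubic = 0" by simp
 then show False by (simp add: peval_cubic)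
qed

lemma linear_not_dvd_cubic:
 assumes "homogeneous (Suc 0) l" shows "\<not> l dvd cubic"
proof
 assume d: "l dvd cubic"
 then obtain h where h: "cubic = l * h" by (elim dvdE)
 have "vars_le 2 l" using vars_le_dvd[OF d] by simp
 then obtain a b c where l: "l = Const a * Var 0 + Const b * Var 1 + Const c * Var 2"
  using homogeneous_1_form assms by blast
 have *: "p 0 * (p 1)\<^sup>2 + p 1 * (p 2)\<^sup>2 + p 2 * (p 0)\<^sup>2 - 3 * p 0 * p 1 * p 2 = 0" if "a * p 0 + b * p 1 + c * p 2 = 0" for p :: "nat => complex"
  unfolding peval_cubic[symmetric] h using that by (simp add: l)
 \<comment> \<open>The points where the line meets the three coordinate lines: on each of these the
   cubic reduces to a single monomial. Hence at most one of a, b, c is nonzero, the line is a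
   coordinate line, and one more point on it excludes that too.\<close>
 have "a * b = 0" using *[of "vec3 (- b) a 0"] by auto
 moreover have "a * c = 0" using *[of "vec3 c 0 (- a)"] by auto
 moreover have "b * c = 0" using *[of "vec3 0 c (- b)"] by auto
 moreover have "a ~= 0 \<or> b ~= 0 \<or> c ~= 0" using h cubic_nz by (auto simp: l)
 ultimately show False using *[of "vec3 0 1 1"] *[of "vec3 1 0 1"] *[of "vec3 1 1 0"] by auto
qed

lemma irreducible_cubic: "irreducible cubic"
proof (rule irreducibleI)
 show "\<not> cubic dvd 1"
 proof
  assume "cubic dvd 1"
  then obtain g where g: "1 = cubic * g" by (elim dvdE)
  have "homogeneous 0 (cubic * g)" unfolding g[symmetric] by simp
  then obtain e where e: "homogeneous e g" using homogeneous_factor[of 0 g cubic] g by (metis mult.commute zero_neq_one)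
  have "0 = 3 + e"
   by (rule homogeneous_degree_unique[OF _ homogeneous_mult[OF homogeneous_cubic e]]) (simp_all flip: g)
  then show False by simp
 qed
 fix g h assume gh: "cubic = g * h"
 have nz: "g * h ~= 0" by (simp flip: gh)
 obtain d where d: "homogeneous d g" using homogeneous_factor[of 3 g h] homogeneous_cubic gh nz by auto
 obtain e where e: "homogeneous e h" using homogeneous_factor[of 3 h g] homogeneous_cubic gh nz by (auto simp: mult.commute)
 have de: "d + e = 3"
  by (rule homogeneous_degree_unique[OF homogeneous_mult[OF d e]]) (use homogeneous_cubic gh in auto)
 have "g dvd cubic" "h dvd cubic" unfolding gh by simp_all
 then have "d ~= 1" "e ~= 1" using linear_not_dvd_cubic[of g] linear_not_dvd_cubic[of h] d e by auto
 then have "d = 0 \<or> e = 0" using de by auto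
 then show "g dvd 1 \<or> h dvd 1"
  using d e nz Const_unit by (auto simp: homogeneous_0_iff)
qed simp

lemma curve_form_cubic: "curve_form 3 cubic"
 using vars_le_cubic by (simp add: curve_form_def homogeneous_cubic irreducible_cubic vars_le_def)

lemma curve_form_Var: "i \<le> 2 ==> curve_form 1 (Var i)"
 by (simp add: curve_form_def irreducible_Var)

subsection \<open>The foliation and its invariant curves\<close>

text \<open>A nonunit has a prime divisor, and a prime divisor of a product of irreducible forms is
  associated to one of them. Coprimality of a triple of forms is thereby reduced to evaluating them
  at well chosen points.\<close>

lemma dvd_product_linear:
 assumes "g dvd prod_list ls" "!!l. l \<in> set ls ==> irreducible l \<and> vars_le 2 l"
 shows "g dvd 1 \<or> (\<exists>l\<in>set ls. l dvd g)"
proof (cases "to_poly3 g dvd 1")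
 case True
 have nz: "prod_list ls ~= 0" using assms(2) by (auto simp: prod_list_zero_iff irreducible_def)
 have "vars_le 2 (prod_list ls)" using assms(2) by (induction ls) auto
 then have "vars_le 2 g" by (rule vars_le_dvd[OF assms(1) nz])
 then have "g dvd 1" using True to_poly3_dvdD[of g 1] by simp
 then show ?thesis ..
next
 case False
 have nz: "prod_list ls ~= 0" using assms(2) by (auto simp: prod_list_zero_iff irreducible_def)
 have v: "vars_le 2 (prod_list ls)" using assms(2) by (induction ls) auto
 have vg: "vars_le 2 g" by (rule vars_le_dvd[OF assms(1) nz v])
 have "g ~= 0" using assms(1) nz by auto
 then have "to_poly3 g ~= 0" using vg by (metis of_poly3_hom(1) of_to_poly3)
 then obtain P where P: "prime P" "P dvd to_poly3 g" using False prime_divisor_exists by blast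
 have "to_poly3 (prod_list ls) = prod_list (map to_poly3 ls)" for ls by (induction ls) auto
 then have "P dvd prod_list (map to_poly3 ls)" using to_poly3_dvdI[OF assms(1)] P(2) by (metis dvd_trans)
 then have "\<exists>l\<in>set ls. P dvd to_poly3 l"
  using P(1) by (induction ls) (auto simp: prime_dvd_mult_iff dest: not_prime_unit)
 then obtain l where l: "l \<in> set ls" "P dvd to_poly3 l" by blast
 have pl: "prime_elem (to_poly3 l)" using prime_elem_to_poly3 assms(2)[OF l(1)] by blast
 obtain R where R: "to_poly3 l = P * R" using l(2) by (elim dvdE)
 have "irreducible (to_poly3 l)" using pl by (rule prime_elem_imp_irreducible)
 then have "R dvd 1" using R P(1) by (metis irreducible_def not_prime_unit)
 then have "to_poly3 l dvd to_poly3 g" using R P(2) by (simp add: mult_unit_dvd_iff)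
 then show ?thesis using to_poly3_dvdD[of l g] vg assms(2)[OF l(1)] l(1) by blast
qed

lemma dvd_peval_zero: "l dvd f ==> peval p l = 0 ==> peval p f = 0"
 by (auto elim!: dvdE)

lemma linear_form_irreducible:
 assumes "a ~= 0 \<or> b ~= 0 \<or> c ~= 0"
 shows "irreducible (Const a * Var 0 + Const b * Var 1 + Const c * Var 2)"
proof (rule irreducible_linear)
 have h: "homogeneous (Suc 0) (Const a * Var i)" for a i
  using homogeneous_mult[OF homogeneous_Const homogeneous_Var, of a i] by simp
 then show "homogeneous (Suc 0) (Const a * Var 0 + Const b * Var 1 + Const c * Var 2)"
  by (intro homogeneous_add)
 show "Const a * Var 0 + Const b * Var 1 + Const c * Var 2 ~= 0"
 proof
  assume z: "Const a * Var 0 + Const b * Var 1 + Const c * Var 2 = 0"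
  have "a * x + b * y + c * t = 0" for x y t
   using arg_cong[OF z, of "peval (vec3 x y t)"] by simp
  from this[of 1 0 0] this[of 0 1 0] this[of 0 0 1] show False using assms by simp
 qed
qed

lemma plane_foliation_Omega: "plane_foliation_form 2 Omega"
 unfolding plane_foliation_form_def
proof (intro conjI allI impI)
 fix i :: nat assume i: "i \<le> 2"
 have lin: "homogeneous (Suc 0) (Var i + Var j - 2 * Var k)" for i j k
  using homogeneous_mult[OF homogeneous_numeral homogeneous_Var, of "num.Bit0 num.One" k] by (intro homogeneous_diff homogeneous_add) auto
 have h: "homogeneous (Suc 0 + Suc 0 + Suc 0) (Var i * Var j * (Var k + Var l - 2 * Var m))" for i j k l m
  by (intro homogeneous_mult lin) auto
 show "homogeneous (2 + 1) (Omega i)"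
  using cases_le2[OF i] h by (elim disjE) (simp_all add: Omega_simps numeral_3_eq_3)
 have "vars_le 2 (Omega i)" using cases_le2[OF i] by (elim disjE) (simp_all add: Omega_simps)
 then show "pvars (Omega i) \<subseteq> {..2}" by (simp add: vars_le_def)
next
 fix i :: nat assume "2 < i" then show "Omega i = 0" by (simp add: Omega_simps)
next
 fix g assume g: "\<forall>i\<le>2. g dvd Omega i"
 let ?l = "Const 1 * Var 0 + Const 1 * Var 1 + Const (- 2) * Var 2"
 have l: "?l = Var 0 + Var 1 - 2 * Var 2" by (simp add: Const_uminus)
 have "g dvd prod_list [Var 1, Var 2, ?l]"
  using g[rule_format, of 0] unfolding l by (simp add: Omega_simps mult.assoc)
 moreover have "irreducible ?l" by (rule linear_form_irreducible) simp
 ultimately have "g dvd 1 \<or> (\<exists>l\<in>set [Var 1, Var 2, ?l]. l dvd g)"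
  by (intro dvd_product_linear) (auto simp: irreducible_Var simp del: Const_1 One_nat_def)
 moreover have "\<not> Var 1 dvd g"
  \<comment> \<open>Each candidate factor is excluded by a point on its line at which another
    component of the triple is nonzero.\<close>
  using dvd_peval_zero[of "Var 1" "Omega 1" "vec3 1 0 1"] g[rule_format, of 1] by (auto simp: peval_Omega dest: dvd_trans)
 moreover have "\<not> Var 2 dvd g"
  using dvd_peval_zero[of "Var 2" "Omega 2" "vec3 1 1 0"] g[rule_format, of 2] by (auto simp: peval_Omega dest: dvd_trans)
 moreover have "\<not> ?l dvd g"
  using dvd_peval_zero[of ?l "Omega 1" "vec3 1 3 2"] g[rule_format, of 1] by (auto simp: peval_Omega dest: dvd_trans)
 ultimately show "g dvd 1" by (auto simp del: Const_1)
next
 show "(\<Sum>i\<le>2. Var i * Omega i) = 0"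
  by (simp add: atMost_2 Omega_simps algebra_simps)
qed

lemma J_fol_iff:
 "(p, v) \<in> J_fol \<longleftrightarrow> p \<in> P2 \<and> (\<forall>i>2. v i = 0) \<and>
   peval p (Omega 0) * v 0 + peval p (Omega 1) * v 1 + peval p (Omega 2) * v 2 = 0"
 unfolding J_fol_def by (rule ker_form_P2)

lemma J_curves_cases: "C \<in> J_curves ==> C = plane_curve cubic \<or> (\<exists>i\<le>2. C = plane_curve (Var i))"
 unfolding J_curves_def by (metis (no_types, lifting) insertE empty_iff le0 one_le_numeral order_refl)

lemma J_curves_invariant: "C \<in> J_curves ==> irreducible_plane_curve C \<and> invariant_curve J_fol C"
proof -
 assume "C \<in> J_curves"
 then consider "C = plane_curve cubic" | i where "i \<le> 2" "C = plane_curve (Var i)" using J_curves_cases by blast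
 then show ?thesis
 proof cases
  case 1
  have "peval p (Omega 0) * grad cubic p 1 = peval p (Omega 1) * grad cubic p 0 \<and>
   peval p (Omega 0) * grad cubic p 2 = peval p (Omega 2) * grad cubic p 0 \<and>
   peval p (Omega 1) * grad cubic p 2 = peval p (Omega 2) * grad cubic p 1" if "peval p cubic = 0" for p
   using that unfolding One_nat_def peval_Omega grad_cubic peval_cubic by algebra
  then show ?thesis using 1 curve_form_cubic
   unfolding J_fol_def by (auto simp: irreducible_plane_curve_def invariant_curve_iff[OF curve_form_cubic] mem_plane_curve)
 next
  case 2
  then show ?thesis using curve_form_Var[OF 2(1)] cases_le2[OF 2(1)]
   unfolding J_fol_def by (auto simp: irreducible_plane_curve_def invariant_curve_iff[OF curve_form_Var[OF 2(1)]] mem_plane_curve grad_Var peval_Omega)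
 qed
qed

text \<open>On x = 0 the cubic restricts to y z^2, so (0:1:0) is the tangency point. Cyclically, y =
  0 gives (0:0:1) and z = 0 gives (1:0:0).\<close>

lemma tangent_Var_cubic:
 assumes "i \<le> 2" shows "tangent_curves (plane_curve (Var i)) (plane_curve cubic)"
proof -
 have *: "tangent_curves (plane_curve (Var i)) (plane_curve cubic)"
  if "p \<in> P2" "p i = 0" "peval p cubic = 0" "!!j. j \<le> 2 ==> grad cubic p j = (if i = j then 1 else 0)" for p
  unfolding tangent_curves_def
  by (rule exI[of _ p])
   (use that assms in \<open>auto simp: curve_smooth_at_iff[OF curve_form_Var[OF assms]] curve_smooth_at_iff[OF curve_form_cubic]
    tangent_plane_curve[OF curve_form_Var[OF assms]] tangent_plane_curve[OF curve_form_cubic] mem_plane_curve grad_Var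
    dest!: cases_le2\<close>)
 have e: "j \<le> 2 \<longleftrightarrow> j = 0 \<or> j = Suc 0 \<or> j = 2" for j :: nat by auto
 consider "i = 0" | "i = 1" | "i = 2" using cases_le2[OF assms] by blast
 then show ?thesis
 proof cases
  case 1
  show ?thesis by (rule *[of "vec3 0 1 0"]) (auto simp: 1 e vec3_in_P2 peval_cubic grad_cubic)
 next
  case 2
  show ?thesis by (rule *[of "vec3 0 0 1"]) (auto simp: 2 e vec3_in_P2 peval_cubic grad_cubic)
 next
  case 3
  show ?thesis by (rule *[of "vec3 1 0 0"]) (auto simp: 3 e vec3_in_P2 peval_cubic grad_cubic)
 qed
qed

subsection \<open>Multiplicities\<close>

definition ord_ge :: "nat => mpoly => bool" where
 "ord_ge n f \<longleftrightarrow> (\<forall>m\<in>keys f. n \<le> tdeg m)"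

lemma ord_ge_0 [simp]: "ord_ge 0 f" "ord_ge n 0"
 by (auto simp: ord_ge_def)

lemma ord_ge_Var [simp]: "ord_ge (Suc 0) (Var i)"
 by (auto simp: ord_ge_def Var_def)

lemma ord_ge_add: "ord_ge n f ==> ord_ge n g ==> ord_ge n (f + g)"
 using keys_add[of f g] by (auto simp: ord_ge_def)

lemma ord_ge_uminus: "ord_ge n f ==> ord_ge n (- f)"
 by (auto simp: ord_ge_def in_keys_iff)

lemma ord_ge_diff: "ord_ge n f ==> ord_ge n g ==> ord_ge n (f - g)"
 using ord_ge_add[of n f "- g"] ord_ge_uminus by simp

lemma ord_ge_mult: "ord_ge m f ==> ord_ge n g ==> ord_ge (m + n) (f * g)"
 using keys_mult[of f g] by (force simp: ord_ge_def intro: add_mono)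

lemma ord_ge_mult_right: "ord_ge m g ==> ord_ge m (f * g)"
 using ord_ge_mult[of 0 f m g] by simp

lemma ord_ge_power: "ord_ge n f ==> ord_ge (k * n) (f ^ k)"
 by (induction k) (auto intro: ord_ge_mult)

text \<open>Restriction to the line through the origin with direction p. A nonzero coefficient at
  T^n exhibits a monomial of degree n, which bounds the multiplicity from above.\<close>

definition ray :: "(nat => complex) => mpoly => complex poly" where
 "ray p = insertion (%c. [:c:]) (%i. [:0, p i:])"

lemma ray_hom [simp]:
 "ray p (f + g) = ray p f + ray p g" "ray p (f * g) = ray p f * ray p g" "ray p (Const c) = [:c:]"
 "ray p (Var i) = [:0, p i:]" "ray p (f - g) = ray p f - ray p g" "ray p (- f) = - ray p f" "ray p (f ^ n) = ray p f ^ n"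
 "ray p 1 = 1" "ray p 0 = 0" "ray p (sum F A) = (\<Sum>x\<in>A. ray p (F x))" "ray p (numeral k) = numeral k"
 by (simp_all add: ray_def)

lemma ray_single: "ray p (single m c) = monom (c * mon p m) (tdeg m)"
proof -
 have m: "[:0, p i:] = monom (p i) (Suc 0)" for i by (simp add: monom_Suc monom_0)
 have "(\<Prod>i\<in>A. monom (p i) (Suc 0) ^ e i) = monom (\<Prod>i\<in>A. p i ^ e i) (sum e A)" if "finite A" for A e
  using that by (induction A) (simp_all add: monom_power mult_monom)
 then have "mon (%i. [:0, p i:]) m = monom (mon p m) (tdeg m)" by (simp add: mon_def tdeg_def m)
 then show ?thesis by (simp add: ray_def insertion_single smult_monom)
qed

lemma coeff_ray_nz:
 assumes "coeff (ray p f) n ~= 0" obtains m where "m \<in> keys f" "tdeg m = n"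
proof -
 have "ray p f = (\<Sum>m\<in>keys f. monom (lookup f m * mon p m) (tdeg m))"
  by (subst mpoly_sum_single[of f]) (simp add: ray_single)
 then have "coeff (ray p f) n = (\<Sum>m\<in>keys f. if tdeg m = n then lookup f m * mon p m else 0)"
  by (simp add: coeff_sum)
 then have "(\<Sum>m\<in>keys f. if tdeg m = n then lookup f m * mon p m else 0) ~= 0"
  using assms by simp
 then obtain m where "m \<in> keys f" "(if tdeg m = n then lookup f m * mon p m else 0) ~= 0"
  by (rule sum.not_neutral_contains_not_neutral)
 then show ?thesis using that by (simp split: if_splits)
qed

lemma mult_origin_le: "f \<in> L ==> coeff (ray p f) n ~= 0 ==> mult_origin L \<le> n"
 unfolding mult_origin_def by (rule coeff_ray_nz, assumption) (auto intro!: Least_le)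

lemma mult_origin_eqI:
 assumes "f \<in> L" "coeff (ray p f) n ~= 0" "!!g. g \<in> L ==> ord_ge n g" shows "mult_origin L = n"
 unfolding mult_origin_def
proof (rule Least_equality)
 show "\<exists>f\<in>L. \<exists>m\<in>keys f. tdeg m = n" using assms(1) coeff_ray_nz[OF assms(2)] by blast
 show "n \<le> k" if "\<exists>f\<in>L. \<exists>m\<in>keys f. tdeg m = k" for k using that assms(3) by (auto simp: ord_ge_def)
qed

lemma coeff_ray_0: "coeff (ray p f) 0 = peval (%_. 0) f"
 by (induction f rule: mpoly_induct) (auto simp: coeff_mult)

lemma coeff_ray_1: "coeff (ray p f) (Suc 0) = dir_deriv (%_. 0) p f"
 by (induction f rule: mpoly_induct) (auto simp: coeff_mult coeff_ray_0)

lemma ord_ge_1I: "peval (%_. 0) f = 0 ==> ord_ge (Suc 0) f"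
proof -
 assume "peval (%_. 0) f = 0"
 have "peval (%_. 0) f = lookup f 0"
 proof -
  have m0: "mon (%_. 0::complex) m = (if m = 0 then 1 else 0)" for m
   by (auto simp: mon_def in_keys_iff poly_mapping_eq_iff fun_eq_iff prod_zero_iff)
  show ?thesis
   unfolding insertion_superset[OF coeff_hom_id finite_keys order.refl] m0
   by (simp add: in_keys_iff if_distrib cong: if_cong)
 qed
 moreover have "m = 0" if "tdeg m = 0" for m using that by (intro poly_mapping_eqI) (auto simp: tdeg_def in_keys_iff)
 ultimately have "tdeg m ~= 0" if "m \<in> keys f" for m
  using \<open>peval (%_. 0) f = 0\<close> that by (metis in_keys_iff)
 then show ?thesis by (simp add: ord_ge_def Suc_le_eq)
qed

lemma pivot_vec3 [simp]: "pivot (vec3 1 b c) = 0" "pivot (vec3 0 1 c) = Suc 0" "pivot (vec3 0 0 (1::complex)) = 2"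
 by (rule pivot_eqI; force simp: less_2_cases_iff)+

definition mono2 :: "nat => nat => nat \<Rightarrow>\<^sub>0 nat" where
 "mono2 a b = single 0 a + single 1 b"

lemma mono2_inject [simp]: "mono2 a b = mono2 c d \<longleftrightarrow> a = c \<and> b = d"
proof
 assume "mono2 a b = mono2 c d"
 then have "lookup (mono2 a b) i = lookup (mono2 c d) i" for i by simp
 from this[of 0] this[of 1] show "a = c \<and> b = d" by (simp add: mono2_def lookup_add lookup_single)
qed simp

lemma lookup_Var_mono2: "lookup (Var 0 ^ a * Var (Suc 0) ^ b) (mono2 c d) = (if a = c \<and> b = d then 1 else 0)"
proof -
 have "Var 0 ^ a * Var (Suc 0) ^ b = single (mono2 a b) 1"
  by (simp add: Var_power mult_single mono2_def)
 then show ?thesis by (simp add: lookup_single when_def)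
qed

lemma nodal_cubic_cubic: "nodal_cubic cubic"
 unfolding nodal_cubic_def
proof (intro conjI bexI[of _ "vec3 1 1 1"] ballI impI)
 let ?e = "%a b. Var 0 ^ a * Var (Suc 0) ^ b"
 \<comment> \<open>With y = 1 + u and z = 1 + v the cubic becomes u^2 - u v + v^2 + u v^2. Its
   quadratic part has discriminant -3, so the tangents at (1:1:1) are distinct.\<close>
 let ?g = "?e 2 0 + ?e 0 2 - ?e 1 1 + ?e 1 2"
 have g: "localize (vec3 1 1 1) cubic = ?g"
  by (simp add: localize_def cubic_eq power2_eq_square algebra_simps)
 have n: "single 0 2 = mono2 2 0" "single 1 2 = mono2 0 2"
  "single 0 1 + single 1 1 = mono2 1 1" by (simp_all add: mono2_def)
 have o: "ord_ge 2 ?g"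
 proof -
  have "ord_ge 2 (?e a b)" if "a + b \<ge> 2" for a b
   using ord_ge_mult[OF ord_ge_power[OF ord_ge_Var, of a 0] ord_ge_power[OF ord_ge_Var, of b "Suc 0"]] that by (force simp: ord_ge_def)
  from this[of 2 0] this[of 0 2] this[of 1 1] this[of 1 2] show ?thesis by (intro ord_ge_add ord_ge_diff) auto
 qed
 have "mult_origin {?g} = 2"
  by (rule mult_origin_eqI[of ?g _ "vec3 1 0 0"]) (use o in \<open>auto simp: power2_eq_square coeff_mult numeral_2_eq_2\<close>)
 then show "node_at cubic (vec3 1 1 1)"
  unfolding node_at_def g n Let_def lookup_add lookup_minus lookup_Var_mono2 by simp
 fix p assume p: "p \<in> plane_curve cubic" and m: "2 \<le> mult_origin {localize p cubic}"
 have pP: "p \<in> P2" "peval p cubic = 0" using p by (auto simp: plane_curve_def)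
 have d: "dir_deriv (%_. 0) w (localize p cubic) = 0" for w
  using mult_origin_le[of "localize p cubic" _ w "Suc 0"] m by (force simp: coeff_ray_1)
 from pP(1) show "p = vec3 1 1 1"
 proof (cases rule: P2_cases)
  case (1 b c)
  have "2 * b + c\<^sup>2 - 3 * c = 0" using d[of "vec3 1 0 0"] by (simp add: 1 localize_def cubic_eq algebra_simps)
  moreover have "2 * b * c + 1 - 3 * b = 0" using d[of "vec3 0 1 0"] by (simp add: 1 localize_def cubic_eq algebra_simps)
  moreover have "b\<^sup>2 + b * c\<^sup>2 + c - 3 * b * c = 0" using pP(2) by (simp add: 1 peval_cubic)
  ultimately have "c = 1 \<and> b = 1" by algebra
  then show ?thesis using 1 by simp
 next
  case (2 c)
  have "c = 0" using pP(2) by (simp add: 2 peval_cubic)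
  then show ?thesis using d[of "vec3 1 0 0"] by (simp add: 2 localize_def cubic_eq)
 next
  case 3
  then show ?thesis using d[of "vec3 0 1 0"] by (simp add: localize_def cubic_eq)
 qed
qed (auto simp: curve_form_cubic plane_curve_def vec3_in_P2 peval_cubic)

subsection \<open>Uniqueness of the foliation\<close>

lemma two_variable_factors:
 assumes A: "homogeneous 3 A" "vars_le 2 A" and ij: "i \<le> 2" "j \<le> 2" "i ~= j" and d: "Var i dvd A" "Var j dvd A"
 obtains a b c where "A = Var i * Var j * (Const a * Var 0 + Const b * Var 1 + Const c * Var 2)"
proof (cases "A = 0")
 case True
 then show ?thesis using that[of 0 0 0] by simp
next
 case False
 obtain A' where A': "A = Var i * A'" using d(1) by (elim dvdE)
 have "vars_le 2 A'" by (rule vars_le_dvd[OF _ False A(2)]) (simp add: A')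
 then have "Var j dvd Var i \<or> Var j dvd A'"
  using mpoly3_prime[OF irreducible_Var, of j "Var i" A'] d(2) ij A' by auto
 then have "Var j dvd A'" using Var_not_dvd[of j i] ij by auto
 then obtain B where "A' = Var j * B" by (elim dvdE)
 then have B: "A = (Var i * Var j) * B" by (simp add: A' mult.assoc)
 have "homogeneous (Suc 0 + Suc 0) (Var i * Var j)" by (intro homogeneous_mult) auto
 then have "homogeneous (Suc 0) B"
  by (rule homogeneous_cancel_left) (use A(1) B in \<open>auto simp: numeral_3_eq_3\<close>)
 moreover have "vars_le 2 B" by (rule vars_le_dvd[OF _ False A(2)]) (simp add: B)
 ultimately show ?thesis using homogeneous_1_form[of B] that B by metis
qed

text \<open>Invariance of the coordinate lines forces each coefficient to be the product of the
  other two variables and a linear form. The nine unknown constants are then restricted by Euler's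
  relation and by the cubic, along which it suffices to test a few points.\<close>

lemma foliation_unique:
 assumes A: "plane_foliation_form 2 A" and inv: "!!C. C \<in> J_curves ==> invariant_curve (ker_form P2 A) C"
 shows "\<exists>c. c ~= 0 \<and> A = (%i. Const c * Omega i)"
proof -
 have h: "homogeneous 3 (A i)" "vars_le 2 (A i)" if "i \<le> 2" for i
  using A that by (auto simp: plane_foliation_form_def vars_le_def)
 have dv: "Var i dvd A j" if ij: "i \<le> 2" "j \<le> 2" "i ~= j" for i j
 proof -
  have "plane_curve (Var i) \<in> J_curves" using cases_le2[OF ij(1)] by (auto simp: J_curves_def)
  then have I: "\<forall>p\<in>plane_curve (Var i). peval p (A 0) * grad (Var i) p 1 = peval p (A 1) * grad (Var i) p 0 \<and>
   peval p (A 0) * grad (Var i) p 2 = peval p (A 2) * grad (Var i) p 0 \<and> peval p (A 1) * grad (Var i) p 2 = peval p (A 2) * grad (Var i) p 1"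
   by (intro iffD1[OF invariant_curve_iff[OF curve_form_Var[OF ij(1)]]] inv)
  then have "\<forall>p\<in>plane_curve (Var i). peval p (A j) = 0"
   using ij cases_le2[OF ij(1)] cases_le2[OF ij(2)] by (auto simp: grad_Var)
  then have "Var i dvd psubst (trunc3 Var) (A j)"
   by (intro plane_curve_dvd[OF curve_form_Var[OF ij(1)] h(1)[OF ij(2)]]) auto
  then show ?thesis using h(2)[OF ij(2)] by simp
 qed
 obtain a0 a1 a2 where a: "A 0 = Var 1 * Var 2 * (Const a0 * Var 0 + Const a1 * Var 1 + Const a2 * Var 2)"
  using two_variable_factors[OF h, of 0 1 2] dv[of 1 0] dv[of 2 0] by auto
 obtain b0 b1 b2 where b: "A 1 = Var 0 * Var 2 * (Const b0 * Var 0 + Const b1 * Var 1 + Const b2 * Var 2)"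
  using two_variable_factors[OF h, of 1 0 2] dv[of 0 1] dv[of 2 1] by auto
 obtain c0 c1 c2 where c: "A 2 = Var 0 * Var 1 * (Const c0 * Var 0 + Const c1 * Var 1 + Const c2 * Var 2)"
  using two_variable_factors[OF h, of 2 0 1] dv[of 0 2] dv[of 1 2] by auto
 have pA: "peval p (A 0) = p 1 * p 2 * (a0 * p 0 + a1 * p 1 + a2 * p 2)"
  "peval p (A (Suc 0)) = p 0 * p 2 * (b0 * p 0 + b1 * p 1 + b2 * p 2)"
  "peval p (A 2) = p 0 * p 1 * (c0 * p 0 + c1 * p 1 + c2 * p 2)" for p
  using a b c by simp_all
 have "(\<Sum>i\<le>2. Var i * A i) = 0" using A by (simp add: plane_foliation_form_def)
 then have "peval p (\<Sum>i\<le>2. Var i * A i) = 0" for p by simp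
 then have E: "p 0 * peval p (A 0) + p 1 * peval p (A (Suc 0)) + p 2 * peval p (A 2) = 0" for p
  by (simp add: atMost_2 add.assoc)
 have e: "a0 + b0 + c0 = 0" "a1 + b1 + c1 = 0" "a2 + b2 + c2 = 0"
  using E[of "vec3 1 1 1"] E[of "vec3 2 1 1"] E[of "vec3 1 2 1"] E[of "vec3 1 1 2"] unfolding pA by simp_all algebra+
 have "plane_curve cubic \<in> J_curves" by (simp add: J_curves_def)
 then have cub: "peval (vec3 1 y z) (A 0) * grad cubic (vec3 1 y z) (Suc 0) = peval (vec3 1 y z) (A (Suc 0)) * grad cubic (vec3 1 y z) 0"
  if "y\<^sup>2 + y * z\<^sup>2 + z - 3 * y * z = 0" for y z
  using inv invariant_curve_iff[OF curve_form_cubic, of A] that vec3_in_P2 by (auto simp: mem_plane_curve peval_cubic)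
 \<comment> \<open>The coordinates (t : u : w) clear the denominators of y and z. The common factor
   z of both sides has been cancelled.\<close>
 have hcub: "u * (a0 * t + a1 * u + a2 * w) * (2 * t * u + w\<^sup>2 - 3 * t * w) = t * (b0 * t + b1 * u + b2 * w) * (u\<^sup>2 + 2 * w * t - 3 * u * w)"
  if "u = t * y" "w = t * z" "z ~= 0" "y\<^sup>2 + y * z\<^sup>2 + z - 3 * y * z = 0" for t u w y z
 proof -
  have "z * (y * (a0 + a1 * y + a2 * z) * (2 * y + z\<^sup>2 - 3 * z)) = z * ((b0 + b1 * y + b2 * z) * (y\<^sup>2 + 2 * z - 3 * y * z))"
   using cub[OF that(4)] unfolding pA grad_cubic by (simp add: mult.assoc mult.left_commute)
  then have "y * (a0 + a1 * y + a2 * z) * (2 * y + z\<^sup>2 - 3 * z) = (b0 + b1 * y + b2 * z) * (y\<^sup>2 + 2 * z - 3 * y * z)"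
   using that(3) by (metis mult_left_cancel)
  then show ?thesis using that(1,2) by algebra
 qed
 \<comment> \<open>Rational points of the cubic, cut out by the lines of slope -1, 1/2, 2, -1/2, -2
   through the node in the chart x = 1: they are (1:-2:4), (2:-4:-1), (4:1:-2), (2:-12:9) and
   (4:-3:18). Their five equations leave a single free constant among a0, ..., b2.\<close>
 have "b0 - 2 * b1 + 4 * b2 = 0"
  using hcub[of "-2" 1 "-2" 4 4] by simp algebra
 moreover have "2 * a0 - 4 * a1 - a2 = 0"
  using hcub[of "-4" 2 "-2" "-1" "-1/2"] by (simp add: power2_eq_square) algebra
 moreover have "4 * (a0 + b0) + (a1 + b1) - 2 * (a2 + b2) = 0"
  using hcub[of 1 4 "1/4" "-2" "-1/2"] by (simp add: power2_eq_square) algebra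
 moreover have "2 * a0 - 12 * a1 + 9 * a2 = 4 * (2 * b0 - 12 * b1 + 9 * b2)"
  using hcub[of "-12" 2 "-6" 9 "9/2"] by (simp add: power2_eq_square) algebra
 moreover have "4 * a0 - 3 * a1 + 18 * a2 = - 5 * (4 * b0 - 3 * b1 + 18 * b2)"
  using hcub[of "-3" 4 "-3/4" 18 "9/2"] by (simp add: power2_eq_square) algebra
 ultimately have l: "a1 = a0 \<and> a2 = - 2 * a0 \<and> b0 = - 2 * a0 \<and> b1 = a0 \<and> b2 = a0"
  by algebra
 have "c0 = - (a0 + b0)" "c1 = - (a1 + b1)" "c2 = - (a2 + b2)"
  using e by (simp_all only: add_eq_0_iff)
 then have cc: "c0 = a0 \<and> c1 = - 2 * a0 \<and> c2 = a0" using l by simp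
 have eq: "A i = Const a0 * Omega i" for i
 proof (cases "i \<le> 2")
  case True
  then show ?thesis using cases_le2[OF True] a b c l cc
   by (elim disjE) (simp_all add: Omega_simps Const_mult Const_uminus algebra_simps)
 next
  case False
  then show ?thesis using A by (simp add: plane_foliation_form_def Omega_simps)
 qed
 have "a0 ~= 0"
 proof
  assume "a0 = 0"
  then have "\<forall>i\<le>2. Var 0 dvd A i" by (simp add: eq)
  then have "Var 0 dvd 1" using A by (auto simp: plane_foliation_form_def)
  then show False using irreducible_Var[of 0] by (simp add: irreducible_def)
 qed
 then show ?thesis using eq by blast
qed

subsection \<open>The quartic involution\<close>

lemma plane_tuple_ev:
 assumes "form_tuple d \<Phi>" "!!i. 2 < i ==> \<Phi> i = 0"
 shows "evals \<Phi> p = vec3 (peval p (\<Phi> 0)) (peval p (\<Phi> 1)) (peval p (\<Phi> 2))"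
 by (rule vec3_eqI) (use assms in \<open>auto simp: evals_def\<close>)

lemma plane_map_tuple:
 assumes "form_tuple d \<Phi>" "!!i. 2 < i ==> \<Phi> i = 0" "p \<in> P2" "evals \<Phi> p i ~= 0"
 shows "map_tuple P2 P2 \<Phi>" "rmap P2 \<Phi> \<in> rational_maps P2 P2" "tuple_on P2 \<Phi>"
proof -
 have "to_point (evals \<Phi> q) \<in> P2" if "evals \<Phi> q i ~= 0" for q i
  by (rule to_point_P2[of "evals \<Phi> q" i, OF that]) (simp add: evals_def assms(2))
 then show "map_tuple P2 P2 \<Phi>" using assms unfolding map_tuple_def evals_def by blast
 then show "rmap P2 \<Phi> \<in> rational_maps P2 P2" "tuple_on P2 \<Phi>"
  unfolding rational_maps_def using map_tuple_tuple_on by blast+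
qed

lemma J4_simps:
 "J4 0 = Var 1 * (Var 1 - Var 2) * (Var 2 - Var 0)\<^sup>2"
 "J4 (Suc 0) = Var 0 * (Var 0 - Var 1) * (Var 1 - Var 2)\<^sup>2"
 "J4 2 = Var 2 * (Var 2 - Var 0) * (Var 0 - Var 1)\<^sup>2"
 "2 < i ==> J4 i = 0"
 by (simp_all add: J4_def Let_def triple_vec3)

lemma form_tuple_J4: "form_tuple 4 J4"
proof -
 have l: "homogeneous (Suc 0) (Var i - Var j)" for i j by (intro homogeneous_diff) auto
 have h: "homogeneous (Suc 0 + Suc 0 + 2 * Suc 0) (Var i * (Var j - Var k) * (Var l - Var m)\<^sup>2)" for i j k l m
  by (intro homogeneous_mult homogeneous_power l) auto
 have "homogeneous 4 (Var i * (Var j - Var k) * (Var l - Var m)\<^sup>2)" for i j k l m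
  using h[of i j k l m] by (simp add: eval_nat_numeral)
 then have "homogeneous 4 (J4 i)" for i
 proof (cases "i \<le> 2")
  case True
  assume "!!i j k l m. homogeneous 4 (Var i * (Var j - Var k) * (Var l - Var m)\<^sup>2)"
  then show ?thesis using cases_le2[OF True] by (elim disjE) (simp_all add: J4_simps)
 qed (simp add: J4_simps)
 then show ?thesis by (simp add: form_tuple_def)
qed

lemma vars_le_J4 [simp]: "vars_le 2 (J4 i)"
proof (cases "i \<le> 2")
 case True
 then show ?thesis using cases_le2[OF True] by (elim disjE) (simp_all add: J4_simps)
qed (simp add: J4_simps)

text \<open>The square of J4 has degree 16 and is the identity multiplied by this form of degree
  15.\<close>

definition J4_factor :: mpoly where
 "J4_factor = ((Var 1 - Var 2) * (Var 2 - Var 0) * (Var 0 - Var 1))\<^sup>2 * cubic ^ 3"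

lemma J4_factor: "homogeneous (2 * 3 + 3 * 3) J4_factor" "vars_le 2 J4_factor" "J4_factor ~= 0"
proof -
 have l: "homogeneous (Suc 0) (Var i - Var j)" for i j by (intro homogeneous_diff) auto
 have "homogeneous (Suc 0 + Suc 0 + Suc 0) ((Var 1 - Var 2) * (Var 2 - Var 0) * (Var 0 - Var 1))"
  by (intro homogeneous_mult l)
 then show "homogeneous (2 * 3 + 3 * 3) J4_factor" unfolding J4_factor_def
  by (intro homogeneous_mult homogeneous_power homogeneous_cubic) (simp add: numeral_3_eq_3)
 show "vars_le 2 J4_factor" by (simp add: J4_factor_def)
 have "peval (vec3 1 2 4) J4_factor ~= 0" by (simp add: J4_factor_def peval_cubic)
 then show "J4_factor ~= 0" by (metis insertion_0)
qed

text \<open>The differences of the coordinates of \<^term>\<open>J4\<close> are divisible by the cubic.\<close>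

lemma J4_J4:
 assumes "p \<in> P2" shows "evals J4 (evals J4 p) = (%i. peval p J4_factor * p i)"
proof -
 obtain x y z where p: "p = vec3 x y z" using vec3_cases[of p] assms by (metis P2_beyond)
 have e: "evals J4 (vec3 x y z) = vec3 (y * (y - z) * (z - x)\<^sup>2) (x * (x - y) * (y - z)\<^sup>2) (z * (z - x) * (x - y)\<^sup>2)" for x y z
  by (subst plane_tuple_ev[OF form_tuple_J4]) (simp_all add: J4_simps)
 let ?c = "peval p cubic"
 define X Y Z where XYZ: "X = y * (y - z) * (z - x)\<^sup>2" "Y = x * (x - y) * (y - z)\<^sup>2" "Z = z * (z - x) * (x - y)\<^sup>2"
 have d: "Y - Z = (x - y) * ?c" "Z - X = (z - x) * ?c" "X - Y = (y - z) * ?c"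
  unfolding XYZ p peval_cubic by (simp_all add: power2_eq_square) algebra+
 have s: "peval p J4_factor = ((y - z) * (z - x) * (x - y))\<^sup>2 * ?c ^ 3"
  by (simp add: J4_factor_def p)
 have "evals J4 (evals J4 p) = vec3 (Y * (Y - Z) * (Z - X)\<^sup>2) (X * (X - Y) * (Y - Z)\<^sup>2) (Z * (Z - X) * (X - Y)\<^sup>2)"
  unfolding p e by (simp add: XYZ)
 also have "\<dots> = vec3 (peval p J4_factor * x) (peval p J4_factor * y) (peval p J4_factor * z)"
  unfolding d s unfolding XYZ by (simp add: power2_eq_square power3_eq_cube mult.commute mult.left_commute)
 finally show ?thesis by (simp add: p)
qed

lemma J4_coprime:
 assumes "\<forall>i\<le>2. g dvd J4 i" shows "g dvd 1"
proof -
 let ?l = "Const 0 * Var 0 + Const 1 * Var 1 + Const (- 1) * Var 2" and ?m = "Const (- 1) * Var 0 + Const 0 * Var 1 + Const 1 * Var 2"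
 have l: "?l = Var 1 - Var 2" "?m = Var 2 - Var 0" by (simp_all add: Const_uminus)
 have "g dvd prod_list [Var 1, ?l, ?m, ?m]"
  using assms[rule_format, of 0] unfolding l by (simp add: J4_simps mult.assoc power2_eq_square)
 moreover have "irreducible ?l" "irreducible ?m" by (rule linear_form_irreducible; simp)+
 ultimately have "g dvd 1 \<or> (\<exists>l\<in>set [Var 1, ?l, ?m, ?m]. l dvd g)"
  by (intro dvd_product_linear) (auto simp: irreducible_Var simp del: Const_1 One_nat_def)
 then have "g dvd 1 \<or> Var 1 dvd g \<or> ?l dvd g \<or> ?m dvd g" by (auto simp del: Const_1 Const_0 One_nat_def)
 moreover have "\<not> Var 1 dvd g"
  using dvd_peval_zero[of "Var 1" "J4 1" "vec3 1 0 1"] assms[rule_format, of 1] by (auto simp: J4_simps dest: dvd_trans)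
 moreover have "\<not> ?l dvd g"
  using dvd_peval_zero[of ?l "J4 2" "vec3 0 1 1"] assms[rule_format, of 2] by (auto simp: J4_simps dest: dvd_trans)
 moreover have "\<not> ?m dvd g"
  using dvd_peval_zero[of ?m "J4 1" "vec3 1 0 1"] assms[rule_format, of 1] by (auto simp: J4_simps dest: dvd_trans)
 ultimately show ?thesis by blast
qed

subsection \<open>The base points of the quartic involution\<close>

lemma localize_hom [simp]:
 "localize p (f + g) = localize p f + localize p g" "localize p (f * g) = localize p f * localize p g"
 "localize p (Const c) = Const c" "localize p (sum F A) = (\<Sum>x\<in>A. localize p (F x))"
 "localize p (f - g) = localize p f - localize p g" "localize p (f ^ n) = localize p f ^ n"
 by (simp_all add: localize_def)

lemma peval_localize [simp]: "peval (%_. 0) (localize p f) = peval p f"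
proof -
 have "(%i. peval (%_. 0) (Const (p i) + (if i < pivot p then Var i else if i = pivot p then 0 else Var (i - 1)))) = p"
  by auto
 then show ?thesis by (simp add: localize_def)
qed

lemma homaloidal_net_mem: "i \<le> 2 ==> \<Phi> i \<in> homaloidal_net \<Phi>"
 unfolding homaloidal_net_def
 by (intro CollectI exI[of _ "%j. if j = i then 1 else 0"]) (auto dest!: cases_le2 simp: atMost_2)

lemma homaloidal_net_comb:
 "f \<in> homaloidal_net \<Phi> ==> \<exists>a b c. f = Const a * \<Phi> 0 + Const b * \<Phi> 1 + Const c * \<Phi> 2"
 by (auto simp: homaloidal_net_def atMost_2 add.assoc)

text \<open>A member that is nonzero at the origin makes the multiplicity 0, so blowing up divides
  by nothing and its pull-back is again nonzero at the new origin. No base point can appear further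
  up.\<close>

lemma fold_blow_up_free:
 assumes "f \<in> L" "peval (%_. 0) f ~= 0" shows "mult_origin (fold blow_up ds L) = 0"
 using assms
proof (induction ds arbitrary: L f)
 case Nil
 then show ?case using mult_origin_le[of f L "%_. 0" 0] by (simp add: coeff_ray_0)
next
 case (Cons t ds)
 have m: "mult_origin L = 0" using mult_origin_le[of f L "%_. 0" 0] Cons.prems by (simp add: coeff_ray_0)
 have "\<exists>g\<in>blow_up t L. peval (%_. 0) g ~= 0"
 proof (cases t)
  case None
  let ?g = "psubst (%i. if i = 0 then Var 0 * Var 1 else Var 1) f"
  have "?g \<in> blow_up t L" using Cons.prems m by (auto simp: None blow_up_def)
  moreover have "(%i. peval (%_. 0) (if i = 0 then Var 0 * Var 1 else Var 1)) = (%_::nat. 0)" by auto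
  then have "peval (%_. 0) ?g ~= 0" using Cons.prems by simp
  ultimately show ?thesis by blast
 next
  case (Some c)
  let ?g = "psubst (%i. if i = 0 then Var 0 else Var 0 * (Var 1 + Const c)) f"
  have "?g \<in> blow_up t L" using Cons.prems m by (auto simp: Some blow_up_def)
  moreover have "(%i. peval (%_. 0) (if i = 0 then Var 0 else Var 0 * (Var 1 + Const c))) = (%_::nat. 0)" by auto
  then have "peval (%_. 0) ?g ~= 0" using Cons.prems by simp
  ultimately show ?thesis by blast
 qed
 then show ?case using Cons.IH by auto
qed

lemma blow_up_SomeI:
 "f \<in> L ==> Var 0 ^ mult_origin L * g = psubst (%i. if i = 0 then Var 0 else Var 0 * (Var 1 + Const c)) f ==> g \<in> blow_up (Some c) L"
 by (auto simp: blow_up_def)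

lemma blow_up_NoneI:
 "f \<in> L ==> Var 1 ^ mult_origin L * g = psubst (%i. if i = 0 then Var 0 * Var 1 else Var 1) f ==> g \<in> blow_up None L"
 by (auto simp: blow_up_def)

lemma mult_origin_oneI:
 assumes "f \<in> L" "dir_deriv (%_. 0) w f ~= 0" "!!g. g \<in> L ==> peval (%_. 0) g = 0"
 shows "mult_origin L = 1"
 unfolding One_nat_def
 by (rule mult_origin_eqI[OF assms(1), of w]) (use assms in \<open>auto simp: coeff_ray_1 intro: ord_ge_1I\<close>)

text \<open>The linear system at the coordinate points: a simple base point with exactly one simple base point infinitely near to it.\<close>

lemma simple_tower_Some:
 assumes L: "P \<in> L" "Q \<in> L" "R \<in> L" "!!f. f \<in> L ==> \<exists>a b c. f = Const a * P + Const b * Q + Const c * R"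
  and P: "P = Var 0 * (Var 0 - Var 1) * (Var 1 - 1)\<^sup>2" and Q: "Q = (1 - Var 0) * (Var 0 - Var 1)\<^sup>2"
  and R: "R = Var 1 * (Var 1 - 1) * (1 - Var 0)\<^sup>2"
 shows "mult_origin (fold blow_up ds L) \<le> 1"
proof -
 have m: "mult_origin L = 1"
  by (rule mult_origin_oneI[OF L(3), of "vec3 0 1 0"]) (use L(4) in \<open>force simp: P Q R\<close>)+
 show ?thesis
 proof (cases ds)
  case Nil
  then show ?thesis using m by simp
 next
  case (Cons t ds')
  show ?thesis
  proof (cases t)
   case None
   have "(Var 1 - 1) * (1 - Var 0 * Var 1)\<^sup>2 \<in> blow_up None L"
    by (rule blow_up_NoneI[OF L(3)]) (simp add: m R algebra_simps)
   then have "mult_origin (fold blow_up ds' (blow_up None L)) = 0" by (rule fold_blow_up_free) simp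
   then show ?thesis by (simp add: Cons None)
  next
   case (Some c)
   show ?thesis
   proof (cases "c = 0")
    case False
    have "(Var 1 + Const c) * (Var 0 * (Var 1 + Const c) - 1) * (1 - Var 0)\<^sup>2 \<in> blow_up (Some c) L"
     by (rule blow_up_SomeI[OF L(3)]) (simp add: m R algebra_simps)
    then have "mult_origin (fold blow_up ds' (blow_up (Some c) L)) = 0"
     by (rule fold_blow_up_free) (use False in simp)
    then show ?thesis by (simp add: Cons Some)
   next
    case True
    \<comment> \<open>The linear term of \<open>R\<close> is -v, so a base point on the exceptional
      curve can only lie in the direction v = 0.\<close>
    define L1 where "L1 = blow_up (Some 0) L"
    have Q1: "(1 - Var 0) * Var 0 * (1 - Var 1)\<^sup>2 \<in> L1" unfolding L1_def
     by (rule blow_up_SomeI[OF L(2)]) (simp add: m Q power2_eq_square algebra_simps)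
    have R1: "Var 1 * (Var 0 * Var 1 - 1) * (1 - Var 0)\<^sup>2 \<in> L1" unfolding L1_def
     by (rule blow_up_SomeI[OF L(3)]) (simp add: m R algebra_simps)
    have z: "peval (%_. 0) g = 0" if gL: "g \<in> L1" for g
    proof -
     obtain f where f: "f \<in> L" "Var 0 * g = psubst (%i. if i = 0 then Var 0 else Var 0 * (Var 1 + Const 0)) f"
      using gL m by (auto simp: L1_def blow_up_def)
     obtain a b c where "f = Const a * P + Const b * Q + Const c * R" using L(4)[OF f(1)] by blast
     then have "dir_deriv (%_. 0) (vec3 1 0 0) (Var 0 * g) = 0" unfolding f(2) by (simp add: P Q R)
     then show ?thesis by simp
    qed
    have m1: "mult_origin L1 = 1" by (rule mult_origin_oneI[OF R1, of "vec3 0 1 0"]) (use z in auto)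
    show ?thesis
    proof (cases ds')
     case Nil
     then show ?thesis using m1 by (simp add: Cons Some True L1_def)
    next
     case Cons': (Cons t' ds'')
     \<comment> \<open>On the second exceptional curve \<open>R1\<close>, with linear term -v, is
       nonzero in the direction u = 0, and \<open>Q1\<close>, with linear term u, in all other
       directions: the tower ends.\<close>
     have "\<exists>g\<in>blow_up t' L1. peval (%_. 0) g ~= 0"
     proof (cases t')
      case None
      have "(Var 0 * Var 1 * Var 1 - 1) * (1 - Var 0 * Var 1)\<^sup>2 \<in> blow_up None L1"
       by (rule blow_up_NoneI[OF R1]) (simp add: m1 algebra_simps)
      then show ?thesis unfolding None by (rule bexI[rotated]) simp
     next
      case (Some c)
      have "(1 - Var 0) * (1 - Var 0 * (Var 1 + Const c))\<^sup>2 \<in> blow_up (Some c) L1"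
       by (rule blow_up_SomeI[OF Q1]) (simp add: m1 algebra_simps)
      then show ?thesis unfolding Some by (rule bexI[rotated]) simp
     qed
     then have "mult_origin (fold blow_up ds'' (blow_up t' L1)) = 0" using fold_blow_up_free by blast
     then show ?thesis by (simp add: Cons Cons' Some True L1_def)
    qed
   qed
  qed
 qed
qed

text \<open>The same germ with the local coordinates exchanged. The chart at (0:1:0) lists them as
  (x, z), against the cyclic order, so the infinitely near base point lies in the direction
  \<open>None\<close>.\<close>

lemma simple_tower_None:
 assumes L: "P \<in> L" "Q \<in> L" "R \<in> L" "!!f. f \<in> L ==> \<exists>a b c. f = Const a * P + Const b * Q + Const c * R"
  and P: "P = Var 1 * (Var 1 - Var 0) * (Var 0 - 1)\<^sup>2" and Q: "Q = (1 - Var 1) * (Var 1 - Var 0)\<^sup>2"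
  and R: "R = Var 0 * (Var 0 - 1) * (1 - Var 1)\<^sup>2"
 shows "mult_origin (fold blow_up ds L) \<le> 1"
proof -
 have m: "mult_origin L = 1"
  by (rule mult_origin_oneI[OF L(3), of "vec3 1 0 0"]) (use L(4) in \<open>force simp: P Q R\<close>)+
 show ?thesis
 proof (cases ds)
  case Nil
  then show ?thesis using m by simp
 next
  case (Cons t ds')
  show ?thesis
  proof (cases t)
   case (Some c)
   have "(Var 0 - 1) * (1 - Var 0 * (Var 1 + Const c))\<^sup>2 \<in> blow_up (Some c) L"
    by (rule blow_up_SomeI[OF L(3)]) (simp add: m R algebra_simps)
   then have "mult_origin (fold blow_up ds' (blow_up (Some c) L)) = 0" by (rule fold_blow_up_free) simp
   then show ?thesis by (simp add: Cons Some)
  next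
   case None
   define L1 where "L1 = blow_up None L"
   have Q1: "(1 - Var 1) * Var 1 * (1 - Var 0)\<^sup>2 \<in> L1" unfolding L1_def
    by (rule blow_up_NoneI[OF L(2)]) (simp add: m Q power2_eq_square algebra_simps)
   have R1: "Var 0 * (Var 0 * Var 1 - 1) * (1 - Var 1)\<^sup>2 \<in> L1" unfolding L1_def
    by (rule blow_up_NoneI[OF L(3)]) (simp add: m R algebra_simps)
   have z: "peval (%_. 0) g = 0" if gL: "g \<in> L1" for g
   proof -
    obtain f where f: "f \<in> L" "Var 1 * g = psubst (%i. if i = 0 then Var 0 * Var 1 else Var 1) f"
     using gL m by (auto simp: L1_def blow_up_def)
    obtain a b c where "f = Const a * P + Const b * Q + Const c * R" using L(4)[OF f(1)] by blast
    then have "dir_deriv (%_. 0) (vec3 0 1 0) (Var 1 * g) = 0" unfolding f(2) by (simp add: P Q R)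
    then show ?thesis by simp
   qed
   have m1: "mult_origin L1 = 1" by (rule mult_origin_oneI[OF R1, of "vec3 1 0 0"]) (use z in auto)
   show ?thesis
   proof (cases ds')
    case Nil
    then show ?thesis using m1 by (simp add: Cons None L1_def)
   next
    case Cons': (Cons t' ds'')
    have "\<exists>g\<in>blow_up t' L1. peval (%_. 0) g ~= 0"
    proof (cases t')
     case None
     have "(1 - Var 1) * (1 - Var 0 * Var 1)\<^sup>2 \<in> blow_up None L1"
      by (rule blow_up_NoneI[OF Q1]) (simp add: m1 algebra_simps)
     then show ?thesis unfolding None by (rule bexI[rotated]) simp
    next
     case (Some c)
     have "(Var 0 * Var 0 * (Var 1 + Const c) - 1) * (1 - Var 0 * (Var 1 + Const c))\<^sup>2 \<in> blow_up (Some c) L1"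
      by (rule blow_up_SomeI[OF R1]) (simp add: m1 algebra_simps)
     then show ?thesis unfolding Some by (rule bexI[rotated]) simp
    qed
    then have "mult_origin (fold blow_up ds'' (blow_up t' L1)) = 0" using fold_blow_up_free by blast
    then show ?thesis by (simp add: Cons Cons' None L1_def)
   qed
  qed
 qed
qed

lemma J4_base_points:
 assumes "p \<in> P2" "\<forall>i\<le>2. peval p (J4 i) = 0"
 shows "p \<in> {vec3 1 1 1, vec3 1 0 0, vec3 0 1 0, vec3 0 0 1}"
proof -
 have j: "peval p (J4 0) = 0" "peval p (J4 1) = 0" "peval p (J4 2) = 0" using assms(2) by auto
 from assms(1) show ?thesis
 proof (cases rule: P2_cases)
  case (1 b c)
  then have "b * (b - c) * (c - 1)\<^sup>2 = 0" "(1 - b) * (b - c)\<^sup>2 = 0" "c * (c - 1) * (1 - b)\<^sup>2 = 0"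
   using j by (simp_all add: J4_simps)
  then have "(b = 1 \<and> c = 1) \<or> (b = 0 \<and> c = 0)" by auto
  then show ?thesis using 1 by auto
 next
  case (2 c)
  then have "(1 - c) * c\<^sup>2 = 0" "c * c = 0" using j by (simp_all add: J4_simps)
  then show ?thesis using 2 by auto
 qed auto
qed

subsection \<open>Diagonal derivations\<close>

text \<open>The derivation along the vector field with components l_i x_i. Every monomial is an
  eigenvector, with eigenvalue \<open>weight\<close>; for l = 1 this is the Euler field.\<close>

definition diag_deriv :: "(nat => complex) => mpoly => mpoly" where
 "diag_deriv l f = (\<Sum>i\<le>2. Const (l i) * Var i * pderiv_wrt i f)"

definition weight :: "(nat => complex) => (nat \<Rightarrow>\<^sub>0 nat) => complex" where
 "weight l m = (\<Sum>i\<le>2. l i * of_nat (lookup m i))"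

lemma diag_deriv_simps [simp]:
 "diag_deriv l (f + g) = diag_deriv l f + diag_deriv l g"
 "diag_deriv l (f - g) = diag_deriv l f - diag_deriv l g"
 "diag_deriv l (- f) = - diag_deriv l f"
 "diag_deriv l (f * g) = diag_deriv l f * g + f * diag_deriv l g"
 "diag_deriv l (Const c) = 0" "diag_deriv l 0 = 0" "diag_deriv l 1 = 0" "diag_deriv l (numeral k) = 0"
 by (simp_all add: diag_deriv_def algebra_simps sum.distrib sum_distrib_left sum_distrib_right sum_negf flip: sum_subtractf)

lemma diag_deriv_Var: "i \<le> 2 ==> diag_deriv l (Var i) = Const (l i) * Var i"
 by (auto simp: diag_deriv_def pderiv_wrt_Var if_distrib cong: if_cong)

lemma diag_deriv_sum [simp]: "diag_deriv l (sum F A) = (\<Sum>x\<in>A. diag_deriv l (F x))"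
 by (induction A rule: infinite_finite_induct) auto

lemma diag_deriv_power: "diag_deriv l (f ^ Suc n) = of_nat (Suc n) * f ^ n * diag_deriv l f"
 by (induction n) (auto simp: algebra_simps)

lemma diag_deriv_single: "diag_deriv l (single m c) = Const (weight l m) * single m c"
proof -
 have "Var i * pderiv_wrt i (single m c) = Const (of_nat (lookup m i)) * single m c" for i
 proof (cases "lookup m i = 0")
  case False
  then have "single i 1 + (m - single i 1) = m"
   by (intro poly_mapping_eqI) (auto simp: lookup_add lookup_minus lookup_single when_def)
  then show ?thesis by (simp add: pderiv_wrt_single Var_def Const_def mult_single del: single_of_nat)
 qed (simp add: pderiv_wrt_single)
 then have *: "Const (l i) * Var i * pderiv_wrt i (single m c) = Const (l i) * Const (of_nat (lookup m i)) * single m c" for i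
  by (simp only: mult.assoc)
 show ?thesis
  unfolding diag_deriv_def weight_def atMost_2 * by (simp add: Const_add Const_mult distrib_right add.assoc)
qed

lemma lookup_Const_mult [simp]: "lookup (Const c * f) m = c * lookup f m"
proof -
 have "lookup (Const c * single k x) m = c * lookup (single k x) m" for k x
  by (simp add: Const_def mult_single lookup_single when_def)
 then show ?thesis
  by (subst (1 2) mpoly_sum_single[of f]) (simp add: sum_distrib_left lookup_sum)
qed

lemma lookup_diag_deriv: "lookup (diag_deriv l f) m = weight l m * lookup f m"
proof -
 have "lookup (diag_deriv l (single k x)) m = weight l m * lookup (single k x) m" for k x
  by (simp add: diag_deriv_single lookup_single when_def)
 then show ?thesis
  by (subst (1 2) mpoly_sum_single[of f]) (simp add: sum_distrib_left lookup_sum)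
qed

lemma diag_deriv_Euler:
 assumes "homogeneous d f" "vars_le 2 f" shows "diag_deriv (%_. 1) f = of_nat d * f"
proof (rule poly_mapping_eqI)
 fix m
 have "weight (%_. 1) m = of_nat d" if m: "m \<in> keys f"
 proof -
  have "keys m \<subseteq> {..2}" using m assms(2) by (auto simp: vars_le_def pvars_def)
  then show ?thesis using tdeg_superset[of "{..2}" m] assms(1) m
   by (simp add: weight_def homogeneous_def flip: of_nat_sum)
 qed
 moreover have "lookup (of_nat d * f) m = of_nat d * lookup f m"
  using lookup_Const_mult[of "of_nat d" f m] by simp
 ultimately show "lookup (diag_deriv (%_. 1) f) m = lookup (of_nat d * f) m"
  by (cases "m \<in> keys f") (auto simp: lookup_diag_deriv in_keys_iff)
qed

lemma vars_le_pderiv_wrt [simp]: "vars_le n f ==> vars_le n (pderiv_wrt i f)"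
proof -
 assume f: "vars_le n f"
 have "vars_le n (single (m - single i 1) (of_nat (lookup m i) * lookup f m))"
  if "m \<in> keys f" for m
 proof -
  have "keys (m - single i 1) \<subseteq> keys m"
   by (auto simp: in_keys_iff lookup_minus)
  also have "\<dots> \<subseteq> {..n}" using f that by (auto simp: vars_le_def pvars_def)
  finally show ?thesis by (simp add: vars_le_def pvars_def)
 qed
 then show ?thesis unfolding pderiv_wrt_def by (intro vars_le_sum)
qed

lemma vars_le_diag_deriv [simp]: "vars_le 2 f ==> vars_le 2 (diag_deriv l f)"
 unfolding diag_deriv_def by (intro vars_le_sum vars_le_mult) auto

lemma homogeneous_diag_deriv: "homogeneous d f ==> homogeneous d (diag_deriv l f)"
 by (auto simp: homogeneous_def in_keys_iff lookup_diag_deriv)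

lemma peval_diag_deriv: "vars_le 2 f ==> peval p (diag_deriv l f) = dir_deriv p (%i. l i * p i) f"
 by (simp add: diag_deriv_def atMost_2 dir_deriv_grad grad_def algebra_simps)

lemma diag_deriv_psubst3:
 assumes "vars_le 2 f" "!!i. vars_le 2 (\<Phi> i)"
 shows "diag_deriv l (psubst \<Phi> f) = psubst \<Phi> (pderiv_wrt 0 f) * diag_deriv l (\<Phi> 0) +
  psubst \<Phi> (pderiv_wrt 1 f) * diag_deriv l (\<Phi> 1) + psubst \<Phi> (pderiv_wrt 2 f) * diag_deriv l (\<Phi> 2)"
proof (rule mpoly3_eqI)
 have v: "vars_le 2 (psubst \<Phi> g)" for g by (rule vars_le_psubst) (rule assms)
 show "vars_le 2 (diag_deriv l (psubst \<Phi> f))" using v by simp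
 show "vars_le 2 (psubst \<Phi> (pderiv_wrt 0 f) * diag_deriv l (\<Phi> 0) +
  psubst \<Phi> (pderiv_wrt 1 f) * diag_deriv l (\<Phi> 1) + psubst \<Phi> (pderiv_wrt 2 f) * diag_deriv l (\<Phi> 2))"
  using v assms by simp
 fix p
 show "peval p (diag_deriv l (psubst \<Phi> f)) = peval p (psubst \<Phi> (pderiv_wrt 0 f) * diag_deriv l (\<Phi> 0) +
  psubst \<Phi> (pderiv_wrt 1 f) * diag_deriv l (\<Phi> 1) + psubst \<Phi> (pderiv_wrt 2 f) * diag_deriv l (\<Phi> 2))"
  by (simp add: peval_diag_deriv[OF v] peval_diag_deriv assms dir_deriv_grad[OF assms(1)] grad_def)
qed

text \<open>The product of the operators D - e over the list. If e runs through the weights of all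
  monomials but one, the result is a multiple of the projection to that monomial. Such a list can be
  taken common to two forms of the same degree.\<close>

definition eigen_filter :: "(nat => complex) => complex list => mpoly => mpoly" where
 "eigen_filter l es f = foldr (%e f. diag_deriv l f - Const e * f) es f"

lemma lookup_eigen_filter:
 "lookup (eigen_filter l es f) m = (\<Prod>e\<leftarrow>es. weight l m - e) * lookup f m"
 by (induction es) (simp_all add: eigen_filter_def lookup_minus lookup_diag_deriv algebra_simps)

definition weights_distinct :: "(nat => complex) => bool" where
 "weights_distinct l \<longleftrightarrow> (\<forall>m m'. keys m \<subseteq> {..2} \<longrightarrow> keys m' \<subseteq> {..2} \<longrightarrow> tdeg m = tdeg m' \<longrightarrow> weight l m = weight l m' \<longrightarrow> m = m')"

lemma eigen_filter_isolate:
 assumes l: "weights_distinct l" and f: "homogeneous d f" "vars_le 2 f" and g: "homogeneous d g" "vars_le 2 g"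
  and m: "m \<in> keys f"
 obtains es c where "c ~= 0" "eigen_filter l es f = single m (c * lookup f m)"
  "eigen_filter l es g = single m (c * lookup g m)"
proof -
 let ?K = "keys f \<union> keys g - {m}"
 obtain ms where ms: "set ms = ?K" using finite_list[of ?K] by auto
 define es where "es = map (weight l) ms"
 define c where "c = (\<Prod>e\<leftarrow>es. weight l m - e)"
 have sub: "keys k \<subseteq> {..2} \<and> tdeg k = d" if "k \<in> keys f \<union> keys g" for k
  using that f g by (auto simp: vars_le_def pvars_def homogeneous_def)
 have "c ~= 0"
 proof
  assume "c = 0"
  then obtain k where k: "k \<in> ?K" "weight l m = weight l k" by (auto simp: c_def es_def ms prod_list_zero_iff simp flip: ms)
  then have "m = k" using l sub[of m] sub[of k] m unfolding weights_distinct_def by (metis DiffD1 UnI1)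
  then show False using k by simp
 qed
 moreover have "eigen_filter l es h = single m (c * lookup h m)" if h: "keys h \<subseteq> keys f \<union> keys g" for h
 proof (rule poly_mapping_eqI)
  fix k
  have "(\<Prod>e\<leftarrow>es. weight l k - e) = 0" if "k \<in> ?K"
   using that by (auto simp: es_def prod_list_zero_iff ms)
  then show "lookup (eigen_filter l es h) k = lookup (single m (c * lookup h m)) k"
   using h by (cases "k \<in> keys h") (auto simp: lookup_eigen_filter lookup_single when_def c_def in_keys_iff)
 qed
 ultimately show ?thesis using that[of c es] by blast
qed

text \<open>A quotient of two forms of equal degree that is a first integral of a diagonal vector field with distinct weights is constant: projecting onto one monomial
 of the denominator turns \<^term>\<open>P * Q\<close> into a multiple of a monomial.\<close>

lemma first_integral_const:
 assumes l: "weights_distinct l" and P: "homogeneous d P" "vars_le 2 P" and Q: "homogeneous d Q" "vars_le 2 Q" "Q ~= 0"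
  and eq: "diag_deriv l P * Q = P * diag_deriv l Q"
 obtains c where "P = Const c * Q"
proof -
 obtain m where m: "m \<in> keys Q" using Q(3) by fastforce
 \<comment> \<open>Subtracting a multiple of Q removes one monomial m of Q from P. The difference is
   still a first integral times Q, and the claim becomes that it is zero.\<close>
 define R where "R = P - Const (lookup P m / lookup Q m) * Q"
 have R0: "lookup R m = 0" using m by (auto simp: R_def lookup_minus in_keys_iff)
 have hR: "homogeneous d R" "vars_le 2 R"
  using P Q homogeneous_mult[OF homogeneous_Const Q(1)] by (auto simp: R_def intro!: homogeneous_diff)
 have eqR: "diag_deriv l R * Q = R * diag_deriv l Q" using eq by (simp add: R_def algebra_simps)
 \<comment> \<open>Since D R * Q = R * D Q, applying D - e to both sides of the identity and
   cancelling Q moves it one step along the list. At the end Q becomes a monomial and R becomes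
   0.\<close>
 have *: "eigen_filter l es R * Q = R * eigen_filter l es Q" for es
 proof (induction es)
  case (Cons e es)
  let ?A = "eigen_filter l es R" and ?B = "eigen_filter l es Q"
  have "(diag_deriv l ?A * Q + ?A * diag_deriv l Q) * Q = (diag_deriv l R * ?B + R * diag_deriv l ?B) * Q"
   using arg_cong[OF Cons.IH, of "diag_deriv l"] by simp
  also have "\<dots> = R * diag_deriv l Q * ?B + R * diag_deriv l ?B * Q" by (simp add: algebra_simps eqR[symmetric])
  finally have "(diag_deriv l ?A * Q) * Q + (?A * Q) * diag_deriv l Q = R * diag_deriv l Q * ?B + R * diag_deriv l ?B * Q"
   by (simp add: algebra_simps)
  then have "(diag_deriv l ?A * Q) * Q = (R * diag_deriv l ?B) * Q" unfolding Cons.IH by (simp add: algebra_simps)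
  then have "diag_deriv l ?A * Q = R * diag_deriv l ?B" using Q(3) by simp
  then show ?case using Cons.IH by (simp add: eigen_filter_def algebra_simps)
 qed (simp add: eigen_filter_def)
 obtain es c where c: "c ~= 0" "eigen_filter l es Q = single m (c * lookup Q m)"
  "eigen_filter l es R = single m (c * lookup R m)"
  by (rule eigen_filter_isolate[OF l Q(1,2) hR m])
 have "R * single m (c * lookup Q m) = 0" using *[of es] c R0 by simp
 moreover have "single m (c * lookup Q m) ~= 0"
  using c(1) m by (metis in_keys_iff lookup_single_eq lookup_zero mult_eq_0_iff)
 ultimately have "R = 0" by simp
 then have "P = Const (lookup P m / lookup Q m) * Q" by (simp add: R_def)
 then show ?thesis by (rule that)
qed

subsection \<open>The triple cover\<close>

locale cube_root_of_unity =
 fixes w :: complex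
 assumes w: "w\<^sup>2 + w + 1 = 0"
begin

lemma w2: "w\<^sup>2 = - w - 1" "w * w = - w - 1"
 using w by algebra+

lemma w3: "w ^ 3 = 1"
 using w by algebra

lemma w_nz [simp]: "w ~= 0" "w ~= 1"
 using w by auto

text \<open>The norm a^2 - a b + b^2 of a + b w is positive definite. Distinctness of weights,
  nonvanishing of residues and the shape of the monomial lifts all rest on this
  independence.\<close>

lemma w_indep:
 assumes "of_int a + of_int b * w = 0" shows "a = 0" "b = 0"
proof -
 have "b = 0"
 proof (rule ccontr)
  assume b: "b ~= 0"
  have "of_int (a\<^sup>2 - a * b + b\<^sup>2) = (of_int b)\<^sup>2 * (w\<^sup>2 + w + 1) - (of_int a + of_int b * w) * (of_int b * w - of_int a + of_int b)"
   by (simp add: power2_eq_square algebra_simps)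
  also have "\<dots> = 0" using assms w by simp
  finally have z: "a\<^sup>2 - a * b + b\<^sup>2 = 0" by (metis of_int_eq_0_iff)
  have "4 * (a\<^sup>2 - a * b + b\<^sup>2) = (2 * a - b)\<^sup>2 + 3 * b\<^sup>2" by (simp add: power2_eq_square algebra_simps)
  moreover have "b\<^sup>2 > 0" using b by simp
  moreover have "(2 * a - b)\<^sup>2 \<ge> 0" by simp
  ultimately show False using z by (simp only: z)
 qed
 then show "b = 0" "a = 0" using assms by auto
qed

text \<open>The weights of a linear field tangent to the foliation with residues 1, w^2, w: the sum
  of weight times residue is 1 + w^4 + w^2 = 0. Together with the Euler field it spans the kernel at
  points of the torus.\<close>

definition lam :: "nat => complex" where "lam = vec3 1 (w\<^sup>2) w"

lemma lam_simps [simp]: "lam 0 = 1" "lam (Suc 0) = w\<^sup>2" "lam 2 = w"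
 by (simp_all add: lam_def)

lemma weights_distinct_lam: "weights_distinct lam"
 unfolding weights_distinct_def
proof (intro allI impI)
 fix m m' :: "nat \<Rightarrow>\<^sub>0 nat"
 assume k: "keys m \<subseteq> {..2}" "keys m' \<subseteq> {..2}" and t: "tdeg m = tdeg m'" and wt: "weight lam m = weight lam m'"
 define n where "n = (%i. int (lookup m i) - int (lookup m' i))"
 have "tdeg m = (\<Sum>i\<le>2. lookup m i)" "tdeg m' = (\<Sum>i\<le>2. lookup m' i)"
  using tdeg_superset k by auto
 then have s: "n 0 + n 1 + n 2 = 0" using t by (simp add: n_def atMost_2)
 have "of_int (n 0 - n 1) + of_int (n 2 - n 1) * w = weight lam m - weight lam m'"
  by (simp add: weight_def atMost_2 n_def w2 algebra_simps)
 then have "of_int (n 0 - n 1) + of_int (n 2 - n 1) * w = 0" using wt by simp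
 then have "n 0 - n 1 = 0" "n 2 - n 1 = 0" by (rule w_indep)+
 then have n: "n 0 = 0" "n 1 = 0" "n 2 = 0" using s by auto
 show "m = m'"
 proof (rule poly_mapping_eqI)
  fix i
  show "lookup m i = lookup m' i"
  proof (cases "i \<le> 2")
   case True
   then show ?thesis using cases_le2[OF True] n by (auto simp: n_def)
  next
   case False
   then have "i \<notin> keys m" "i \<notin> keys m'" using k by auto
   then show ?thesis by (simp add: in_keys_iff)
  qed
 qed
qed

definition pa :: mpoly where "pa = Var 0 + Var 1 + Var 2"
definition pb :: mpoly where "pb = Var 0 + Const (w\<^sup>2) * Var 1 + Const w * Var 2"
definition pc :: mpoly where "pc = Var 0 + Const w * Var 1 + Const (w\<^sup>2) * Var 2"

definition cov :: "nat => mpoly" where "cov = vec3 (pa\<^sup>2 * pb) (pb\<^sup>2 * pc) (pc\<^sup>2 * pa)"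

lemma cov_simps [simp]:
 "cov 0 = pa\<^sup>2 * pb" "cov (Suc 0) = pb\<^sup>2 * pc" "cov 2 = pc\<^sup>2 * pa" "2 < i ==> cov i = 0"
 by (simp_all add: cov_def)

lemma vars_le_abc [simp]: "vars_le 2 pa" "vars_le 2 pb" "vars_le 2 pc"
 by (simp_all add: pa_def pb_def pc_def)

lemma vars_le_cov [simp]: "vars_le 2 (cov i)"
proof (cases "i \<le> 2")
 case True
 then show ?thesis using cases_le2[OF True] by (elim disjE) simp_all
qed simp

lemma homogeneous_abc [simp]: "homogeneous (Suc 0) pa" "homogeneous (Suc 0) pb" "homogeneous (Suc 0) pc"
 unfolding pa_def pb_def pc_def
 using homogeneous_mult[OF homogeneous_Const homogeneous_Var] by (auto intro!: homogeneous_add)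

lemma form_tuple_cov: "form_tuple 3 cov"
proof -
 have "homogeneous (2 * Suc 0 + Suc 0) (cov i)" for i
 proof (cases "i \<le> 2")
  case True
  then show ?thesis using cases_le2[OF True]
   by (elim disjE) (simp_all only: cov_simps One_nat_def homogeneous_mult homogeneous_power homogeneous_abc)
 qed simp
 then show ?thesis by (simp add: form_tuple_def numeral_3_eq_3)
qed

lemma peval_abc: "peval q pa = q 0 + q 1 + q 2" "peval q pb = q 0 + w\<^sup>2 * q 1 + w * q 2" "peval q pc = q 0 + w * q 1 + w\<^sup>2 * q 2"
 by (simp_all add: pa_def pb_def pc_def)

lemma dir_abc: "dir_deriv q v pa = v 0 + v 1 + v 2" "dir_deriv q v pb = v 0 + w\<^sup>2 * v 1 + w * v 2" "dir_deriv q v pc = v 0 + w * v 1 + w\<^sup>2 * v 2"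
 by (simp_all add: pa_def pb_def pc_def)

text \<open>Multiplying the coefficients by 1, w^2, w shifts the three characters cyclically. This
  is why the push-forward of the linear field by the cover, multiplied by abc, is quadratic.\<close>

lemma diag_abc: "diag_deriv lam pa = pb" "diag_deriv lam pb = pc" "diag_deriv lam pc = pa"
proof -
 have w4: "w ^ 4 = w" "w\<^sup>2 * w\<^sup>2 = w" "w * w\<^sup>2 = 1" "w\<^sup>2 * w = 1" using w by algebra+
 show "diag_deriv lam pa = pb" "diag_deriv lam pb = pc" "diag_deriv lam pc = pa"
  by (simp_all add: pa_def pb_def pc_def diag_deriv_Var flip: mult.assoc Const_mult)
   (simp_all add: w4 power2_eq_square[of w, symmetric] flip: power2_eq_square)
qed

lemma evals_cov: "evals cov q = vec3 ((peval q pa)\<^sup>2 * peval q pb) ((peval q pb)\<^sup>2 * peval q pc) ((peval q pc)\<^sup>2 * peval q pa)"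
 by (rule vec3_eqI) (simp_all add: evals_def)

text \<open>The classical factorisation of a^3 + b^3 + c^3 - 3abc; its linear factors are 3 q_0, 3
  q_1 and 3 q_2.\<close>

lemma cube_factor: "peval q pa ^ 3 + peval q pb ^ 3 + peval q pc ^ 3 - 3 * peval q pa * peval q pb * peval q pc = 27 * q 0 * q 1 * q 2"
 unfolding peval_abc using w by algebra

lemma cubic_cov: "peval (evals cov q) cubic = 27 * (peval q pa * peval q pb * peval q pc)\<^sup>2 * (q 0 * q 1 * q 2)"
proof -
 let ?a = "peval q pa" and ?b = "peval q pb" and ?c = "peval q pc"
 have "peval (evals cov q) cubic = (?a * ?b * ?c)\<^sup>2 * (?a ^ 3 + ?b ^ 3 + ?c ^ 3 - 3 * ?a * ?b * ?c)"
  unfolding peval_cubic evals_cov by simp algebra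
 then show ?thesis unfolding cube_factor by simp
qed

definition eta :: "(nat => complex) => (nat => complex) => complex" where
 "eta q v = q 1 * q 2 * v 0 + w\<^sup>2 * q 0 * q 2 * v 1 + w * q 0 * q 1 * v 2"

lemma Omega_cov:
 "peval (evals cov q) (Omega 0) * dir_deriv q v (cov 0) + peval (evals cov q) (Omega 1) * dir_deriv q v (cov 1) +
  peval (evals cov q) (Omega 2) * dir_deriv q v (cov 2) = - 27 * (peval q pa * peval q pb * peval q pc) ^ 3 * eta q v"
proof -
 let ?a = "peval q pa" and ?b = "peval q pb" and ?c = "peval q pc"
 let ?u = "dir_deriv q v pa" and ?v = "dir_deriv q v pb" and ?w = "dir_deriv q v pc"
 \<comment> \<open>First as an identity in a, b, c and their differentials, independent of the
   choice of the three linear forms. Only the quadratic remainder is then rewritten in the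
   coordinates q.\<close>
 have 1: "peval (evals cov q) (Omega 0) * dir_deriv q v (cov 0) + peval (evals cov q) (Omega 1) * dir_deriv q v (cov 1) +
  peval (evals cov q) (Omega 2) * dir_deriv q v (cov 2) =
  3 * (?a * ?b * ?c) ^ 3 * ((?a * ?b - ?c\<^sup>2) * ?u + (?b * ?c - ?a\<^sup>2) * ?v + (?c * ?a - ?b\<^sup>2) * ?w)"
  unfolding evals_cov One_nat_def peval_Omega by simp algebra
 have 2: "(?a * ?b - ?c\<^sup>2) * ?u + (?b * ?c - ?a\<^sup>2) * ?v + (?c * ?a - ?b\<^sup>2) * ?w = - 9 * eta q v"
  unfolding peval_abc dir_abc eta_def using w by algebra
 show ?thesis unfolding 1 2 by simp
qed

lemma eta_lam: "eta q (%i. lam i * q i) = 0" "eta q q = 0"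
 unfolding eta_def using w by (simp_all, algebra+)

lemma cube_root: obtains u where "u ^ 3 = (v::complex)"
proof -
 have "\<not> constant (poly [:- v, 0, 0, 1:])" by (simp add: constant_degree)
 then obtain u where "poly [:- v, 0, 0, 1:] u = 0" using fundamental_theorem_of_algebra by blast
 then have "u ^ 3 = v" by (simp add: power3_eq_cube mult.assoc)
 then show ?thesis by (rule that)
qed

lemma abc_inverse:
 obtains q where "!!i. 2 < i ==> q i = 0" "peval q pa = a" "peval q pb = b" "peval q pc = c"
\<comment> \<open>The inverse discrete Fourier transform of order 3.\<close>
proof (rule that[of "vec3 ((a + b + c) / 3) ((a + w * b + w\<^sup>2 * c) / 3) ((a + w\<^sup>2 * b + w * c) / 3)"])
 have "3 * ((a + b + c) / 3) = a + b + c" "3 * ((a + w * b + w\<^sup>2 * c) / 3) = a + w * b + w\<^sup>2 * c"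
  "3 * ((a + w\<^sup>2 * b + w * c) / 3) = a + w\<^sup>2 * b + w * c" by simp_all
 then have *: "3 * (x + y * ((a + w * b + w\<^sup>2 * c) / 3) + z * ((a + w\<^sup>2 * b + w * c) / 3)) = 3 * x + y * (a + w * b + w\<^sup>2 * c) + z * (a + w\<^sup>2 * b + w * c)" for x y z
  by (simp add: algebra_simps)
 have three: "3 * u = 3 * v ==> u = v" for u v :: complex by simp
 show "peval (vec3 ((a + b + c) / 3) ((a + w * b + w\<^sup>2 * c) / 3) ((a + w\<^sup>2 * b + w * c) / 3)) pa = a"
  by (rule three) (simp add: peval_abc w2 algebra_simps)
 show "peval (vec3 ((a + b + c) / 3) ((a + w * b + w\<^sup>2 * c) / 3) ((a + w\<^sup>2 * b + w * c) / 3)) pb = b"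
 proof (rule three)
  have "3 * peval (vec3 ((a + b + c) / 3) ((a + w * b + w\<^sup>2 * c) / 3) ((a + w\<^sup>2 * b + w * c) / 3)) pb =
   (a + b + c) + w\<^sup>2 * (a + w * b + w\<^sup>2 * c) + w * (a + w\<^sup>2 * b + w * c)"
   by (simp add: peval_abc distrib_left)
  also have "\<dots> = 3 * b" using w by algebra
  finally show "3 * peval (vec3 ((a + b + c) / 3) ((a + w * b + w\<^sup>2 * c) / 3) ((a + w\<^sup>2 * b + w * c) / 3)) pb = 3 * b" .
 qed
 show "peval (vec3 ((a + b + c) / 3) ((a + w * b + w\<^sup>2 * c) / 3) ((a + w\<^sup>2 * b + w * c) / 3)) pc = c"
 proof (rule three)
  have "3 * peval (vec3 ((a + b + c) / 3) ((a + w * b + w\<^sup>2 * c) / 3) ((a + w\<^sup>2 * b + w * c) / 3)) pc =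
   (a + b + c) + w * (a + w * b + w\<^sup>2 * c) + w\<^sup>2 * (a + w\<^sup>2 * b + w * c)"
   by (simp add: peval_abc distrib_left)
  also have "\<dots> = 3 * c" using w by algebra
  finally show "3 * peval (vec3 ((a + b + c) / 3) ((a + w * b + w\<^sup>2 * c) / 3) ((a + w\<^sup>2 * b + w * c) / 3)) pc = 3 * c" .
 qed
qed simp

lemma cov_surj:
 assumes "x ~= 0" "y ~= 0" "z ~= 0"
 obtains q where "!!i. 2 < i ==> q i = 0" "evals cov q = vec3 x y z" "peval q pa ~= 0" "peval q pb ~= 0" "peval q pc ~= 0"
proof -
 \<comment> \<open>With k = a and u = b/a the equations a^2 b = x, b^2 c = y, c^2 a = z become c/a =
   y/(x u), u^3 = y^2/(x z) and k^3 = x/u.\<close>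
 obtain u where u: "u ^ 3 = y\<^sup>2 / (x * z)" by (rule cube_root)
 obtain k where k: "k ^ 3 = x / u" by (rule cube_root)
 have u0: "u ~= 0" using u assms by auto
 have k0: "k ~= 0" using k u0 assms by auto
 obtain q where q: "!!i. 2 < i ==> q i = 0" "peval q pa = k" "peval q pb = k * u" "peval q pc = k * (y / (x * u))"
  using abc_inverse[of k "k * u" "k * (y / (x * u))"] by metis
 have ux: "u ^ 3 * (x * z) = y\<^sup>2" using u assms by simp
 have "k\<^sup>2 * (k * u) = x" using k u0 by (simp add: power2_eq_square power3_eq_cube field_simps)
 moreover have "(k * u)\<^sup>2 * (k * (y / (x * u))) = y"
 proof -
  have "(k * u)\<^sup>2 * (k * (y / (x * u))) = k ^ 3 * u * y / x" using u0 assms by (simp add: power2_eq_square power3_eq_cube field_simps)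
  then show ?thesis using k u0 assms by simp
 qed
 moreover have "(k * (y / (x * u)))\<^sup>2 * k = z"
 proof -
  have "(k * (y / (x * u)))\<^sup>2 * k = k ^ 3 * y\<^sup>2 / (x\<^sup>2 * u\<^sup>2)"
   by (simp add: power2_eq_square power3_eq_cube mult.commute mult.left_commute)
  also have "\<dots> = y\<^sup>2 / (x * u ^ 3)" unfolding k using assms u0 by (simp add: power2_eq_square power3_eq_cube)
  also have "\<dots> = z" using ux assms u0 by (simp add: divide_eq_eq mult.assoc mult.commute mult.left_commute)
  finally show ?thesis .
 qed
 ultimately have "evals cov q = vec3 x y z" by (simp add: evals_cov q)
 then show ?thesis using that[OF q(1)] q u0 k0 assms by auto
qed

text \<open>The foliation is also given by a Lotka-Volterra vector field, the push-forward of the linear one rescaled by \<^term>\<open>pa * pb * pc\<close>.\<close>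

definition lotka :: "mpoly => mpoly" where
 "lotka f = Var 0 * (2 * Var 1 + Var 2) * pderiv_wrt 0 f + Var 1 * (2 * Var 2 + Var 0) * pderiv_wrt 1 f + Var 2 * (2 * Var 0 + Var 1) * pderiv_wrt 2 f"

lemma vars_le_lotka: "vars_le 2 f ==> vars_le 2 (lotka f)"
 by (simp add: lotka_def)

lemma lotka_cov: "vars_le 2 f ==> pa * pb * pc * diag_deriv lam (psubst cov f) = psubst cov (lotka f)"
proof -
 assume f: "vars_le 2 f"
 have d: "pa * pb * pc * diag_deriv lam (cov 0) = cov 0 * (2 * cov 1 + cov 2)"
  "pa * pb * pc * diag_deriv lam (cov 1) = cov 1 * (2 * cov 2 + cov 0)"
  "pa * pb * pc * diag_deriv lam (cov 2) = cov 2 * (2 * cov 0 + cov 1)"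
  by (simp_all add: power2_eq_square diag_abc algebra_simps)
 have "pa * pb * pc * diag_deriv lam (psubst cov f) = psubst cov (pderiv_wrt 0 f) * (pa * pb * pc * diag_deriv lam (cov 0)) +
   psubst cov (pderiv_wrt 1 f) * (pa * pb * pc * diag_deriv lam (cov 1)) + psubst cov (pderiv_wrt 2 f) * (pa * pb * pc * diag_deriv lam (cov 2))"
  unfolding diag_deriv_psubst3[OF f vars_le_cov] by (simp only: distrib_left mult.assoc mult.commute mult.left_commute)
 also have "\<dots> = psubst cov (lotka f)"
  unfolding lotka_def d by (simp add: mult.commute mult.left_commute del: cov_simps)
 finally show ?thesis .
qed

section \<open>Completeness of the list of invariant curves\<close>

lemma psubst_cov_eq_0:
 assumes "vars_le 2 f" "psubst cov f = 0" shows "f = 0"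
proof -
 have "Var 0 * Var 1 * Var 2 * f = 0"
 proof (rule mpoly3_eq_0I)
  show "vars_le 2 (Var 0 * Var 1 * Var 2 * f)" using assms by simp
  fix p
  show "peval p (Var 0 * Var 1 * Var 2 * f) = 0"
  proof (cases "p 0 = 0 \<or> p 1 = 0 \<or> p 2 = 0")
   case False
   then obtain q where q: "evals cov q = vec3 (p 0) (p 1) (p 2)" using cov_surj[of "p 0" "p 1" "p 2"] by blast
   have "peval q (psubst cov f) = 0" using assms by simp
   then have "peval (evals cov q) f = 0" unfolding peval_comp .
   then have "peval (trunc3 p) f = 0" by (simp add: q trunc3_vec3)
   then show ?thesis using assms by (simp add: peval_trunc3)
  qed auto
 qed
 then show ?thesis by simp
qed

text \<open>Invariance is known only after multiplication by g, which will be abc. Each application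
  of D costs one more power of g, but never leaves the ideal of f after inverting g.\<close>

lemma eigen_filter_ideal:
 assumes "g * diag_deriv lam f = f * h"
 shows "\<exists>n k. g ^ n * eigen_filter lam es f = f * k"
proof (induction es)
 case Nil
 show ?case by (intro exI[of _ 0] exI[of _ 1]) (simp add: eigen_filter_def)
next
 case (Cons e es)
 then obtain n k where nk: "g ^ n * eigen_filter lam es f = f * k" by blast
 let ?P = "eigen_filter lam es f"
 have step: "eigen_filter lam (e # es) f = diag_deriv lam ?P - Const e * ?P" by (simp add: eigen_filter_def)
 have "diag_deriv lam (g ^ Suc n * ?P) = diag_deriv lam (g * f * k)" using nk by (simp add: mult.assoc)
 then have "of_nat (Suc n) * g ^ n * diag_deriv lam g * ?P + g ^ Suc n * diag_deriv lam ?P = diag_deriv lam g * f * k + g * diag_deriv lam f * k + g * f * diag_deriv lam k"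
  by (simp add: diag_deriv_power del: power_Suc of_nat_Suc) (simp add: algebra_simps)
 then have "g ^ Suc n * diag_deriv lam ?P = diag_deriv lam g * f * k + f * h * k + g * f * diag_deriv lam k - of_nat (Suc n) * diag_deriv lam g * (g ^ n * ?P)"
  unfolding assms by (simp add: algebra_simps)
 also have "\<dots> = f * (diag_deriv lam g * k + h * k + g * diag_deriv lam k - of_nat (Suc n) * diag_deriv lam g * k)"
  unfolding nk by (simp add: algebra_simps)
 finally have "g ^ Suc n * eigen_filter lam (e # es) f = f * (diag_deriv lam g * k + h * k + g * diag_deriv lam k - of_nat (Suc n) * diag_deriv lam g * k - Const e * g * k)"
  unfolding step using nk by (simp add: algebra_simps)
 then show ?case by blast
qed

text \<open>At a zero on the torus all iterates of the linear vector field vanish along an invariant form, hence so does each of its monomials.\<close>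

lemma invariant_form_no_torus_zero:
 assumes f: "homogeneous d f" "vars_le 2 f" "f ~= 0" and inv: "g * diag_deriv lam f = f * h"
  and q: "peval q f = 0" "peval q g ~= 0" shows "q 0 * q 1 * q 2 = 0"
proof (rule ccontr)
 assume q0: "q 0 * q 1 * q 2 ~= 0"
 obtain m where m: "m \<in> keys f" using f(3) by fastforce
 obtain es c where c: "c ~= 0" "eigen_filter lam es f = single m (c * lookup f m)"
  by (rule eigen_filter_isolate[OF weights_distinct_lam f(1,2) f(1,2) m])
 obtain n k where "g ^ n * eigen_filter lam es f = f * k" using eigen_filter_ideal[OF inv] by blast
 then have "peval q (g ^ n * eigen_filter lam es f) = 0" using q(1) by simp
 then have "c * lookup f m * mon q m = 0" using q(2) by (simp add: c insertion_single)
 then have "mon q m = 0" using c(1) m by (simp add: in_keys_iff)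
 then obtain i where "i \<in> keys m" "q i = 0" by (auto simp: mon_def)
 moreover have "i \<le> 2" using \<open>i \<in> keys m\<close> m f(2) by (auto simp: vars_le_def pvars_def)
 ultimately show False using q0 cases_le2[of i] by auto
qed

lemma invariant_curves:
 assumes C: "irreducible_plane_curve C" "invariant_curve J_fol C" shows "C \<in> J_curves"
proof -
 obtain d f where f: "curve_form d f" "C = plane_curve f" using C(1) by (auto simp: irreducible_plane_curve_def)
 have fi: "irreducible f" "vars_le 2 f" "homogeneous d f" using f by (auto simp: curve_form_def vars_le_def)
 have d: "0 < d" by (rule irreducible_homogeneous_degree[OF fi(3,1)])
 have par: "\<forall>p\<in>plane_curve f. peval p (Omega 0) * grad f p 1 = peval p (Omega 1) * grad f p 0 \<and>
   peval p (Omega 0) * grad f p 2 = peval p (Omega 2) * grad f p 0 \<and> peval p (Omega 1) * grad f p 2 = peval p (Omega 2) * grad f p 1"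
  using C(2) invariant_curve_iff[OF f(1), of Omega] by (simp add: f(2) J_fol_def)
 have "peval p (lotka f) = 0" if p: "p \<in> plane_curve f" for p
 proof -
  have f0: "peval p f = 0" "p \<in> P2" using p by (auto simp: mem_plane_curve)
  have E: "p 0 * grad f p 0 + p 1 * grad f p 1 + p 2 * grad f p 2 = 0"
   using dir_deriv_Euler[OF fi(3), of p] f0 by (simp add: dir_deriv_grad[OF fi(2)] mult.commute)
  let ?V0 = "p 0 * (2 * p 1 + p 2)" and ?V1 = "p 1 * (2 * p 2 + p 0)" and ?V2 = "p 2 * (2 * p 0 + p 1)"
  let ?g = "grad f p"
  have e: "peval p (lotka f) = ?V0 * ?g 0 + ?V1 * ?g 1 + ?V2 * ?g 2"
   by (simp add: lotka_def grad_def)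
  \<comment> \<open>\<open>Omega\<close> is the cross product of the position vector with the
    Lotka-Volterra field. Hence proportionality of \<open>Omega\<close> to the gradient and Euler's
    relation make the derivative of f along the field vanish on the curve.\<close>
  have o: "peval p (Omega 0) = p 1 * ?V2 - p 2 * ?V1" "peval p (Omega (Suc 0)) = p 2 * ?V0 - p 0 * ?V2" "peval p (Omega 2) = p 0 * ?V1 - p 1 * ?V0"
   unfolding peval_Omega by (simp_all add: algebra_simps)
  have P: "peval p (Omega 0) * ?g 1 = peval p (Omega (Suc 0)) * ?g 0" "peval p (Omega 0) * ?g 2 = peval p (Omega 2) * ?g 0"
   "peval p (Omega (Suc 0)) * ?g 2 = peval p (Omega 2) * ?g 1" using par p by auto
  have "p 0 * peval p (lotka f) = 0" "p 1 * peval p (lotka f) = 0" "p 2 * peval p (lotka f) = 0"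
   using P E unfolding o e by algebra+
  then show ?thesis using vec3_nz_P2[OF f0(2)] by auto
 qed
 moreover have "homogeneous (d + 1) (lotka f)"
 proof -
  have pd: "homogeneous (d - 1) (pderiv_wrt i f)" for i
   unfolding homogeneous_def
  proof
   fix m assume "m \<in> keys (pderiv_wrt i f)"
   then obtain k where k: "k \<in> keys f" "m = k - single i 1" "lookup k i ~= 0"
    unfolding pderiv_wrt_def using keys_sum by (force split: if_splits)
   have "k = m + single i 1"
    using k(3) by (intro poly_mapping_eqI) (auto simp: k(2) lookup_add lookup_minus lookup_single when_def)
   then have "tdeg k = tdeg m + 1" by simp
   then show "tdeg m = d - 1" using k(1) fi(3) by (auto simp: homogeneous_def)
  qed
  have l: "homogeneous (Suc 0) (2 * Var i + Var j)" for i j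
   using homogeneous_mult[OF homogeneous_numeral homogeneous_Var, of "num.Bit0 num.One" i] by (auto intro!: homogeneous_add)
  have "homogeneous (Suc 0 + Suc 0 + (d - 1)) (Var i * (2 * Var j + Var k) * pderiv_wrt i f)" for i j k
   by (intro homogeneous_mult l pd) auto
  then show ?thesis using d unfolding lotka_def by (intro homogeneous_add) (auto simp: Suc_diff_Suc)
 qed
 ultimately have "f dvd psubst (trunc3 Var) (lotka f)" using plane_curve_dvd[OF f(1)] by blast
 then have "f dvd lotka f" using vars_le_lotka[OF fi(2)] by simp
 then obtain g where g: "lotka f = f * g" by (elim dvdE)
 have fh: "homogeneous (d * 3) (psubst cov f)" "vars_le 2 (psubst cov f)" "psubst cov f ~= 0"
  using homogeneous_comp[OF fi(3) form_tuple_cov] psubst_cov_eq_0[OF fi(2)] fi(1) by (auto intro: vars_le_psubst)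
 have inv: "pa * pb * pc * diag_deriv lam (psubst cov f) = psubst cov f * psubst cov g"
  unfolding lotka_cov[OF fi(2)] g by simp
 \<comment> \<open>A zero of f off the coordinate lines lifts to a zero with abc nonzero, which
   cannot lie on the torus; it lies on the triangle and so comes from a point of the cubic. The
   curve is therefore contained in the union of the four known ones.\<close>
 have "f dvd Var 0 * (Var 1 * (Var 2 * cubic))"
 proof (rule mpoly3_nullstellensatz[OF fi(1,2)])
  fix p assume p: "peval p f = 0"
  show "peval p (Var 0 * (Var 1 * (Var 2 * cubic))) = 0"
  proof (cases "p 0 = 0 \<or> p 1 = 0 \<or> p 2 = 0")
   case False
   then obtain q where q: "evals cov q = vec3 (p 0) (p 1) (p 2)" "peval q pa ~= 0" "peval q pb ~= 0" "peval q pc ~= 0"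
    using cov_surj[of "p 0" "p 1" "p 2"] by metis
   have "peval q (psubst cov f) = 0"
    unfolding peval_comp q(1) using p peval_trunc3[OF fi(2), of p] by (simp add: trunc3_vec3)
   then have "q 0 * q 1 * q 2 = 0"
    by (rule invariant_form_no_torus_zero[OF fh inv]) (use q in simp)
   then have "peval (evals cov q) cubic = 0" unfolding cubic_cov by simp
   then have "peval p cubic = 0" using peval_trunc3[OF vars_le_cubic, of p] by (simp add: q(1) trunc3_vec3)
   then show ?thesis by simp
  qed auto
 qed simp
 then have "f dvd Var 0 \<or> f dvd Var 1 \<or> f dvd Var 2 \<or> f dvd cubic"
  by (metis (no_types, lifting) mpoly3_prime[OF fi(1,2)] vars_le_cubic vars_le_mult vars_le_simps(5) le0 one_le_numeral order_refl)
 then obtain h where h: "f dvd h" "irreducible h" "plane_curve h \<in> J_curves"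
  using irreducible_Var irreducible_cubic by (auto simp: J_curves_def)
 have "h dvd f" by (rule dvd_irreducible[OF h(2) fi(1) h(1)])
 then have "plane_curve f = plane_curve h"
  using h(1) by (auto simp: plane_curve_def elim: dvd_peval_zero)
 then show ?thesis using h(3) f(2) by simp
qed

end

subsection \<open>Logarithmic derivatives and invariant factors\<close>

text \<open>If the residues \<^term>\<open>e0 * n0 + e1 * n1 + e2 * n2\<close> along a prime cannot cancel, the equation
 forces every prime factor to be invariant under the derivation.\<close>

lemma invariant_prime_factor:
 fixes D :: "'a::{factorial_ring_gcd, semiring_gcd_mult_normalize} => 'a"
 assumes D: "!!x y. D (x * y) = D x * y + x * D y"
  and nz: "y0 ~= 0" "y1 ~= 0" "y2 ~= 0" and cop: "gcd y0 (gcd y1 y2) = 1"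
  and eq: "e0 * (y1 * y2 * D y0) + e1 * (y0 * y2 * D y1) + e2 * (y0 * y1 * D y2) = 0"
  and res: "!!n0 n1 n2. \<not> (n0 = n1 \<and> n1 = n2) ==> (e0 * of_nat n0 + e1 * of_nat n1 + e2 * of_nat n2) dvd 1"
  and P: "prime P" "P dvd y0 \<or> P dvd y1 \<or> P dvd y2"
 shows "P dvd D P"
proof -
 have "D 1 = D 1 + D 1" using D[of 1 1] by (simp only: mult_1_left mult_1_right)
 then have D1: "D 1 = 0" by (metis add_cancel_right_right)
 have pw: "P * D (P ^ m) = of_nat m * P ^ m * D P" for m
 proof (induction m)
  case (Suc m)
  have "P * D (P ^ Suc m) = P * (D P * P ^ m) + P * (P * D (P ^ m))" by (simp add: D distrib_left)
  then show ?case unfolding Suc.IH by (simp add: algebra_simps)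
 qed (simp add: D1)
 have dec: "\<exists>m z. y = P ^ m * z \<and> \<not> P dvd z \<and> (P dvd y \<longleftrightarrow> m > 0) \<and> P * D y = P ^ m * (of_nat m * D P * z + P * D z)" if ynz: "y ~= 0" for y
 proof -
  have "\<not> is_unit P" using P(1) by auto
  from multiplicity_decompose'[OF ynz this]
  obtain z where z: "y = P ^ multiplicity P y * z" "\<not> P dvd z" by blast
  let ?m = "multiplicity P y"
  have "P * D y = P * D (P ^ ?m) * z + P ^ ?m * (P * D z)" by (subst z(1), subst D) (simp add: algebra_simps)
  then have "P * D y = P ^ ?m * (of_nat ?m * D P * z + P * D z)" unfolding pw by (simp add: algebra_simps)
  moreover have "P dvd y \<longleftrightarrow> ?m > 0" using z by (metis dvd_mult2 dvd_power gr0I mult_1 power_0)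
  ultimately show ?thesis using z by (intro exI[of _ ?m] exI[of _ z]) simp
 qed
 obtain m0 z0 where 0: "y0 = P ^ m0 * z0" "\<not> P dvd z0" "P dvd y0 \<longleftrightarrow> m0 > 0" "P * D y0 = P ^ m0 * (of_nat m0 * D P * z0 + P * D z0)" using dec[OF nz(1)] by blast
 obtain m1 z1 where 1: "y1 = P ^ m1 * z1" "\<not> P dvd z1" "P dvd y1 \<longleftrightarrow> m1 > 0" "P * D y1 = P ^ m1 * (of_nat m1 * D P * z1 + P * D z1)" using dec[OF nz(2)] by blast
 obtain m2 z2 where 2: "y2 = P ^ m2 * z2" "\<not> P dvd z2" "P dvd y2 \<longleftrightarrow> m2 > 0" "P * D y2 = P ^ m2 * (of_nat m2 * D P * z2 + P * D z2)" using dec[OF nz(3)] by blast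
 define E where "E = e0 * of_nat m0 + e1 * of_nat m1 + e2 * of_nat m2"
 define W where "W = e0 * z1 * z2 * D z0 + e1 * z0 * z2 * D z1 + e2 * z0 * z1 * D z2"
 \<comment> \<open>The equation multiplied by P, with the powers of P extracted. Modulo P only D P
   times the residue E survives, and E is a unit because the three multiplicities are not all
   equal.\<close>
 have "P ^ (m0 + m1 + m2) * (D P * z0 * z1 * z2 * E + P * W) =
   e0 * (y1 * y2 * (P * D y0)) + e1 * (y0 * y2 * (P * D y1)) + e2 * (y0 * y1 * (P * D y2))"
  unfolding 0(4) 1(4) 2(4) unfolding 0(1) 1(1) 2(1) by (simp add: E_def W_def power_add algebra_simps)
 also have "\<dots> = P * (e0 * (y1 * y2 * D y0) + e1 * (y0 * y2 * D y1) + e2 * (y0 * y1 * D y2))" by (simp add: algebra_simps)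
 also have "\<dots> = 0" using eq by simp
 finally have "D P * z0 * z1 * z2 * E + P * W = 0" using P(1) by auto
 then have "D P * z0 * z1 * z2 * E = P * (- W)" by (simp add: eq_neg_iff_add_eq_0)
 then have d: "P dvd D P * z0 * z1 * z2 * E" by simp
 have "\<not> (m0 = m1 \<and> m1 = m2)"
 proof
  assume "m0 = m1 \<and> m1 = m2"
  then have "P dvd gcd y0 (gcd y1 y2)" using P(2) 0(3) 1(3) 2(3) by simp
  then show False using cop P(1) by auto
 qed
 then have "E dvd 1" unfolding E_def by (rule res)
 then have "\<not> P dvd E" using P(1) not_prime_unit dvd_trans by blast
 then show ?thesis using d 0(2) 1(2) 2(2) P(1) by (simp add: prime_dvd_mult_iff)
qed

lemma dvd_derivI:
 fixes D :: "'a::{factorial_ring_gcd, semiring_gcd_mult_normalize} => 'a"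
 assumes D: "!!x y. D (x * y) = D x * y + x * D y" and P: "!!P. prime P ==> P dvd y ==> P dvd D P"
 shows "y dvd D y"
 using P
proof (induction y rule: prime_divisors_induct)
 case zero
 have "D 0 = 0" using D[of 0 0] by simp
 then show ?case by simp
next
 case (unit x)
 then show ?case by (metis unit_imp_dvd)
next
 case (factor p x)
 have "x dvd D x" by (rule factor.IH) (use factor.prems in auto)
 moreover have "p dvd D p" by (rule factor.prems) (use factor.hyps in auto)
 ultimately show ?case by (simp add: D mult_dvd_mono dvd_add)
qed

text \<open>A diagonal derivation does not raise the total degree, so the cofactor has degree
  0.\<close>

lemma diag_deriv_eigen:
 assumes "vars_le 2 Y" "Y ~= 0" "Y dvd diag_deriv l Y" obtains c where "diag_deriv l Y = Const c * Y"
proof (cases "diag_deriv l Y = 0")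
 case True
 then show ?thesis using that[of 0] by simp
next
 case False
 obtain h where h: "diag_deriv l Y = Y * h" using assms(3) by (elim dvdE)
 have "degree (grade_poly (diag_deriv l Y)) \<le> degree (grade_poly Y)"
 proof (rule degree_le, intro allI impI)
  fix n assume n: "degree (grade_poly Y) < n"
  show "coeff (grade_poly (diag_deriv l Y)) n = 0"
  proof (rule poly_mapping_eqI)
   fix m
   have "lookup (coeff (grade_poly Y) n) m = 0" using n by (simp add: coeff_eq_0)
   then show "lookup (coeff (grade_poly (diag_deriv l Y)) n) m = lookup 0 m"
    by (auto simp: lookup_coeff_grade_poly lookup_diag_deriv split: if_splits)
  qed
 qed
 moreover have "degree (grade_poly (diag_deriv l Y)) = degree (grade_poly Y) + degree (grade_poly h)"
  unfolding h grade_poly_hom by (rule degree_mult_eq) (use False h in auto)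
 ultimately have "degree (grade_poly h) = 0" by simp
 then obtain h0 where "grade_poly h = [:h0:]" by (metis degree_eq_zeroE)
 then have "grade_poly h = monom h 0" using poly_grade_poly_1[of h] by (simp add: monom_0)
 then obtain c where "h = Const c" using homogeneous_iff_grade_poly homogeneous_0_iff by blast
 then show ?thesis using that[of c] h by (simp add: mult.commute)
qed

text \<open>For s = w^2 and t = w the factor 1 + s + t is zero: since the residues sum to zero, a
  common factor of the components does not affect the logarithmic form.\<close>

lemma eta_scale_identity:
 fixes g dg x0 x1 x2 d0 d1 d2 s t :: "'a::comm_ring_1"
 shows "g * x1 * (g * x2) * (dg * x0 + g * d0) + s * (g * x0 * (g * x2) * (dg * x1 + g * d1)) + t * (g * x0 * (g * x1) * (dg * x2 + g * d2)) =
  g ^ 3 * (x1 * x2 * d0 + s * (x0 * x2 * d1) + t * (x0 * x1 * d2)) + g\<^sup>2 * dg * x0 * x1 * x2 * (1 + s + t)"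
 by (simp add: power2_eq_square power3_eq_cube algebra_simps)

context cube_root_of_unity
begin

definition eta_form :: "(nat => complex) => (nat => mpoly) => mpoly" where
 "eta_form l G = G 1 * G 2 * diag_deriv l (G 0) + Const (w\<^sup>2) * (G 0 * G 2 * diag_deriv l (G 1)) + Const w * (G 0 * G 1 * diag_deriv l (G 2))"

lemma residue_unit:
 fixes n0 n1 n2 :: nat
 assumes "\<not> (n0 = n1 \<and> n1 = n2)" shows "of_nat n0 + w\<^sup>2 * of_nat n1 + w * of_nat n2 ~= 0"
proof
 assume "of_nat n0 + w\<^sup>2 * of_nat n1 + w * of_nat n2 = 0"
 then have "of_int (int n0 - int n1) + of_int (int n2 - int n1) * w = 0" unfolding w2 by (simp add: algebra_simps)
 then have "int n0 - int n1 = 0" "int n2 - int n1 = 0" by (rule w_indep)+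
 then show False using assms by simp
qed

text \<open>The eigenvalue of the Euler field fixes the degree, and within one degree the weights
  for \<open>lam\<close> are distinct. Only one monomial can occur.\<close>

lemma single_monomialI:
 assumes "vars_le 2 Y" "Y ~= 0" "diag_deriv lam Y = Const c * Y" "diag_deriv (%_. 1) Y = Const d * Y"
 obtains m k where "Y = single m k" "k ~= 0" "keys m \<subseteq> {..2}"
proof -
 have wt: "weight lam m = c" "weight (%_. 1) m = d" "keys m \<subseteq> {..2}" if m: "m \<in> keys Y" for m
 proof -
  have "weight lam m * lookup Y m = c * lookup Y m" "weight (%_. 1) m * lookup Y m = d * lookup Y m"
   using assms(3,4) by (simp_all flip: lookup_diag_deriv)
  then show "weight lam m = c" "weight (%_. 1) m = d" using m by (simp_all add: in_keys_iff)
  show "keys m \<subseteq> {..2}" using m assms(1) by (auto simp: vars_le_def pvars_def)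
 qed
 obtain m where m: "m \<in> keys Y" using assms(2) by fastforce
 have "k = m" if k: "k \<in> keys Y" for k
 proof -
  have "(of_nat (tdeg k) :: complex) = of_nat (tdeg m)"
   using wt(2)[OF k] wt(2)[OF m] tdeg_superset[OF _ wt(3)[OF k]] tdeg_superset[OF _ wt(3)[OF m]] by (simp add: weight_def)
  then have "tdeg k = tdeg m" by simp
  then show ?thesis using weights_distinct_lam wt[OF k] wt[OF m] unfolding weights_distinct_def by simp
 qed
 then have keys: "keys Y = {m}" using m by blast
 have "Y = single m (lookup Y m)"
  using mpoly_sum_single[of Y] unfolding keys by (simp only: sum.insert[OF finite.emptyI] empty_iff not_False_eq_True sum.empty add_0_right)
 then show ?thesis using that[of m "lookup Y m"] m wt(3)[OF m] by (simp add: in_keys_iff)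
qed

lemma eta_form_scale: "eta_form l (%i. g * G i) = g ^ 3 * eta_form l G"
proof -
 have "1 + w\<^sup>2 + w = 0" using w by algebra
 then have "Const (1 + w\<^sup>2 + w) = 0" by (simp only: Const_0)
 then have e: "1 + Const (w\<^sup>2) + Const w = 0" by (simp only: Const_add Const_1)
 have "eta_form l (%i. g * G i) = g ^ 3 * eta_form l G + g\<^sup>2 * diag_deriv l g * G 0 * G 1 * G 2 * (1 + Const (w\<^sup>2) + Const w)"
  unfolding eta_form_def diag_deriv_simps by (rule eta_scale_identity)
 then show ?thesis unfolding e by simp
qed

text \<open>Divide the components by their gcd. A prime dividing one of them is then a pole of the
  pulled-back logarithmic form with residue n0 + w^2 n1 + w n2, which is nonzero as the
  multiplicities are not all equal; so the prime is invariant under both diagonal fields. The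
  components become common eigenvectors, that is monomials, and the equations turn into relations
  between their exponents.\<close>

lemma monomial_map:
 assumes G: "!!i. vars_le 2 (G i)" "G 0 ~= 0" "G 1 ~= 0" "G 2 ~= 0"
  and eta: "eta_form lam G = 0" "eta_form (%_. 1) G = 0"
 obtains g m c where "g ~= 0" "vars_le 2 g" "!!i. i \<le> 2 ==> G i = g * single (m i) (c i)" "!!i. i \<le> 2 ==> c i ~= 0"
  "!!i. i \<le> 2 ==> keys (m i) \<subseteq> {..2}"
  "weight lam (m 0) + w\<^sup>2 * weight lam (m 1) + w * weight lam (m 2) = 0"
  "weight (%_. 1) (m 0) + w\<^sup>2 * weight (%_. 1) (m 1) + w * weight (%_. 1) (m 2) = 0"
proof -
 define x where "x = (%i. to_poly3 (G i))"
 define g where "g = gcd (x 0) (gcd (x 1) (x 2))"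
 have x0: "x i ~= 0" if "i \<le> 2" for i
  using cases_le2[OF that] G by (elim disjE) (auto simp: x_def dest!: arg_cong[where f = of_poly3])
 have g0: "g ~= 0" using x0[of 0] by (simp add: g_def)
 define y where "y = (%i. x i div g)"
 have gd: "g dvd x i" if "i \<le> 2" for i using cases_le2[OF that] by (elim disjE) (auto simp: g_def intro: dvd_trans)
 have xy: "x i = g * y i" if "i \<le> 2" for i using gd[OF that] by (simp add: y_def)
 have y0: "y i ~= 0" if "i \<le> 2" for i using xy[OF that] x0[OF that] by auto
 have cop: "gcd (y 0) (gcd (y 1) (y 2)) = 1"
 proof -
  have "gcd (x 0) (gcd (x 1) (x 2)) = gcd (g * y 0) (gcd (g * y 1) (g * y 2))" by (simp add: xy)
  also have "\<dots> = gcd (g * y 0) (g * gcd (y 1) (y 2))"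
  proof -
   have ng: "normalize g = g" by (simp add: g_def)
   have "gcd (g * y 1) (g * y 2) = normalize (g * gcd (y 1) (y 2))" by (rule gcd_mult_left)
   then show ?thesis by simp
  qed
  also have "\<dots> = normalize (g * gcd (y 0) (gcd (y 1) (y 2)))" by (rule gcd_mult_left)
  finally have "normalize (g * gcd (y 0) (gcd (y 1) (y 2))) = normalize (g * 1)" by (simp add: g_def)
  then have "g * gcd (y 0) (gcd (y 1) (y 2)) dvd g * 1" by (metis associatedD1)
  then have "gcd (y 0) (gcd (y 1) (y 2)) dvd 1" using g0 by (simp only: dvd_mult_cancel_left) blast
  then show ?thesis by (metis is_unit_gcd_iff is_unit_normalize normalize_gcd)
 qed
 define Y where "Y = (%i. of_poly3 (y i))"
 have GY: "G i = of_poly3 g * Y i" if "i \<le> 2" for i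
  using xy[OF that] G(1)[of i] by (metis Y_def of_poly3_hom(4) of_to_poly3 x_def)
 have Yv: "vars_le 2 (Y i)" for i by (simp add: Y_def)
 have Yt: "to_poly3 (Y i) = y i" for i by (simp add: Y_def)
 have Y0: "Y i ~= 0" if "i \<le> 2" for i using y0[OF that] Yt by (metis to_poly3_hom(1))
 have etaY: "eta_form l Y = 0" if "eta_form l G = 0" for l
 proof -
  have "eta_form l G = eta_form l (%i. of_poly3 g * Y i)" unfolding eta_form_def by (simp add: GY)
  then have "of_poly3 g ^ 3 * eta_form l Y = 0" using that by (simp add: eta_form_scale)
  moreover have "of_poly3 g ~= 0" using g0 by (metis to_of_poly3 to_poly3_hom(1))
  ultimately show ?thesis by simp
 qed
 have Ydvd: "Y i dvd diag_deriv l (Y i)" if i: "i \<le> 2" and l: "eta_form l G = 0" for i l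
 proof -
  \<comment> \<open>The derivation is moved to nested polynomials, where primes and gcds are at
    hand.\<close>
  define D where "D = (%P. to_poly3 (diag_deriv l (of_poly3 P)))"
  have D: "D (P * Q) = D P * Q + P * D Q" for P Q by (simp add: D_def)
  have "const3 1 * (y 1 * y 2 * D (y 0)) + const3 (w\<^sup>2) * (y 0 * y 2 * D (y 1)) + const3 w * (y 0 * y 1 * D (y 2)) = to_poly3 (eta_form l Y)"
   by (simp add: eta_form_def D_def Y_def) (simp add: const3_def one_pCons[symmetric])
  then have eq: "const3 1 * (y 1 * y 2 * D (y 0)) + const3 (w\<^sup>2) * (y 0 * y 2 * D (y 1)) + const3 w * (y 0 * y 1 * D (y 2)) = 0"
   using etaY[OF l] by simp
  have res: "(const3 1 * of_nat n0 + const3 (w\<^sup>2) * of_nat n1 + const3 w * of_nat n2) dvd 1" if "\<not> (n0 = n1 \<and> n1 = n2)" for n0 n1 n2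
  proof -
   have "const3 1 * of_nat n0 + const3 (w\<^sup>2) * of_nat n1 + const3 w * of_nat n2 = const3 (of_nat n0 + w\<^sup>2 * of_nat n1 + w * of_nat n2)"
    by (simp add: const3_def of_nat_poly)
   moreover have "const3 k dvd 1" if "k ~= 0" for k
    by (rule dvdI[of _ _ "const3 (1 / k)"]) (use that in \<open>simp add: const3_def one_pCons\<close>)
   ultimately show ?thesis using residue_unit[OF that] by simp
  qed
  have "y i dvd D (y i)"
  proof (rule dvd_derivI[OF D])
   fix P assume "prime P" "P dvd y i"
   then show "P dvd D P"
    using invariant_prime_factor[of D "y 0" "y 1" "y 2", OF D y0 y0 y0 cop eq res] cases_le2[OF i] by auto
  qed
  then show ?thesis using to_poly3_dvdD[of "Y i" "diag_deriv l (Y i)"] Yv by (simp add: Yt D_def Y_def)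
 qed
 have "\<exists>m k. Y i = single m k \<and> k ~= 0 \<and> keys m \<subseteq> {..2}" if i: "i \<le> 2" for i
 proof -
  obtain c where "diag_deriv lam (Y i) = Const c * Y i" by (rule diag_deriv_eigen[OF Yv Y0[OF i] Ydvd[OF i eta(1)]])
  moreover obtain d where "diag_deriv (%_. 1) (Y i) = Const d * Y i" by (rule diag_deriv_eigen[OF Yv Y0[OF i] Ydvd[OF i eta(2)]])
  ultimately show ?thesis using single_monomialI[OF Yv Y0[OF i]] by metis
 qed
 then obtain m c where mc: "!!i. i \<le> 2 ==> Y i = single (m i) (c i) \<and> c i ~= 0 \<and> keys (m i) \<subseteq> {..2}" by metis
 have wt: "weight l (m 0) + w\<^sup>2 * weight l (m 1) + w * weight l (m 2) = 0" if "eta_form l G = 0" for l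
 proof -
  have dd: "diag_deriv l (Y i) = Const (weight l (m i)) * Y i" if "i \<le> 2" for i
   using mc[OF that] diag_deriv_single by metis
  have "eta_form l Y = Y 0 * Y 1 * Y 2 * (Const (weight l (m 0)) + Const (w\<^sup>2) * Const (weight l (m 1)) + Const w * Const (weight l (m 2)))"
   unfolding eta_form_def by (simp add: dd algebra_simps)
  then have "Const (weight l (m 0) + w\<^sup>2 * weight l (m 1) + w * weight l (m 2)) = 0"
   using etaY[OF that] Y0[of 0] Y0[of 1] Y0[of 2] by (simp add: Const_add Const_mult)
  then show ?thesis by simp
 qed
 show ?thesis
  by (rule that[of "of_poly3 g" m c])
   (use GY mc wt[OF eta(1)] wt[OF eta(2)] g0 in \<open>auto dest!: arg_cong[where f = to_poly3]\<close>)
qed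

end

subsection \<open>Birational symmetries in terms of forms\<close>

definition Om :: "(nat => complex) => (nat => complex) => complex" where
 "Om u x = peval u (Omega 0) * x 0 + peval u (Omega 1) * x 1 + peval u (Omega 2) * x 2"

lemma Om_explicit:
 "Om u x = u 1 * u 2 * (u 0 + u 1 - 2 * u 2) * x 0 + u 0 * u 2 * (u 1 + u 2 - 2 * u 0) * x 1 + u 0 * u 1 * (u 2 + u 0 - 2 * u 1) * x 2"
 by (simp add: Om_def peval_Omega)

lemma Om_scale: "Om (%i. c * u i) (%i. d * x i) = c ^ 3 * d * Om u x"
 by (simp add: Om_explicit power3_eq_cube algebra_simps)

lemma Om_scale1: "Om (%i. c * u i) x = c ^ 3 * Om u x"
 using Om_scale[of c u 1 x] by simp

lemma Om_linear: "Om u (%i. a * x i + b * y i) = a * Om u x + b * Om u y"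
 by (simp add: Om_explicit algebra_simps)

lemma Om_self [simp]: "Om u u = 0"
 by (simp add: Om_explicit algebra_simps)

lemma Om_cong: "(!!i. i \<le> 2 ==> x i = y i) ==> Om u x = Om u y"
 by (simp add: Om_def)

lemma J_fol_Om: "(p, v) \<in> J_fol \<longleftrightarrow> p \<in> P2 \<and> (\<forall>i>2. v i = 0) \<and> Om p v = 0"
 by (simp add: J_fol_iff Om_def)

lemma Om_to_point: "u k ~= 0 ==> Om (to_point u) x = 0 \<longleftrightarrow> Om u x = 0"
 by (rule to_point_obtain[of u k]) (simp_all add: Om_scale1)

text \<open>Normal form of a symmetry: a tuple in three variables with zero components beyond the
  plane, and an exceptional set given by one form s, so that the condition can be used on vectors of
  the affine cone.\<close>

lemma pulls_back_tuple:
 assumes "pulls_back f P2 J_fol J_fol"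
 obtains d \<Phi> k s where "form_tuple d \<Phi>" "!!i. vars_le 2 (\<Phi> i)" "!!i. 2 < i ==> \<Phi> i = 0" "f = rmap P2 \<Phi>" "tuple_on P2 \<Phi>"
  "homogeneous k s" "vars_le 2 s" "s ~= 0"
  "!!p v. (!!i. 2 < i ==> p i = 0) ==> peval p s ~= 0 ==> (!!i. 2 < i ==> v i = 0) ==>
   Om p v = 0 \<longleftrightarrow> Om (evals \<Phi> p) (%i. dir_deriv p v (\<Phi> i)) = 0"
proof -
 obtain d \<Phi>0 Z where \<Phi>0: "form_tuple d \<Phi>0" "f = rmap P2 \<Phi>0" and Z: "proj_closed Z" "\<not> P2 \<subseteq> Z"
  and pb: "!!p. p \<in> P2 - Z ==> (\<exists>i. peval p (\<Phi>0 i) ~= 0) \<and> (\<forall>v\<in>tangent P2 p. (p, v) \<in> J_fol \<longleftrightarrow> (to_point (evals \<Phi>0 p), %j. dir_deriv p v (\<Phi>0 j)) \<in> J_fol)"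
  using assms unfolding pulls_back_def by blast
 define \<Phi> where "\<Phi> = (%i. if i \<le> 2 then psubst (trunc3 Var) (\<Phi>0 i) else 0)"
 have gen: "eventually (%p. p \<in> P2 - Z) (generic P2)"
  using generic_not_closed[OF irr_P2 Z] generic_in[OF irr_P2] by eventually_elim simp
 have van: "peval p (\<Phi>0 i) = 0" if "p \<in> P2" "2 < i" for p i
 proof (rule generic_identity[OF irr_P2 _ _ that(1)])
  show "homogeneous d (\<Phi>0 i)" using \<Phi>0 by (simp add: form_tuple_def)
  show "eventually (%p. peval p (\<Phi>0 i) = 0) (generic P2)"
   using gen
  proof eventually_elim
   case (elim p)
   then have p: "p \<in> P2" by simp
   \<comment> \<open>The Euler vector belongs to the foliation at p, so the pull-back condition
     applied to it places the image point in the plane.\<close>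
   then have "(p, p) \<in> J_fol" "p \<in> tangent P2 p" by (simp_all add: J_fol_Om tangent_P2)
   then have "to_point (evals \<Phi>0 p) \<in> P2" using pb[OF elim] by (auto simp: J_fol_Om)
   then have "to_point (evals \<Phi>0 p) i = 0" using that(2) by simp
   then show ?case using to_point_nz[of "evals \<Phi>0 p" i] by (auto simp: evals_def)
  qed
 qed
 have ev: "evals \<Phi> p = evals \<Phi>0 p" if "p \<in> P2" for p
  using van[OF that] by (intro ext) (simp add: evals_def \<Phi>_def P2_trunc3[OF that] del: insertion_psubst)
 have h\<Phi>: "form_tuple d \<Phi>" using \<Phi>0(1) homogeneous_trunc3 by (auto simp: form_tuple_def \<Phi>_def)
 have v\<Phi>: "vars_le 2 (\<Phi> i)" for i by (simp add: \<Phi>_def)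
 obtain p0 where p0: "p0 \<in> P2 - Z" using generic_ex[OF irr_P2 gen] by blast
 then obtain i0 where i0: "evals \<Phi>0 p0 i0 ~= 0" using pb[OF p0] by (auto simp: evals_def)
 have t0: "tuple_on P2 \<Phi>0" using \<Phi>0 p0 i0 unfolding tuple_on_def evals_def by blast
 have t: "tuple_on P2 \<Phi>" using h\<Phi> p0 i0 ev[of p0] unfolding tuple_on_def evals_def by (metis DiffD1)
 have f: "f = rmap P2 \<Phi>" unfolding \<Phi>0(2)
  by (rule rmap_cong[OF irr_P2 t0 t], rule eventually_mono[OF generic_in[OF irr_P2]]) (simp add: ev)
 have cond: "Om p v = 0 \<longleftrightarrow> Om (evals \<Phi> p) (%i. dir_deriv p v (\<Phi> i)) = 0" if p: "p \<in> P2 - Z" and v: "!!i. 2 < i ==> v i = 0" for p v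
 proof -
  have vt: "v \<in> tangent P2 p" using p v by (simp add: tangent_P2)
  have d0: "dir_deriv p v (\<Phi>0 j) = 0" if "2 < j" for j
  proof -
   have "\<Phi>0 j \<in> vanishing_forms P2" using van that \<Phi>0(1) by (auto simp: vanishing_forms_def form_tuple_def)
   then show ?thesis using vt by (simp add: tangent_def)
  qed
  obtain i where "evals \<Phi>0 p i ~= 0" using pb[OF p] by (auto simp: evals_def)
  then have i: "evals \<Phi> p i ~= 0" using ev[of p] p by simp
  have P: "to_point (evals \<Phi> p) \<in> P2" by (rule to_point_P2[of "evals \<Phi> p" i, OF i]) (simp add: evals_def \<Phi>_def)
  have "dir_deriv p v (\<Phi> j) = dir_deriv p v (\<Phi>0 j)" if "j \<le> 2" for j
   using that dir_deriv_trunc3[of p v "\<Phi>0 j"] p v by (auto simp: \<Phi>_def simp del: dir_deriv_psubst)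
  then have "Om u (%i. dir_deriv p v (\<Phi> i)) = Om u (%i. dir_deriv p v (\<Phi>0 i))" for u by (rule Om_cong)
  moreover have "Om p v = 0 \<longleftrightarrow> Om (to_point (evals \<Phi> p)) (%j. dir_deriv p v (\<Phi>0 j)) = 0"
   using pb[OF p] vt p P d0 v ev[of p] by (auto simp: J_fol_Om)
  ultimately show ?thesis using Om_to_point[of "evals \<Phi> p" i, OF i] by simp
 qed
 have "eventually (%p. p \<notin> Z) (generic P2)" by (rule generic_not_closed[OF irr_P2 Z])
 then obtain k s where s: "homogeneous k s" "\<exists>p\<in>P2. peval p s ~= 0" "!!p. p \<in> P2 ==> peval p s ~= 0 ==> p \<notin> Z"
  unfolding eventually_generic[OF irr_P2] by blast
 \<comment> \<open>The factor \<open>Var 0\<close> makes p a nonzero vector, so that it represents a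
   point.\<close>
 let ?s = "Var 0 * psubst (trunc3 Var) s"
 have s0: "psubst (trunc3 Var) s ~= 0" using s(2) by (metis P2_trunc3 insertion_0 peval_psubst_trunc3)
 show ?thesis
 proof (rule that[OF h\<Phi> v\<Phi> _ f t])
  show "2 < i ==> \<Phi> i = 0" for i by (simp add: \<Phi>_def)
  show "homogeneous (Suc 0 + k) ?s" using s(1) by (intro homogeneous_mult homogeneous_trunc3) auto
  show "vars_le 2 ?s" by simp
  show "?s ~= 0" using s0 by simp
  fix p v :: "nat => complex" assume p: "!!i. 2 < i ==> p i = 0" and ps: "peval p ?s ~= 0" and v: "!!i. 2 < i ==> v i = 0"
  have p0: "p 0 ~= 0" using ps by auto
  obtain c where c: "c ~= 0" "to_point p = (%i. c * p i)" by (rule to_point_obtain[of p 0, OF p0])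
  have P: "to_point p \<in> P2" by (rule to_point_P2[of p 0, OF p0]) (simp add: p)
  have "peval p s ~= 0" using ps p trunc3_id[of p] by (simp add: peval_psubst_trunc3 del: insertion_psubst)
  then have "to_point p \<notin> Z" using s(3)[OF P] peval_to_point_eq_0[OF s(1), of p 0] p0 by auto
  then have "Om (to_point p) v = 0 \<longleftrightarrow> Om (evals \<Phi> (to_point p)) (%i. dir_deriv (to_point p) v (\<Phi> i)) = 0"
   using cond P v by blast
  moreover have "evals \<Phi> (to_point p) = (%i. c ^ d * evals \<Phi> p i)" unfolding c(2) by (rule evals_scale[OF h\<Phi>])
  moreover have "(%i. dir_deriv (to_point p) v (\<Phi> i)) = (%i. (c ^ d / c) * dir_deriv p v (\<Phi> i))"
   unfolding c(2) using dir_deriv_scale_point[of d _ c p v] h\<Phi> c(1) by (auto simp: form_tuple_def fun_eq_iff eq_divide_eq mult.commute)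
  moreover have "Om (to_point p) v = 0 \<longleftrightarrow> Om p v = 0" using Om_to_point[of p 0] p0 by blast
  ultimately have "Om p v = 0 \<longleftrightarrow> (c ^ d) ^ 3 * (c ^ d / c) * Om (evals \<Phi> p) (%i. dir_deriv p v (\<Phi> i)) = 0"
   by (simp only: Om_scale)
  then show "Om p v = 0 \<longleftrightarrow> Om (evals \<Phi> p) (%i. dir_deriv p v (\<Phi> i)) = 0"
   using c(1) by simp
 qed
qed

lemma mpoly3_generic_zero:
 assumes "vars_le 2 R" "vars_le 2 S" "S ~= 0" "!!q. (!!i. 2 < i ==> q i = 0) ==> peval q S ~= 0 ==> peval q R = 0" shows "R = 0"
proof -
 have "S * R = 0"
 proof (rule mpoly3_eq_0I)
  fix p
  have "peval (trunc3 p) S = 0 \<or> peval (trunc3 p) R = 0" using assms(4)[of "trunc3 p"] by (auto simp: trunc3_def)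
  then show "peval p (S * R) = 0" using assms(1,2) by (auto simp: peval_trunc3)
 qed (use assms in simp)
 then show ?thesis using assms(3) by simp
qed

lemma diag_deriv_commute: "diag_deriv l (diag_deriv l' f) = diag_deriv l' (diag_deriv l f)"
 by (rule poly_mapping_eqI) (simp add: lookup_diag_deriv)

text \<open>The differential of the form, divided by the cubic and by a cube root of the product of the coordinates, is closed. Here this is the identity
 d Omega = theta wedge Omega with 3 theta = 3 dlog cubic + dlog (xyz), evaluated on two commuting derivations.\<close>

lemma closed_form_identity:
 fixes x y z :: "'a::idom"
 defines "C \<equiv> x * y\<^sup>2 + y * z\<^sup>2 + z * x\<^sup>2 - 3 * x * y * z" and "P \<equiv> x * y * z"
  and "DC \<equiv> %a b c. (y\<^sup>2 + 2 * z * x - 3 * y * z) * a + (2 * x * y + z\<^sup>2 - 3 * x * z) * b + (2 * y * z + x\<^sup>2 - 3 * x * y) * c"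
  and "DP \<equiv> %a b c. y * z * a + x * z * b + x * y * c"
  and "A \<equiv> %a b c. y * z * (x + y - 2 * z) * a + x * z * (y + z - 2 * x) * b + x * y * (z + x - 2 * y) * c"
  and "B \<equiv> %u0 u1 u2 v0 v1 v2. (y * z * u0 + z * (x + 2 * y - 2 * z) * u1 + y * (x + y - 4 * z) * u2) * v0 +
   (z * (y + z - 4 * x) * u0 + x * z * u1 + x * (y + 2 * z - 2 * x) * u2) * v1 + (y * (z + 2 * x - 2 * y) * u0 + x * (z + x - 4 * y) * u1 + x * y * u2) * v2"
 shows "3 * C * P * (B u0 u1 u2 v0 v1 v2 - B v0 v1 v2 u0 u1 u2) =
  (3 * DC u0 u1 u2 * P + C * DP u0 u1 u2) * A v0 v1 v2 - (3 * DC v0 v1 v2 * P + C * DP v0 v1 v2) * A u0 u1 u2"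
proof -
 define C0 C1 C2 where "C0 = y\<^sup>2 + 2 * z * x - 3 * y * z" and "C1 = 2 * x * y + z\<^sup>2 - 3 * x * z" and "C2 = 2 * y * z + x\<^sup>2 - 3 * x * y"
 define O0 O1 O2 where "O0 = y * z * (x + y - 2 * z)" and "O1 = x * z * (y + z - 2 * x)" and "O2 = x * y * (z + x - 2 * y)"
 \<comment> \<open>These are the coefficients of d Omega. Both sides are alternating in u and v, so
   it suffices to compare the coefficients of the three minors.\<close>
 define M01 M02 M12 where "M01 = z * (y + z - 4 * x) - z * (x + 2 * y - 2 * z)" and "M02 = y * (z + 2 * x - 2 * y) - y * (x + y - 4 * z)"
  and "M12 = x * (z + x - 4 * y) - x * (y + 2 * z - 2 * x)"
 have 1: "3 * C * P * M01 = (3 * C0 * P + C * (y * z)) * O1 - (3 * C1 * P + C * (x * z)) * O0"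
  unfolding C_def P_def C0_def C1_def O0_def O1_def M01_def by algebra
 have 2: "3 * C * P * M02 = (3 * C0 * P + C * (y * z)) * O2 - (3 * C2 * P + C * (x * y)) * O0"
  unfolding C_def P_def C0_def C2_def O0_def O2_def M02_def by algebra
 have 3: "3 * C * P * M12 = (3 * C1 * P + C * (x * z)) * O2 - (3 * C2 * P + C * (x * y)) * O1"
  unfolding C_def P_def C1_def C2_def O1_def O2_def M12_def by algebra
 have "B u0 u1 u2 v0 v1 v2 - B v0 v1 v2 u0 u1 u2 = M01 * (u0 * v1 - u1 * v0) + M02 * (u0 * v2 - u2 * v0) + M12 * (u1 * v2 - u2 * v1)"
  unfolding B_def M01_def M02_def M12_def by (simp add: algebra_simps)
 moreover have "(3 * DC u0 u1 u2 * P + C * DP u0 u1 u2) * A v0 v1 v2 - (3 * DC v0 v1 v2 * P + C * DP v0 v1 v2) * A u0 u1 u2 =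
   ((3 * C0 * P + C * (y * z)) * O1 - (3 * C1 * P + C * (x * z)) * O0) * (u0 * v1 - u1 * v0) +
   ((3 * C0 * P + C * (y * z)) * O2 - (3 * C2 * P + C * (x * y)) * O0) * (u0 * v2 - u2 * v0) +
   ((3 * C1 * P + C * (x * z)) * O2 - (3 * C2 * P + C * (x * y)) * O1) * (u1 * v2 - u2 * v1)"
  unfolding DC_def DP_def A_def C0_def[symmetric] C1_def[symmetric] C2_def[symmetric] O0_def[symmetric] O1_def[symmetric] O2_def[symmetric]
  by algebra
 moreover have "3 * C * P * (M01 * a + M02 * b + M12 * c) = (3 * C * P * M01) * a + (3 * C * P * M02) * b + (3 * C * P * M12) * c" for a b c
  by (simp add: algebra_simps)
 ultimately show ?thesis by (simp only: 1 2 3)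
qed

context cube_root_of_unity
begin

definition Om_form :: "(nat => complex) => (nat => mpoly) => mpoly" where
 "Om_form l g = g 1 * g 2 * (g 0 + g 1 - 2 * g 2) * diag_deriv l (g 0) + g 0 * g 2 * (g 1 + g 2 - 2 * g 0) * diag_deriv l (g 1) +
   g 0 * g 1 * (g 2 + g 0 - 2 * g 1) * diag_deriv l (g 2)"

lemma peval_Om_form:
 assumes "!!i. vars_le 2 (g i)" shows "peval q (Om_form l g) = Om (evals g q) (%i. dir_deriv q (%j. l j * q j) (g i))"
 by (simp add: Om_form_def Om_explicit peval_diag_deriv assms evals_def)

lemma peval_eta_form:
 assumes "!!i. vars_le 2 (g i)" shows "peval q (eta_form l g) = eta (evals g q) (%i. dir_deriv q (%j. l j * q j) (g i))"
 by (simp add: eta_form_def eta_def peval_diag_deriv assms evals_def)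

text \<open>Evaluate d Omega = theta wedge Omega on the commuting derivations l and l'. The
  pulled-back Omega vanishes on l, so the left side is the derivative of its value H on l' along l,
  and the right side is theta(l) H.\<close>

lemma Om_form_closed:
 fixes f :: "nat => mpoly" and l l' :: "nat => complex"
 assumes K: "Om_form l f = 0"
 defines "C \<equiv> psubst f cubic" and "P \<equiv> f 0 * f 1 * f 2" and "H \<equiv> Om_form l' f"
 shows "3 * C * P * diag_deriv l H = (3 * diag_deriv l C * P + C * diag_deriv l P) * H"
proof -
 let ?u = "%i. diag_deriv l (f i)" and ?v = "%i. diag_deriv l' (f i)" and ?w = "%i. diag_deriv l (diag_deriv l' (f i))"
 let ?B = "%u v. (f 1 * f 2 * u 0 + f 2 * (f 0 + 2 * f 1 - 2 * f 2) * u 1 + f 1 * (f 0 + f 1 - 4 * f 2) * u 2) * v 0 +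
   (f 2 * (f 1 + f 2 - 4 * f 0) * u 0 + f 0 * f 2 * u 1 + f 0 * (f 1 + 2 * f 2 - 2 * f 0) * u 2) * v 1 +
   (f 1 * (f 2 + 2 * f 0 - 2 * f 1) * u 0 + f 0 * (f 2 + f 0 - 4 * f 1) * u 1 + f 0 * f 1 * u 2) * v 2"
 let ?W = "f 1 * f 2 * (f 0 + f 1 - 2 * f 2) * ?w 0 + f 0 * f 2 * (f 1 + f 2 - 2 * f 0) * ?w 1 + f 0 * f 1 * (f 2 + f 0 - 2 * f 1) * ?w 2"
 have DH: "diag_deriv l H = ?B ?u ?v + ?W"
  unfolding H_def Om_form_def by (simp add: algebra_simps)
 have "diag_deriv l' (Om_form l f) = ?B ?v ?u + ?W"
  unfolding Om_form_def by (simp add: diag_deriv_commute[of l'] algebra_simps)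
 then have DK: "?B ?v ?u + ?W = 0" using K by simp
 have Ce: "C = f 0 * (f 1)\<^sup>2 + f 1 * (f 2)\<^sup>2 + f 2 * (f 0)\<^sup>2 - 3 * f 0 * f 1 * f 2"
  by (simp add: C_def cubic_eq)
 have DC: "diag_deriv l C = ((f 1)\<^sup>2 + 2 * f 2 * f 0 - 3 * f 1 * f 2) * ?u 0 + (2 * f 0 * f 1 + (f 2)\<^sup>2 - 3 * f 0 * f 2) * ?u 1 + (2 * f 1 * f 2 + (f 0)\<^sup>2 - 3 * f 0 * f 1) * ?u 2"
  unfolding Ce power2_eq_square by (simp add: algebra_simps)
 have DP: "diag_deriv l P = f 1 * f 2 * ?u 0 + f 0 * f 2 * ?u 1 + f 0 * f 1 * ?u 2"
  unfolding P_def by (simp add: algebra_simps)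
 have H: "H = f 1 * f 2 * (f 0 + f 1 - 2 * f 2) * ?v 0 + f 0 * f 2 * (f 1 + f 2 - 2 * f 0) * ?v 1 + f 0 * f 1 * (f 2 + f 0 - 2 * f 1) * ?v 2"
  unfolding H_def Om_form_def ..
 have K': "f 1 * f 2 * (f 0 + f 1 - 2 * f 2) * ?u 0 + f 0 * f 2 * (f 1 + f 2 - 2 * f 0) * ?u 1 + f 0 * f 1 * (f 2 + f 0 - 2 * f 1) * ?u 2 = 0"
  using K unfolding Om_form_def .
 have "3 * C * P * (?B ?u ?v - ?B ?v ?u) = (3 * diag_deriv l C * P + C * diag_deriv l P) * H"
  unfolding DC DP H unfolding Ce P_def
  using closed_form_identity[of "f 0" "f 1" "f 2" "?u 0" "?u 1" "?u 2" "?v 0" "?v 1" "?v 2", unfolded K'] by simp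
 moreover have "b - c = a" if "a = b + w" "c + w = 0" for a b c w :: mpoly
  using that by (simp add: add_eq_0_iff2)
 from this[OF DH DK] have "?B ?u ?v - ?B ?v ?u = diag_deriv l H" .
 ultimately show ?thesis by (simp only:)
qed

end

subsection \<open>Lifting a symmetry to the triple cover\<close>

text \<open>Put h = H / (N C), a cube root of f0 f1 f2. The triple (f0 h, f0 f1, h^2) solves a^2 b :
  b^2 c : c^2 a = f0 : f1 : f2, and A, B, E are this triple multiplied by N^2 C^2.\<close>

lemma lift_identity:
 fixes f0 f1 f2 H N C :: "'a::idom"
 assumes "H ^ 3 = N ^ 3 * (C ^ 3 * (f0 * f1 * f2))"
 defines "A \<equiv> f0 * H * N * C" and "B \<equiv> f0 * f1 * N\<^sup>2 * C\<^sup>2" and "E \<equiv> H\<^sup>2" and "r \<equiv> f0\<^sup>2 * f1 * N ^ 4 * C ^ 4 * H\<^sup>2"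
 shows "A\<^sup>2 * B = r * f0" "B\<^sup>2 * E = r * f1" "E\<^sup>2 * A = r * f2"
proof -
 show "A\<^sup>2 * B = r * f0" "B\<^sup>2 * E = r * f1" unfolding A_def B_def E_def r_def by algebra+
 have "E\<^sup>2 * A = H ^ 3 * (H\<^sup>2 * (f0 * N * C))" unfolding A_def E_def by algebra
 also have "\<dots> = r * f2" unfolding assms(1) r_def by algebra
 finally show "E\<^sup>2 * A = r * f2" .
qed

lemma first_integral_identity:
 fixes H C P DH DC DP :: "'a::idom"
 assumes "3 * C * P * DH = (3 * DC * P + C * DP) * H"
 shows "(3 * H\<^sup>2 * DH) * (C ^ 3 * P) = H ^ 3 * (3 * C\<^sup>2 * DC * P + C ^ 3 * DP)"
proof -
 have "(3 * H\<^sup>2 * DH) * (C ^ 3 * P) = H\<^sup>2 * C\<^sup>2 * (3 * C * P * DH)" by algebra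
 then show ?thesis unfolding assms by algebra
qed

lemma diag_deriv_cube: "diag_deriv l (f ^ 3) = 3 * f\<^sup>2 * diag_deriv l f"
 by (simp add: power3_eq_cube power2_eq_square algebra_simps)

context cube_root_of_unity
begin

lemma one_w: "1 + Const w + Const (w\<^sup>2) = 0"
proof -
 have "1 + w + w\<^sup>2 = 0" using w by algebra
 then have "Const (1 + w + w\<^sup>2) = 0" by (simp only: Const_0)
 then show ?thesis by (simp only: Const_add Const_1)
qed

lemma Const_w2: "Const (w\<^sup>2) = Const w * Const w" "Const w * Const w * Const w = 1"
proof -
 show "Const (w\<^sup>2) = Const w * Const w" by (simp only: power2_eq_square Const_mult)
 have "Const (w ^ 3) = 1" by (simp only: w3 Const_1)
 then show "Const w * Const w * Const w = 1" by (simp only: power3_eq_cube Const_mult)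
qed

lemma inverse_dft:
 fixes A B E :: mpoly
 defines "G \<equiv> vec3 (A + B + E) (A + Const w * B + Const (w\<^sup>2) * E) (A + Const (w\<^sup>2) * B + Const w * E)"
 shows "psubst G pa = 3 * A" "psubst G pb = 3 * B" "psubst G pc = 3 * E"
proof -
 let ?c = "Const w"
 have e: "1 + ?c + ?c * ?c = 0" using one_w unfolding Const_w2(1) .
 have alg: "(A + B + E) + (A + c * B + c * c * E) + (A + c * c * B + c * E) = 3 * A"
   "(A + B + E) + c * c * (A + c * B + c * c * E) + c * (A + c * c * B + c * E) = 3 * B"
   "(A + B + E) + c * (A + c * B + c * c * E) + c * c * (A + c * c * B + c * E) = 3 * E"
  if "1 + c + c * c = 0" for c :: mpoly using that by algebra+
 show "psubst G pa = 3 * A" "psubst G pb = 3 * B" "psubst G pc = 3 * E"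
  unfolding pa_def pb_def pc_def G_def using alg[OF e] by (simp_all add: Const_w2(1))
qed

lemma Om_form_cov:
 assumes \<Phi>: "!!i. vars_le 2 (\<Phi> i)"
  and cond: "!!p v. (!!i. 2 < i ==> p i = 0) ==> peval p s ~= 0 ==> (!!i. 2 < i ==> v i = 0) ==>
   Om p v = 0 \<longleftrightarrow> Om (evals \<Phi> p) (%i. dir_deriv p v (\<Phi> i)) = 0"
  and q: "peval q (psubst cov s * pa * pb * pc) ~= 0"
 shows "peval q (Om_form l (%i. psubst cov (\<Phi> i))) = 0 \<longleftrightarrow> eta q (%j. l j * q j) = 0"
proof -
 let ?u = "%j. l j * q j"
 let ?v = "%i. dir_deriv q ?u (cov i)"
 have "peval q (Om_form l (%i. psubst cov (\<Phi> i))) = Om (evals \<Phi> (evals cov q)) (%i. dir_deriv (evals cov q) ?v (\<Phi> i))"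
  by (subst peval_Om_form) (auto simp: \<Phi> evals_def intro!: vars_le_psubst)
 moreover have "Om (evals cov q) ?v = 0 \<longleftrightarrow> Om (evals \<Phi> (evals cov q)) (%i. dir_deriv (evals cov q) ?v (\<Phi> i)) = 0"
  by (rule cond) (use q in \<open>simp_all add: evals_def\<close>)
 moreover have "Om (evals cov q) ?v = - 27 * (peval q pa * peval q pb * peval q pc) ^ 3 * eta q ?u"
  using Omega_cov[of q ?u] by (simp only: Om_def)
 ultimately show ?thesis using q by auto
qed

theorem lift:
 assumes \<Phi>: "form_tuple d \<Phi>" "!!i. vars_le 2 (\<Phi> i)" "!!i. 2 < i ==> \<Phi> i = 0" and s: "vars_le 2 s" "s ~= 0"
  and cond: "!!p v. (!!i. 2 < i ==> p i = 0) ==> peval p s ~= 0 ==> (!!i. 2 < i ==> v i = 0) ==>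
   Om p v = 0 \<longleftrightarrow> Om (evals \<Phi> p) (%i. dir_deriv p v (\<Phi> i)) = 0"
  and nz: "psubst \<Phi> cubic ~= 0" "\<Phi> 0 ~= 0" "\<Phi> 1 ~= 0" "\<Phi> 2 ~= 0"
 obtains G r where "!!i. vars_le 2 (G i)" "vars_le 2 r" "r ~= 0" "!!i. psubst G (cov i) = r * psubst cov (\<Phi> i)"
  "G 0 ~= 0" "G 1 ~= 0" "G 2 ~= 0" "eta_form lam G = 0" "eta_form (%_. 1) G = 0"
proof -
 define f where "f = (%i. psubst cov (\<Phi> i))"
 have fv: "vars_le 2 (f i)" for i unfolding f_def by (rule vars_le_psubst) simp
 have fh: "homogeneous (d * 3) (f i)" for i
  using homogeneous_comp[OF _ form_tuple_cov] \<Phi>(1) by (simp add: f_def form_tuple_def)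
 let ?e = "d * 3"
 let ?S = "psubst cov s * pa * pb * pc"
 have abc0: "pa ~= 0" "pb ~= 0" "pc ~= 0"
  using peval_abc[of "vec3 1 0 0"] by auto
 have S: "vars_le 2 ?S" "?S ~= 0"
  using psubst_cov_eq_0[OF s(1)] s(2) abc0 by (auto intro!: vars_le_mult vars_le_psubst)
 have cc: "peval q ?S ~= 0 ==> peval q (Om_form l f) = 0 \<longleftrightarrow> eta q (%j. l j * q j) = 0" for q l
  unfolding f_def by (rule Om_form_cov[OF \<Phi>(2) cond]) auto
 have ov: "vars_le 2 (Om_form l f)" for l by (simp add: Om_form_def fv)
 have K: "Om_form lam f = 0"
  by (rule mpoly3_generic_zero[OF ov S]) (use cc eta_lam in blast)
 \<comment> \<open>The value on the field X d/dX, which is transverse to the foliation: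
   \<open>eta\<close> takes the value XYZ on it.\<close>
 define H where "H = Om_form (vec3 1 0 0) f"
 have H0: "H ~= 0"
 proof
  assume "H = 0"
  have "Var 0 * Var 1 * Var 2 = (0::mpoly)"
  proof (rule mpoly3_generic_zero[OF _ S])
   fix q assume "peval q ?S ~= 0"
   then have "eta q (%j. vec3 1 0 0 j * q j) = 0" using cc[of q "vec3 1 0 0"] \<open>H = 0\<close> by (simp add: H_def)
   then show "peval q (Var 0 * Var 1 * Var 2) = 0" by (auto simp: eta_def)
  qed simp
  then show False by simp
 qed
 define C where "C = psubst f cubic"
 define P where "P = f 0 * f 1 * f 2"
 have C0: "C ~= 0"
 proof -
  have "C = psubst cov (psubst \<Phi> cubic)" by (simp add: C_def f_def)
  moreover have "vars_le 2 (psubst \<Phi> cubic)" by (rule vars_le_psubst) (rule \<Phi>)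
  ultimately show ?thesis using psubst_cov_eq_0 nz(1) by metis
 qed
 have f0: "f 0 ~= 0" "f 1 ~= 0" "f 2 ~= 0" using psubst_cov_eq_0[OF \<Phi>(2)] nz by (auto simp: f_def)
 have P0: "P ~= 0" using f0 by (simp add: P_def)
 have lin: "homogeneous ?e (f i + f j - 2 * f k)" for i j k
  using homogeneous_mult[OF homogeneous_numeral fh, of "num.Bit0 num.One" k] by (intro homogeneous_diff homogeneous_add fh) simp
 have Hh: "homogeneous (?e + ?e + ?e + ?e) H" unfolding H_def Om_form_def
  by (intro homogeneous_add homogeneous_mult lin fh homogeneous_diag_deriv)
 have Hv: "vars_le 2 H" by (simp add: H_def ov)
 have Ch: "homogeneous (3 * ?e) C" unfolding C_def
  by (rule homogeneous_psubst[OF homogeneous_cubic fh])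
 have Cv: "vars_le 2 C" unfolding C_def by (rule vars_le_psubst) (rule fv)
 have clo: "3 * C * P * diag_deriv lam H = (3 * diag_deriv lam C * P + C * diag_deriv lam P) * H"
  unfolding C_def P_def H_def by (rule Om_form_closed[OF K])
 \<comment> \<open>H^3 and C^3 P both have 12 times the degree of f, so their quotient is a rational
   function on the plane, and the closedness relation says that it is a first integral of the linear
   field.\<close>
 have "diag_deriv lam (H ^ 3) * (C ^ 3 * P) = H ^ 3 * diag_deriv lam (C ^ 3 * P)"
  unfolding diag_deriv_simps diag_deriv_cube by (rule first_integral_identity[OF clo])
 moreover have "homogeneous (3 * (?e + ?e + ?e + ?e)) (H ^ 3)" by (rule homogeneous_power[OF Hh])
 moreover have "homogeneous (3 * (3 * ?e) + (?e + ?e + ?e)) (C ^ 3 * P)"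
  unfolding P_def by (intro homogeneous_mult homogeneous_power Ch fh)
 moreover have "3 * (3 * ?e) + (?e + ?e + ?e) = 3 * (?e + ?e + ?e + ?e)" by simp
 moreover have "C ^ 3 * P ~= 0" using C0 P0 by simp
 moreover have "vars_le 2 (H ^ 3)" "vars_le 2 (C ^ 3 * P)" using Hv Cv fv by (simp_all add: P_def)
 ultimately obtain c where c: "H ^ 3 = Const c * (C ^ 3 * P)"
  using first_integral_const[OF weights_distinct_lam] by metis
 obtain n where n: "n ^ 3 = c" by (rule cube_root)
 have n0: "n ~= 0" using c n H0 by auto
 define N where "N = Const n"
 have N0: "N ~= 0" using n0 by (simp add: N_def)
 have HN: "H ^ 3 = N ^ 3 * (C ^ 3 * (f 0 * f 1 * f 2))"
  using c by (simp add: N_def P_def flip: n Const_power)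
 define A where "A = f 0 * H * N * C"
 define B where "B = f 0 * f 1 * N\<^sup>2 * C\<^sup>2"
 define E where "E = H\<^sup>2"
 define r where "r = (f 0)\<^sup>2 * f 1 * N ^ 4 * C ^ 4 * H\<^sup>2"
 note ABE = lift_identity[OF HN, folded A_def B_def E_def r_def]
 have nz': "A ~= 0" "B ~= 0" "E ~= 0" "r ~= 0" using f0 H0 N0 C0 by (auto simp: A_def B_def E_def r_def)
 have v: "vars_le 2 A" "vars_le 2 B" "vars_le 2 E" "vars_le 2 r" using fv Hv Cv by (simp_all add: A_def B_def E_def r_def N_def)
 have Nh: "homogeneous 0 N" by (simp add: N_def)
 have "homogeneous (?e + (?e + ?e + ?e + ?e) + 0 + 3 * ?e) A" unfolding A_def by (intro homogeneous_mult fh Hh Nh Ch)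
 then have Ah: "homogeneous (8 * ?e) A" by (simp add: algebra_simps)
 have "homogeneous (?e + ?e + 2 * 0 + 2 * (3 * ?e)) B" unfolding B_def by (intro homogeneous_mult homogeneous_power fh Nh Ch)
 then have Bh: "homogeneous (8 * ?e) B" by (simp add: algebra_simps)
 have "homogeneous (2 * (?e + ?e + ?e + ?e)) E" unfolding E_def by (intro homogeneous_power Hh)
 then have Eh: "homogeneous (8 * ?e) E" by (simp add: algebra_simps)
 define G where "G = vec3 (A + B + E) (A + Const w * B + Const (w\<^sup>2) * E) (A + Const (w\<^sup>2) * B + Const w * E)"
 have Gv: "vars_le 2 (G i)" for i
 proof (cases "i \<le> 2")
  case True
  then show ?thesis using cases_le2[OF True] v by (elim disjE) (simp_all add: G_def)
 qed (simp add: G_def)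
 have cm: "homogeneous (8 * ?e) (Const k * X)" if "homogeneous (8 * ?e) X" for k X
  using homogeneous_mult[OF homogeneous_Const that] by simp
 have Gh: "homogeneous (8 * ?e) (G i)" for i
 proof (cases "i \<le> 2")
  case True
  then show ?thesis using cases_le2[OF True] Ah Bh Eh cm by (elim disjE) (simp_all add: G_def homogeneous_add)
 qed (simp add: G_def)
 note Gabc = inverse_dft[of A B E, folded G_def]
 \<comment> \<open>The factor 27 appears because the inverse transform defining \<open>G\<close> is
   not divided by 3.\<close>
 have Gcov: "psubst G (cov i) = (27 * r) * psubst cov (\<Phi> i)" for i
 proof (cases "i \<le> 2")
  case True
  then show ?thesis using cases_le2[OF True]
  proof (elim disjE)
   assume i: "i = 0"
   have "psubst G (cov i) = 27 * (A\<^sup>2 * B)" unfolding i by (simp add: Gabc power2_eq_square)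
   then show ?thesis unfolding ABE by (simp add: i f_def mult.assoc)
  next
   assume i: "i = 1"
   have "psubst G (cov i) = 27 * (B\<^sup>2 * E)" unfolding i by (simp add: Gabc power2_eq_square)
   then show ?thesis unfolding ABE by (simp add: i f_def mult.assoc)
  next
   assume i: "i = 2"
   have "psubst G (cov i) = 27 * (E\<^sup>2 * A)" unfolding i by (simp add: Gabc power2_eq_square)
   then show ?thesis unfolding ABE by (simp add: i f_def mult.assoc)
  qed
 next
  case False
  then show ?thesis by (simp add: \<Phi>(3))
 qed
 define R where "R = 27 * r"
 have R: "R ~= 0" "vars_le 2 R" using nz' v by (simp_all add: R_def)
 have evG: "evals cov (evals G q) = (%i. peval q R * evals f q i)" for q
 proof
  fix i
  have "evals cov (evals G q) i = peval q (psubst G (cov i))" by (simp add: evals_def)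
  also have "\<dots> = peval q R * evals f q i" unfolding Gcov by (simp add: R_def evals_def f_def)
  finally show "evals cov (evals G q) i = peval q R * evals f q i" .
 qed
 have pG: "peval (evals G q) pa = 3 * peval q A" "peval (evals G q) pb = 3 * peval q B" "peval (evals G q) pc = 3 * peval q E" for q
  unfolding peval_comp[symmetric] Gabc by simp_all
 \<comment> \<open>Pull Omega back along the composite of G and the cover in two ways: through the
   cover it is a multiple of \<open>eta\<close> along G, and through f it vanishes on the linear
   field.\<close>
 have eta0: "eta_form lam G = 0"
 proof (rule mpoly3_generic_zero[of _ "A * B * E"])
  show "vars_le 2 (eta_form lam G)" by (simp add: eta_form_def Gv)
  show "vars_le 2 (A * B * E)" "A * B * E ~= 0" using v nz' by simp_all
  fix q assume q: "peval q (A * B * E) ~= 0"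
  let ?u = "%j. lam j * q j"
  let ?v = "%i. dir_deriv q ?u (G i)"
  have d: "dir_deriv (evals G q) ?v (cov i) = peval q R * dir_deriv q ?u (f i) + dir_deriv q ?u R * evals f q i" for i
  proof -
   have "dir_deriv (evals G q) ?v (cov i) = dir_deriv q ?u (psubst G (cov i))" by (simp add: evals_def)
   then show ?thesis unfolding Gcov by (simp add: R_def f_def evals_def algebra_simps)
  qed
  have "- 27 * (peval (evals G q) pa * peval (evals G q) pb * peval (evals G q) pc) ^ 3 * eta (evals G q) ?v
    = Om (evals cov (evals G q)) (%i. dir_deriv (evals G q) ?v (cov i))"
   using Omega_cov[of "evals G q" ?v] by (simp only: Om_def)
  also have "\<dots> = Om (%i. peval q R * evals f q i) (%i. peval q R * dir_deriv q ?u (f i) + dir_deriv q ?u R * evals f q i)"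
   unfolding evG d ..
  also have "\<dots> = peval q R ^ 3 * (peval q R * Om (evals f q) (%i. dir_deriv q ?u (f i)))"
   unfolding Om_scale1 Om_linear by simp
  also have "Om (evals f q) (%i. dir_deriv q ?u (f i)) = 0"
   using peval_Om_form[of f q lam] fv K by simp
  finally have "eta (evals G q) ?v = 0" using q by (simp add: pG)
  then show "peval q (eta_form lam G) = 0" using peval_eta_form[of G q lam] Gv by simp
 qed
 have eta1: "eta_form (%_. 1) G = 0"
 proof -
  have "diag_deriv (%_. 1) (G i) = of_nat (8 * ?e) * G i" for i by (rule diag_deriv_Euler[OF Gh Gv])
  then have "eta_form (%_. 1) G = of_nat (8 * ?e) * (G 0 * G 1 * G 2) * (1 + Const w + Const (w\<^sup>2))"
   unfolding eta_form_def by (simp add: algebra_simps)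
  then show ?thesis unfolding one_w by simp
 qed
 \<comment> \<open>If a component of G vanished, the cover would send the image of G into the cubic,
   against C being nonzero.\<close>
 have "G 0 * G 1 * G 2 ~= 0"
 proof
  assume z: "G 0 * G 1 * G 2 = 0"
  have "R * C = 0"
  proof (rule mpoly3_eq_0I)
   show "vars_le 2 (R * C)" using R Cv by simp
   fix q
   have "peval q (G 0) * peval q (G 1) * peval q (G 2) = 0" using arg_cong[OF z, of "peval q"] by simp
   then have "peval (evals cov (evals G q)) cubic = 0" unfolding cubic_cov by (simp add: evals_def)
   then have "peval q R ^ 3 * peval (evals f q) cubic = 0" unfolding evG by (simp add: peval_scale[OF homogeneous_cubic])
   then show "peval q (R * C) = 0" by (auto simp: C_def evals_def)
  qed
  then show False using R C0 by simp
 qed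
 then show ?thesis
  using that[OF Gv R(2,1) _ _ _ _ eta0 eta1] Gcov by (auto simp: R_def)
qed

end

subsection \<open>Symmetries are monomial on the triple cover\<close>

text \<open>A monomial map normalised by its third coordinate. The exponent rows (a, b, -a-b) and
  (-b, a+b, -a) describe multiplication by an element of Z[w], whose norm is a^2 + a b +
  b^2.\<close>

definition twist :: "complex => complex => complex => int => int => (nat => complex) => nat => complex" where
 "twist c0 c1 c2 a b q = vec3 (c0 * (q 0 powi a * q 1 powi b * q 2 powi (- a - b))) (c1 * (q 0 powi (- b) * q 1 powi (a + b) * q 2 powi (- a))) c2"

lemma root_of_unity_powi:
 assumes "0 < (n::int)"
 obtains z :: complex where "z ~= 0" "!!k. z powi k = 1 \<longleftrightarrow> n dvd k"
proof
 let ?z = "cis (2 * pi / of_int n)"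
 show "?z ~= 0" by simp
 fix k :: int
 have z: "?z powi k = cis (of_int k * (2 * pi / of_int n))" by (rule cis_power_int)
 show "?z powi k = 1 \<longleftrightarrow> n dvd k"
 proof
  assume "?z powi k = 1"
  then have "cos (of_int k * (2 * pi / of_int n)) = 1" unfolding z by (simp add: complex_eq_iff)
  then obtain l :: int where "of_int k * (2 * pi / of_int n) = of_int l * 2 * pi" by (auto simp: cos_one_2pi_int)
  then have "(of_int k :: real) = of_int (n * l)" using assms by (simp add: field_simps)
  then have "k = n * l" by (simp only: of_int_eq_iff)
  then show "n dvd k" by simp
 next
  assume "n dvd k"
  then obtain l where "k = n * l" by blast
  then have "of_int k * (2 * pi / of_int n) = 2 * pi * of_int l" using assms by simp
  then have "?z powi k = cis (2 * pi * of_int l)" unfolding z by (rule arg_cong)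
  then show "?z powi k = 1" by (simp only: cis_multiple_2pi Ints_of_int)
 qed
qed

context cube_root_of_unity
begin

lemma evals_cov_cong: "q 0 = q' 0 ==> q 1 = q' 1 ==> q 2 = q' 2 ==> evals cov q = evals cov q'"
 by (simp add: evals_cov peval_abc)

lemma generic_cov:
 assumes "eventually P (generic P2)"
 obtains S D where "homogeneous D S" "vars_le 2 S" "S ~= 0" "!!q. (!!i. 2 < i ==> q i = 0) ==> peval q S ~= 0 ==>
   evals cov q 0 ~= 0 \<and> to_point (evals cov q) \<in> P2 \<and> P (to_point (evals cov q))"
proof -
 obtain d s where s: "homogeneous d s" "\<exists>p\<in>P2. peval p s ~= 0" "!!p. p \<in> P2 ==> peval p s ~= 0 ==> P p"
  using assms unfolding eventually_generic[OF irr_P2] by blast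
 let ?s = "Var 0 * psubst (trunc3 Var) s"
 have "psubst (trunc3 Var) s ~= 0" using s(2) by (metis P2_trunc3 insertion_0 peval_psubst_trunc3)
 then have s0: "?s ~= 0" by simp
 show ?thesis
 proof (rule that)
  show "homogeneous ((Suc 0 + d) * 3) (psubst cov ?s)"
   by (intro homogeneous_comp[OF _ form_tuple_cov] homogeneous_mult homogeneous_Var homogeneous_trunc3 s)
  show "vars_le 2 (psubst cov ?s)" by (rule vars_le_psubst) simp
  show "psubst cov ?s ~= 0" using s0 psubst_cov_eq_0[of ?s] by auto
  fix q assume q: "!!i. 2 < i ==> q i = 0" and S: "peval q (psubst cov ?s) ~= 0"
  have e: "trunc3 (evals cov q) = evals cov q" by (simp add: evals_cov)
  have n0: "evals cov q 0 ~= 0" and n1: "peval (evals cov q) s ~= 0"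
   using S unfolding peval_comp by (auto simp: peval_psubst_trunc3 e simp del: insertion_psubst)
  moreover have "to_point (evals cov q) \<in> P2" by (rule to_point_P2[of "evals cov q" 0, OF n0]) (simp add: evals_cov)
  ultimately show "evals cov q 0 ~= 0 \<and> to_point (evals cov q) \<in> P2 \<and> P (to_point (evals cov q))"
   using s(3) peval_to_point_eq_0[OF s(1), of "evals cov q" 0] by auto
 qed
qed

text \<open>Each of the two weight relations lies in Z[w] and splits into two integer equations.
  Relative to the third row these leave two free parameters.\<close>

lemma monomial_exponents:
 fixes m :: "nat => (nat \<Rightarrow>\<^sub>0 nat)"
 assumes "weight lam (m 0) + w\<^sup>2 * weight lam (m 1) + w * weight lam (m 2) = 0"
  "weight (%_. 1) (m 0) + w\<^sup>2 * weight (%_. 1) (m 1) + w * weight (%_. 1) (m 2) = 0"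
 defines "e \<equiv> %i j. int (lookup (m i) j) - int (lookup (m 2) j)"
 obtains a b where "e 0 0 = a" "e 0 1 = b" "e 0 2 = - a - b" "e 1 0 = - b" "e 1 1 = a + b" "e 1 2 = - a"
proof -
 define n where "n = (%i j. int (lookup (m i) j))"
 have w4: "w\<^sup>2 * w\<^sup>2 = w" "w\<^sup>2 * w = 1" "w * w\<^sup>2 = 1" "w ^ 4 = w" "w * w = w\<^sup>2" using w by (algebra, algebra, algebra, algebra, simp add: power2_eq_square)
 let ?A = "n 0 0 + n 1 2 + n 2 1" and ?B = "n 0 1 + n 1 0 + n 2 2" and ?C = "n 0 2 + n 1 1 + n 2 0"
 have "weight lam (m 0) + w\<^sup>2 * weight lam (m 1) + w * weight lam (m 2) = of_int ?A + w\<^sup>2 * of_int ?B + w * of_int ?C"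
  by (simp add: weight_def atMost_2 n_def distrib_left w4 flip: mult.assoc)
 also have "\<dots> = of_int (?A - ?B) + of_int (?C - ?B) * w" unfolding w2 by (simp add: algebra_simps)
 finally have "of_int (?A - ?B) + of_int (?C - ?B) * w = 0" using assms(1) by simp
 then have 1: "?A - ?B = 0" "?C - ?B = 0" by (rule w_indep)+
 let ?A' = "n 0 0 + n 0 1 + n 0 2" and ?B' = "n 1 0 + n 1 1 + n 1 2" and ?C' = "n 2 0 + n 2 1 + n 2 2"
 have "weight (%_. 1) (m 0) + w\<^sup>2 * weight (%_. 1) (m 1) + w * weight (%_. 1) (m 2) = of_int ?A' + w\<^sup>2 * of_int ?B' + w * of_int ?C'"
  by (simp add: weight_def atMost_2 n_def distrib_left)
 also have "\<dots> = of_int (?A' - ?B') + of_int (?C' - ?B') * w" unfolding w2 by (simp add: algebra_simps)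
 finally have "of_int (?A' - ?B') + of_int (?C' - ?B') * w = 0" using assms(2) by simp
 then have 2: "?A' - ?B' = 0" "?C' - ?B' = 0" by (rule w_indep)+
 show ?thesis
  by (rule that[of "e 0 0" "e 0 1"]) (use 1 2 in \<open>simp_all add: e_def n_def\<close>)
qed

text \<open>A diagonal map under which the cover is invariant preserves the line a = 0. The points
  (2:-1:-1) and (-1:2:-1) of this line then force the diagonal entries to be equal.\<close>

lemma twist_invariance_const:
 assumes d: "d0 ~= 0" "d1 ~= 0" "d2 ~= 0" and S: "vars_le 2 S" "S ~= 0"
  and par: "!!q. (!!i. 2 < i ==> q i = 0) ==> peval q S ~= 0 ==> par (evals cov (vec3 (d0 * q 0) (d1 * q 1) (d2 * q 2))) (evals cov q)"
 shows "d0 = d1" "d1 = d2"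
proof -
 define D where "D = vec3 (Const d0 * Var 0) (Const d1 * Var 1) (Const d2 * Var 2)"
 have Dv: "vars_le 2 (D i)" for i
  by (cases "i \<le> 2") (auto simp: D_def dest!: cases_le2)
 let ?a = "psubst D pa" and ?b = "psubst D pb" and ?c = "psubst D pc"
 have ev: "evals D q = vec3 (d0 * q 0) (d1 * q 1) (d2 * q 2)" for q
  by (rule vec3_eqI) (simp_all add: evals_def D_def)
 have v: "vars_le 2 ?a" "vars_le 2 ?b" "vars_le 2 ?c" using Dv by (auto intro: vars_le_psubst)
 have nz: "?b ~= 0" "pb ~= 0" "pa ~= 0"
 proof -
  have "peval (vec3 1 0 0) ?b = d0" "peval (vec3 1 0 0) pa = 1" "peval (vec3 1 0 0) pb = 1" unfolding peval_comp ev by (simp_all add: peval_abc)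
  then show "?b ~= 0" "pb ~= 0" "pa ~= 0" using d insertion_0 by (metis zero_neq_one)+
 qed
 have "(?b * pb) * (?a\<^sup>2 * pb * pc - ?b * ?c * pa\<^sup>2) = 0"
 proof (rule mpoly3_generic_zero[OF _ S])
  show "vars_le 2 ((?b * pb) * (?a\<^sup>2 * pb * pc - ?b * ?c * pa\<^sup>2))" using v by simp
  fix q assume "!!i. 2 < i ==> q i = 0" "peval q S ~= 0"
  then have "par (evals cov (evals D q)) (evals cov q)" unfolding ev by (rule par)
  then have "evals cov (evals D q) 0 * evals cov q 1 = evals cov (evals D q) 1 * evals cov q 0" unfolding par_def by blast
  then have "(peval q ?a)\<^sup>2 * peval q ?b * ((peval q pb)\<^sup>2 * peval q pc) = (peval q ?b)\<^sup>2 * peval q ?c * ((peval q pa)\<^sup>2 * peval q pb)"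
   unfolding evals_cov peval_comp by simp
  then show "peval q ((?b * pb) * (?a\<^sup>2 * pb * pc - ?b * ?c * pa\<^sup>2)) = 0"
   by (simp add: power2_eq_square algebra_simps)
 qed
 then have "?a\<^sup>2 * pb * pc - ?b * ?c * pa\<^sup>2 = 0" using nz by simp
 then have "peval q (?a\<^sup>2 * pb * pc - ?b * ?c * pa\<^sup>2) = 0" for q by (simp only: insertion_0)
 then have *: "(peval q ?a)\<^sup>2 * peval q pb * peval q pc = peval q ?b * peval q ?c * (peval q pa)\<^sup>2" for q by simp
 have key: "peval q ?a = 0" if "peval q pa = 0" "peval q pb ~= 0" "peval q pc ~= 0" for q
  using *[of q] that by simp
 have "peval (vec3 2 (- 1) (- 1)) ?a = 0"
 proof (rule key)
  show "peval (vec3 2 (- 1) (- 1)) pa = 0" by (simp add: peval_abc)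
  have "2 - w\<^sup>2 - w = 3" "2 - w - w\<^sup>2 = 3" using w by algebra+
  then have "peval (vec3 2 (- 1) (- 1)) pb = 3" "peval (vec3 2 (- 1) (- 1)) pc = 3" by (simp_all add: peval_abc)
  then show "peval (vec3 2 (- 1) (- 1)) pb ~= 0" "peval (vec3 2 (- 1) (- 1)) pc ~= 0" by simp_all
 qed
 then have 1: "2 * d0 = d1 + d2" unfolding peval_comp ev by (simp add: peval_abc algebra_simps)
 have "peval (vec3 (- 1) 2 (- 1)) ?a = 0"
 proof (rule key)
  show "peval (vec3 (- 1) 2 (- 1)) pa = 0" by (simp add: peval_abc)
  have "- 1 + w\<^sup>2 * 2 - w = 3 * w\<^sup>2" "- 1 + w * 2 - w\<^sup>2 = 3 * w" using w by algebra+
  then have "peval (vec3 (- 1) 2 (- 1)) pb = 3 * w\<^sup>2" "peval (vec3 (- 1) 2 (- 1)) pc = 3 * w" by (simp_all add: peval_abc)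
  then show "peval (vec3 (- 1) 2 (- 1)) pb ~= 0" "peval (vec3 (- 1) 2 (- 1)) pc ~= 0" by simp_all
 qed
 then have 2: "2 * d1 = d0 + d2" unfolding peval_comp ev by (simp add: peval_abc algebra_simps)
 show "d0 = d1" "d1 = d2" using 1 2 by algebra+
qed

lemma aut_twist:
 assumes f: "f \<in> bir_aut P2 J_fol"
 obtains \<Phi> d c0 c1 c2 a b S where "form_tuple d \<Phi>" "!!i. vars_le 2 (\<Phi> i)" "!!i. 2 < i ==> \<Phi> i = 0" "f = rmap P2 \<Phi>" "tuple_on P2 \<Phi>"
  "c0 ~= 0" "c1 ~= 0" "c2 ~= 0" "vars_le 2 S" "S ~= 0"
  "!!q. (!!i. 2 < i ==> q i = 0) ==> peval q S ~= 0 ==> q 0 ~= 0 \<and> q 1 ~= 0 \<and> q 2 ~= 0 \<and>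
   (\<exists>k. k ~= 0 \<and> evals cov (twist c0 c1 c2 a b q) = (%i. k * evals \<Phi> (evals cov q) i))"
proof -
 have fb: "f \<in> birational_maps P2 P2" "pulls_back f P2 J_fol J_fol" using f by (auto simp: bir_aut_def)
 obtain d \<Phi> k s where \<Phi>: "form_tuple d \<Phi>" "!!i. vars_le 2 (\<Phi> i)" "!!i. 2 < i ==> \<Phi> i = 0" "f = rmap P2 \<Phi>" "tuple_on P2 \<Phi>"
  and s: "homogeneous k s" "vars_le 2 s" "s ~= 0"
  and cond: "!!p v. (!!i. 2 < i ==> p i = 0) ==> peval p s ~= 0 ==> (!!i. 2 < i ==> v i = 0) ==>
   Om p v = 0 \<longleftrightarrow> Om (evals \<Phi> p) (%i. dir_deriv p v (\<Phi> i)) = 0"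
  by (rule pulls_back_tuple[OF fb(2)]) blast
 have fdom: "dominant f P2 P2" by (rule birational_inverse[OF irr_P2 proj_closed_P2 irr_P2 proj_closed_P2 fb(1)])
 \<comment> \<open>A dominant map does not send the plane into a curve. The lift needs this for the
   cubic and for the coordinate lines.\<close>
 have nz: "psubst \<Phi> h ~= 0" if h: "homogeneous e h" "vars_le 2 h" "h ~= 0" for h e
 proof
  assume 0: "psubst \<Phi> h = 0"
  have "h = 0"
  proof (rule generic_P2_zero[OF h(1,2)])
   have "peval y h = 0" if "y \<in> P2" for y
   proof (rule dominant_form[OF irr_P2 irr_P2 fdom h(1) _ that])
    show "eventually (%p. peval (the (f p)) h = 0) (generic P2)"
     using generic_rmap[OF irr_P2 \<Phi>(5)]
    proof eventually_elim
     case (elim p)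
     then obtain i where i: "evals \<Phi> p i ~= 0" by blast
     have "peval (evals \<Phi> p) h = 0" using 0 unfolding peval_comp[symmetric] by simp
     then show ?case using elim peval_to_point_eq_0[OF h(1), of "evals \<Phi> p" i] i by (simp add: \<Phi>(4))
    qed
   qed
   then show "eventually (%p. peval p h = 0) (generic P2)" using generic_in[OF irr_P2] by (auto elim: eventually_mono)
  qed
  then show False using h(3) by simp
 qed
 have nzV: "\<Phi> i ~= 0" if "i \<le> 2" for i using nz[of "Suc 0" "Var i"] that by auto
 obtain G r where G: "!!i. vars_le 2 (G i)" "vars_le 2 r" "r ~= 0" "!!i. psubst G (cov i) = r * psubst cov (\<Phi> i)"
  "G 0 ~= 0" "G 1 ~= 0" "G 2 ~= 0" "eta_form lam G = 0" "eta_form (%_. 1) G = 0"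
  by (rule lift[OF \<Phi>(1,2,3) s(2,3) cond nz[OF homogeneous_cubic] nzV[of 0] nzV[of 1] nzV[of 2]]) (use irreducible_cubic in auto)
 obtain g m c where g: "g ~= 0" "vars_le 2 g" and Gm: "!!i. i \<le> 2 ==> G i = g * single (m i) (c i)" and c: "!!i. i \<le> 2 ==> c i ~= 0"
  and m: "!!i. i \<le> 2 ==> keys (m i) \<subseteq> {..2}"
  and wt: "weight lam (m 0) + w\<^sup>2 * weight lam (m 1) + w * weight lam (m 2) = 0"
  "weight (%_. 1) (m 0) + w\<^sup>2 * weight (%_. 1) (m 1) + w * weight (%_. 1) (m 2) = 0"
  by (rule monomial_map[of G, OF G(1,5-9)]) blast
 obtain a b where ab: "int (lookup (m 0) 0) = int (lookup (m 2) 0) + a"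
  "int (lookup (m 0) 1) = int (lookup (m 2) 1) + b"
  "int (lookup (m 0) 2) = int (lookup (m 2) 2) + (- a - b)"
  "int (lookup (m 1) 0) = int (lookup (m 2) 0) + (- b)"
  "int (lookup (m 1) 1) = int (lookup (m 2) 1) + (a + b)"
  "int (lookup (m 1) 2) = int (lookup (m 2) 2) + (- a)"
  using monomial_exponents[OF wt] by (smt (verit))
 show ?thesis
 proof (rule that[OF \<Phi> c[of 0] c[of 1] c[of 2], of "g * r * (Var 0 * Var 1 * Var 2)" a b])
  show "vars_le 2 (g * r * (Var 0 * Var 1 * Var 2))" "g * r * (Var 0 * Var 1 * Var 2) ~= 0" using g G by simp_all
  fix q assume q: "!!i. 2 < i ==> q i = 0" and S: "peval q (g * r * (Var 0 * Var 1 * Var 2)) ~= 0"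
  have q0: "q 0 ~= 0" "q 1 ~= 0" "q 2 ~= 0" and gr: "peval q g ~= 0" "peval q r ~= 0" using S by auto
  let ?M = "%i. mon q (m i)"
  have M: "?M i = q 0 ^ lookup (m i) 0 * q 1 ^ lookup (m i) 1 * q 2 ^ lookup (m i) 2" if "i \<le> 2" for i
   using mon_superset[OF _ m[OF that], of q] by (simp add: atMost_2)
  have shift: "x ^ n' = x ^ n * x powi k" if "int n' = int n + k" "x ~= 0" for x :: complex and n n' k
  proof -
   have "x powi int n' = x powi int n * x powi k" unfolding that(1) by (rule power_int_add) (use that(2) in simp)
   then show ?thesis by simp
  qed
  have M2: "?M 2 ~= 0" using q0 by (simp add: M)
  have tw: "(%i. ?M 2 * twist (c 0) (c 1) (c 2) a b q i) = vec3 (c 0 * ?M 0) (c 1 * ?M 1) (c 2 * ?M 2)"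
  proof -
   have "?M 2 * (q 0 powi a * q 1 powi b * q 2 powi (- a - b)) = ?M 0" "?M 2 * (q 0 powi (- b) * q 1 powi (a + b) * q 2 powi (- a)) = ?M 1"
    unfolding M[of 0, OF le0] M[of 1, OF one_le_numeral] M[of 2, OF order.refl] shift[OF ab(1) q0(1)] shift[OF ab(2) q0(2)] shift[OF ab(3) q0(3)]
     shift[OF ab(4) q0(1)] shift[OF ab(5) q0(2)] shift[OF ab(6) q0(3)] by (simp_all only: mult_ac)
   then show ?thesis unfolding twist_def scale_vec3 by (simp add: mult.left_commute)
  qed
  define \<kappa> where "\<kappa> = peval q g * ?M 2"
  have k0: "\<kappa> ~= 0" using gr M2 by (simp add: \<kappa>_def)
  have pG: "peval q (G i) = peval q g * (c i * ?M i)" if "i \<le> 2" for i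
   using Gm[OF that] by (simp add: insertion_single)
  have "evals cov (evals G q) = evals cov (%i. peval q g * vec3 (c 0 * ?M 0) (c 1 * ?M 1) (c 2 * ?M 2) i)"
   by (rule evals_cov_cong) (use pG[of 0] pG[of 1] pG[of 2] in \<open>simp_all only: evals_def vec3_simps le0 one_le_numeral order.refl simp_thms\<close>)
  also have "\<dots> = evals cov (%i. \<kappa> * twist (c 0) (c 1) (c 2) a b q i)" by (simp only: tw[symmetric] \<kappa>_def mult.assoc)
  also have "\<dots> = (%i. \<kappa> ^ 3 * evals cov (twist (c 0) (c 1) (c 2) a b q) i)" by (rule evals_scale[OF form_tuple_cov])
  finally have 1: "evals cov (evals G q) i = \<kappa> ^ 3 * evals cov (twist (c 0) (c 1) (c 2) a b q) i" for i by (rule fun_cong)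
  have 2: "evals cov (evals G q) i = peval q r * evals \<Phi> (evals cov q) i" for i
  proof -
   have "evals cov (evals G q) i = peval q (psubst G (cov i))" by (simp add: evals_def)
   then show ?thesis unfolding G(4) by (simp add: evals_def)
  qed
  have div: "x = r / k * y" if "k * x = r * y" "k ~= 0" for x y k r :: complex using that by (simp add: field_simps)
  have "evals cov (twist (c 0) (c 1) (c 2) a b q) = (%i. peval q r / \<kappa> ^ 3 * evals \<Phi> (evals cov q) i)"
  proof
   fix i
   have "\<kappa> ^ 3 * evals cov (twist (c 0) (c 1) (c 2) a b q) i = peval q r * evals \<Phi> (evals cov q) i"
    by (rule trans[OF 1[symmetric] 2])
   then show "evals cov (twist (c 0) (c 1) (c 2) a b q) i = peval q r / \<kappa> ^ 3 * evals \<Phi> (evals cov q) i"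
    using k0 by (intro div) simp_all
  qed
  moreover have "peval q r / \<kappa> ^ 3 ~= 0" using gr k0 by simp
  ultimately show "q 0 ~= 0 \<and> q 1 ~= 0 \<and> q 2 ~= 0 \<and> (\<exists>k. k ~= 0 \<and> evals cov (twist (c 0) (c 1) (c 2) a b q) = (%i. k * evals \<Phi> (evals cov q) i))"
   using q0 by blast
 qed simp_all
qed

end

subsection \<open>The six symmetries\<close>

definition sym_map :: "bool => nat => nat => mpoly" where
 "sym_map e k i = (if i \<le> 2 then (if e then J4 else Var) ((i + k) mod 3) else 0)"

definition dvec :: "complex => complex => complex => (nat => complex) => nat => complex" where
 "dvec d0 d1 d2 v = vec3 (d0 * v 0) (d1 * v 1) (d2 * v 2)"

text \<open>For \<open>e\<close> true this is the standard quadratic involution, the inversion of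
  the torus; it accounts for the sign of a unit of Z[w].\<close>

definition cremona :: "bool => (nat => complex) => nat => complex" where
 "cremona e q = (if e then vec3 (q 1 * q 2) (q 0 * q 2) (q 0 * q 1) else vec3 (q 0) (q 1) (q 2))"

definition rot :: "(nat => 'a::zero) => nat => 'a" where
 "rot q = vec3 (q 2) (q 0) (q 1)"

lemma norm_form_one:
 fixes a b :: int
 assumes "a\<^sup>2 + a * b + b\<^sup>2 = 1"
 shows "(a, b) \<in> {(1, 0), (- 1, 1), (0, - 1), (- 1, 0), (0, 1), (1, - 1)}"
proof -
 have *: "\<bar>y\<bar> \<le> 1" if "x\<^sup>2 + x * y + y\<^sup>2 = 1" for x y :: int
 proof (rule ccontr)
  assume "\<not> \<bar>y\<bar> \<le> 1"
  then have "2\<^sup>2 \<le> \<bar>y\<bar>\<^sup>2" by (intro power_mono) auto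
  moreover have "4 * (x\<^sup>2 + x * y + y\<^sup>2) = (2 * x + y)\<^sup>2 + 3 * y\<^sup>2" by (simp add: power2_eq_square algebra_simps)
  ultimately show False using that zero_le_power2[of "2 * x + y"] by simp
 qed
 have "b\<^sup>2 + b * a + a\<^sup>2 = 1" using assms by (simp add: algebra_simps)
 then have "\<bar>a\<bar> \<le> 1" by (rule *)
 moreover have "\<bar>b\<bar> \<le> 1" by (rule *[OF assms])
 ultimately have "a = - 1 \<or> a = 0 \<or> a = 1" "b = - 1 \<or> b = 0 \<or> b = 1" by auto
 then show ?thesis using assms by auto
qed

lemma psubst_torus_nz:
 assumes S: "vars_le 2 S" "S ~= 0"
  and D: "!!v :: nat => complex. v 0 ~= 0 ==> v 1 ~= 0 ==> v 2 ~= 0 ==> \<exists>q. evals D q 0 = v 0 \<and> evals D q 1 = v 1 \<and> evals D q 2 = v 2"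
 shows "psubst D S ~= 0"
proof
 assume 0: "psubst D S = 0"
 have "S = 0"
 proof (rule mpoly3_generic_zero[of S "Var 0 * Var 1 * Var 2"])
  fix v :: "nat => complex" assume v: "!!i. 2 < i ==> v i = 0" "peval v (Var 0 * Var 1 * Var 2) ~= 0"
  then obtain q where q: "evals D q 0 = v 0" "evals D q 1 = v 1" "evals D q 2 = v 2" using D[of v] by auto
  have "peval (evals D q) S = 0" using 0 unfolding peval_comp[symmetric] by simp
  then have "peval (trunc3 (evals D q)) S = 0" using S by (simp add: peval_trunc3)
  moreover have "trunc3 (evals D q) = v" unfolding trunc3_vec3 q using v(1) by (metis trunc3_id trunc3_vec3)
  ultimately show "peval v S = 0" by simp
 qed (use S in simp_all)
 then show False using S by simp
qed

lemma dvec_nz: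
 assumes "d0 ~= 0" "d1 ~= 0" "d2 ~= 0" "vars_le 2 S" "S ~= 0"
 obtains S' where "vars_le 2 S'" "S' ~= 0" "!!q. peval q S' = peval (dvec d0 d1 d2 q) S"
proof (rule that)
 let ?D = "vec3 (Const d0 * Var 0) (Const d1 * Var 1) (Const d2 * Var 2)"
 have ev: "evals ?D q = dvec d0 d1 d2 q" for q
  unfolding dvec_def by (rule vec3_eqI) (simp_all add: evals_def)
 show "vars_le 2 (psubst ?D S)"
 proof (rule vars_le_psubst)
  show "vars_le 2 (?D i)" for i by (cases "i \<le> 2") (auto dest!: cases_le2)
 qed
 show "peval q (psubst ?D S) = peval (dvec d0 d1 d2 q) S" for q by (simp only: peval_comp ev)
 show "psubst ?D S ~= 0"
 proof (rule psubst_torus_nz[OF assms(4,5)])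
  fix v :: "nat => complex"
  show "\<exists>q. evals ?D q 0 = v 0 \<and> evals ?D q 1 = v 1 \<and> evals ?D q 2 = v 2"
   unfolding ev by (rule exI[of _ "vec3 (v 0 / d0) (v 1 / d1) (v 2 / d2)"]) (use assms in \<open>simp add: dvec_def\<close>)
 qed
qed

lemma cremona_nz:
 assumes "vars_le 2 S" "S ~= 0"
 obtains S' where "vars_le 2 S'" "S' ~= 0" "!!q. peval q S' = peval (cremona e q) S"
proof (rule that)
 let ?D = "if e then vec3 (Var 1 * Var 2) (Var 0 * Var 2) (Var 0 * Var 1) else vec3 (Var 0) (Var 1) (Var 2)"
 have ev: "evals ?D q = cremona e q" for q
  unfolding cremona_def by (cases e) (auto simp: evals_def intro!: vec3_eqI)
 show "vars_le 2 (psubst ?D S)"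
 proof (rule vars_le_psubst)
  show "vars_le 2 (?D i)" for i by (cases "i \<le> 2") (auto dest!: cases_le2)
 qed
 show "peval q (psubst ?D S) = peval (cremona e q) S" for q by (simp only: peval_comp ev)
 show "psubst ?D S ~= 0"
 proof (rule psubst_torus_nz[OF assms])
  fix v :: "nat => complex" assume v: "v 0 ~= 0" "v 1 ~= 0" "v 2 ~= 0"
  define s where "s = csqrt (v 0 * v 1 * v 2)"
  have s: "s * s = v 0 * v 1 * v 2" using power2_csqrt[of "v 0 * v 1 * v 2"] by (simp add: s_def power2_eq_square)
  have "(s / v 1) * (s / v 2) = v 0" "(s / v 0) * (s / v 2) = v 1" "(s / v 0) * (s / v 1) = v 2"
   using v s by (simp_all add: field_simps)
  then show "\<exists>q. evals ?D q 0 = v 0 \<and> evals ?D q 1 = v 1 \<and> evals ?D q 2 = v 2"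
   unfolding ev by (intro exI[of _ "if e then vec3 (s / v 0) (s / v 1) (s / v 2) else v"]) (simp add: cremona_def)
 qed
qed

lemma rot_nz:
 assumes "vars_le 2 S" "S ~= 0"
 obtains S' where "vars_le 2 S'" "S' ~= 0" "!!q. peval q S' = peval (rot q) S"
proof (rule that)
 let ?D = "rot Var :: nat => mpoly"
 have ev: "evals ?D q = rot q" for q
  unfolding rot_def by (rule vec3_eqI) (simp_all add: evals_def)
 show "vars_le 2 (psubst ?D S)"
 proof (rule vars_le_psubst)
  show "vars_le 2 (?D i)" for i by (cases "i \<le> 2") (auto simp: rot_def dest!: cases_le2)
 qed
 show "peval q (psubst ?D S) = peval (rot q) S" for q by (simp only: peval_comp ev)
 show "psubst ?D S ~= 0"
 proof (rule psubst_torus_nz[OF assms])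
  fix v :: "nat => complex"
  show "\<exists>q. evals ?D q 0 = v 0 \<and> evals ?D q 1 = v 1 \<and> evals ?D q 2 = v 2"
   unfolding ev by (rule exI[of _ "vec3 (v 1) (v 2) (v 0)"]) (simp add: rot_def)
 qed
qed

text \<open>On the torus the kernel of a monomial map has as many elements as its norm n. For n = 0
  the map is constant, and otherwise a primitive n-th root of unity yields a kernel element,
  nontrivial unless n = 1.\<close>

lemma twist_kernel:
 fixes a b :: int
 assumes "a\<^sup>2 + a * b + b\<^sup>2 ~= 1"
 obtains z0 z1 where "z0 ~= 0" "z1 ~= 0" "\<not> (z0 = 1 \<and> z1 = 1)" "!!c0 c1 c2 q. twist c0 c1 c2 a b (dvec z0 z1 1 q) = twist c0 c1 c2 a b q"
proof -
 have tw: "twist c0 c1 c2 a b (dvec z0 z1 1 q) = twist c0 c1 c2 a b q"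
  if "z0 powi a * z1 powi b = 1" "z0 powi (- b) * z1 powi (a + b) = 1" for z0 z1 c0 c1 c2 q
 proof -
  have "(z0 * q 0) powi a * (z1 * q 1) powi b = (z0 powi a * z1 powi b) * (q 0 powi a * q 1 powi b)"
   "(z0 * q 0) powi (- b) * (z1 * q 1) powi (a + b) = (z0 powi (- b) * z1 powi (a + b)) * (q 0 powi (- b) * q 1 powi (a + b))"
   by (simp_all add: power_int_mult_distrib mult_ac)
  then show ?thesis unfolding that by (simp add: twist_def dvec_def)
 qed
 define n where "n = a\<^sup>2 + a * b + b\<^sup>2"
 have n4: "4 * n = (2 * a + b)\<^sup>2 + 3 * b\<^sup>2" by (simp add: n_def power2_eq_square algebra_simps)
 show ?thesis
 proof (cases "n = 0")
  case True
  then have "b = 0" "a = 0" using n4 by (simp_all add: sum_power2_eq_zero_iff add_nonneg_eq_0_iff)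
  then show ?thesis using that[of 2 1] tw[of 2 1] by simp
 next
  case False
  have "0 \<le> n" using n4 zero_le_power2[of "2 * a + b"] zero_le_power2[of b] by linarith
  then have n: "0 < n" using False by simp
  obtain z :: complex where z: "z ~= 0" "!!k. z powi k = 1 \<longleftrightarrow> n dvd k" using root_of_unity_powi[OF n] by blast
  show ?thesis
  proof (rule that)
   \<comment> \<open>The exponents a + b and b form a column of the adjugate of the exponent matrix,
     so applying the map gives the powers of z with exponents n and 0.\<close>
   show "z powi (a + b) ~= 0" "z powi b ~= 0" using z by simp_all
   show "\<not> (z powi (a + b) = 1 \<and> z powi b = 1)"
   proof
    assume "z powi (a + b) = 1 \<and> z powi b = 1"
    then have "n dvd a + b" and b: "n dvd b" using z by auto
    then have a: "n dvd a" by (simp add: dvd_add_left_iff)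
    have "n * n dvd a * a + a * b + b * b" using a b by (intro dvd_add mult_dvd_mono)
    then have "n * n dvd n * 1" by (simp add: n_def power2_eq_square)
    then have "n dvd 1" using n by (simp only: dvd_mult_cancel_left) simp
    then show False using n assms by (simp add: n_def)
   qed
   have "(a + b) * a + b * b = n" "(a + b) * (- b) + b * (a + b) = 0" by (simp_all add: n_def power2_eq_square algebra_simps)
   then have "z powi ((a + b) * a + b * b) = 1" "z powi ((a + b) * (- b) + b * (a + b)) = 1" using z by simp_all
   then have "(z powi (a + b)) powi a * (z powi b) powi b = 1" "(z powi (a + b)) powi (- b) * (z powi b) powi (a + b) = 1"
    using z(1) by (simp_all only: power_int_add power_int_mult disjI1 simp_thms)
   then show "twist c0 c1 c2 a b (dvec (z powi (a + b)) (z powi b) 1 q) = twist c0 c1 c2 a b q" for c0 c1 c2 q by (rule tw)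
  qed
 qed
qed

context cube_root_of_unity
begin

lemma evals_cov_rot: "evals cov (rot q) = (%i. w\<^sup>2 * evals cov q i)"
proof -
 have e: "peval (rot q) pa = peval q pa" "peval (rot q) pb = w\<^sup>2 * peval q pb" "peval (rot q) pc = w * peval q pc"
  unfolding peval_abc rot_def using w by (simp, simp_all, algebra+)
 show ?thesis unfolding evals_cov e scale_vec3 vec3_eq_iff using w by algebra
qed

text \<open>If the norm is not 1, a nontrivial diagonal D in the kernel gives the same value of f
  after the cover at q and at D q. Generic injectivity of f makes the cover agree at both, and then
  D is scalar; as one of its entries is 1, it is trivial.\<close>

lemma aut_unimodular:
 assumes f: "f \<in> birational_maps P2 P2"
  and \<Phi>: "form_tuple d \<Phi>" "f = rmap P2 \<Phi>" "tuple_on P2 \<Phi>"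
  and S: "vars_le 2 S" "S ~= 0"
  and cond: "!!q. (!!i. 2 < i ==> q i = 0) ==> peval q S ~= 0 ==>
   (\<exists>k. k ~= 0 \<and> evals cov (twist c0 c1 c2 a b q) = (%i. k * evals \<Phi> (evals cov q) i))"
 shows "a\<^sup>2 + a * b + b\<^sup>2 = 1"
proof (rule ccontr)
 assume "a\<^sup>2 + a * b + b\<^sup>2 ~= 1"
 then obtain z0 z1 where z: "z0 ~= 0" "z1 ~= 0" "\<not> (z0 = 1 \<and> z1 = 1)" "!!q. twist c0 c1 c2 a b (dvec z0 z1 1 q) = twist c0 c1 c2 a b q"
  using twist_kernel by metis
 obtain g where g: "eventually (%p. \<exists>y. f p = Some y \<and> g y = Some p) (generic P2)"
  by (rule birational_inverse[OF irr_P2 proj_closed_P2 irr_P2 proj_closed_P2 f]) blast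
 have "eventually (%p. (\<exists>y. f p = Some y \<and> g y = Some p) \<and> (\<exists>i. evals \<Phi> p i ~= 0) \<and> f p = Some (to_point (evals \<Phi> p))) (generic P2)"
  using g generic_rmap[OF irr_P2 \<Phi>(3)] by eventually_elim (simp add: \<Phi>(2))
 from generic_cov[OF this] obtain S1 where S1: "vars_le 2 S1" "S1 ~= 0"
  "!!q. (!!i. 2 < i ==> q i = 0) ==> peval q S1 ~= 0 ==> evals cov q 0 ~= 0 \<and> to_point (evals cov q) \<in> P2 \<and>
    (\<exists>y. f (to_point (evals cov q)) = Some y \<and> g y = Some (to_point (evals cov q))) \<and>
    (\<exists>i. evals \<Phi> (to_point (evals cov q)) i ~= 0) \<and> f (to_point (evals cov q)) = Some (to_point (evals \<Phi> (to_point (evals cov q))))"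
  by metis
 let ?tw = "%q. evals cov (twist c0 c1 c2 a b q)"
 have val: "f (to_point (evals cov q)) = Some (to_point (?tw q))"
  if q: "!!i. 2 < i ==> q i = 0" "peval q S ~= 0" "peval q S1 ~= 0" for q
 proof -
  note 1 = S1(3)[OF q(1,3)]
  obtain k where k: "k ~= 0" "?tw q = (%i. k * evals \<Phi> (evals cov q) i)" using cond[OF q(1,2)] by blast
  have "evals cov q 0 ~= 0" using 1 by blast
  then obtain l where l: "l ~= 0" "evals \<Phi> (to_point (evals cov q)) = (%i. l * evals \<Phi> (evals cov q) i)"
   using evals_to_point[OF \<Phi>(1), of "evals cov q" 0] by blast
  have "to_point (?tw q) = to_point (evals \<Phi> (to_point (evals cov q)))"
   unfolding k(2) l(2) using k(1) l(1) by simp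
  then show ?thesis using 1 by simp
 qed
 have SS: "vars_le 2 (S * S1)" "S * S1 ~= 0" using S S1 by simp_all
 obtain S2 where S2: "vars_le 2 S2" "S2 ~= 0" "!!q. peval q S2 = peval (dvec z0 z1 1 q) (S * S1)"
  using dvec_nz[OF z(1,2) one_neq_zero SS] by blast
 have "z0 = z1 \<and> z1 = 1"
 proof -
  have *: "par (evals cov (vec3 (z0 * q 0) (z1 * q 1) (1 * q 2))) (evals cov q)"
   if q: "!!i. 2 < i ==> q i = 0" "peval q (S * S1 * S2) ~= 0" for q
  proof -
   let ?q = "dvec z0 z1 1 q"
   have q': "!!i. 2 < i ==> ?q i = 0" by (simp add: dvec_def)
   have nz: "peval q S ~= 0" "peval q S1 ~= 0" "peval ?q S ~= 0" "peval ?q S1 ~= 0" using q(2) by (simp_all add: S2(3))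
   have "f (to_point (evals cov q)) = f (to_point (evals cov ?q))"
    using val[OF q(1) nz(1,2)] val[OF q' nz(3,4)] z(4) by simp
   then have "to_point (evals cov q) = to_point (evals cov ?q)"
    using S1(3)[OF q(1) nz(2)] S1(3)[OF q' nz(4)] by (metis option.inject)
   then have "par (to_point (evals cov q)) (evals cov ?q)" by (metis par_to_point(2))
   moreover have "to_point (evals cov q) 0 ~= 0" using S1(3)[OF q(1) nz(2)] to_point_nz[of "evals cov q" 0] by blast
   ultimately have "par (evals cov q) (evals cov ?q)" using par_trans[of "evals cov q" "to_point (evals cov q)" "evals cov ?q" 0] by simp
   then show ?thesis unfolding dvec_def by (rule par_sym)
  qed
  have "vars_le 2 (S * S1 * S2)" "S * S1 * S2 ~= 0" using S S1 S2 by simp_all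
  then show ?thesis using twist_invariance_const[OF z(1,2) one_neq_zero _ _ *] by blast
 qed
 then show False using z(3) by simp
qed

text \<open>The six elements of norm 1 are plus or minus a power of w. The sign is the Cremona
  involution, and a power of w acts as a rotation of the coordinates, which the cover absorbs up to
  a scalar factor.\<close>

lemma twist_unit:
 assumes "a\<^sup>2 + a * b + b\<^sup>2 = 1" and c: "c0 ~= 0" "c1 ~= 0" "c2 ~= 0"
 obtains e d0 d1 d2 where "d0 ~= 0" "d1 ~= 0" "d2 ~= 0"
  "!!q. q 0 ~= 0 ==> q 1 ~= 0 ==> q 2 ~= 0 ==>
   \<exists>k. k ~= 0 \<and> evals cov (dvec d0 d1 d2 (cremona e q)) = (%i. k * evals cov (twist c0 c1 c2 a b q) i)"
proof -
 have scal: "\<exists>k. k ~= 0 \<and> evals cov v = (%i. k * evals cov u i)" if "v = (%i. l * u i)" "l ~= 0" for u v :: "nat => complex" and l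
  using that evals_scale[OF form_tuple_cov, of l u] by (intro exI[of _ "l ^ 3"]) simp
 have "w * w\<^sup>2 = 1" using w3 by (simp add: power3_eq_cube power2_eq_square mult.assoc)
 then have ww: "w * (w\<^sup>2 * x) = x" for x by (simp flip: mult.assoc)
 have rsc: "\<exists>k. k ~= 0 \<and> evals cov v = (%i. k * evals cov u i)" if "rot v = (%i. l * u i)" "l ~= 0" for u v :: "nat => complex" and l
 proof -
  have "evals cov v = (%i. w * evals cov (rot v) i)" unfolding evals_cov_rot ww ..
  then have "evals cov v = (%i. w * l ^ 3 * evals cov u i)" by (simp only: that(1) evals_scale[OF form_tuple_cov, of l u] mult.assoc)
  moreover have "w * l ^ 3 ~= 0" using that(2) by simp
  ultimately show ?thesis by blast
 qed
 have rrsc: "\<exists>k. k ~= 0 \<and> evals cov v = (%i. k * evals cov u i)" if rr: "rot (rot v) = (%i. l * u i)" "l ~= 0" for u v :: "nat => complex" and l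
 proof -
  obtain k where k: "k ~= 0" "evals cov (rot v) = (%i. k * evals cov u i)" using rsc[OF rr] by blast
  have "evals cov v = (%i. w * evals cov (rot v) i)" unfolding evals_cov_rot ww ..
  then have "evals cov v = (%i. w * k * evals cov u i)" by (simp only: k(2) mult.assoc)
  moreover have "w * k ~= 0" using k(1) by simp
  ultimately show ?thesis by blast
 qed
 note defs = dvec_def cremona_def rot_def twist_def
 from norm_form_one[OF assms(1)] consider "a = 1 \<and> b = 0" | "a = - 1 \<and> b = 1" | "a = 0 \<and> b = - 1" | "a = - 1 \<and> b = 0" | "a = 0 \<and> b = 1" | "a = 1 \<and> b = - 1"
  by auto
 then show ?thesis
 proof cases
  case 1
  have "\<exists>k. k ~= 0 \<and> evals cov (dvec c0 c1 c2 (cremona False q)) = (%i. k * evals cov (twist c0 c1 c2 a b q) i)"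
   if "q 0 ~= 0" "q 1 ~= 0" "q 2 ~= 0" for q
   by (rule scal[of _ "q 2"]) (use that 1 in \<open>simp_all add: defs\<close>)
  then show ?thesis using that[of c0 c1 c2 False] c by blast
 next
  case 2
  have "\<exists>k. k ~= 0 \<and> evals cov (dvec c2 c0 c1 (cremona False q)) = (%i. k * evals cov (twist c0 c1 c2 a b q) i)"
   if "q 0 ~= 0" "q 1 ~= 0" "q 2 ~= 0" for q
   by (rule rrsc[of _ "q 0"]) (use that 2 in \<open>simp_all add: defs\<close>)
  then show ?thesis using that[of c2 c0 c1 False] c by blast
 next
  case 3
  have "\<exists>k. k ~= 0 \<and> evals cov (dvec c1 c2 c0 (cremona False q)) = (%i. k * evals cov (twist c0 c1 c2 a b q) i)"
   if "q 0 ~= 0" "q 1 ~= 0" "q 2 ~= 0" for q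
   by (rule rsc[of _ "q 1"]) (use that 3 in \<open>simp_all add: defs\<close>)
  then show ?thesis using that[of c1 c2 c0 False] c by blast
 next
  case 4
  have "\<exists>k. k ~= 0 \<and> evals cov (dvec c0 c1 c2 (cremona True q)) = (%i. k * evals cov (twist c0 c1 c2 a b q) i)"
   if "q 0 ~= 0" "q 1 ~= 0" "q 2 ~= 0" for q
   by (rule scal[of _ "q 0 * q 1"]) (use that 4 in \<open>simp_all add: defs\<close>)
  then show ?thesis using that[of c0 c1 c2 True] c by blast
 next
  case 5
  have "\<exists>k. k ~= 0 \<and> evals cov (dvec c1 c2 c0 (cremona True q)) = (%i. k * evals cov (twist c0 c1 c2 a b q) i)"
   if "q 0 ~= 0" "q 1 ~= 0" "q 2 ~= 0" for q
   by (rule rsc[of _ "q 0 * q 2"]) (use that 5 in \<open>simp_all add: defs\<close>)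
  then show ?thesis using that[of c1 c2 c0 True] c by blast
 next
  case 6
  have "\<exists>k. k ~= 0 \<and> evals cov (dvec c2 c0 c1 (cremona True q)) = (%i. k * evals cov (twist c0 c1 c2 a b q) i)"
   if "q 0 ~= 0" "q 1 ~= 0" "q 2 ~= 0" for q
   by (rule rrsc[of _ "q 1 * q 2"]) (use that 6 in \<open>simp_all add: defs\<close>)
  then show ?thesis using that[of c2 c0 c1 True] c by blast
 qed
qed

end

lemma three_cases: "(k::nat) mod 3 = 0 \<or> k mod 3 = 1 \<or> k mod 3 = 2"
 by presburger

lemma form_tuple_sym_map: "form_tuple (if e then 4 else Suc 0) (sym_map e k)"
 using form_tuple_J4 by (auto simp: form_tuple_def sym_map_def)

lemma vars_le_sym_map [simp]: "vars_le 2 (sym_map e k i)"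
proof -
 have "(i + k) mod 3 \<le> 2" using mod_less_divisor[of 3 "i + k"] by linarith
 then show ?thesis by (auto simp: sym_map_def)
qed

lemma sym_map_beyond [simp]: "2 < i ==> sym_map e k i = 0"
 by (simp add: sym_map_def)

definition cyc_vec :: "nat => (nat => complex) => nat => complex" where
 "cyc_vec k p = (%i. if i \<le> 2 then p ((i + k) mod 3) else 0)"

lemma evals_sym_map: "evals (sym_map e k) p = cyc_vec k (if e then evals J4 p else p)"
 by (auto simp: evals_def sym_map_def cyc_vec_def)

lemma cyc_vec_scale: "cyc_vec k (%i. c * p i) = (%i. c * cyc_vec k p i)"
 by (auto simp: cyc_vec_def)

lemma cyc_vec_cyc_vec: "cyc_vec k (cyc_vec l p) = cyc_vec ((k + l) mod 3) p"
proof
 fix i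
 have "(i + k) mod 3 \<le> 2" using mod_less_divisor[of 3 "i + k"] by linarith
 moreover have "((i + k) mod 3 + l) mod 3 = (i + (k + l) mod 3) mod 3" by presburger
 ultimately show "cyc_vec k (cyc_vec l p) i = cyc_vec ((k + l) mod 3) p i" by (simp add: cyc_vec_def)
qed

lemma cyc_vec_mod: "cyc_vec (k mod 3) p = cyc_vec k p"
proof -
 have "(i + k mod 3) mod 3 = (i + k) mod 3" for i by presburger
 then show ?thesis by (simp add: cyc_vec_def fun_eq_iff)
qed

lemma cyc_vec_vec3:
 "k mod 3 = 0 ==> cyc_vec k p = vec3 (p 0) (p 1) (p 2)"
 "k mod 3 = 1 ==> cyc_vec k p = vec3 (p 1) (p 2) (p 0)"
 "k mod 3 = 2 ==> cyc_vec k p = vec3 (p 2) (p 0) (p 1)"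
proof -
 have *: "cyc_vec m p = vec3 (p m) (p ((1 + m) mod 3)) (p ((2 + m) mod 3))" if "m < 3" for m
  by (rule vec3_eqI) (use that in \<open>simp_all add: cyc_vec_def\<close>)
 show "k mod 3 = 0 ==> cyc_vec k p = vec3 (p 0) (p 1) (p 2)" "k mod 3 = 1 ==> cyc_vec k p = vec3 (p 1) (p 2) (p 0)"
  "k mod 3 = 2 ==> cyc_vec k p = vec3 (p 2) (p 0) (p 1)"
  using *[of 0] *[of 1] *[of 2] cyc_vec_mod[of k p] by (simp_all add: numeral_2_eq_2[symmetric])
qed

lemma evals_J4: "evals J4 p = vec3 (p 1 * (p 1 - p 2) * (p 2 - p 0)\<^sup>2) (p 0 * (p 0 - p 1) * (p 1 - p 2)\<^sup>2) (p 2 * (p 2 - p 0) * (p 0 - p 1)\<^sup>2)"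
 by (rule vec3_eqI) (simp_all add: evals_def J4_simps)

text \<open>Modulo 3 the shift 2 l is -l: J4 conjugates the rotation to its inverse, which is the
  dihedral relation among the six maps.\<close>

lemma evals_J4_cyc_vec: "evals J4 (cyc_vec l p) = cyc_vec (2 * l) (evals J4 p)"
proof -
 have "l mod 3 = 0 ==> (2 * l) mod 3 = 0" "l mod 3 = 1 ==> (2 * l) mod 3 = 2" "l mod 3 = 2 ==> (2 * l) mod 3 = 1" by presburger+
 then show ?thesis using three_cases[of l] by (elim disjE) (simp_all add: cyc_vec_vec3 evals_J4)
qed

lemma evals_sym_map_comp:
 assumes "p \<in> P2"
 shows "evals (sym_map e k) (evals (sym_map e' l) p) =
  (%i. (if e \<and> e' then peval p J4_factor else 1) * evals (sym_map (e ~= e') ((k + (if e then 2 * l else l)) mod 3)) p i)"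
 by (cases e; cases e') (simp_all add: evals_sym_map evals_J4_cyc_vec cyc_vec_cyc_vec J4_J4[OF assms] cyc_vec_scale)

text \<open>The point (1:2:4) lies off the cubic and off the lines where two coordinates agree, so
  all six maps and their composites are given there by their defining tuples.\<close>

lemma sym_base_point: "evals (sym_map e k) (vec3 1 2 4) 0 ~= 0"
 using three_cases[of k] by (cases e; elim disjE) (simp_all add: evals_sym_map cyc_vec_vec3 evals_J4)

lemma tuple_on_sym_map: "tuple_on P2 (sym_map e k)"
 unfolding tuple_on_def using form_tuple_sym_map sym_base_point vec3_in_P2(4)[of 2 4] unfolding evals_def by blast

context cube_root_of_unity
begin

text \<open>The three linear forms at the inverted point are (a^2 - bc)/3, (c^2 - ab)/3 and (b^2 -
  ca)/3. The same expressions appear in the differences of coordinates entering J4, for instance b^2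
  c - c^2 a = c (b^2 - ca). Thus J4 lifts to the Cremona involution, up to one rotation.\<close>

lemma J4_cov: "evals J4 (evals cov q) = (%i. 27 * (peval q pa * peval q pb * peval q pc)\<^sup>2 * cyc_vec 1 (evals cov (cremona True q)) i)"
proof -
 let ?a = "peval q pa" and ?b = "peval q pb" and ?c = "peval q pc" and ?v = "cremona True q"
 have 1: "3 * peval ?v pa = ?a\<^sup>2 - ?b * ?c" "3 * peval ?v pb = ?c\<^sup>2 - ?a * ?b" "3 * peval ?v pc = ?b\<^sup>2 - ?c * ?a"
  unfolding peval_abc cremona_def using w by (simp_all, algebra+)
 have alg: "(b\<^sup>2 * c) * (b\<^sup>2 * c - c\<^sup>2 * a) * (c\<^sup>2 * a - a\<^sup>2 * b)\<^sup>2 = 27 * (a * b * c)\<^sup>2 * (b'\<^sup>2 * c')"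
   "(a\<^sup>2 * b) * (a\<^sup>2 * b - b\<^sup>2 * c) * (b\<^sup>2 * c - c\<^sup>2 * a)\<^sup>2 = 27 * (a * b * c)\<^sup>2 * (c'\<^sup>2 * a')"
   "(c\<^sup>2 * a) * (c\<^sup>2 * a - a\<^sup>2 * b) * (a\<^sup>2 * b - b\<^sup>2 * c)\<^sup>2 = 27 * (a * b * c)\<^sup>2 * (a'\<^sup>2 * b')"
  if "3 * a' = a\<^sup>2 - b * c" "3 * b' = c\<^sup>2 - a * b" "3 * c' = b\<^sup>2 - c * a" for a b c a' b' c' :: complex
 proof -
  have d: "b\<^sup>2 * c - c\<^sup>2 * a = c * (3 * c')" "c\<^sup>2 * a - a\<^sup>2 * b = a * (3 * b')" "a\<^sup>2 * b - b\<^sup>2 * c = b * (3 * a')"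
   unfolding that by (simp_all add: power2_eq_square algebra_simps)
  show "(b\<^sup>2 * c) * (b\<^sup>2 * c - c\<^sup>2 * a) * (c\<^sup>2 * a - a\<^sup>2 * b)\<^sup>2 = 27 * (a * b * c)\<^sup>2 * (b'\<^sup>2 * c')"
   "(a\<^sup>2 * b) * (a\<^sup>2 * b - b\<^sup>2 * c) * (b\<^sup>2 * c - c\<^sup>2 * a)\<^sup>2 = 27 * (a * b * c)\<^sup>2 * (c'\<^sup>2 * a')"
   "(c\<^sup>2 * a) * (c\<^sup>2 * a - a\<^sup>2 * b) * (a\<^sup>2 * b - b\<^sup>2 * c)\<^sup>2 = 27 * (a * b * c)\<^sup>2 * (a'\<^sup>2 * b')"
   unfolding d by (simp_all add: power2_eq_square algebra_simps)
 qed
 have c1: "cyc_vec 1 (vec3 x y z) = vec3 y z x" for x y z by (subst cyc_vec_vec3(2)) simp_all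
 show ?thesis
  unfolding evals_cov evals_J4 c1 scale_vec3 vec3_eq_iff using alg[OF 1] by simp
qed

text \<open>The diagonal map with entries 1, z, z^2 permutes the three characters cyclically, so
  downstairs it is a cyclic permutation of the coordinates.\<close>

lemma cov_root_shift:
 assumes "z ^ 3 = 1"
 obtains j where "!!v. evals cov (dvec 1 z (z\<^sup>2) v) = cyc_vec j (evals cov v)"
proof -
 have "(z - 1) * (z - w) * (z - w\<^sup>2) = 0" using assms w by algebra
 then consider "z = 1" | "z = w" | "z = w\<^sup>2" by auto
 then show ?thesis
 proof cases
  case 1
  then show ?thesis by (intro that[of 0]) (simp add: cyc_vec_vec3 dvec_def evals_cov peval_abc)
 next
  case 2
  have "peval (dvec 1 w (w\<^sup>2) v) pa = peval v pc" "peval (dvec 1 w (w\<^sup>2) v) pb = peval v pa" "peval (dvec 1 w (w\<^sup>2) v) pc = peval v pb" for v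
   unfolding peval_abc dvec_def using w by (simp_all, algebra+)
  then show ?thesis using 2 by (intro that[of 2]) (simp add: cyc_vec_vec3 evals_cov)
 next
  case 3
  have "peval (dvec 1 (w\<^sup>2) ((w\<^sup>2)\<^sup>2) v) pa = peval v pb" "peval (dvec 1 (w\<^sup>2) ((w\<^sup>2)\<^sup>2) v) pb = peval v pc" "peval (dvec 1 (w\<^sup>2) ((w\<^sup>2)\<^sup>2) v) pc = peval v pa" for v
   unfolding peval_abc dvec_def using w by (simp_all, algebra+)
  then show ?thesis using 3 by (intro that[of 1]) (simp add: cyc_vec_vec3 evals_cov)
 qed
qed

text \<open>The diagonal map with entries d1/d0, d2/d1, d0/d2 leaves the cover invariant, so the
  three ratios are equal. Their product is 1, hence the common value is a cube root of
  unity.\<close>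

lemma rotation_invariance:
 assumes d: "d0 ~= 0" "d1 ~= 0" "d2 ~= 0" and S: "vars_le 2 S" "S ~= 0"
  and par: "!!v. (!!i. 2 < i ==> v i = 0) ==> peval v S ~= 0 ==> par (evals cov (dvec d1 d2 d0 v)) (evals cov (dvec d0 d1 d2 v))"
 obtains z where "z ^ 3 = 1" "d1 = z * d0" "d2 = z\<^sup>2 * d0"
proof -
 obtain S' where S': "vars_le 2 S'" "S' ~= 0" "!!q. peval q S' = peval (dvec (1 / d0) (1 / d1) (1 / d2) q) S"
  by (rule dvec_nz[of "1 / d0" "1 / d1" "1 / d2" S]) (use d S in auto)
 have *: "par (evals cov (vec3 (d1 / d0 * q 0) (d2 / d1 * q 1) (d0 / d2 * q 2))) (evals cov q)"
  if q: "!!i. 2 < i ==> q i = 0" "peval q S' ~= 0" for q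
 proof -
  let ?v = "dvec (1 / d0) (1 / d1) (1 / d2) q"
  have "par (evals cov (dvec d1 d2 d0 ?v)) (evals cov (dvec d0 d1 d2 ?v))"
   by (rule par) (use q(2) in \<open>simp_all add: S'(3) dvec_def\<close>)
  moreover have "evals cov (dvec d0 d1 d2 ?v) = evals cov q" by (rule evals_cov_cong) (use d in \<open>simp_all add: dvec_def\<close>)
  moreover have "dvec d1 d2 d0 ?v = vec3 (d1 / d0 * q 0) (d2 / d1 * q 1) (d0 / d2 * q 2)" by (simp add: dvec_def)
  ultimately show ?thesis by simp
 qed
 have "d1 / d0 ~= 0" "d2 / d1 ~= 0" "d0 / d2 ~= 0" using d by auto
 note 1 = twist_invariance_const[OF this S'(1,2) *]
 show ?thesis
 proof (rule that[of "d1 / d0"])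
  show "d1 = d1 / d0 * d0" using d by simp
  have "d2 = d1 / d0 * d1" using 1(1) d by (simp add: field_simps)
  then show 2: "d2 = (d1 / d0)\<^sup>2 * d0" using d by (simp add: power2_eq_square)
  have "d0 = d0 / d2 * d2" using d by simp
  also have "d0 / d2 = d1 / d0" using 1 by simp
  finally have "d0 = d1 / d0 * d2" .
  with 2 have "d0 * 1 = d1 / d0 * ((d1 / d0)\<^sup>2 * d0)" by (metis mult_1_right)
  also have "\<dots> = d0 * (d1 / d0) ^ 3" unfolding power2_eq_square power3_eq_cube by (simp only: mult_ac)
  finally have "d0 * 1 = d0 * (d1 / d0) ^ 3" .
  then show "(d1 / d0) ^ 3 = 1" using d(1) by (simp only: mult_cancel_left) simp
 qed
qed

lemma par_cov_transfer:
 assumes v: "!!i. vars_le 2 (\<Phi> i)" "!!i. vars_le 2 (\<Psi> i)" and S: "vars_le 2 S" "S ~= 0"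
  and par: "!!q. (!!i. 2 < i ==> q i = 0) ==> peval q S ~= 0 ==> par (evals \<Phi> (evals cov q)) (evals \<Psi> (evals cov q))"
 shows "par (evals \<Phi> p) (evals \<Psi> p)"
 unfolding par_def
proof (intro allI)
 fix i j
 let ?R = "\<Phi> i * \<Psi> j - \<Phi> j * \<Psi> i"
 have vR: "vars_le 2 ?R" using v by simp
 have "psubst cov ?R = 0"
 proof (rule mpoly3_generic_zero[OF _ S])
  show "vars_le 2 (psubst cov ?R)" by (rule vars_le_psubst) simp
  fix q :: "nat => complex" assume "!!i. 2 < i ==> q i = 0" "peval q S ~= 0"
  then have "par (evals \<Phi> (evals cov q)) (evals \<Psi> (evals cov q))" by (rule par)
  then have "evals \<Phi> (evals cov q) i * evals \<Psi> (evals cov q) j = evals \<Phi> (evals cov q) j * evals \<Psi> (evals cov q) i" unfolding par_def by blast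
  then show "peval q (psubst cov ?R) = 0" unfolding peval_comp by (simp add: evals_def[of \<Phi>] evals_def[of \<Psi>])
 qed
 then have "?R = 0" by (rule psubst_cov_eq_0[OF vR])
 then have "peval p ?R = 0" by (simp only: insertion_0)
 then show "evals \<Phi> p i * evals \<Psi> p j = evals \<Phi> p j * evals \<Psi> p i" by (simp add: evals_def)
qed

lemma aut_classification:
 assumes f: "f \<in> bir_aut P2 J_fol" shows "\<exists>e k. f = rmap P2 (sym_map e k)"
proof -
 obtain \<Phi> d c0 c1 c2 a b S where \<Phi>: "form_tuple d \<Phi>" "!!i. vars_le 2 (\<Phi> i)" "!!i. 2 < i ==> \<Phi> i = 0" "f = rmap P2 \<Phi>" "tuple_on P2 \<Phi>"
  and c: "c0 ~= 0" "c1 ~= 0" "c2 ~= 0" and S: "vars_le 2 S" "S ~= 0"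
  and tw: "!!q. (!!i. 2 < i ==> q i = 0) ==> peval q S ~= 0 ==> q 0 ~= 0 \<and> q 1 ~= 0 \<and> q 2 ~= 0 \<and>
   (\<exists>k. k ~= 0 \<and> evals cov (twist c0 c1 c2 a b q) = (%i. k * evals \<Phi> (evals cov q) i))"
  by (rule aut_twist[OF f]) blast
 have fb: "f \<in> birational_maps P2 P2" using f by (simp add: bir_aut_def)
 have ab: "a\<^sup>2 + a * b + b\<^sup>2 = 1" by (rule aut_unimodular[OF fb \<Phi>(1,4,5) S]) (use tw in blast)
 obtain e d0 d1 d2 where dd: "d0 ~= 0" "d1 ~= 0" "d2 ~= 0"
  and un: "!!q. q 0 ~= 0 ==> q 1 ~= 0 ==> q 2 ~= 0 ==>
   \<exists>k. k ~= 0 \<and> evals cov (dvec d0 d1 d2 (cremona e q)) = (%i. k * evals cov (twist c0 c1 c2 a b q) i)"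
  by (rule twist_unit[OF ab c]) blast
 have 1: "\<exists>k. k ~= 0 \<and> evals cov (dvec d0 d1 d2 (cremona e q)) = (%i. k * evals \<Phi> (evals cov q) i)"
  if q: "!!i. 2 < i ==> q i = 0" "peval q S ~= 0" for q
 proof -
  note t = tw[OF q]
  obtain k where k: "k ~= 0" "evals cov (twist c0 c1 c2 a b q) = (%i. k * evals \<Phi> (evals cov q) i)" using t by blast
  obtain l where l: "l ~= 0" "evals cov (dvec d0 d1 d2 (cremona e q)) = (%i. l * evals cov (twist c0 c1 c2 a b q) i)" using un[of q] t by blast
  show ?thesis unfolding l(2) k(2) using l(1) k(1) by (intro exI[of _ "l * k"]) simp
 qed
 obtain S' where S': "vars_le 2 S'" "S' ~= 0" "!!q. peval q S' = peval (rot q) S" using rot_nz[OF S] by blast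
 have "vars_le 2 (S * S')" "S * S' ~= 0" using S S' by simp_all
 then obtain S3 where S3: "vars_le 2 S3" "S3 ~= 0" "!!q. peval q S3 = peval (cremona e q) (S * S')" using cremona_nz by blast
 \<comment> \<open>The cover does not distinguish q from its rotation, hence neither does \<Phi>
   after the cover. Comparing the lifted map at both points rotates the diagonal entries.\<close>
 have par_rot: "par (evals cov (dvec d1 d2 d0 v)) (evals cov (dvec d0 d1 d2 v))"
  if v: "!!i. 2 < i ==> v i = 0" "peval v (S3 * (Var 0 * Var 1 * Var 2)) ~= 0" for v
 proof -
  define q where "q = cremona e v"
  have q: "!!i. 2 < i ==> q i = 0" "!!i. 2 < i ==> rot q i = 0" by (auto simp: q_def cremona_def rot_def)
  have nz: "peval q S ~= 0" "peval (rot q) S ~= 0" using v(2) by (auto simp: S3(3) S'(3) q_def)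
  \<comment> \<open>Applying the Cremona involution twice multiplies a vector by the product of its
    coordinates.\<close>
  define t where "t = (if e then v 0 * v 1 * v 2 else 1)"
  have t0: "t ~= 0" using v(2) by (auto simp: t_def)
  have uq: "cremona e q = (%i. t * v i)"
  proof -
   have "(%i. t * v i) = vec3 (t * v 0) (t * v 1) (t * v 2)" by (rule vec3_eqI) (simp_all add: v(1))
   then show ?thesis by (simp add: q_def cremona_def t_def)
  qed
  have ur: "cremona e (rot q) = rot (cremona e q)" by (simp add: cremona_def rot_def mult.commute)
  have dr: "dvec d0 d1 d2 (rot x) = rot (dvec d1 d2 d0 x)" for x by (simp add: dvec_def rot_def)
  have dt: "dvec x y z (%i. t * v i) = (%i. t * dvec x y z v i)" for x y z by (simp add: dvec_def mult.left_commute)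
  obtain k where k: "k ~= 0" "evals cov (dvec d0 d1 d2 (cremona e q)) = (%i. k * evals \<Phi> (evals cov q) i)" using 1[OF q(1) nz(1)] by blast
  obtain l where l: "l ~= 0" "evals cov (dvec d0 d1 d2 (cremona e (rot q))) = (%i. l * evals \<Phi> (evals cov (rot q)) i)" using 1[OF q(2) nz(2)] by blast
  have "(%i. w\<^sup>2 * (t ^ 3 * evals cov (dvec d1 d2 d0 v) i)) = (%i. l * ((w\<^sup>2) ^ d * evals \<Phi> (evals cov q) i))"
   using l(2) unfolding ur dr evals_cov_rot uq dt evals_scale[OF form_tuple_cov] evals_scale[OF \<Phi>(1)] .
  then have A: "w\<^sup>2 * (t ^ 3 * evals cov (dvec d1 d2 d0 v) i) = l * ((w\<^sup>2) ^ d * evals \<Phi> (evals cov q) i)" for i by (rule fun_cong)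
  have "(%i. t ^ 3 * evals cov (dvec d0 d1 d2 v) i) = (%i. k * evals \<Phi> (evals cov q) i)"
   using k(2) unfolding uq dt evals_scale[OF form_tuple_cov] .
  then have B: "t ^ 3 * evals cov (dvec d0 d1 d2 v) i = k * evals \<Phi> (evals cov q) i" for i by (rule fun_cong)
  have alg: "x * y' = x' * y" if "r * (s * x) = m * (n * f)" "s * y = k * f" "r * (s * x') = m * (n * f')" "s * y' = k * f'" "r ~= 0" "s ~= 0"
   for x y x' y' r s m n f f' k :: complex
  proof -
   have "(r * (s * x)) * (s * y') = (r * (s * x')) * (s * y)" unfolding that by simp
   then have "(r * s * s) * (x * y') = (r * s * s) * (x' * y)" by (simp add: mult_ac)
   then show ?thesis using that(5,6) by simp
  qed
  show ?thesis unfolding par_def by (intro allI alg[OF A B A B]) (use t0 in auto)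
 qed
 have "vars_le 2 (S3 * (Var 0 * Var 1 * Var 2))" "S3 * (Var 0 * Var 1 * Var 2) ~= 0" using S3 by simp_all
 then obtain z where z: "z ^ 3 = 1" "d1 = z * d0" "d2 = z\<^sup>2 * d0" using rotation_invariance[OF dd _ _ par_rot] by blast
 obtain j where j: "!!v. evals cov (dvec 1 z (z\<^sup>2) v) = cyc_vec j (evals cov v)" using cov_root_shift[OF z(1)] by blast
 have dj: "evals cov (dvec d0 d1 d2 v) = (%i. d0 ^ 3 * cyc_vec j (evals cov v) i)" for v
 proof -
  have "dvec d0 d1 d2 v = (%i. d0 * dvec 1 z (z\<^sup>2) v i)" by (simp add: dvec_def z mult_ac)
  then show ?thesis using j by (simp add: evals_scale[OF form_tuple_cov])
 qed
 \<comment> \<open>\<open>J4_cov\<close> contains a shift by 1, and 2 compensates for it modulo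
   3.\<close>
 define k where "k = (if e then j + 2 else j)"
 have fin: "par (evals \<Phi> (evals cov q)) (evals (sym_map e k) (evals cov q))"
  if q: "!!i. 2 < i ==> q i = 0" "peval q (S * pa * pb * pc) ~= 0" for q
 proof -
  have qS: "peval q S ~= 0" using q(2) by simp
  obtain l where l: "l ~= 0" "evals cov (dvec d0 d1 d2 (cremona e q)) = (%i. l * evals \<Phi> (evals cov q) i)" using 1[OF q(1) qS] by blast
  define t where "t = (if e then 27 * (peval q pa * peval q pb * peval q pc)\<^sup>2 else 1)"
  have s: "evals (sym_map e k) (evals cov q) = (%i. t * cyc_vec j (evals cov (cremona e q)) i)"
  proof (cases e)
   case True
   have "evals (sym_map e k) (evals cov q) = cyc_vec k (%i. t * cyc_vec 1 (evals cov (cremona True q)) i)"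
    using True by (simp add: evals_sym_map J4_cov t_def)
   also have "\<dots> = (%i. t * cyc_vec ((k + 1) mod 3) (evals cov (cremona True q)) i)" by (simp only: cyc_vec_scale cyc_vec_cyc_vec)
   also have "(k + 1) mod 3 = j mod 3" using True by (simp add: k_def)
   finally show ?thesis using True by (simp add: cyc_vec_mod)
  next
   case False
   have "evals cov (cremona False q) = evals cov q" by (rule evals_cov_cong) (simp_all add: cremona_def)
   then show ?thesis using False by (simp add: evals_sym_map t_def k_def)
  qed
  have "(%i. d0 ^ 3 * cyc_vec j (evals cov (cremona e q)) i) = (%i. l * evals \<Phi> (evals cov q) i)" using l(2) unfolding dj .
  then have A: "d0 ^ 3 * cyc_vec j (evals cov (cremona e q)) i = l * evals \<Phi> (evals cov q) i" for i by (rule fun_cong)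
  have "d0 ^ 3 * evals (sym_map e k) (evals cov q) i = (t * l) * evals \<Phi> (evals cov q) i" for i
  proof -
   have "d0 ^ 3 * evals (sym_map e k) (evals cov q) i = t * (d0 ^ 3 * cyc_vec j (evals cov (cremona e q)) i)" unfolding s by (simp only: mult_ac)
   also have "\<dots> = t * l * evals \<Phi> (evals cov q) i" unfolding A by (simp only: mult_ac)
   finally show ?thesis .
  qed
  moreover have "x = r / k * y" if "k * x = r * y" "k ~= 0" for x y k r :: complex using that by (simp add: field_simps)
  ultimately have B: "evals (sym_map e k) (evals cov q) i = (t * l / d0 ^ 3) * evals \<Phi> (evals cov q) i" for i
   using dd(1) by (metis power_not_zero)
  show ?thesis unfolding par_def B by simp
 qed
 have ab: "pa ~= 0" "pb ~= 0" "pc ~= 0" using peval_abc[of "vec3 1 0 0"] by auto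
 have "par (evals \<Phi> p) (evals (sym_map e k) p)" for p
  by (rule par_cov_transfer[of \<Phi> "sym_map e k" "S * pa * pb * pc", OF _ _ _ _ fin]) (use \<Phi> S ab in auto)
 then have "rmap P2 \<Phi> = rmap P2 (sym_map e k)"
  by (intro rmap_cong[OF irr_P2 \<Phi>(5) tuple_on_sym_map] always_eventually) simp
 then show ?thesis using \<Phi>(4) by blast
qed

end

section \<open>The group generated by the involution and the cyclic permutation\<close>

lemma rcomp_rmap:
 assumes \<Phi>: "form_tuple d \<Phi>" "!!i. 2 < i ==> \<Phi> i = 0" and \<Psi>: "form_tuple e \<Psi>" "!!i. 2 < i ==> \<Psi> i = 0"
  and \<Theta>: "tuple_on P2 \<Theta>" and p0: "p0 \<in> P2" "evals \<Phi> p0 i ~= 0" "evals \<Psi> (evals \<Phi> p0) j ~= 0"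
  and par: "!!p. p \<in> P2 ==> par (evals \<Psi> (evals \<Phi> p)) (evals \<Theta> p)"
 shows "rcomp P2 P2 (rmap P2 \<Psi>) (rmap P2 \<Phi>) = rmap P2 \<Theta>"
  "dom (rmap P2 \<Psi> \<circ>\<^sub>m rmap P2 \<Phi>) ~= {}" "rmap P2 \<Psi> \<circ>\<^sub>m rmap P2 \<Phi> \<subseteq>\<^sub>m rmap P2 \<Theta>"
proof -
 have t\<Phi>: "map_tuple P2 P2 \<Phi>" "rmap P2 \<Phi> \<in> rational_maps P2 P2" "tuple_on P2 \<Phi>"
  by (rule plane_map_tuple[of d \<Phi> p0 i]; use \<Phi> p0 in simp)+
 let ?y = "%p. to_point (evals \<Phi> p)"
 have y: "?y p \<in> P2" if "evals \<Phi> p k ~= 0" for p k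
  by (rule to_point_P2[of "evals \<Phi> p" k, OF that]) (simp add: evals_def \<Phi>(2))
 have ey: "\<exists>c. c ~= 0 \<and> evals \<Psi> (?y p) = (%l. c * evals \<Psi> (evals \<Phi> p) l)" if "evals \<Phi> p k ~= 0" for p k
  using evals_to_point[OF \<Psi>(1), of "evals \<Phi> p" k] that by blast
 have y0: "evals \<Psi> (?y p0) j ~= 0" using ey[OF p0(2)] p0(3) by auto
 have t\<Psi>: "map_tuple P2 P2 \<Psi>" "rmap P2 \<Psi> \<in> rational_maps P2 P2" "tuple_on P2 \<Psi>"
  by (rule plane_map_tuple[of e \<Psi> "?y p0" j]; use \<Psi> y[OF p0(2)] y0 in simp)+
 have val: "(rmap P2 \<Psi> \<circ>\<^sub>m rmap P2 \<Phi>) p = Some (to_point (evals \<Psi> (evals \<Phi> p)))"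
  if v: "p \<in> P2" "evals \<Phi> p k ~= 0" "evals \<Psi> (evals \<Phi> p) l ~= 0" for p k l
 proof -
  obtain c where c: "c ~= 0" "evals \<Psi> (?y p) = (%l. c * evals \<Psi> (evals \<Phi> p) l)" using ey[OF v(2)] by blast
  have "evals \<Psi> (?y p) l ~= 0" using c v(3) by simp
  then have "rmap P2 \<Psi> (?y p) = Some (to_point (evals \<Psi> (?y p)))" using rmap_eval[OF irr_P2 t\<Psi>(3) y[OF v(2)]] by blast
  then show ?thesis using rmap_eval[OF irr_P2 t\<Phi>(3) v(1,2)] c by simp
 qed
 note v0 = val[OF p0]
 note rc = rcomp_props[OF irr_P2 irr_P2 proj_closed_P2 proj_closed_P2 t\<Phi>(2) t\<Psi>(2) v0]
 show dne: "dom (rmap P2 \<Psi> \<circ>\<^sub>m rmap P2 \<Phi>) ~= {}" using v0 by blast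
 have "eventually (%p. peval p (psubst \<Phi> (\<Psi> j)) ~= 0) (generic P2)"
  by (rule generic_form[OF irr_P2 homogeneous_comp[of e "\<Psi> j", OF _ \<Phi>(1)] p0(1)])
   (use \<Psi>(1) p0(3) in \<open>simp_all add: form_tuple_def evals_def\<close>)
 then have n\<Psi>: "eventually (%p. evals \<Psi> (evals \<Phi> p) j ~= 0) (generic P2)"
  unfolding peval_comp by (simp add: evals_def)
 have "eventually (%p. rcomp P2 P2 (rmap P2 \<Psi>) (rmap P2 \<Phi>) p = rmap P2 \<Theta> p) (generic P2)"
  using rc(3) n\<Psi> generic_rmap[OF irr_P2 t\<Phi>(3)] generic_rmap[OF irr_P2 \<Theta>]
 proof eventually_elim
  case (elim p)
  then obtain k where k: "evals \<Phi> p k ~= 0" by blast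
  from elim obtain l where l: "evals \<Theta> p l ~= 0" by blast
  have "p \<in> P2" using elim by simp
  then have "(rmap P2 \<Psi> \<circ>\<^sub>m rmap P2 \<Phi>) p = Some (to_point (evals \<Psi> (evals \<Phi> p)))" using val k elim by blast
  moreover have "to_point (evals \<Psi> (evals \<Phi> p)) = to_point (evals \<Theta> p)"
   by (rule to_point_par[OF par]) (use elim l in auto)
  ultimately show ?case using elim by simp
 qed
 moreover have mt: "map_tuple P2 P2 \<Theta>"
 proof (rule map_tupleI[OF irr_P2 \<Theta> proj_closed_P2])
  show "eventually (%p. to_point (evals \<Theta> p) \<in> P2) (generic P2)"
   using n\<Psi> generic_rmap[OF irr_P2 t\<Phi>(3)] generic_rmap[OF irr_P2 \<Theta>]
  proof eventually_elim
   case (elim p)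
   then obtain l where l: "evals \<Theta> p l ~= 0" by blast
   have "to_point (evals \<Psi> (evals \<Phi> p)) = to_point (evals \<Theta> p)"
    by (rule to_point_par[OF par]) (use elim l in auto)
   moreover have "to_point (evals \<Psi> (evals \<Phi> p)) \<in> P2"
    by (rule to_point_P2[of "evals \<Psi> (evals \<Phi> p)" j]) (use elim in \<open>simp_all add: evals_def[of \<Psi>] \<Psi>(2)\<close>)
   ultimately show ?case by simp
  qed
 qed
 ultimately show eq: "rcomp P2 P2 (rmap P2 \<Psi>) (rmap P2 \<Phi>) = rmap P2 \<Theta>"
  by (intro rational_maps_eqI[OF irr_P2 rc(1)]) (auto simp: rational_maps_def)
 show "rmap P2 \<Psi> \<circ>\<^sub>m rmap P2 \<Phi> \<subseteq>\<^sub>m rmap P2 \<Theta>" using rc(2) unfolding eq .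
qed

lemma bir_group_simps:
 "carrier (bir_group X) = birational_maps X X" "\<one>\<^bsub>bir_group X\<^esub> = Some |` X" "f \<otimes>\<^bsub>bir_group X\<^esub> g = rcomp X X f g"
 by (simp_all add: bir_group_def)

lemma sym_map_one: "\<one>\<^bsub>bir_group P2\<^esub> = rmap P2 (sym_map False 0)"
proof -
 have "par (evals Var p) (evals (sym_map False 0) p)" if "p \<in> P2" for p
 proof -
  have "p = cyc_vec 0 p" using that P2_trunc3[OF that] by (simp add: cyc_vec_vec3 trunc3_vec3)
  then show ?thesis by (simp add: evals_sym_map) (simp add: evals_def)
 qed
 then have "rmap P2 Var = rmap P2 (sym_map False 0)"
  by (intro rmap_cong[OF irr_P2 tuple_on_Var[OF irr_P2] tuple_on_sym_map] eventually_mono[OF generic_in[OF irr_P2]])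
 then show ?thesis by (simp add: bir_group_simps rmap_Var[OF irr_P2])
qed

lemma sym_map_eq: "J4 = sym_map True 0" "cyclic_perm = sym_map False 1"
proof -
 show "J4 = sym_map True 0"
  by (rule ext) (simp add: sym_map_def J4_simps(4))
 show "cyclic_perm = sym_map False 1"
 proof
  fix i show "cyclic_perm i = sym_map False 1 i"
   by (cases "i \<le> 2") (auto simp: sym_map_def cyclic_perm_def triple_vec3 numeral_2_eq_2[symmetric] dest!: cases_le2)
 qed
qed

lemma sym_map_comp:
 fixes e e' :: bool and k l :: nat
 defines "m \<equiv> (k + (if e then 2 * l else l)) mod 3"
 shows "rcomp P2 P2 (rmap P2 (sym_map e k)) (rmap P2 (sym_map e' l)) = rmap P2 (sym_map (e ~= e') m)"
  "dom (rmap P2 (sym_map e k) \<circ>\<^sub>m rmap P2 (sym_map e' l)) ~= {}"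
  "rmap P2 (sym_map e k) \<circ>\<^sub>m rmap P2 (sym_map e' l) \<subseteq>\<^sub>m rmap P2 (sym_map (e ~= e') m)"
proof -
 have p0: "vec3 1 2 4 \<in> P2" by (rule vec3_in_P2)
 have "peval (vec3 1 2 4) J4_factor ~= 0" by (simp add: J4_factor_def cubic_eq)
 then have nz: "evals (sym_map e k) (evals (sym_map e' l) (vec3 1 2 4)) 0 ~= 0"
  unfolding evals_sym_map_comp[OF p0] using sym_base_point by auto
 have par: "par (evals (sym_map e k) (evals (sym_map e' l) p)) (evals (sym_map (e ~= e') m) p)" if "p \<in> P2" for p
  unfolding evals_sym_map_comp[OF that] m_def by (rule par_scale(2))
 note * = rcomp_rmap[OF form_tuple_sym_map sym_map_beyond form_tuple_sym_map sym_map_beyond tuple_on_sym_map p0 sym_base_point nz par]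
 show "rcomp P2 P2 (rmap P2 (sym_map e k)) (rmap P2 (sym_map e' l)) = rmap P2 (sym_map (e ~= e') m)"
  "dom (rmap P2 (sym_map e k) \<circ>\<^sub>m rmap P2 (sym_map e' l)) ~= {}"
  "rmap P2 (sym_map e k) \<circ>\<^sub>m rmap P2 (sym_map e' l) \<subseteq>\<^sub>m rmap P2 (sym_map (e ~= e') m)"
  by (rule *; assumption)+
qed

definition sym_inv :: "bool => nat => nat" where
 "sym_inv e k = (if e then k else 2 * k)"

lemma sym_map_inverse:
 "rcomp P2 P2 (rmap P2 (sym_map e k)) (rmap P2 (sym_map e (sym_inv e k))) = \<one>\<^bsub>bir_group P2\<^esub>"
 "rcomp P2 P2 (rmap P2 (sym_map e (sym_inv e k))) (rmap P2 (sym_map e k)) = \<one>\<^bsub>bir_group P2\<^esub>"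
 unfolding sym_map_comp sym_map_one by (auto simp: sym_inv_def)

lemma sym_map_birational: "rmap P2 (sym_map e k) \<in> birational_maps P2 P2"
proof -
 have r: "rmap P2 (sym_map e k) \<in> rational_maps P2 P2" for e k
  by (rule plane_map_tuple(2)[OF form_tuple_sym_map _ vec3_in_P2(4) sym_base_point]) simp
 have "rmap P2 (sym_map e k) \<circ>\<^sub>m rmap P2 (sym_map e (sym_inv e k)) \<subseteq>\<^sub>m Some |` P2"
  "rmap P2 (sym_map e (sym_inv e k)) \<circ>\<^sub>m rmap P2 (sym_map e k) \<subseteq>\<^sub>m Some |` P2"
  using sym_map_comp(3)[of e k e "sym_inv e k"] sym_map_comp(3)[of e "sym_inv e k" e k]
  unfolding sym_map_one[unfolded bir_group_simps] by (auto simp: sym_inv_def split: if_splits)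
 then have le: "rmap P2 (sym_map e k) \<circ>\<^sub>m rmap P2 (sym_map e (sym_inv e k)) \<subseteq>\<^sub>m Some"
  "rmap P2 (sym_map e (sym_inv e k)) \<circ>\<^sub>m rmap P2 (sym_map e k) \<subseteq>\<^sub>m Some"
  by (auto simp: map_le_def restrict_map_def split: if_splits)
 then show ?thesis unfolding birational_maps_def
  by (intro CollectI conjI bexI[of _ "rmap P2 (sym_map e (sym_inv e k))"] r sym_map_comp(2))
qed

text \<open>Inverses in \<open>bir_group\<close> are definite descriptions over all birational maps.
  Uniqueness is obtained from the generic identity y = y x z = z for partial functions, instead of
  from associativity of \<open>rcomp\<close>.\<close>

lemma birational_inverse_unique:
 assumes X: "irr X" "proj_closed X" and x: "x \<in> birational_maps X X" and y: "y \<in> birational_maps X X" and z: "z \<in> birational_maps X X"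
  and yx: "rcomp X X y x = Some |` X" and xz: "rcomp X X x z = Some |` X"
 shows "y = z"
proof -
 have comp: "eventually (%p. (g \<circ>\<^sub>m f) p = Some p) (generic X)"
  if f: "f \<in> birational_maps X X" and g: "g \<in> birational_maps X X" and gf: "rcomp X X g f = Some |` X" for f g
 proof -
  have fr: "f \<in> rational_maps X X" "g \<in> rational_maps X X" using f g by (auto simp: birational_maps_def)
  have "dominant f X X" by (rule birational_inverse[OF X X f])
  then have "eventually (%p. \<exists>y\<in>X. g (the (f p)) = Some y) (generic X)"
   using generic_rational[OF X(1) fr(2)] unfolding filterlim_iff by blast
  then have "eventually (%p. \<exists>z0. (g \<circ>\<^sub>m f) p = Some z0) (generic X)"
   using generic_rational[OF X(1) fr(1)] by eventually_elim auto
  then obtain p0 z0 where "(g \<circ>\<^sub>m f) p0 = Some z0" using generic_ex[OF X(1)] by blast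
  from rcomp_props(3)[OF X(1) X X(2) fr this] show ?thesis
   using generic_in[OF X(1)] by eventually_elim (auto simp: gf)
 qed
 have zr: "y \<in> rational_maps X X" "z \<in> rational_maps X X" using y z by (auto simp: birational_maps_def)
 have "dominant z X X" by (rule birational_inverse[OF X X z])
 then have "eventually (%p. (y \<circ>\<^sub>m x) (the (z p)) = Some (the (z p))) (generic X)"
  using comp[OF x y yx] unfolding filterlim_iff by blast
 then have "eventually (%p. y p = z p) (generic X)"
  using comp[OF z x xz]
 proof eventually_elim
  case (elim p)
  then obtain t where "z p = Some t" "x t = Some p" by (auto simp: map_comp_def split: option.splits)
  then show ?case using elim by (simp add: map_comp_def)
 qed
 then show ?thesis by (rule rational_maps_eqI[OF X(1) zr])
qed

lemma sym_map_m_inv: "inv\<^bsub>bir_group P2\<^esub> (rmap P2 (sym_map e k)) = rmap P2 (sym_map e (sym_inv e k))"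
 unfolding m_inv_def
proof (rule the_equality)
 show "rmap P2 (sym_map e (sym_inv e k)) \<in> carrier (bir_group P2) \<and>
  rmap P2 (sym_map e k) \<otimes>\<^bsub>bir_group P2\<^esub> rmap P2 (sym_map e (sym_inv e k)) = \<one>\<^bsub>bir_group P2\<^esub> \<and>
  rmap P2 (sym_map e (sym_inv e k)) \<otimes>\<^bsub>bir_group P2\<^esub> rmap P2 (sym_map e k) = \<one>\<^bsub>bir_group P2\<^esub>"
  using sym_map_birational sym_map_inverse by (simp add: bir_group_simps)
 fix y assume "y \<in> carrier (bir_group P2) \<and> rmap P2 (sym_map e k) \<otimes>\<^bsub>bir_group P2\<^esub> y = \<one>\<^bsub>bir_group P2\<^esub> \<and>
  y \<otimes>\<^bsub>bir_group P2\<^esub> rmap P2 (sym_map e k) = \<one>\<^bsub>bir_group P2\<^esub>"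
 then have y: "y \<in> birational_maps P2 P2" "rcomp P2 P2 y (rmap P2 (sym_map e k)) = Some |` P2" by (simp_all add: bir_group_simps)
 show "y = rmap P2 (sym_map e (sym_inv e k))"
  by (rule birational_inverse_unique[OF irr_P2 proj_closed_P2 sym_map_birational y(1) sym_map_birational y(2)])
   (use sym_map_inverse(1) in \<open>simp add: bir_group_simps\<close>)
qed

lemma generate_sym_maps:
 "generate (bir_group P2) {rmap P2 J4, rmap P2 cyclic_perm} = {rmap P2 (sym_map e k) | e k. True}" (is "?G = ?E")
proof
 show "?G \<subseteq> ?E"
 proof
  fix h assume "h \<in> ?G"
  then show "h \<in> ?E"
  proof induction
   case one
   then show ?case unfolding sym_map_one by blast
  next
   case (incl h)
   then show ?case unfolding sym_map_eq by blast
  next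
   case (inv h)
   then show ?case unfolding sym_map_eq using sym_map_m_inv by auto
  next
   case (eng h1 h2)
   then obtain e k e' l where "h1 = rmap P2 (sym_map e k)" "h2 = rmap P2 (sym_map e' l)" by blast
   then show ?case using sym_map_comp(1)[of e k e' l] unfolding bir_group_simps by blast
  qed
 qed
 have mult: "rmap P2 (sym_map (e ~= e') ((k + (if e then 2 * l else l)) mod 3)) \<in> ?G" if "rmap P2 (sym_map e k) \<in> ?G" "rmap P2 (sym_map e' l) \<in> ?G" for e e' k l
  using generate.eng[OF that] unfolding bir_group_simps sym_map_comp(1) .
 have J: "rmap P2 (sym_map True 0) \<in> ?G" and c1: "rmap P2 (sym_map False 1) \<in> ?G"
  unfolding sym_map_eq by (rule generate.incl, simp)+
 have c0: "rmap P2 (sym_map False 0) \<in> ?G" using generate.one[of "bir_group P2" "{rmap P2 J4, rmap P2 cyclic_perm}"] unfolding sym_map_one .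
 have "rmap P2 (sym_map False (k mod 3)) \<in> ?G" for k
  using c0 c1 mult[OF c1 c1] three_cases[of k] by (elim disjE) (auto simp: numeral_2_eq_2)
 then have k: "rmap P2 (sym_map e (k mod 3)) \<in> ?G" for e k
  using mult[OF _ J, of False "k mod 3"] by (cases e) auto
 have red: "sym_map e k = sym_map e (k mod 3)" for e k
 proof -
  have "(i + k mod 3) mod 3 = (i + k) mod 3" for i by presburger
  then show ?thesis by (simp add: sym_map_def fun_eq_iff)
 qed
 show "?E \<subseteq> ?G"
 proof
  fix h assume "h \<in> ?E"
  then obtain e l where "h = rmap P2 (sym_map e l)" by blast
  then show "h \<in> ?G" using k[of e l] red[of e l] by simp
 qed
qed

section \<open>Invariance of the foliation under the quartic involution\<close>

lemma Om_J4_identity: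
 fixes x y z P Q R dx dy dz dP dQ dR :: complex
 assumes PQR: "R = - P - Q" "dR = - dP - dQ"
 defines "X \<equiv> y * P * Q\<^sup>2" and "Y \<equiv> x * R * P\<^sup>2" and "Z \<equiv> z * Q * R\<^sup>2"
 shows "Y * Z * (R - Q) * (P * Q\<^sup>2 * dy + y * Q\<^sup>2 * dP + 2 * y * P * Q * dQ) +
   X * Z * (Q - P) * (R * P\<^sup>2 * dx + x * P\<^sup>2 * dR + 2 * x * R * P * dP) +
   X * Y * (P - R) * (Q * R\<^sup>2 * dz + z * R\<^sup>2 * dQ + 2 * z * Q * R * dR) =
   - ((P * Q * R) ^ 3) * (y * z * (P - Q) * dx + x * z * (Q - R) * dy + x * y * (R - P) * dz)"
proof -
 \<comment> \<open>P, Q, R stand for y - z, z - x, x - y. Treating them as variables with sum zero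
   lets (P Q R)^2 be extracted before anything is expanded.\<close>
 have 1: "Y * Z * (P * Q\<^sup>2 * dy + y * Q\<^sup>2 * dP + 2 * y * P * Q * dQ) = (P * Q * R)\<^sup>2 * (R * x * z * (P * Q * dy + y * Q * dP + 2 * y * P * dQ))"
  unfolding X_def Y_def Z_def by (simp add: power2_eq_square algebra_simps)
 have 2: "X * Z * (R * P\<^sup>2 * dx + x * P\<^sup>2 * dR + 2 * x * R * P * dP) = (P * Q * R)\<^sup>2 * (Q * y * z * (R * P * dx + x * P * dR + 2 * x * R * dP))"
  unfolding X_def Y_def Z_def by (simp add: power2_eq_square algebra_simps)
 have 3: "X * Y * (Q * R\<^sup>2 * dz + z * R\<^sup>2 * dQ + 2 * z * Q * R * dR) = (P * Q * R)\<^sup>2 * (P * x * y * (Q * R * dz + z * R * dQ + 2 * z * Q * dR))"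
  unfolding X_def Y_def Z_def by (simp add: power2_eq_square algebra_simps)
 have factor: "(p * a) * r + (p * b) * q + (p * c) * s = p * (a * r + b * q + c * s)" for p a b c r q s :: complex
  by (simp add: algebra_simps)
 have 4: "R * x * z * (P * Q * dy + y * Q * dP + 2 * y * P * dQ) * (R - Q) + Q * y * z * (R * P * dx + x * P * dR + 2 * x * R * dP) * (Q - P) +
   P * x * y * (Q * R * dz + z * R * dQ + 2 * z * Q * dR) * (P - R) =
   - (P * Q * R) * (y * z * (P - Q) * dx + x * z * (Q - R) * dy + x * y * (R - P) * dz)"
  unfolding PQR by (simp add: power2_eq_square algebra_simps)
 have "Y * Z * (R - Q) * (P * Q\<^sup>2 * dy + y * Q\<^sup>2 * dP + 2 * y * P * Q * dQ) +
   X * Z * (Q - P) * (R * P\<^sup>2 * dx + x * P\<^sup>2 * dR + 2 * x * R * P * dP) +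
   X * Y * (P - R) * (Q * R\<^sup>2 * dz + z * R\<^sup>2 * dQ + 2 * z * Q * R * dR) =
   (Y * Z * (P * Q\<^sup>2 * dy + y * Q\<^sup>2 * dP + 2 * y * P * Q * dQ)) * (R - Q) +
   (X * Z * (R * P\<^sup>2 * dx + x * P\<^sup>2 * dR + 2 * x * R * P * dP)) * (Q - P) +
   (X * Y * (Q * R\<^sup>2 * dz + z * R\<^sup>2 * dQ + 2 * z * Q * R * dR)) * (P - R)" by (simp only: mult_ac)
 also have "\<dots> = (P * Q * R)\<^sup>2 * (R * x * z * (P * Q * dy + y * Q * dP + 2 * y * P * dQ) * (R - Q) + Q * y * z * (R * P * dx + x * P * dR + 2 * x * R * dP) * (Q - P) +
   P * x * y * (Q * R * dz + z * R * dQ + 2 * z * Q * dR) * (P - R))" unfolding 1 2 3 by (rule factor)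
 finally show ?thesis unfolding 4 by (simp add: power2_eq_square power3_eq_cube)
qed

lemma Om_J4:
 "Om (evals J4 p) (%i. dir_deriv p v (J4 i)) =
  - peval p cubic * ((p 1 - p 2) * (p 2 - p 0) * (p 0 - p 1)) ^ 3 * Om p v"
proof -
 define x y z where xyz: "x = p 0" "y = p 1" "z = p 2"
 define P Q R where PQR: "P = y - z" "Q = z - x" "R = x - y"
 define dx dy dz where d: "dx = v 0" "dy = v 1" "dz = v 2"
 define c where "c = peval p cubic"
 let ?X = "y * P * Q\<^sup>2" and ?Y = "x * R * P\<^sup>2" and ?Z = "z * Q * R\<^sup>2"
 have J: "evals J4 p = vec3 ?X ?Y ?Z" by (simp add: evals_J4 xyz PQR)
 have D: "dir_deriv p v (J4 0) = P * Q\<^sup>2 * dy + y * Q\<^sup>2 * (dy - dz) + 2 * y * P * Q * (dz - dx)"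
  "dir_deriv p v (J4 1) = R * P\<^sup>2 * dx + x * P\<^sup>2 * (dx - dy) + 2 * x * R * P * (dy - dz)"
  "dir_deriv p v (J4 2) = Q * R\<^sup>2 * dz + z * R\<^sup>2 * (dz - dx) + 2 * z * Q * R * (dx - dy)"
  unfolding PQR xyz d by (simp_all add: J4_simps power2_eq_square algebra_simps)
 have c: "?Y - ?Z = R * c" "?Z - ?X = Q * c" "?X - ?Y = P * c" unfolding c_def PQR xyz by (simp_all add: cubic_eq power2_eq_square algebra_simps)
 have "?X + ?Y - 2 * ?Z = (?Y - ?Z) - (?Z - ?X)" "?Y + ?Z - 2 * ?X = (?Z - ?X) - (?X - ?Y)" "?Z + ?X - 2 * ?Y = (?X - ?Y) - (?Y - ?Z)" by simp_all
 then have co: "?X + ?Y - 2 * ?Z = c * (R - Q)" "?Y + ?Z - 2 * ?X = c * (Q - P)" "?Z + ?X - 2 * ?Y = c * (P - R)"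
  unfolding c by (simp_all add: algebra_simps)
 have "Om (evals J4 p) (%i. dir_deriv p v (J4 i)) = c * (?Y * ?Z * (R - Q) * dir_deriv p v (J4 0) + ?X * ?Z * (Q - P) * dir_deriv p v (J4 1) + ?X * ?Y * (P - R) * dir_deriv p v (J4 2))"
  unfolding Om_explicit J vec3_simps co by (simp only: distrib_left mult_ac)
 also have "\<dots> = c * (- ((P * Q * R) ^ 3) * (y * z * (P - Q) * dx + x * z * (Q - R) * dy + x * y * (R - P) * dz))"
  unfolding D by (subst Om_J4_identity) (simp_all add: PQR)
 also have "y * z * (P - Q) * dx + x * z * (Q - R) * dy + x * y * (R - P) * dz = Om p v"
  unfolding Om_explicit PQR xyz d by (simp add: algebra_simps)
 finally show ?thesis by (simp add: c_def PQR xyz)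
qed

lemma Om_cyc_vec: "Om (cyc_vec k u) (cyc_vec k x) = Om u x"
 using three_cases[of k] by (elim disjE) (simp_all add: cyc_vec_vec3 Om_explicit algebra_simps)

lemma sym_map_pulls_back: "pulls_back (rmap P2 (sym_map e k)) P2 J_fol J_fol"
proof -
 \<comment> \<open>The locus where the factor in \<open>Om_J4\<close> vanishes: the cubic and the
   three lines on which two coordinates agree.\<close>
 define s where "s = cubic * ((Var 1 - Var 2) * (Var 2 - Var 0) * (Var 0 - Var 1))"
 define Z where "Z = {p \<in> P2. peval p s = 0}"
 have hl: "homogeneous (Suc 0) (Var i - Var j)" for i j by (intro homogeneous_diff) simp_all
 have "homogeneous (3 + (Suc 0 + Suc 0 + Suc 0)) s" unfolding s_def
  by (intro homogeneous_mult homogeneous_cubic hl)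
 then have Z: "proj_closed Z" unfolding Z_def by (rule proj_closed_form)
 have "peval (vec3 1 2 4) s ~= 0" by (simp add: s_def cubic_eq)
 then have Z': "\<not> P2 \<subseteq> Z" using vec3_in_P2(4)[of 2 4] by (auto simp: Z_def)
 have main: "(\<exists>i. peval p (sym_map e k i) ~= 0) \<and> (\<forall>v\<in>tangent P2 p. (p, v) \<in> J_fol \<longleftrightarrow>
   (to_point (evals (sym_map e k) p), %j. dir_deriv p v (sym_map e k j)) \<in> J_fol)" if p: "p \<in> P2 - Z" for p
 proof -
  have pP: "p \<in> P2" and ps: "peval p s ~= 0" using p by (auto simp: Z_def)
  define b where "b = (if e then J4 else Var)"
  have e: "evals (sym_map e k) p = cyc_vec k (evals b p)" by (simp add: evals_sym_map b_def) (simp add: evals_def)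
  have "\<exists>i\<le>2. evals b p i ~= 0"
  proof (cases e)
   case True
   show ?thesis
   proof (rule ccontr)
    assume "\<not> ?thesis"
    then have "evals b p 0 = 0" "evals b p 1 = 0" "evals b p 2 = 0" by auto
    then have "p 0 = 0" "p 1 = 0" "p 2 = 0" using ps True by (simp_all add: b_def evals_J4 s_def)
    then show False using vec3_nz_P2[OF pP] by simp
   qed
  next
   case False
   then have "evals b p = p" by (simp add: b_def evals_def)
   then show ?thesis using vec3_nz_P2[OF pP] by (metis le0 one_le_numeral order.refl)
  qed
  then have "\<exists>i. cyc_vec k (evals b p) i ~= 0"
  proof -
   have "\<exists>i\<le>2. cyc_vec k u i ~= 0" if "u 0 ~= 0 \<or> u 1 ~= 0 \<or> u 2 ~= 0" for u
    using three_cases[of k] that by (elim disjE) (simp_all add: cyc_vec_vec3 exI[of _ "0::nat"] exI[of _ "1::nat"] exI[of _ "2::nat"])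
   then show ?thesis using \<open>\<exists>i\<le>2. evals b p i ~= 0\<close> by (metis cases_le2)
  qed
  then obtain i where i: "evals (sym_map e k) p i ~= 0" unfolding e by blast
  have P: "to_point (evals (sym_map e k) p) \<in> P2"
   by (rule to_point_P2[of "evals (sym_map e k) p" i, OF i]) (simp add: evals_def)
  have "Om p v = 0 \<longleftrightarrow> Om (evals (sym_map e k) p) (%j. dir_deriv p v (sym_map e k j)) = 0" for v
  proof -
   have "(%j. dir_deriv p v (sym_map e k j)) = cyc_vec k (%j. dir_deriv p v (b j))"
    by (auto simp: cyc_vec_def sym_map_def b_def)
   then have "Om (evals (sym_map e k) p) (%j. dir_deriv p v (sym_map e k j)) = Om (evals b p) (%j. dir_deriv p v (b j))"
    unfolding e by (simp only: Om_cyc_vec)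
   also have "\<dots> = 0 \<longleftrightarrow> Om p v = 0"
   proof (cases e)
    case True
    then show ?thesis using ps by (simp add: b_def Om_J4 s_def)
   next
    case False
    then show ?thesis by (simp add: b_def evals_def)
   qed
   finally show ?thesis by simp
  qed
  then show ?thesis using i P pP Om_to_point[of "evals (sym_map e k) p" i]
   by (auto simp: J_fol_Om tangent_P2[OF pP] evals_def)
 qed
 show ?thesis unfolding pulls_back_def
  using form_tuple_sym_map Z Z' main by blast
qed

lemma cube_root_of_unity_exists: obtains w :: complex where "w\<^sup>2 + w + 1 = 0"
proof
 show "(cis (2 * pi / 3))\<^sup>2 + cis (2 * pi / 3) + 1 = 0"
  by (simp add: complex_eq_iff power2_eq_square cos_120 sin_120)
qed

theorem bir_aut_J_fol: "bir_aut P2 J_fol = generate (bir_group P2) {rmap P2 J4, rmap P2 cyclic_perm}"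
proof -
 obtain w where "(w::complex)\<^sup>2 + w + 1 = 0" by (rule cube_root_of_unity_exists)
 then interpret cube_root_of_unity w by unfold_locales
 show ?thesis unfolding generate_sym_maps
  using aut_classification sym_map_birational sym_map_pulls_back by (auto simp: bir_aut_def)
qed

section \<open>The quartic map as a de Jonquieres involution\<close>

lemma J4_not_one: "rmap P2 J4 ~= \<one>\<^bsub>bir_group P2\<^esub>"
proof
 assume "rmap P2 J4 = \<one>\<^bsub>bir_group P2\<^esub>"
 then have "rmap P2 (sym_map True 0) (vec3 1 2 4) = Some (vec3 1 2 4)" using vec3_in_P2(4)[of 2 4] by (simp add: bir_group_simps sym_map_eq)
 then have "to_point (evals (sym_map True 0) (vec3 1 2 4)) = vec3 1 2 4"
  using rmap_eval[OF irr_P2 tuple_on_sym_map vec3_in_P2(4) sym_base_point] by simp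
 then have "par (evals (sym_map True 0) (vec3 1 2 4)) (vec3 1 2 4)" by (metis par_to_point(1))
 then have "evals (sym_map True 0) (vec3 1 2 4) 0 * vec3 1 2 4 1 = evals (sym_map True 0) (vec3 1 2 4) 1 * vec3 1 2 4 0" unfolding par_def by blast
 then show False by (simp add: evals_sym_map cyc_vec_vec3 evals_J4)
qed

lemma J4_involution: "rmap P2 J4 \<otimes>\<^bsub>bir_group P2\<^esub> rmap P2 J4 = \<one>\<^bsub>bir_group P2\<^esub>"
 using sym_map_inverse(1)[of True 0] by (simp add: sym_map_eq bir_group_simps sym_inv_def)

lemma J4_plane_birational: "plane_birational_of_degree 4 J4"
 unfolding plane_birational_of_degree_def
 using form_tuple_J4 vars_le_J4 J4_coprime sym_map_birational[of True 0, folded sym_map_eq] by (auto simp: form_tuple_def vars_le_def J4_simps)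

text \<open>The point (1:1:1) is triple, and each coordinate vertex is a simple base point with one
  further simple base point infinitely near to it, in agreement with 16 - 9 - 6 = 1.\<close>

lemma de_jonquieres_J4: "de_jonquieres 4 J4"
 unfolding de_jonquieres_def
proof (intro conjI J4_plane_birational bexI[of _ "(vec3 1 1 1, [])"] ballI impI)
 define L where "L = (%p. localize p ` homaloidal_net J4)"
 have b: "base_mult J4 (p, ds) = mult_origin (fold blow_up ds (L p))" for p ds by (simp add: base_mult_def L_def)
 have Lm: "localize p (J4 i) \<in> L p" if "i \<le> 2" for p i using homaloidal_net_mem[OF that] by (simp add: L_def)
 have Lc: "\<exists>a b c. f = Const a * localize p (J4 0) + Const b * localize p (J4 1) + Const c * localize p (J4 2)" if "f \<in> L p" for f p
  using that homaloidal_net_comb[of _ J4] by (fastforce simp: L_def)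
 have h: "localize (vec3 1 1 1) (J4 0) = (1 + Var 0) * (Var 0 - Var 1) * (Var 1)\<^sup>2"
   "localize (vec3 1 1 1) (J4 1) = - Var 0 * (Var 0 - Var 1)\<^sup>2"
   "localize (vec3 1 1 1) (J4 2) = (1 + Var 1) * Var 1 * (Var 0)\<^sup>2"
  by (simp_all add: J4_simps localize_def)
 have m3: "mult_origin (L (vec3 1 1 1)) = 3"
 proof (rule mult_origin_eqI)
  show "localize (vec3 1 1 1) (J4 2) \<in> L (vec3 1 1 1)" by (rule Lm) simp
  show "coeff (ray (vec3 1 1 0) (localize (vec3 1 1 1) (J4 2))) 3 ~= 0"
   unfolding h by (simp add: power2_eq_square numeral_3_eq_3)
  have d: "ord_ge (Suc 0) (Var 0 - Var 1)" by (intro ord_ge_diff) auto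
  have "ord_ge (0 + Suc 0 + 2 * Suc 0) ((1 + Var 0) * (Var 0 - Var 1) * (Var 1)\<^sup>2)"
   by (intro ord_ge_mult ord_ge_power d) auto
  moreover have "ord_ge (Suc 0 + 2 * Suc 0) (- Var 0 * (Var 0 - Var 1)\<^sup>2)"
   by (intro ord_ge_mult ord_ge_power ord_ge_uminus d) auto
  moreover have "ord_ge (0 + Suc 0 + 2 * Suc 0) ((1 + Var 1) * Var 1 * (Var 0)\<^sup>2)"
   by (intro ord_ge_mult ord_ge_power) auto
  ultimately have o: "ord_ge 3 (localize (vec3 1 1 1) (J4 0))" "ord_ge 3 (localize (vec3 1 1 1) (J4 1))" "ord_ge 3 (localize (vec3 1 1 1) (J4 2))"
   unfolding h by (simp_all add: numeral_3_eq_3)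
  fix g assume "g \<in> L (vec3 1 1 1)"
  then show "ord_ge 3 g" using Lc[of g "vec3 1 1 1"] o by (auto intro!: ord_ge_add ord_ge_mult_right)
 qed
 then show "base_mult J4 (vec3 1 1 1, []) = 4 - 1" by (simp add: b)
 fix b' assume b': "b' \<in> P2 \<times> UNIV" "b' ~= (vec3 1 1 1, [])" "base_mult J4 b' ~= 0"
 obtain p ds where p: "b' = (p, ds)" "p \<in> P2" using b' by (cases b') auto
 have "base_mult J4 (p, ds) \<le> 1"
 proof (cases "\<forall>i\<le>2. peval p (J4 i) = 0")
  case False
  then obtain i where i: "i \<le> 2" "peval p (J4 i) ~= 0" by blast
  have "mult_origin (fold blow_up ds (L p)) = 0"
   by (rule fold_blow_up_free[OF Lm[OF i(1)]]) (use i in simp)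
  then show ?thesis by (simp add: b)
 next
  case True
  then consider "p = vec3 1 1 1" | "p = vec3 1 0 0" | "p = vec3 0 1 0" | "p = vec3 0 0 1"
   using J4_base_points[OF p(2)] by blast
  then show ?thesis
  proof cases
   case 1
   then obtain t ds' where ds: "ds = t # ds'" using b' p by (cases ds) auto
   \<comment> \<open>The cubic leading forms (u - v) v^2, - u (u - v)^2 and u^2 v have no common
     zero direction, so in every direction one of them survives division by the exceptional curve
     and nothing infinitely near remains.\<close>
   have "\<exists>g\<in>blow_up t (L p). peval (%_. 0) g ~= 0"
   proof (cases t)
    case None
    have "(1 + Var 0 * Var 1) * (Var 0 - 1) \<in> blow_up None (L p)"
     unfolding 1 by (rule blow_up_NoneI[OF Lm[of 0]], simp, unfold h m3) (simp add: power2_eq_square power3_eq_cube algebra_simps)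
    then show ?thesis unfolding None by (rule bexI[rotated]) simp
   next
    case (Some c)
    show ?thesis
    proof (cases "c = 0")
     case True
     have "- ((1 - Var 1)\<^sup>2) \<in> blow_up (Some c) (L p)"
      unfolding 1 by (rule blow_up_SomeI[OF Lm[of 1]], simp, unfold h m3 True) (simp add: power2_eq_square power3_eq_cube algebra_simps)
     then show ?thesis unfolding Some by (rule bexI[rotated]) simp
    next
     case False
     have "(1 + Var 0 * (Var 1 + Const c)) * (Var 1 + Const c) \<in> blow_up (Some c) (L p)"
      unfolding 1 by (rule blow_up_SomeI[OF Lm[of 2]], simp, unfold h m3) (simp add: power2_eq_square power3_eq_cube algebra_simps)
     then show ?thesis unfolding Some by (rule bexI[rotated]) (use False in simp)
    qed
   qed
   then show ?thesis using fold_blow_up_free[of _ "blow_up t (L p)" ds'] by (auto simp: b ds)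
  next
   case 2
   have "mult_origin (fold blow_up ds (L p)) \<le> 1"
    by (rule simple_tower_Some[OF Lm[of 0] Lm[of 1] Lm[of 2] Lc]) (auto simp: 2 J4_simps localize_def)
   then show ?thesis by (simp add: b)
  next
   case 3
   have "mult_origin (fold blow_up ds (L p)) \<le> 1"
   proof (rule simple_tower_None[OF Lm[of 2] Lm[of 0] Lm[of 1]])
    show "\<exists>a b c. f = Const a * localize p (J4 2) + Const b * localize p (J4 0) + Const c * localize p (J4 1)" if "f \<in> L p" for f
     using Lc[OF that] by (metis add.assoc add.commute)
   qed (auto simp: 3 J4_simps localize_def)
   then show ?thesis by (simp add: b)
  next
   case 4
   have "mult_origin (fold blow_up ds (L p)) \<le> 1"
   proof (rule simple_tower_Some[OF Lm[of 1] Lm[of 2] Lm[of 0]])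
    show "\<exists>a b c. f = Const a * localize p (J4 1) + Const b * localize p (J4 2) + Const c * localize p (J4 0)" if "f \<in> L p" for f
     using Lc[OF that] by (metis add.assoc add.commute)
   qed (auto simp: 4 J4_simps localize_def)
   then show ?thesis by (simp add: b)
  qed
 qed
 then show "base_mult J4 b' = 1" using b'(3) p by simp
qed (simp add: vec3_in_P2)

subsection \<open>Forms invariant under the cyclic permutation\<close>

lemma mon_prod: "mon (%i. a i * b i) m = mon a m * mon b m"
 by (simp add: mon_def power_mult_distrib prod.distrib)

lemma Const_prod: "(\<Prod>i\<in>A. Const (z i)) = Const (\<Prod>i\<in>A. z i)"
 by (induction A rule: infinite_finite_induct) (simp_all add: Const_mult)

lemma lookup_psubst_diag: "lookup (psubst (%i. Const (z i) * Var i) f) m = mon z m * lookup f m"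
proof -
 have "psubst (%i. Const (z i) * Var i) (single k x) = Const (mon z k) * single k x" for k x
 proof -
  have "mon (%i. Const (z i)) k = Const (mon z k)"
   unfolding mon_def Const_prod[symmetric] by (intro prod.cong) (simp_all add: Const_power)
  moreover have "psubst (%i. Const (z i) * Var i) (single k x) = Const x * (mon (%i. Const (z i)) k * mon Var k)"
   by (subst insertion_single) (simp_all add: mon_prod)
  ultimately show ?thesis by (simp only: single_eq_Const_mon mult.left_commute)
 qed
 then have "lookup (psubst (%i. Const (z i) * Var i) (single k x)) m = mon z m * lookup (single k x) m" for k x
  by (simp add: lookup_single when_def)
 then show ?thesis
  by (subst (1 2) mpoly_sum_single[of f]) (simp add: sum_distrib_left lookup_sum)
qed

context cube_root_of_unity
begin

lemma w_power_one: "w ^ n = 1 ==> 3 dvd n"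
proof -
 assume n: "w ^ n = 1"
 have "w ^ n = w ^ (n mod 3 + 3 * (n div 3))" by simp
 also have "\<dots> = w ^ (n mod 3)" by (simp only: power_add power_mult w3 power_one mult_1_right)
 finally have "w ^ (n mod 3) = 1" using n by simp
 moreover have "w\<^sup>2 ~= 1" using w w_nz(2) by (metis add.commute add_cancel_right_left add_eq_0_iff2 one_add_one power2_eq_1_iff w_nz(1) zero_neq_numeral)
 ultimately have "n mod 3 = 0" using three_cases[of n] w_nz(2) by auto
 then show ?thesis by auto
qed

text \<open>An invariant form is a sum of invariant monomials, and multiplying by (XYZ)^(6e) turns
  each of them into a product of powers of X^2 Y, Y^2 Z and Z^2 X with natural exponents.\<close>

lemma invariant_descends_diag:
 assumes f: "homogeneous (9 * e) f" "vars_le 2 f"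
  and inv: "!!q. (!!i. 2 < i ==> q i = 0) ==> peval (dvec 1 (w\<^sup>2) w q) f = peval q f"
 obtains g where "homogeneous (9 * e) g" "vars_le 2 g"
  "!!q. peval (vec3 ((q 0)\<^sup>2 * q 1) ((q 1)\<^sup>2 * q 2) ((q 2)\<^sup>2 * q 0)) g = (q 0 * q 1 * q 2) ^ (6 * e) * peval q f"
proof -
 define z where "z = vec3 1 (w\<^sup>2) w"
 have "psubst (%i. Const (z i) * Var i) f = f"
 proof (rule mpoly3_eqI)
  show "vars_le 2 (psubst (%i. Const (z i) * Var i) f)"
  proof (rule vars_le_psubst)
   fix i assume "i \<in> pvars f"
   then have "i \<le> 2" using f(2) by (auto simp: vars_le_def)
   then show "vars_le 2 (Const (z i) * Var i)" by simp
  qed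
  fix p
  have "peval p (psubst (%i. Const (z i) * Var i) f) = peval (evals (%i. Const (z i) * Var i) p) f" by (rule peval_comp)
  also have "\<dots> = peval (trunc3 (evals (%i. Const (z i) * Var i) p)) f" using f(2) by (simp add: peval_trunc3)
  also have "trunc3 (evals (%i. Const (z i) * Var i) p) = dvec 1 (w\<^sup>2) w (trunc3 p)"
   by (simp add: trunc3_vec3 evals_def dvec_def z_def)
  also have "peval (dvec 1 (w\<^sup>2) w (trunc3 p)) f = peval p f" using inv[of "trunc3 p"] peval_trunc3[OF f(2), of p] by (simp add: trunc3_def)
  finally show "peval p (psubst (%i. Const (z i) * Var i) f) = peval p f" .
 qed (fact f)
 then have fixm: "mon z m * lookup f m = lookup f m" for m using lookup_psubst_diag[of z f m] by simp
 let ?i = "%m. lookup m 0" and ?j = "%m. lookup m 1" and ?k = "%m. lookup m 2"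
 define t where "t = (%m :: nat \<Rightarrow>\<^sub>0 nat. (2 * ?j m + ?k m) div 3)"
 have km: "keys m \<subseteq> {..2}" if "m \<in> keys f" for m using f(2) that by (auto simp: vars_le_def pvars_def)
 have mon3: "mon q m = q 0 ^ ?i m * q 1 ^ ?j m * q 2 ^ ?k m" if "m \<in> keys f" for m and q :: "nat => complex"
  using mon_superset[OF _ km[OF that], of q] by (simp add: atMost_2 mult.assoc)
 have ex: "?i m + ?j m + ?k m = 9 * e" "3 * t m = 2 * ?j m + ?k m" if m: "m \<in> keys f" for m
 proof -
  have "tdeg m = (\<Sum>i\<le>2. lookup m i)" by (rule tdeg_superset[OF _ km[OF m]]) simp
  then show "?i m + ?j m + ?k m = 9 * e" using f(1) m by (simp add: homogeneous_def atMost_2)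
  have "mon z m = 1" using fixm[of m] m by (simp add: in_keys_iff)
  then have "w ^ (2 * ?j m + ?k m) = 1" using mon3[OF m, of z] by (simp add: z_def power_add power_mult)
  then show "3 * t m = 2 * ?j m + ?k m" using w_power_one by (simp add: t_def)
 qed
 \<comment> \<open>A, t, C solve 2A + C = 6e + i, A + 2t = 6e + j, t + 2C = 6e + k for a monomial
   with exponents i, j, k. As i + j + k = 9e and 3t = 2j + k, the subtractions never
   truncate.\<close>
 define A where "A = (%m. 6 * e + ?j m - 2 * t m)"
 define C where "C = (%m. 3 * e + t m - ?j m)"
 have AC: "2 * A m + C m = 6 * e + ?i m" "A m + 2 * t m = 6 * e + ?j m" "t m + 2 * C m = 6 * e + ?k m" "A m + t m + C m = 9 * e"
  if "m \<in> keys f" for m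
  using ex[OF that] by (simp_all add: A_def C_def)
 define g where "g = (\<Sum>m\<in>keys f. Const (lookup f m) * (Var 0 ^ A m * Var 1 ^ t m * Var 2 ^ C m))"
 show ?thesis
 proof (rule that)
  show "vars_le 2 g" by (simp add: g_def)
  show "homogeneous (9 * e) g" unfolding g_def
  proof (rule homogeneous_sum)
   fix m assume "m \<in> keys f"
   then have "9 * e = 0 + (A m * Suc 0 + t m * Suc 0 + C m * Suc 0)" using AC by simp
   then show "homogeneous (9 * e) (Const (lookup f m) * (Var 0 ^ A m * Var 1 ^ t m * Var 2 ^ C m))"
    by (simp only:) (intro homogeneous_mult homogeneous_Const homogeneous_power homogeneous_Var)
  qed
  fix q :: "nat => complex"
  have pw: "(x\<^sup>2 * y) ^ a * (y\<^sup>2 * u) ^ b * (u\<^sup>2 * x) ^ c = (x * y * u) ^ n * (x ^ i * y ^ j * u ^ k)"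
   if "2 * a + c = n + i" "a + 2 * b = n + j" "b + 2 * c = n + k" for x y u :: complex and a b c n i j k :: nat
  proof -
   have "z ^ (2 * n) = z ^ n * z ^ n" for z :: complex and n by (simp add: mult_2 power_add)
   then have "(x\<^sup>2 * y) ^ a * (y\<^sup>2 * u) ^ b * (u\<^sup>2 * x) ^ c = x ^ (2 * a + c) * y ^ (a + 2 * b) * u ^ (b + 2 * c)"
    by (simp only: power2_eq_square power_mult_distrib power_add mult_ac)
   also have "\<dots> = (x * y * u) ^ n * (x ^ i * y ^ j * u ^ k)" unfolding that by (simp add: power_mult_distrib power_add mult_ac)
   finally show ?thesis .
  qed
  have "peval q f = (\<Sum>m\<in>keys f. lookup f m * mon q m)" by (simp add: insertion_def mon_def)
  then show "peval (vec3 ((q 0)\<^sup>2 * q 1) ((q 1)\<^sup>2 * q 2) ((q 2)\<^sup>2 * q 0)) g = (q 0 * q 1 * q 2) ^ (6 * e) * peval q f"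
   unfolding g_def by (simp add: sum_distrib_left pw[OF AC(1-3), simplified] mon3 mult.left_commute)
 qed
qed

definition uncov :: "nat => mpoly" where
 "uncov = vec3 (Const (1 / 3) * (Var 0 + Var 1 + Var 2)) (Const (1 / 3) * (Var 0 + Const w * Var 1 + Const (w\<^sup>2) * Var 2))
   (Const (1 / 3) * (Var 0 + Const (w\<^sup>2) * Var 1 + Const w * Var 2))"

lemma vars_le_uncov [simp]: "vars_le 2 (uncov i)"
 by (cases "i \<le> 2") (auto simp: uncov_def dest!: cases_le2)

lemma evals_uncov: "evals uncov v = vec3 ((v 0 + v 1 + v 2) / 3) ((v 0 + w * v 1 + w\<^sup>2 * v 2) / 3) ((v 0 + w\<^sup>2 * v 1 + w * v 2) / 3)"
 by (rule vec3_eqI) (simp_all add: evals_def uncov_def)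

lemma uncov_abc: "evals uncov (vec3 (peval q pa) (peval q pb) (peval q pc)) = vec3 (q 0) (q 1) (q 2)"
 unfolding evals_uncov vec3_simps peval_abc vec3_eq_iff
proof (intro conjI)
 have d: "x / 3 = y" if "x = 3 * y" for x y :: complex using that by simp
 show "(q 0 + q 1 + q 2 + (q 0 + w\<^sup>2 * q 1 + w * q 2) + (q 0 + w * q 1 + w\<^sup>2 * q 2)) / 3 = q 0"
  "(q 0 + q 1 + q 2 + w * (q 0 + w\<^sup>2 * q 1 + w * q 2) + w\<^sup>2 * (q 0 + w * q 1 + w\<^sup>2 * q 2)) / 3 = q 1"
  "(q 0 + q 1 + q 2 + w\<^sup>2 * (q 0 + w\<^sup>2 * q 1 + w * q 2) + w * (q 0 + w * q 1 + w\<^sup>2 * q 2)) / 3 = q 2"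
  by (rule d, use w in algebra)+
qed

lemma invariant_descends:
 assumes s: "homogeneous (9 * e) s" "vars_le 2 s"
  and inv: "!!q. (!!i. 2 < i ==> q i = 0) ==> peval (rot q) s = peval q s"
 obtains g where "homogeneous (9 * e) g" "vars_le 2 g"
  "!!q. peval (evals cov q) g = (peval q pa * peval q pb * peval q pc) ^ (6 * e) * peval q s"
proof -
 have "homogeneous (Suc 0) (uncov i)" for i
 proof (cases "i \<le> 2")
  case True
  have "homogeneous (0 + Suc 0) (Const k * Var j)" for k j by (intro homogeneous_mult) simp_all
  then have "homogeneous (0 + Suc 0) (uncov i)"
   using cases_le2[OF True] homogeneous_Var unfolding uncov_def
   by (elim disjE) (simp_all only: vec3_simps, (intro homogeneous_mult[of 0] homogeneous_add homogeneous_Const; simp)+)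
  then show ?thesis by simp
 qed (simp add: uncov_def)
 then have "homogeneous (9 * e * Suc 0) (psubst uncov s)" by (intro homogeneous_psubst s)
 then have f1: "homogeneous (9 * e) (psubst uncov s)" by simp
 have f2: "vars_le 2 (psubst uncov s)" by (rule vars_le_psubst) simp
 have "peval (dvec 1 (w\<^sup>2) w q) (psubst uncov s) = peval q (psubst uncov s)" for q
 proof -
  have "evals uncov (dvec 1 (w\<^sup>2) w q) = rot (evals uncov q)"
  proof -
   have w4: "w * (w\<^sup>2 * x) = x" "w\<^sup>2 * (w * x) = x" "w\<^sup>2 * (w\<^sup>2 * x) = w * x" "w * (w * x) = w\<^sup>2 * x" for x
    using w by (algebra, algebra, algebra, simp add: power2_eq_square)
   show ?thesis unfolding evals_uncov rot_def dvec_def vec3_simps w4 mult_1_left ..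
  qed
  moreover have "evals uncov q i = 0" if "2 < i" for i using that by (simp add: evals_uncov)
  ultimately show ?thesis unfolding peval_comp using inv by simp
 qed
 then obtain g where g: "homogeneous (9 * e) g" "vars_le 2 g"
  "!!q. peval (vec3 ((q 0)\<^sup>2 * q 1) ((q 1)\<^sup>2 * q 2) ((q 2)\<^sup>2 * q 0)) g = (q 0 * q 1 * q 2) ^ (6 * e) * peval q (psubst uncov s)"
  using invariant_descends_diag[OF f1 f2] by blast
 show ?thesis
 proof (rule that[OF g(1,2)])
  fix q
  have "peval (vec3 (q 0) (q 1) (q 2)) s = peval q s" using peval_trunc3[OF s(2), of q] by (simp add: trunc3_vec3)
  then show "peval (evals cov q) g = (peval q pa * peval q pb * peval q pc) ^ (6 * e) * peval q s"
   using g(3)[of "vec3 (peval q pa) (peval q pb) (peval q pc)"] unfolding peval_comp uncov_abc by (simp add: evals_cov)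
 qed
qed

lemma psubst_rot:
 assumes "homogeneous d s" "vars_le 2 s"
 defines "s' \<equiv> psubst (rot Var) s"
 shows "homogeneous d s'" "vars_le 2 s'" "s ~= 0 ==> s' ~= 0" "!!q. peval q s' = peval (rot q) s"
proof -
 have ev: "evals (rot Var) q = rot q" for q :: "nat => complex"
  unfolding rot_def by (rule vec3_eqI) (simp_all add: evals_def)
 have v: "vars_le 2 (rot Var i)" and h: "homogeneous (Suc 0) (rot Var i)" for i
  by (cases "i \<le> 2", auto simp: rot_def dest!: cases_le2)+
 show "vars_le 2 s'" unfolding s'_def by (rule vars_le_psubst) (rule v)
 have "homogeneous (d * Suc 0) s'" unfolding s'_def by (rule homogeneous_psubst[OF assms(1) h])
 then show "homogeneous d s'" by simp
 show "!!q. peval q s' = peval (rot q) s" unfolding s'_def peval_comp ev ..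
 assume s0: "s ~= 0"
 show "s' ~= 0" unfolding s'_def
 proof (rule psubst_torus_nz[OF assms(2) s0])
  fix v :: "nat => complex"
  show "\<exists>q. evals (rot Var) q 0 = v 0 \<and> evals (rot Var) q 1 = v 1 \<and> evals (rot Var) q 2 = v 2"
   unfolding ev by (rule exI[of _ "vec3 (v 1) (v 2) (v 0)"]) (simp add: rot_def)
 qed
qed

lemma rot_rot_rot:
 assumes "!!i. 2 < i ==> q i = 0" shows "rot (rot (rot q)) = q"
proof -
 have "q = vec3 (q 0) (q 1) (q 2)" by (rule vec3_eqI) (simp_all add: assms)
 then show ?thesis by (simp add: rot_def)
qed

text \<open>A rational map that is invariant under the cyclic permutation factors through the cover: multiplying its components by conjugates of one
 of them makes them invariant themselves.\<close>

lemma invariant_map_descends: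
 assumes F: "form_tuple e F" "!!i. vars_le 2 (F i)" "F k ~= 0"
  and inv: "!!q. (!!i. 2 < i ==> q i = 0) ==> par (evals F (rot q)) (evals F q)"
 obtains \<Psi> D h where "form_tuple (9 * e) \<Psi>" "!!i. vars_le 2 (\<Psi> i)" "homogeneous D h" "vars_le 2 h" "h ~= 0"
  "!!q. evals \<Psi> (evals cov q) = (%i. peval q h * evals F q i)"
proof -
 have Fk: "homogeneous e (F k)" using F(1) by (simp add: form_tuple_def)
 note 1 = psubst_rot[OF Fk F(2)]
 note 2 = psubst_rot[OF 1(1,2)]
 define K1 where "K1 = psubst (rot Var) (F k)"
 define K2 where "K2 = psubst (rot Var) K1"
 note K1 = 1[folded K1_def] and K2 = 2[folded K1_def, folded K2_def]
 \<comment> \<open>With the norm N = F_k K1 K2, the product of F_i and H is (F_i / F_k) N^3. The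
   quotient is invariant by hypothesis and the norm by construction, and the total degree is
   9e.\<close>
 define H where "H = K1 * K2 * (F k * K1 * K2)\<^sup>2"
 have Hh: "homogeneous (e + e + 2 * (e + e + e)) H" unfolding H_def by (intro homogeneous_mult homogeneous_power K1 K2 Fk)
 have H: "vars_le 2 H" "H ~= 0" using K1 K2 F by (simp_all add: H_def)
 have "\<exists>g. homogeneous (9 * e) g \<and> vars_le 2 g \<and> (\<forall>q. peval (evals cov q) g = (peval q pa * peval q pb * peval q pc) ^ (6 * e) * peval q (F i * H))" for i
 proof -
  have "homogeneous (e + (e + e + 2 * (e + e + e))) (F i * H)" using F(1) by (intro homogeneous_mult Hh) (simp add: form_tuple_def)
  then have h: "homogeneous (9 * e) (F i * H)" by (simp add: algebra_simps)
  have v: "vars_le 2 (F i * H)" using F H by simp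
  have "peval (rot q) (F i * H) = peval q (F i * H)" if q: "!!i. 2 < i ==> q i = 0" for q
  proof -
   have r: "rot (rot (rot q)) = q" by (rule rot_rot_rot[OF q])
   have "peval (rot q) (F i) * peval q (F k) = peval (rot q) (F k) * peval q (F i)" using inv[OF q] by (simp add: par_def evals_def)
   moreover have "f' * (k2 * k0 * (k1 * k2 * k0)\<^sup>2) = f * (k1 * k2 * (k0 * k1 * k2)\<^sup>2)" if "f' * k0 = k1 * f" for f' f k0 k1 k2 :: complex
    using that by algebra
   ultimately show ?thesis by (simp add: H_def K1(4) K2(4) r)
  qed
  then show ?thesis using invariant_descends[OF h v] by metis
 qed
 then obtain \<Psi> where \<Psi>: "!!i. homogeneous (9 * e) (\<Psi> i)" "!!i. vars_le 2 (\<Psi> i)"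
   "!!i q. peval (evals cov q) (\<Psi> i) = (peval q pa * peval q pb * peval q pc) ^ (6 * e) * peval q (F i * H)" by metis
 show ?thesis
 proof (rule that[of \<Psi> "(6 * e) * (Suc 0 + Suc 0 + Suc 0) + (e + e + 2 * (e + e + e))" "(pa * pb * pc) ^ (6 * e) * H"])
  show "form_tuple (9 * e) \<Psi>" using \<Psi> by (simp add: form_tuple_def)
  show "vars_le 2 (\<Psi> i)" for i by (rule \<Psi>)
  show "homogeneous ((6 * e) * (Suc 0 + Suc 0 + Suc 0) + (e + e + 2 * (e + e + e))) ((pa * pb * pc) ^ (6 * e) * H)"
   by (intro homogeneous_mult homogeneous_power homogeneous_abc Hh)
  show "vars_le 2 ((pa * pb * pc) ^ (6 * e) * H)" using H by simp
  have "pa ~= 0" "pb ~= 0" "pc ~= 0" using peval_abc[of "vec3 1 0 0"] by auto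
  then show "(pa * pb * pc) ^ (6 * e) * H ~= 0" using H by simp
  show "evals \<Psi> (evals cov q) = (%i. peval q ((pa * pb * pc) ^ (6 * e) * H) * evals F q i)" for q
   by (rule ext) (simp add: evals_def[of \<Psi>] \<Psi>(3), simp add: evals_def)
 qed
qed

text \<open>Descent of the tuple (s, 0, 0, ...), which is proportional to its rotation for any s.
  The resulting g is used to exclude downstairs the image of an exceptional curve upstairs.\<close>

lemma norm_descends:
 assumes s: "homogeneous d s" "vars_le 2 s" "s ~= 0"
 obtains D g where "homogeneous D g" "vars_le 2 g" "g ~= 0" "!!q. peval (evals cov q) g ~= 0 ==> peval q s ~= 0"
proof -
 let ?F = "%i::nat. if i = 0 then s else 0"
 have F: "form_tuple d ?F" "!!i. vars_le 2 (?F i)" using s by (auto simp: form_tuple_def)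
 obtain \<Psi> D h where *: "form_tuple (9 * d) \<Psi>" "!!i. vars_le 2 (\<Psi> i)" "homogeneous D h" "vars_le 2 h" "h ~= 0"
  "!!q. evals \<Psi> (evals cov q) = (%i. peval q h * evals ?F q i)"
  by (rule invariant_map_descends[OF F, of 0]) (use s in \<open>auto simp: par_def evals_def\<close>)
 have v: "peval (evals cov q) (\<Psi> 0) = peval q h * peval q s" for q
  using fun_cong[OF *(6), of q 0] by (simp add: evals_def[of \<Psi>] evals_def[of ?F])
 show ?thesis
 proof (rule that[of "9 * d" "\<Psi> 0"])
  show "\<Psi> 0 ~= 0"
  proof
   assume 0: "\<Psi> 0 = 0"
   have "h * s = 0"
   proof (rule mpoly3_eq_0I)
    show "peval q (h * s) = 0" for q using v[of q] by (simp add: 0)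
   qed (use * s in simp)
   then show False using * s by simp
  qed
  show "homogeneous (9 * d) (\<Psi> 0)" "vars_le 2 (\<Psi> 0)" using * by (simp_all add: form_tuple_def)
  show "peval (evals cov q) (\<Psi> 0) ~= 0 ==> peval q s ~= 0" for q by (simp add: v)
 qed
qed

end

subsection \<open>Strict transforms of plane curves\<close>

lemma mpoly3_prime_power:
 assumes "irreducible f" "vars_le 2 f" "vars_le 2 g" "vars_le 2 h" "f dvd g * h ^ n" "\<not> f dvd h"
 shows "f dvd g"
 using assms(5)
proof (induction n)
 case (Suc n)
 then have "f dvd (g * h ^ n) * h" by (simp add: mult_ac)
 then have "f dvd g * h ^ n" using mpoly3_prime[OF assms(1,2), of "g * h ^ n" h] assms by auto
 then show ?case by (rule Suc.IH)
qed simp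

lemma trunc3_vars_le: "vars_le 2 f ==> psubst (trunc3 Var) f = f"
 by (rule mpoly3_eqI) (simp_all add: peval_trunc3 del: insertion_psubst)

lemma curve_formD: "curve_form n c ==> homogeneous n c \<and> vars_le 2 c \<and> irreducible c"
 by (simp add: curve_form_def vars_le_def)

text \<open>Dividing by the equation of the curve as long as all components allow it lowers the
  degree. What remains represents the same map and is defined at a general point of the
  curve.\<close>

lemma curve_representative:
 assumes c: "curve_form n c" and \<Phi>: "form_tuple d \<Phi>" "!!i. vars_le 2 (\<Phi> i)" "\<exists>i. \<Phi> i ~= 0"
 obtains d' \<Phi>' t j where "form_tuple d' \<Phi>'" "!!i. vars_le 2 (\<Phi>' i)" "!!i. \<Phi> i = t * \<Phi>' i" "\<not> c dvd \<Phi>' j"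
proof -
 note c' = curve_formD[OF c]
 have "\<exists>d' \<Phi>' t j. form_tuple d' \<Phi>' \<and> (\<forall>i. vars_le 2 (\<Phi>' i)) \<and> (\<forall>i. \<Phi> i = t * \<Phi>' i) \<and> \<not> c dvd \<Phi>' j"
  using \<Phi>
 proof (induction d arbitrary: \<Phi> rule: less_induct)
  case (less d)
  show ?case
  proof (cases "\<exists>j. \<not> c dvd \<Phi> j")
   case True
   then obtain j where "\<not> c dvd \<Phi> j" by blast
   then show ?thesis using less.prems by (intro exI[of _ d] exI[of _ \<Phi>] exI[of _ 1] exI[of _ j]) simp
  next
   case False
   then have "\<forall>i. \<exists>h. \<Phi> i = c * h" by (auto simp: dvd_def)
   then obtain Q where Q: "!!i. \<Phi> i = c * Q i" by metis
   obtain i0 where i0: "\<Phi> i0 ~= 0" using less.prems(3) by blast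
   have h: "homogeneous d (\<Phi> i)" for i using less.prems(1) by (simp add: form_tuple_def)
   have "homogeneous d (Q i0 * c)" using h[of i0] Q by (simp add: mult.commute)
   then obtain e where e: "homogeneous e (Q i0)" using i0 Q homogeneous_factor[of d "Q i0" c] by (auto simp: mult.commute)
   have d: "d = n + e" by (rule homogeneous_degree_unique[OF h[of i0] _ i0]) (use homogeneous_mult[of n c e "Q i0"] c' e Q in simp)
   have c0: "c ~= 0" using c' by auto
   have "homogeneous e (Q i)" for i by (rule homogeneous_cancel_left[of n c e]) (use h[of i] c' Q d c0 in auto)
   then have 1: "form_tuple e Q" by (simp add: form_tuple_def)
   have 2: "vars_le 2 (Q i)" for i
   proof (cases "Q i = 0")
    case False
    then show ?thesis by (intro vars_le_dvd[of "Q i" "\<Phi> i"]) (use Q c0 less.prems(2) in auto)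
   qed simp
   have "0 < n" by (rule irreducible_homogeneous_degree[of n c]) (use c' in auto)
   then have "e < d" using d by simp
   moreover have "\<exists>i. Q i ~= 0" using i0 Q by auto
   ultimately obtain d' \<Phi>' t j where *: "form_tuple d' \<Phi>'" "\<forall>i. vars_le 2 (\<Phi>' i)" "\<forall>i. Q i = t * \<Phi>' i" "\<not> c dvd \<Phi>' j"
    using less.IH[OF _ 1 2] by blast
   then show ?thesis using Q by (intro exI[of _ d'] exI[of _ \<Phi>'] exI[of _ "c * t"] exI[of _ j]) (simp add: mult.assoc)
  qed
 qed
 then show ?thesis using that by blast
qed

text \<open>This turns containment of a strict transform in the zeros of s into a divisibility
  statement. At points where \<Phi> vanishes another representative supplies the value; the two are
  compared after multiplication by a power of the component that the curve does not divide.\<close>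

lemma curve_image_form:
 assumes c: "curve_form n c" and \<Phi>: "form_tuple d \<Phi>" "!!i. vars_le 2 (\<Phi> i)" "\<not> c dvd \<Phi> j" and s: "homogeneous e s"
 shows "(\<forall>x\<in>plane_curve c. \<forall>y. rmap P2 \<Phi> x = Some y \<longrightarrow> peval y s = 0) \<longleftrightarrow> c dvd psubst \<Phi> s"
proof
 note c' = curve_formD[OF c]
 have sv: "vars_le 2 (psubst \<Phi> s)" by (rule vars_le_psubst) (rule \<Phi>)
 have sh: "homogeneous (e * d) (psubst \<Phi> s)" by (rule homogeneous_comp[OF s \<Phi>(1)])
 have jh: "homogeneous d (\<Phi> j)" using \<Phi>(1) by (simp add: form_tuple_def)
 {
  assume L: "\<forall>x\<in>plane_curve c. \<forall>y. rmap P2 \<Phi> x = Some y \<longrightarrow> peval y s = 0"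
  have "c dvd psubst (trunc3 Var) (psubst \<Phi> s * \<Phi> j)"
  proof (rule plane_curve_dvd[OF c homogeneous_mult[OF sh jh]])
   fix x assume x: "x \<in> plane_curve c"
   then have xP: "x \<in> P2" by (simp add: mem_plane_curve)
   show "peval x (psubst \<Phi> s * \<Phi> j) = 0"
   proof (cases "evals \<Phi> x j = 0")
    case True
    then show ?thesis by (simp add: evals_def)
   next
    case False
    have "tuple_on P2 \<Phi>" unfolding tuple_on_def using \<Phi>(1) xP False by (auto simp: evals_def)
    then have "rmap P2 \<Phi> x = Some (to_point (evals \<Phi> x))" using rmap_eval[of P2 \<Phi> x j] irr_P2 xP False by blast
    then have "peval (to_point (evals \<Phi> x)) s = 0" using L x by blast
    then have "peval (evals \<Phi> x) s = 0" using peval_to_point_eq_0[OF s, of "evals \<Phi> x" j] False by blast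
    then show ?thesis unfolding insertion_mult[OF coeff_hom_id] peval_comp by simp
   qed
  qed
  then have "c dvd psubst \<Phi> s * \<Phi> j ^ 1" using trunc3_vars_le[of "psubst \<Phi> s * \<Phi> j"] sv \<Phi>(2) by simp
  then show "c dvd psubst \<Phi> s" using mpoly3_prime_power[of c "psubst \<Phi> s" "\<Phi> j" 1] c' sv \<Phi> by blast
 }
 {
  assume R: "c dvd psubst \<Phi> s"
  show "\<forall>x\<in>plane_curve c. \<forall>y. rmap P2 \<Phi> x = Some y \<longrightarrow> peval y s = 0"
  proof (intro ballI allI impI)
   fix x y assume x: "x \<in> plane_curve c" and y: "rmap P2 \<Phi> x = Some y"
   obtain \<Psi> where \<Psi>: "regular_rep P2 \<Phi> x \<Psi>" "y = to_point (evals \<Psi> x)" by (rule rmap_SomeD[OF y])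
   obtain e' where e': "form_tuple e' \<Psi>" using \<Psi>(1) by (auto simp: regular_rep_def)
   obtain i where i: "evals \<Psi> x i ~= 0" using \<Psi>(1) by (auto simp: regular_rep_def evals_def)
   have sm: "peval z (\<Phi> k) * peval z (\<Psi> l) = peval z (\<Phi> l) * peval z (\<Psi> k)" if "z \<in> P2" for z k l
    using \<Psi>(1) that by (auto simp: regular_rep_def same_on_def)
   have "c dvd psubst (trunc3 Var) (psubst \<Psi> s * \<Phi> j ^ e)"
   proof (rule plane_curve_dvd[OF c])
    show "homogeneous (e * e' + e * d) (psubst \<Psi> s * \<Phi> j ^ e)" by (intro homogeneous_mult homogeneous_comp[OF s e'] homogeneous_power jh)
    fix z assume z: "z \<in> plane_curve c"
    then have zP: "z \<in> P2" and zc: "peval z c = 0" by (simp_all add: mem_plane_curve)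
    have "peval z (psubst \<Phi> s) = 0" using R zc by (auto simp del: insertion_psubst elim!: dvdE)
    then have "peval (evals \<Phi> z) s = 0" unfolding peval_comp .
    then have "peval (%k. evals \<Psi> z j * evals \<Phi> z k) s = 0" by (simp add: peval_scale[OF s])
    moreover have "(%k. evals \<Psi> z j * evals \<Phi> z k) = (%k. evals \<Phi> z j * evals \<Psi> z k)"
     using sm[OF zP] by (auto simp: evals_def mult.commute)
    ultimately have "evals \<Phi> z j ^ e * peval (evals \<Psi> z) s = 0" by (simp add: peval_scale[OF s])
    then show "peval z (psubst \<Psi> s * \<Phi> j ^ e) = 0" unfolding insertion_mult[OF coeff_hom_id] peval_comp by (auto simp: evals_def[of \<Phi>])
   qed
   then have "c dvd psubst (trunc3 Var) (psubst \<Psi> s) * psubst (trunc3 Var) (\<Phi> j) ^ e" by (simp del: insertion_psubst)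
   then have "c dvd psubst (trunc3 Var) (psubst \<Psi> s) * \<Phi> j ^ e" unfolding trunc3_vars_le[OF \<Phi>(2)] .
   moreover have "vars_le 2 (psubst (trunc3 Var) (psubst \<Psi> s))" by (rule vars_le_psubst) (simp add: trunc3_def)
   ultimately have "c dvd psubst (trunc3 Var) (psubst \<Psi> s)"
    using mpoly3_prime_power[of c "psubst (trunc3 Var) (psubst \<Psi> s)" "\<Phi> j" e] c' \<Phi> by blast
   moreover have "peval x c = 0" using x by (simp add: mem_plane_curve)
   ultimately have "peval x (psubst (trunc3 Var) (psubst \<Psi> s)) = 0" by (auto simp del: insertion_psubst peval_psubst_trunc3 elim!: dvdE)
   then have "peval (trunc3 x) (psubst \<Psi> s) = 0" by (simp only: peval_psubst_trunc3)
   then have "peval (evals \<Psi> x) s = 0" using x by (simp only: P2_trunc3 mem_plane_curve peval_comp)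
   then show "peval y s = 0" using peval_to_point_eq_0[OF s, of "evals \<Psi> x" i] i \<Psi>(2) by blast
  qed
 }
qed

lemma cubic_not_dvd_Var: "\<not> cubic dvd Var i"
proof
 assume "cubic dvd Var i"
 then obtain h where h: "Var i = cubic * h" by blast
 have "peval (%_. 1) (Var i) = 0" unfolding h by (simp add: cubic_eq)
 then show False by simp
qed

context cube_root_of_unity
begin

lemma cov_dominant: "filterlim (%p. to_point (evals cov p)) (generic P2) (generic P2)"
 unfolding filterlim_iff
proof (intro allI impI)
 fix P assume "eventually P (generic P2)"
 from generic_cov[OF this] obtain S D where S: "homogeneous D S" "vars_le 2 S" "S ~= 0"
  "!!q. (!!i. 2 < i ==> q i = 0) ==> peval q S ~= 0 ==> P (to_point (evals cov q))" by metis
 show "eventually (%q. P (to_point (evals cov q))) (generic P2)"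
  using generic_P2_nz[OF S(1-3)] generic_in[OF irr_P2] by eventually_elim (use S(4) P2_beyond in blast)
qed

text \<open>The cover maps each side of the coordinate triangle onto the nodal cubic.\<close>

lemma line_onto_cubic:
 assumes i: "i \<le> 2" and g: "homogeneous d g" "vars_le 2 g" and dv: "Var i dvd psubst cov g"
 shows "cubic dvd g"
proof -
 note c' = curve_formD[OF curve_form_cubic]
 let ?R = "g * Var 0 * Var 1 * Var 2"
 have dvdR: "cubic dvd psubst (trunc3 Var) ?R"
 proof (rule plane_curve_dvd[OF curve_form_cubic])
  show "homogeneous (d + Suc 0 + Suc 0 + Suc 0) ?R" by (intro homogeneous_mult g homogeneous_Var)
  fix x assume x: "x \<in> plane_curve cubic"
  show "peval x ?R = 0"
  proof (cases "x 0 = 0 \<or> x 1 = 0 \<or> x 2 = 0")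
   case False
   then obtain q where q: "evals cov q = vec3 (x 0) (x 1) (x 2)" "peval q pa ~= 0" "peval q pb ~= 0" "peval q pc ~= 0"
    using cov_surj[of "x 0" "x 1" "x 2"] by metis
   have xe: "vec3 (x 0) (x 1) (x 2) = x" using x P2_trunc3[of x] by (simp add: mem_plane_curve trunc3_vec3)
   have "peval (evals cov q) cubic = 0" unfolding q(1) xe using x by (simp add: mem_plane_curve)
   then have q0: "q 0 = 0 \<or> q 1 = 0 \<or> q 2 = 0" unfolding cubic_cov using q(2-4) by auto
   \<comment> \<open>Rotating q moves its zero coordinate to the place i and changes the image under
     the cover only by a scalar.\<close>
   obtain q' k where q': "q' i = 0" "k ~= 0" "evals cov q' = (%j. k * evals cov q j)"
   proof -
    have 1: "evals cov q = (%j. 1 * evals cov q j)" "evals cov (rot q) = (%j. w\<^sup>2 * evals cov q j)"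
     "evals cov (rot (rot q)) = (%j. w\<^sup>2 * w\<^sup>2 * evals cov q j)" by (simp_all add: evals_cov_rot mult.assoc)
    have "q i = 0 \<or> rot q i = 0 \<or> rot (rot q) i = 0" using cases_le2[OF i] q0 by (auto simp: rot_def)
    then show ?thesis using that[OF _ _ 1(1)] that[OF _ _ 1(2)] that[OF _ _ 1(3)] by auto
   qed
   have "peval q' (psubst cov g) = 0" using dv q'(1) by (auto simp del: insertion_psubst elim!: dvdE)
   then have "peval (%j. k * x j) g = 0" unfolding peval_comp q'(3) q(1) xe .
   then have "peval x g = 0" using q'(2) by (simp add: peval_scale[OF g(1)])
   then show ?thesis by simp
  qed auto
 qed
 have "vars_le 2 ?R" using g(2) by simp
 from dvdR[unfolded trunc3_vars_le[OF this]] have "cubic dvd ?R" .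
 then have "cubic dvd g * Var 0 * Var 1 * Var 2 ^ 1" by simp
 then have "cubic dvd g * Var 0 * Var 1 ^ 1" using mpoly3_prime_power[of cubic "g * Var 0 * Var 1" "Var 2" 1] c' g cubic_not_dvd_Var by auto
 then have "cubic dvd g * Var 0 ^ 1" using mpoly3_prime_power[of cubic "g * Var 0" "Var 1" 1] c' g cubic_not_dvd_Var by auto
 then show ?thesis using mpoly3_prime_power[of cubic g "Var 0" 1] c' g cubic_not_dvd_Var by auto
qed

text \<open>Both sides become divisibility conditions, by the cubic downstairs and by a variable
  upstairs. The proportionality of the two tuples over the cover relates them: the variable divides
  the pull-back of the cubic, and it divides the pull-back of a form only if the cubic divides the
  form.\<close>

lemma cubic_image_iff:
 assumes \<Psi>: "form_tuple d \<Psi>" "!!i. vars_le 2 (\<Psi> i)" and F: "form_tuple e F" "!!i. vars_le 2 (F i)" "\<exists>i. F i ~= 0"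
  and par: "!!q. par (evals \<Psi> (evals cov q)) (evals F q)" and \<Psi>0: "\<exists>i. \<Psi> i ~= 0" and s: "homogeneous k s" and i: "i \<le> 2"
 shows "(\<forall>x\<in>plane_curve cubic. \<forall>y. rmap P2 \<Psi> x = Some y \<longrightarrow> peval y s = 0) \<longleftrightarrow>
  (\<forall>x\<in>plane_curve (Var i). \<forall>y. rmap P2 F x = Some y \<longrightarrow> peval y s = 0)"
proof -
 obtain d1 \<Psi>1 t1 j1 where 1: "form_tuple d1 \<Psi>1" "!!i. vars_le 2 (\<Psi>1 i)" "!!i. \<Psi> i = t1 * \<Psi>1 i" "\<not> cubic dvd \<Psi>1 j1"
  by (rule curve_representative[OF curve_form_cubic \<Psi> \<Psi>0]) blast
 obtain d2 F2 t2 j2 where 2: "form_tuple d2 F2" "!!i. vars_le 2 (F2 i)" "!!i. F i = t2 * F2 i" "\<not> Var i dvd F2 j2"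
  by (rule curve_representative[OF curve_form_Var[OF i] F]) blast
 have ton: "tuple_on P2 \<Phi>" if "form_tuple l \<Phi>" "!!i. vars_le 2 (\<Phi> i)" "\<Phi> j ~= 0" for l j \<Phi>
 proof -
  have "eventually (%p. peval p (\<Phi> j) ~= 0) (generic P2)" by (rule generic_P2_nz[of l]) (use that in \<open>auto simp: form_tuple_def\<close>)
  then show ?thesis using generic_ex[OF irr_P2] that(1) unfolding tuple_on_def by blast
 qed
 have rm: "rmap P2 \<Phi> = rmap P2 \<Phi>'" if a: "form_tuple l \<Phi>" "!!i. vars_le 2 (\<Phi> i)" "\<exists>i. \<Phi> i ~= 0" "form_tuple l' \<Phi>'" "!!i. vars_le 2 (\<Phi>' i)" "!!i. \<Phi> i = t * \<Phi>' i"
  for \<Phi> \<Phi>' t l l'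
 proof -
  obtain j where j: "\<Phi> j ~= 0" using a(3) by blast
  then have "\<Phi>' j ~= 0" using a(6)[of j] by auto
  moreover have "par (evals \<Phi> p) (evals \<Phi>' p)" for p using a(6) by (simp add: par_def evals_def)
  ultimately show ?thesis using ton[OF a(1,2) j] ton[OF a(4,5)] by (intro rmap_cong[OF irr_P2] always_eventually) auto
 qed
 have nz: "psubst cov \<Psi>1' ~= 0" if "vars_le 2 \<Psi>1'" "\<Psi>1' ~= 0" for \<Psi>1' using psubst_cov_eq_0 that by blast
 have t1: "t1 ~= 0" using \<Psi>0 1(3) by auto
 have t2: "t2 ~= 0" using F(3) 2(3) by auto
 have t1v: "vars_le 2 t1" and t2v: "vars_le 2 t2"
 proof -
  obtain i where "\<Psi> i ~= 0" using \<Psi>0 by blast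
  then show "vars_le 2 t1" using vars_le_dvd[of t1 "\<Psi> i"] 1(3) \<Psi>(2) by auto
  obtain i where "F i ~= 0" using F(3) by blast
  then show "vars_le 2 t2" using vars_le_dvd[of t2 "F i"] 2(3) F(2) by auto
 qed
 have id: "psubst cov (\<Psi>1 l) * F2 m = psubst cov (\<Psi>1 m) * F2 l" for l m
 proof -
  have "(psubst cov t1 * t2) * (psubst cov (\<Psi>1 l) * F2 m - psubst cov (\<Psi>1 m) * F2 l) = 0"
  proof (rule mpoly3_eq_0I)
   show "vars_le 2 ((psubst cov t1 * t2) * (psubst cov (\<Psi>1 l) * F2 m - psubst cov (\<Psi>1 m) * F2 l))"
    using t2v 2(2) by (intro vars_le_mult vars_le_diff vars_le_psubst) simp_all
   fix q
   have "evals \<Psi> (evals cov q) l * evals F q m = evals \<Psi> (evals cov q) m * evals F q l" using par[of q] by (simp add: par_def)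
   then show "peval q ((psubst cov t1 * t2) * (psubst cov (\<Psi>1 l) * F2 m - psubst cov (\<Psi>1 m) * F2 l)) = 0"
    unfolding evals_def[of \<Psi>] evals_def[of F] 1(3) 2(3) by (simp add: peval_comp algebra_simps del: insertion_psubst)
  qed
  moreover have "psubst cov t1 * t2 ~= 0" using nz[OF t1v t1] t2 by simp
  ultimately show ?thesis by simp
 qed
 have sid: "psubst cov (psubst \<Psi>1 s) * F2 l ^ k = psubst F2 s * psubst cov (\<Psi>1 l) ^ k" for l
 proof (rule mpoly3_eqI)
  have v1: "vars_le 2 (psubst cov (psubst \<Psi>1 s))" "vars_le 2 (psubst cov (\<Psi>1 l))" by (rule vars_le_psubst, simp)+
  have "vars_le 2 (psubst F2 s)" by (rule vars_le_psubst) (rule 2)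
  then show "vars_le 2 (psubst cov (psubst \<Psi>1 s) * F2 l ^ k)" "vars_le 2 (psubst F2 s * psubst cov (\<Psi>1 l) ^ k)"
   using 2(2) v1 by (simp_all del: insertion_psubst)
  fix q
  have "evals \<Psi>1 (evals cov q) m * evals F2 q l = evals \<Psi>1 (evals cov q) l * evals F2 q m" for m
   using arg_cong[OF id[of m l], of "peval q"] by (simp add: peval_comp evals_def[of \<Psi>1] evals_def[of F2] del: insertion_psubst)
  then have "(%m. evals F2 q l * evals \<Psi>1 (evals cov q) m) = (%m. evals \<Psi>1 (evals cov q) l * evals F2 q m)" by (simp add: mult.commute)
  from arg_cong[OF this, of "%v. peval v s"]
  have "evals F2 q l ^ k * peval (evals \<Psi>1 (evals cov q)) s = evals \<Psi>1 (evals cov q) l ^ k * peval (evals F2 q) s" by (simp only: peval_scale[OF s])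
  moreover have "peval q (psubst cov (psubst \<Psi>1 s)) = peval (evals \<Psi>1 (evals cov q)) s" "peval q (psubst F2 s) = peval (evals F2 q) s"
   "peval q (psubst cov (\<Psi>1 l)) = evals \<Psi>1 (evals cov q) l"
   by (simp_all only: peval_comp) (simp only: evals_def)
  ultimately show "peval q (psubst cov (psubst \<Psi>1 s) * F2 l ^ k) = peval q (psubst F2 s * psubst cov (\<Psi>1 l) ^ k)"
   by (simp add: evals_def[of F2] mult.commute del: insertion_psubst)
 qed
 have vi: "irreducible (Var i)" "vars_le 2 (Var i)" using curve_formD[OF curve_form_Var[OF i]] by simp_all
 have v\<Psi>s: "vars_le 2 (psubst \<Psi>1 s)" by (rule vars_le_psubst) (rule 1)
 have "cubic dvd psubst \<Psi>1 s \<longleftrightarrow> Var i dvd psubst F2 s"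
 proof
  assume "cubic dvd psubst \<Psi>1 s"
  then obtain b where b: "psubst \<Psi>1 s = cubic * b" by blast
  have "psubst cov cubic = 27 * (pa * pb * pc)\<^sup>2 * (Var 0 * Var 1 * Var 2)"
  proof (rule mpoly3_eqI)
   show "peval q (psubst cov cubic) = peval q (27 * (pa * pb * pc)\<^sup>2 * (Var 0 * Var 1 * Var 2))" for q
    unfolding peval_comp cubic_cov by simp
   show "vars_le 2 (psubst cov cubic)" by (rule vars_le_psubst) simp
  qed simp
  moreover have "Var i dvd (Var 0 * Var 1 * Var 2 :: mpoly)" using cases_le2[OF i] by (elim disjE) simp_all
  ultimately have "Var i dvd psubst cov cubic" by simp
  then have "Var i dvd psubst cov (psubst \<Psi>1 s)" unfolding b by (simp del: insertion_psubst)
  then have "Var i dvd psubst F2 s * psubst cov (\<Psi>1 j1) ^ k" using sid[of j1] by (metis dvd_mult2)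
  moreover have "\<not> Var i dvd psubst cov (\<Psi>1 j1)" using line_onto_cubic[OF i _ 1(2)] 1(1,4) by (auto simp: form_tuple_def)
  ultimately show "Var i dvd psubst F2 s"
   using mpoly3_prime_power[OF vi, of "psubst F2 s" "psubst cov (\<Psi>1 j1)" k] 2(2) vars_le_psubst[of _ 2 cov] vars_le_psubst[of s 2 F2] by auto
 next
  assume "Var i dvd psubst F2 s"
  then have "Var i dvd psubst cov (psubst \<Psi>1 s) * F2 j2 ^ k" using sid[of j2] by (metis dvd_mult2)
  then have "Var i dvd psubst cov (psubst \<Psi>1 s)"
   using mpoly3_prime_power[OF vi, of "psubst cov (psubst \<Psi>1 s)" "F2 j2" k] 2(2,4) vars_le_psubst[of "psubst \<Psi>1 s" 2 cov] by auto
  then show "cubic dvd psubst \<Psi>1 s" by (rule line_onto_cubic[OF i homogeneous_comp[OF s 1(1)] v\<Psi>s])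
 qed
 then show ?thesis
  unfolding rm[OF \<Psi> \<Psi>0 1(1-3)] rm[OF F 2(1-3)] curve_image_form[OF curve_form_cubic 1(1,2,4) s] curve_image_form[OF curve_form_Var[OF i] 2(1,2,4) s] .
qed

end

subsection \<open>The very special foliation\<close>

text \<open>The universal property of the quotient admits only varieties as targets, so a map is
  first restricted to the closure of its image. The closure is cut out by the forms vanishing
  generically along f, and it inherits irreducibility from A.\<close>

lemma image_closure:
 assumes A: "irr A" and f: "f \<in> rational_maps A B" and B: "proj_closed B"
 obtains W where "irr W" "proj_closed W" "W \<subseteq> B" "f \<in> rational_maps A W"
  "!!s d. homogeneous d s ==> eventually (%p. peval (the (f p)) s = 0) (generic A) ==> \<forall>y\<in>W. peval y s = 0"
proof -
 obtain n where n: "B \<subseteq> proj_space n" using proj_closed_subset[OF B] by blast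
 define S where "S = {s. (\<exists>d. homogeneous d s) \<and> eventually (%p. peval (the (f p)) s = 0) (generic A)}"
 define W where "W = {y \<in> proj_space n. \<forall>s\<in>S. peval y s = 0}"
 obtain \<Phi> d where \<Phi>: "f = rmap A \<Phi>" "map_tuple A B \<Phi>" "tuple_on A \<Phi>" "form_tuple d \<Phi>" by (rule rational_mapsE[OF f])
 have val: "y \<in> W" if "f p = Some y" for p y
 proof -
  have "y \<in> proj_space n" using rational_value(2)[OF A B f that] n by blast
  then show ?thesis using rational_value_form[OF A f _ _ that] by (auto simp: W_def S_def)
 qed
 have Wc: "proj_closed W" unfolding W_def by (rule proj_closedI) (auto simp: S_def)
 have W0: "W ~= {}" using generic_ex[OF A generic_rational[OF A f]] val by blast
 have zero: "peval (the (f p)) s = 0 \<longleftrightarrow> peval p (psubst \<Phi> s) = 0"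
  if "homogeneous e s" "evals \<Phi> p i ~= 0" "rmap A \<Phi> p = Some (to_point (evals \<Phi> p))" for e s p i
  using peval_to_point_eq_0[of e s "evals \<Phi> p" i] that unfolding peval_comp by (simp add: \<Phi>(1))
 have "irr W" unfolding irr_def
 proof (intro conjI allI impI)
  show "W ~= {}" by (rule W0)
  show "\<exists>n. W \<subseteq> proj_space n" unfolding W_def by blast
  fix a b k l assume a: "homogeneous k a" and b: "homogeneous l b" and ab: "\<forall>p\<in>W. peval p a * peval p b = 0"
  show "(\<forall>p\<in>W. peval p a = 0) \<or> (\<forall>p\<in>W. peval p b = 0)"
  proof (cases "eventually (%p. peval (the (f p)) a = 0) (generic A)")
   case True
   then have "a \<in> S" using a by (auto simp: S_def)
   then show ?thesis by (auto simp: W_def)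
  next
   case False
   have "\<exists>p\<in>A. peval p (psubst \<Phi> a) ~= 0"
   proof (rule ccontr)
    assume "\<not> ?thesis"
    then have "eventually (%p. peval (the (f p)) a = 0) (generic A)"
     by (intro eventually_mono[OF generic_rmap[OF A \<Phi>(3)]]) (use zero[OF a] in blast)
    then show False using False by simp
   qed
   then have "eventually (%p. peval p (psubst \<Phi> a) ~= 0) (generic A)"
    using generic_form[OF A homogeneous_comp[OF a \<Phi>(4)]] by blast
   then have "eventually (%p. peval (the (f p)) b = 0) (generic A)"
    using generic_rmap[OF A \<Phi>(3)] generic_rational[OF A f]
   proof eventually_elim
    case (elim p)
    then obtain i where i: "evals \<Phi> p i ~= 0" by blast
    have "the (f p) \<in> W" using val elim by auto
    then have "peval (the (f p)) a * peval (the (f p)) b = 0" using ab by blast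
    moreover have "peval (the (f p)) a ~= 0" using zero[OF a i] elim by blast
    ultimately show ?case by simp
   qed
   then have "b \<in> S" using b by (auto simp: S_def)
   then show ?thesis by (auto simp: W_def)
  qed
 qed
 moreover have "W \<subseteq> B"
 proof
  fix y assume y: "y \<in> W"
  show "y \<in> B"
  proof (rule ccontr)
   assume "y \<notin> B"
   moreover have "y \<in> proj_space n" using y by (simp add: W_def)
   ultimately obtain s e where s: "homogeneous e s" "!!z. z \<in> B ==> peval z s = 0" "peval y s ~= 0" using proj_closed_separate'[OF B] by blast
   have "eventually (%p. peval (the (f p)) s = 0) (generic A)"
    using generic_rational[OF A f] by eventually_elim (use s(2) in auto)
   then have "s \<in> S" using s(1) by (auto simp: S_def)
   then show False using y s(3) by (auto simp: W_def)
  qed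
 qed
 moreover have "f \<in> rational_maps A W"
 proof -
  have "eventually (%p. to_point (evals \<Phi> p) \<in> W) (generic A)"
   using generic_rmap[OF A \<Phi>(3)] by eventually_elim (use val \<Phi>(1) in blast)
  then have "map_tuple A W \<Phi>" by (rule map_tupleI[OF A \<Phi>(3) Wc])
  then show ?thesis unfolding rational_maps_def \<Phi>(1) by blast
 qed
 moreover have "\<forall>y\<in>W. peval y s = 0" if "homogeneous d s" "eventually (%p. peval (the (f p)) s = 0) (generic A)" for s d
  using that by (auto simp: W_def S_def)
 ultimately show ?thesis using that Wc by blast
qed

text \<open>The quotient map factors through the closure W of its own image by some g. As a self-map
  of X, g and the identity solve the same universal problem, so they agree, and W is all of
  X.\<close>

lemma quotient_dominant:
 assumes q: "quotient_by P2 T X q" shows "dominant q P2 X"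
proof -
 have X: "irr X" "proj_closed X" using q proj_variety_irr by (auto simp: quotient_by_def proj_variety_def)
 have qr: "q \<in> rational_maps P2 X" "dom q = P2" "q \<circ>\<^sub>m T = q" using q by (auto simp: quotient_by_def regular_maps_def)
 have univ: "\<exists>!g. g \<in> regular_maps X Y \<and> g \<circ>\<^sub>m f = f'" if "proj_variety Y" "f' \<in> regular_maps P2 Y" "f' \<circ>\<^sub>m T = f'" "f = q" for Y f f'
  using q that unfolding quotient_by_def by blast
 obtain W where W: "irr W" "proj_closed W" "W \<subseteq> X" "q \<in> rational_maps P2 W"
  "!!s d. homogeneous d s ==> eventually (%p. peval (the (q p)) s = 0) (generic P2) ==> \<forall>y\<in>W. peval y s = 0"
  by (rule image_closure[OF irr_P2 qr(1) X(2)]) blast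
 have "\<exists>g. g \<in> regular_maps X W \<and> g \<circ>\<^sub>m q = q"
  using univ[OF irr_proj_variety[OF W(1,2)] _ qr(3) refl] W(4) qr(2) by (auto simp: regular_maps_def)
 then obtain g where g: "g \<in> rational_maps X W" "dom g = X" "g \<circ>\<^sub>m q = q" by (auto simp: regular_maps_def)
 have "g \<in> rational_maps X X" using g(1) W(3) unfolding rational_maps_def map_tuple_def by blast
 then have gX: "g \<in> regular_maps X X \<and> g \<circ>\<^sub>m q = q" using g by (simp add: regular_maps_def)
 have idq: "(Some |` X) \<circ>\<^sub>m q = q"
 proof
  fix p show "((Some |` X) \<circ>\<^sub>m q) p = q p"
   using rational_value(2)[OF irr_P2 X(2) qr(1), of p] by (cases "q p") auto
 qed
 have "Some |` X \<in> regular_maps X X" using id_rational[OF X(1)] by (auto simp: regular_maps_def dom_def restrict_map_def)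
 moreover have "\<exists>!g. g \<in> regular_maps X X \<and> g \<circ>\<^sub>m q = q"
  by (rule univ[OF irr_proj_variety[OF X] _ qr(3) refl]) (use qr in \<open>simp add: regular_maps_def\<close>)
 ultimately have "g = Some |` X" using gX idq by blast
 then have "X \<subseteq> W" using rational_value(2)[OF X(1) W(2) g(1)] by (metis restrict_in subsetI)
 then show ?thesis using W(5) by (intro dominantI[OF irr_P2 X(1) qr(1)]) blast
qed

text \<open>The fibre is the kernel of a linear form and contains the Euler vector. Different
  representatives of a map have differentials that differ by a scalar and a multiple of the image
  point, and this absorbs the difference.\<close>

lemma fibre_linear:
 assumes G: "foliation M G" and M: "proj_closed M" and v: "(y, v) \<in> G"
 shows "(y, %i. a * v i + b * y i) \<in> G"
proof -
 obtain n where n: "M \<subseteq> proj_space n" using proj_closed_subset[OF M] by blast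
 have yM: "y \<in> M" and vt: "v \<in> tangent M y" using G v by (auto simp: foliation_def)
 have yy: "(y, y) \<in> G" using G yM by (auto simp: foliation_def)
 then have yt: "y \<in> tangent M y" using G by (auto simp: foliation_def)
 obtain d A Z where Z: "y \<notin> Z" "\<forall>s\<in>M - Z. G `` {s} = ker_form M A `` {s}" using G yM unfolding foliation_def by blast
 then have K: "(y, u) \<in> G \<longleftrightarrow> (y, u) \<in> ker_form M A" for u using yM by blast
 have supp: "u i = 0" if "u \<in> tangent M y" "n < i" for u i
 proof -
  have "Var i \<in> vanishing_forms M" using n that(2) proj_space_beyond by (auto simp: vanishing_forms_def intro!: exI[of _ "Suc 0"])
  then show ?thesis using that(1) by (auto simp: tangent_def)
 qed
 have fin: "(\<Sum>i | u i ~= 0. peval y (A i) * u i) = (\<Sum>i\<le>n. peval y (A i) * u i)" if "u \<in> tangent M y" for u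
  by (rule sum.mono_neutral_left) (use supp[OF that] in \<open>auto simp: not_less[symmetric]\<close>)
 let ?v = "%i. a * v i + b * y i"
 have vt': "?v \<in> tangent M y" using vt yt by (simp add: tangent_def dir_deriv_lin)
 have "(\<Sum>i\<le>n. peval y (A i) * ?v i) = a * (\<Sum>i\<le>n. peval y (A i) * v i) + b * (\<Sum>i\<le>n. peval y (A i) * y i)"
  by (simp add: distrib_left sum.distrib sum_distrib_left mult_ac)
 also have "\<dots> = 0" using v yy fin[OF vt] fin[OF yt] unfolding K by (simp add: ker_form_def)
 finally show ?thesis unfolding K using vt' yM fin[OF vt'] by (simp add: ker_form_def)
qed

lemma fibre_linear_iff:
 assumes "foliation M G" "proj_closed M" "a ~= 0"
 shows "(y, %i. a * v i + b * y i) \<in> G \<longleftrightarrow> (y, v) \<in> G"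
proof
 assume "(y, %i. a * v i + b * y i) \<in> G"
 note * = fibre_linear[OF assms(1,2) this, of "1 / a" "- b / a"]
 have "1 / a * (a * x + b * z) + - b / a * z = x" for x z using assms(3) by (simp add: distrib_left)
 with * show "(y, v) \<in> G" by (simp only:)
qed (rule fibre_linear[OF assms(1,2)])

lemma mem_triangle: "x \<in> triangle \<longleftrightarrow> (\<exists>i\<le>2. x \<in> plane_curve (Var i))"
proof
 assume "x \<in> triangle"
 then have "x \<in> P2" "x 0 = 0 \<or> x 1 = 0 \<or> x 2 = 0" by (auto simp: triangle_def mem_plane_curve)
 then show "\<exists>i\<le>2. x \<in> plane_curve (Var i)" by (auto simp: mem_plane_curve intro: exI[of _ 0] exI[of _ 1] exI[of _ 2])
next
 assume "\<exists>i\<le>2. x \<in> plane_curve (Var i)"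
 then show "x \<in> triangle" by (auto simp: triangle_def mem_plane_curve dest!: cases_le2)
qed

context cube_root_of_unity
begin

lemma mem_E3: "(p, u) \<in> E3 w \<longleftrightarrow> p \<in> P2 \<and> (\<forall>i>2. u i = 0) \<and> eta p u = 0"
proof -
 have "eta p u = w * (w\<^sup>2 * p 1 * p 2 * u 0 + w * p 0 * p 2 * u 1 + p 0 * p 1 * u 2)"
  unfolding eta_def using w by algebra
 then show ?thesis unfolding E3_def Let_def ker_form_P2 triple_vec3 by simp
qed

lemma cov_tangent_surj:
 assumes "peval q pa ~= 0" "peval q pb ~= 0" "peval q pc ~= 0" "!!i. 2 < i ==> v i = 0"
 obtains u where "!!i. 2 < i ==> u i = 0" "(%i. dir_deriv q u (cov i)) = v"
proof -
 define a b c where abc: "a = peval q pa" "b = peval q pb" "c = peval q pc"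
 define V0 V1 V2 where V: "V0 = v 0 / (a\<^sup>2 * b)" "V1 = v 1 / (b\<^sup>2 * c)" "V2 = v 2 / (c\<^sup>2 * a)"
 \<comment> \<open>In logarithmic coordinates the differential of the cover is the circulant matrix
   of 2, 1, 0, with determinant 9; these are the entries of its inverse applied to V0, V1,
   V2.\<close>
 define A B C where ABC: "A = (4 * V0 - 2 * V1 + V2) / 9" "B = (4 * V1 - 2 * V2 + V0) / 9" "C = (4 * V2 - 2 * V0 + V1) / 9"
 have e: "2 * A + B = V0" "2 * B + C = V1" "2 * C + A = V2" unfolding ABC by (simp_all add: field_simps)
 obtain u where u: "!!i. 2 < i ==> u i = 0" "peval u pa = a * A" "peval u pb = b * B" "peval u pc = c * C"
  using abc_inverse by metis
 have d: "dir_deriv q u pa = a * A" "dir_deriv q u pb = b * B" "dir_deriv q u pc = c * C"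
  using u(2-4) unfolding dir_abc peval_abc .
 have k: "2 * x * (x * X) * y + x\<^sup>2 * (y * Y) = x\<^sup>2 * y * (2 * X + Y)" for x y X Y :: complex by (simp add: power2_eq_square algebra_simps)
 have n: "a ~= 0" "b ~= 0" "c ~= 0" using assms abc by simp_all
 show ?thesis
 proof (rule that[OF u(1)])
  have "dir_deriv q u (cov 0) = v 0" using k[of a A b] n by (simp add: d e V flip: abc)
  moreover have "dir_deriv q u (cov 1) = v 1" using k[of b B c] n by (simp add: d e V flip: abc)
  moreover have "dir_deriv q u (cov 2) = v 2" using k[of c C a] n by (simp add: d e V flip: abc)
  moreover have "dir_deriv q u (cov i) = v i" if "2 < i" for i using that assms(4) by simp
  ultimately show "(%i. dir_deriv q u (cov i)) = v" by (intro ext) (metis cases_le2 not_le)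
 qed
qed

text \<open>At a general x both conditions are read at a preimage q under the cover, where tangent
  vectors lift and \<open>Omega\<close> becomes a nonzero multiple of \<open>eta\<close>. The bad
  set is given upstairs, and the norm of its equation carries it down.\<close>

lemma pulls_back_descends:
 assumes M: "proj_closed M" and G: "foliation M G"
  and F: "form_tuple e F" "!!i. vars_le 2 (F i)"
  and \<Psi>: "form_tuple d \<Psi>" "!!i. vars_le 2 (\<Psi> i)" and h: "homogeneous D h" "vars_le 2 h" "h ~= 0"
  and eq: "!!q. evals \<Psi> (evals cov q) = (%i. peval q h * evals F q i)"
  and pb: "eventually (%p. (\<exists>i. evals F p i ~= 0) \<and> (\<forall>u\<in>tangent P2 p. (p, u) \<in> E3 w \<longleftrightarrow> (to_point (evals F p), %j. dir_deriv p u (F j)) \<in> G)) (generic P2)"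
 shows "pulls_back (rmap P2 \<Psi>) P2 J_fol G"
proof -
 obtain k s0 where s0: "homogeneous k s0" "\<exists>p\<in>P2. peval p s0 ~= 0" and
  s0': "!!p. p \<in> P2 ==> peval p s0 ~= 0 ==> (\<exists>i. evals F p i ~= 0) \<and> (\<forall>u\<in>tangent P2 p. (p, u) \<in> E3 w \<longleftrightarrow> (to_point (evals F p), %j. dir_deriv p u (F j)) \<in> G)"
  using pb unfolding eventually_generic[OF irr_P2] by blast
 define s where "s = psubst (trunc3 Var) s0"
 have "s ~= 0" using s0(2) unfolding s_def by (metis P2_trunc3 insertion_0 peval_psubst_trunc3)
 then have "homogeneous (k + D) (s * h)" "vars_le 2 (s * h)" "s * h ~= 0"
  using h s0(1) by (auto simp: s_def intro!: homogeneous_mult homogeneous_trunc3 simp del: insertion_psubst)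
 then obtain D' g where g: "homogeneous D' g" "vars_le 2 g" "g ~= 0" "!!q. peval (evals cov q) g ~= 0 ==> peval q (s * h) ~= 0"
  by (rule norm_descends) blast
 define t where "t = g * Var 0 * Var 1 * Var 2"
 have t: "homogeneous (D' + Suc 0 + Suc 0 + Suc 0) t" unfolding t_def by (intro homogeneous_mult g homogeneous_Var)
 define Z where "Z = {x \<in> P2. peval x t = 0}"
 have Zc: "proj_closed Z" unfolding Z_def by (rule proj_closed_form[OF t])
 have "t ~= 0" "vars_le 2 t" using g by (simp_all add: t_def)
 then have "\<exists>p\<in>P2. peval p t ~= 0" using generic_ex[OF irr_P2 generic_P2_nz[OF t]] by blast
 then have Z': "\<not> P2 \<subseteq> Z" by (auto simp: Z_def)
 have poly: "psubst cov (\<Psi> j) = h * F j" for j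
 proof (rule mpoly3_eqI)
  show "vars_le 2 (psubst cov (\<Psi> j))" by (rule vars_le_psubst) simp
  show "vars_le 2 (h * F j)" using h F by simp
  show "peval q (psubst cov (\<Psi> j)) = peval q (h * F j)" for q
   using fun_cong[OF eq, of q j] unfolding peval_comp by (simp add: evals_def[of \<Psi>] evals_def[of F])
 qed
 have "(\<exists>i. peval x (\<Psi> i) ~= 0) \<and> (\<forall>v\<in>tangent P2 x. (x, v) \<in> J_fol \<longleftrightarrow> (to_point (evals \<Psi> x), %j. dir_deriv x v (\<Psi> j)) \<in> G)"
  if x: "x \<in> P2 - Z" for x
 proof -
  have xP: "x \<in> P2" and xt: "peval x t ~= 0" using x by (auto simp: Z_def)
  have xn: "x 0 ~= 0" "x 1 ~= 0" "x 2 ~= 0" and xg: "peval x g ~= 0" using xt by (auto simp: t_def)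
  have "vec3 (x 0) (x 1) (x 2) = x" using P2_trunc3[OF xP] by (simp add: trunc3_vec3)
  then obtain q where q: "!!i. 2 < i ==> q i = 0" "evals cov q = x" "peval q pa ~= 0" "peval q pb ~= 0" "peval q pc ~= 0"
   using cov_surj[OF xn] by metis
  have qs: "peval q s ~= 0" and qh: "peval q h ~= 0" using g(4)[of q] xg by (auto simp: q(2))
  have "\<exists>i. q i ~= 0"
  proof (rule ccontr)
   assume "\<not> ?thesis"
   then show False using q(3) by (simp add: peval_abc)
  qed
  then obtain i0 where i0: "q i0 ~= 0" by blast
  define p where "p = to_point q"
  obtain c where c: "c ~= 0" "p = (%i. c * q i)" unfolding p_def by (rule to_point_obtain[of q i0, OF i0])
  have pP: "p \<in> P2" unfolding p_def by (rule to_point_P2[of q i0, OF i0 q(1)])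
  have "peval q s0 ~= 0" using qs trunc3_id[of q] q(1) by (simp add: s_def del: insertion_psubst)
  then have "peval p s0 ~= 0" unfolding p_def using peval_to_point_eq_0[OF s0(1), of q i0] i0 by simp
  note Fp = s0'[OF pP this]
  have Fs: "evals F p = (%i. c ^ e * evals F q i)" unfolding c(2) by (rule evals_scale[OF F(1)])
  obtain j0 where j0: "evals F q j0 ~= 0" using Fp Fs c by auto
  have \<Psi>x: "evals \<Psi> x = (%i. peval q h * evals F q i)" using eq[of q] unfolding q(2) .
  define y where "y = to_point (evals F q)"
  have y: "to_point (evals F p) = y" "to_point (evals \<Psi> x) = y" unfolding Fs \<Psi>x y_def using c(1) qh by simp_all
  obtain l where l: "l ~= 0" "evals F q = (%i. l * y i)" unfolding y_def by (rule to_point_obtain'[of "evals F q" j0, OF j0])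
  have "(x, v) \<in> J_fol \<longleftrightarrow> (y, %j. dir_deriv x v (\<Psi> j)) \<in> G" if v: "v \<in> tangent P2 x" for v
  proof -
   have v0: "!!i. 2 < i ==> v i = 0" using v by (simp add: tangent_P2[OF xP])
   obtain u where u: "!!i. 2 < i ==> u i = 0" "(%i. dir_deriv q u (cov i)) = v"
    by (rule cov_tangent_surj[of q v, OF q(3-5) v0]) blast+
   have ut: "u \<in> tangent P2 p" using u(1) by (simp add: tangent_P2[OF pP])
   have "Om x v = - 27 * (peval q pa * peval q pb * peval q pc) ^ 3 * eta q u"
    using Omega_cov[of q u] unfolding q(2) Om_def u(2)[symmetric] .
   then have "(x, v) \<in> J_fol \<longleftrightarrow> eta q u = 0" using q(3-5) xP v0 by (auto simp: J_fol_Om)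
   also have "\<dots> \<longleftrightarrow> eta p u = 0"
   proof -
    have "eta p u = c\<^sup>2 * eta q u" unfolding c(2) eta_def by (simp add: power2_eq_square algebra_simps)
    then show ?thesis using c(1) by simp
   qed
   also have "\<dots> \<longleftrightarrow> (p, u) \<in> E3 w" using pP u(1) by (simp add: mem_E3)
   also have "\<dots> \<longleftrightarrow> (y, %j. dir_deriv p u (F j)) \<in> G" using Fp ut unfolding y(1) by blast
   also have "\<dots> \<longleftrightarrow> (y, %j. dir_deriv x v (\<Psi> j)) \<in> G"
   proof -
    have D: "dir_deriv q u (F j) = c / c ^ e * dir_deriv p u (F j)" for j
     using dir_deriv_scale_point[of e "F j" c q u] F(1) c(1) unfolding c(2) by (simp add: form_tuple_def field_simps)
    \<comment> \<open>Differentiating the relation between \<Psi> after the cover and h F produces,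
      besides a multiple of the differential of F, a multiple of the image point itself, which the
      fibre of \<open>G\<close> absorbs.\<close>
    have "dir_deriv x v (\<Psi> j) = dir_deriv q u h * (l * y j) + peval q h * dir_deriv q u (F j)" for j
    proof -
     have "dir_deriv x v (\<Psi> j) = dir_deriv q u (psubst cov (\<Psi> j))"
      unfolding dir_deriv_psubst u(2) using q(2) by (simp add: evals_def)
     also have "\<dots> = dir_deriv q u h * evals F q j + peval q h * dir_deriv q u (F j)" unfolding poly by (simp add: evals_def)
     finally show ?thesis unfolding l(2) .
    qed
    then have fn: "(%j. dir_deriv x v (\<Psi> j)) = (%j. (peval q h * (c / c ^ e)) * dir_deriv p u (F j) + (dir_deriv q u h * l) * y j)"
     unfolding D by (simp add: mult_ac add.commute)
    have "peval q h * (c / c ^ e) ~= 0" using qh c(1) by simp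
    from fibre_linear_iff[OF G M this, of y "%j. dir_deriv p u (F j)" "dir_deriv q u h * l"]
    show ?thesis unfolding fn by (rule sym)
   qed
   finally show ?thesis .
  qed
  moreover have "peval x (\<Psi> j0) ~= 0" using fun_cong[OF \<Psi>x, of j0] j0 qh by (simp add: evals_def[of \<Psi>])
  ultimately show ?thesis unfolding y(2) by blast
 qed
 then show ?thesis unfolding pulls_back_def using \<Psi>(1) Zc Z' by blast
qed

end

context cube_root_of_unity
begin

lemma T3_eq: "T3 p = (if p \<in> P2 then Some (to_point (rot p)) else None)"
proof (cases "p \<in> P2")
 case True
 have r: "triple (Var 2) (Var 0) (Var 1) = (rot Var :: nat => mpoly)" by (simp add: triple_vec3 rot_def)
 have ev: "evals (rot Var) x = rot x" for x :: "nat => complex" unfolding rot_def by (rule vec3_eqI) (simp_all add: evals_def)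
 have "form_tuple (Suc 0) (rot Var)" unfolding form_tuple_def
 proof
  fix i show "homogeneous (Suc 0) (rot Var i)" by (cases "i \<le> 2") (auto simp: rot_def dest!: cases_le2)
 qed
 moreover obtain k where k: "rot p k ~= 0" using vec3_nz_P2[OF True] by (metis rot_def vec3_simps(1,3,4))
 ultimately have "tuple_on P2 (rot Var)" using True unfolding tuple_on_def by (metis ev evals_def)
 then have "rmap P2 (rot Var) p = Some (to_point (rot p))" using rmap_eval[OF irr_P2 _ True, of "rot Var" k] k by (simp add: ev)
 then show ?thesis using True unfolding T3_def r by simp
qed (simp add: T3_def rmap_def)

lemma rot_P2: "p \<in> P2 ==> \<exists>k. rot p k ~= 0" "p \<in> P2 ==> to_point (rot p) \<in> P2"
proof -
 assume p: "p \<in> P2"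
 show "\<exists>k. rot p k ~= 0" using vec3_nz_P2[OF p] by (metis rot_def vec3_simps(1,3,4))
 then obtain k where "rot p k ~= 0" by blast
 then show "to_point (rot p) \<in> P2" using to_point_P2[of "rot p" k] by (simp add: rot_def)
qed

lemma rot_dominant: "filterlim (%p. to_point (rot p)) (generic P2) (generic P2)"
 unfolding filterlim_iff
proof (intro allI impI)
 fix P assume "eventually P (generic P2)"
 then obtain d s where s: "homogeneous d s" "\<exists>p\<in>P2. peval p s ~= 0" "!!p. p \<in> P2 ==> peval p s ~= 0 ==> P p"
  unfolding eventually_generic[OF irr_P2] by blast
 define s1 where "s1 = psubst (trunc3 Var) s"
 have s1: "homogeneous d s1" "vars_le 2 s1" unfolding s1_def by (rule homogeneous_trunc3[OF s(1)], rule vars_le_psubst, simp add: trunc3_def)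
 have "s1 ~= 0" using s(2) unfolding s1_def by (metis P2_trunc3 insertion_0 peval_psubst_trunc3)
 then have "psubst (rot Var) s1 ~= 0" by (rule psubst_rot(3)[OF s1])
 then have "eventually (%p. peval p (psubst (rot Var) s1) ~= 0) (generic P2)"
  by (rule generic_P2_nz[OF psubst_rot(1,2)[OF s1]])
 then show "eventually (%p. P (to_point (rot p))) (generic P2)"
  using generic_in[OF irr_P2]
 proof eventually_elim
  case (elim p)
  obtain k where k: "rot p k ~= 0" using rot_P2(1)[OF elim(2)] by blast
  have "trunc3 (rot p) = rot p" by (simp add: rot_def)
  moreover have "peval (rot p) s1 ~= 0" using elim(1) unfolding psubst_rot(4)[OF s1] .
  ultimately have "peval (rot p) s ~= 0" unfolding s1_def peval_psubst_trunc3 by simp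
  then have "peval (to_point (rot p)) s ~= 0" using peval_to_point_eq_0[OF s(1), of "rot p" k] k by blast
  then show ?case using s(3) rot_P2(2)[OF elim(2)] by blast
 qed
qed

text \<open>The rotation multiplies b by w^2 and c by w, so these cubics are invariant. They have no
  common zero and define a regular map on the whole plane, as the universal property of the quotient
  demands; the cover itself is undefined where two of the three forms vanish.\<close>

definition invariants :: "nat => mpoly" where
 "invariants = (%_. 0)(0 := pa ^ 3, 1 := pa * pb * pc, 2 := pb ^ 3, 3 := pc ^ 3)"

lemma evals_invariants: "evals invariants p = (%_. 0)(0 := peval p pa ^ 3, 1 := peval p pa * peval p pb * peval p pc, 2 := peval p pb ^ 3, 3 := peval p pc ^ 3)"
 by (rule ext) (simp add: evals_def invariants_def)

lemma invariants_regular: "rmap P2 invariants \<in> regular_maps P2 (proj_space 3)" "rmap P2 invariants \<circ>\<^sub>m T3 = rmap P2 invariants"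
 "p \<in> P2 ==> rmap P2 invariants p = Some (to_point (evals invariants p))"
proof -
 have ft: "form_tuple (3 * Suc 0) invariants"
 proof -
  have "homogeneous (Suc 0 + Suc 0 + Suc 0) (pa * pb * pc)" by (intro homogeneous_mult homogeneous_abc)
  then have "homogeneous (3 * Suc 0) (pa * pb * pc)" by (simp add: numeral_3_eq_3)
  then show ?thesis unfolding form_tuple_def invariants_def using homogeneous_power[OF homogeneous_abc(1)] homogeneous_power[OF homogeneous_abc(2)] homogeneous_power[OF homogeneous_abc(3)]
   by (auto simp del: mult_Suc_right)
 qed
 have nz: "\<exists>k. evals invariants p k ~= 0" if "p 0 ~= 0 \<or> p 1 ~= 0 \<or> p 2 ~= 0" for p
 proof (rule ccontr)
  assume z: "\<not> ?thesis"
  have "peval p pa = 0" "peval p pb = 0" "peval p pc = 0"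
   using z[simplified, rule_format, of 0] z[simplified, rule_format, of 2] z[simplified, rule_format, of 3] by (simp_all add: evals_invariants)
  then have "vec3 (p 0) (p 1) (p 2) = evals uncov (vec3 0 0 0)" using uncov_abc[of p] by simp
  from fun_cong[OF this, of 0] fun_cong[OF this, of 1] fun_cong[OF this, of 2] show False using that by (simp add: evals_uncov)
 qed
 have nzP: "\<exists>k. evals invariants p k ~= 0" if "p \<in> P2" for p using nz vec3_nz_P2[OF that] by blast
 have ton: "tuple_on P2 invariants" unfolding tuple_on_def using ft nzP[OF vec3_in_P2(1)] vec3_in_P2(1) unfolding evals_def by blast
 show val: "rmap P2 invariants p = Some (to_point (evals invariants p))" if p: "p \<in> P2" for p
  using rmap_eval[OF irr_P2 ton p] nzP[OF p] by blast
 have "map_tuple P2 (proj_space 3) invariants" unfolding map_tuple_def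
 proof (intro conjI ballI impI)
  show "\<exists>d. form_tuple d invariants" using ft by blast
  show "\<exists>p\<in>P2. \<exists>i. peval p (invariants i) ~= 0" using ton unfolding tuple_on_def by blast
  fix p assume "\<exists>i. peval p (invariants i) ~= 0"
  then obtain i where "evals invariants p i ~= 0" by (auto simp: evals_def)
  then show "to_point (evals invariants p) \<in> proj_space 3" using to_point_in_proj_space[of "evals invariants p" i 3] by (simp add: evals_invariants)
 qed
 then have "rmap P2 invariants \<in> rational_maps P2 (proj_space 3)" unfolding rational_maps_def by blast
 moreover have "dom (rmap P2 invariants) = P2" using val by (auto simp: rmap_def split: if_splits)
 ultimately show "rmap P2 invariants \<in> regular_maps P2 (proj_space 3)" by (simp add: regular_maps_def)
 show "rmap P2 invariants \<circ>\<^sub>m T3 = rmap P2 invariants"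
 proof
  fix p show "(rmap P2 invariants \<circ>\<^sub>m T3) p = rmap P2 invariants p"
  proof (cases "p \<in> P2")
   case True
   obtain k where k: "rot p k ~= 0" using rot_P2(1)[OF True] by blast
   obtain c where c: "c ~= 0" "evals invariants (to_point (rot p)) = (%i. c * evals invariants (rot p) i)"
    using evals_to_point[OF ft, of "rot p" k] k by blast
   have e: "peval (rot p) pa = peval p pa" "peval (rot p) pb = w\<^sup>2 * peval p pb" "peval (rot p) pc = w * peval p pc"
    unfolding peval_abc rot_def using w by (simp, simp_all, algebra+)
   have "(w\<^sup>2 * b) ^ 3 = b ^ 3" "(w * b) ^ 3 = b ^ 3" "a * (w\<^sup>2 * b) * (w * c') = a * b * c'" for a b c' using w3 w by algebra+
   then have "evals invariants (rot p) = evals invariants p" unfolding evals_invariants e by (simp only:)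
   then show ?thesis using True val rot_P2(2)[OF True] c by (simp add: T3_eq)
  qed (simp add: T3_eq rmap_def)
 qed
qed

end

text \<open>The map from the plane to M is the descent of \<pi> along the cover. Its inverse is
  assembled from the resolution, the factorisation of the regular invariants through the quotient,
  and a projection. That they are inverse to each other is tested only along the cover and along
  \<pi>.\<close>

lemma brunella_plane_model:
 assumes "brunella_very_special M \<pi> G"
 shows "\<exists>\<phi> \<in> birational_maps P2 M. pulls_back \<phi> P2 J_fol G \<and> proper_image \<phi> (plane_curve cubic) = brunella_link \<pi>"
proof -
 obtain w X q r where w3: "w ^ 3 = 1" "w ~= 1" and Q: "quotient_by P2 T3 X q" and D: "minimal_desingularization X M r"
  and \<pi>: "\<pi> \<in> rational_maps P2 M" "(r \<circ>\<^sub>m \<pi>) \<subseteq>\<^sub>m q" and G: "foliation M G" and pb: "pulls_back \<pi> P2 (E3 w) G"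
  using assms unfolding brunella_very_special_def by blast
 have "(w - 1) * (w\<^sup>2 + w + 1) = 0" using w3(1) by algebra
 then interpret cube_root_of_unity w by unfold_locales (use w3 in simp)
 have X: "irr X" "proj_closed X" using Q proj_variety_irr by (auto simp: quotient_by_def proj_variety_def)
 have "proj_variety M" using D by (auto simp: minimal_desingularization_def desingularization_def smooth_surface_def)
 then have M: "irr M" "proj_closed M" using proj_variety_irr by (auto simp: proj_variety_def)
 have r: "r \<in> rational_maps M X" "dom r = M" "r \<in> birational_maps M X"
  using D by (auto simp: minimal_desingularization_def desingularization_def regular_maps_def)
 have q: "q \<in> rational_maps P2 X" "dom q = P2" "q \<circ>\<^sub>m T3 = q" using Q by (auto simp: quotient_by_def regular_maps_def)
 have qdom: "dominant q P2 X" by (rule quotient_dominant[OF Q])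
 obtain r' where r': "r' \<in> birational_maps X M" "(r' \<circ>\<^sub>m r) \<subseteq>\<^sub>m Some" and r'dom: "dominant r' X M"
  by (rule birational_inverse[OF M X r(3)]) blast
 have r'r: "r' \<in> rational_maps X M" using r'(1) by (simp add: birational_maps_def)
 have r'val: "m' = m" if "r m = Some x" "r' x = Some m'" for m m' x
 proof -
  have "(r' \<circ>\<^sub>m r) m = Some m'" using that by simp
  then show ?thesis using r'(2) unfolding map_le_def by (metis domI option.inject)
 qed
 \<comment> \<open>At a general p the value of \<pi> is recovered from q p by the inverse of the
   resolution. In this way \<pi> inherits dominance and invariance under the rotation from
   q.\<close>
 let ?E = "%p. \<exists>m x. p \<in> P2 \<and> m \<in> M \<and> \<pi> p = Some m \<and> r m = Some x \<and> q p = Some x \<and> r' x = Some m"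
 have E1: "eventually ?E (generic P2)"
 proof -
  have "eventually (%p. \<exists>m\<in>M. r' (the (q p)) = Some m) (generic P2)"
   using generic_rational[OF X(1) r'r] qdom unfolding filterlim_iff by blast
  then show ?thesis using generic_rational[OF irr_P2 \<pi>(1)] generic_in[OF irr_P2]
  proof eventually_elim
   case (elim p)
   then obtain m where m: "m \<in> M" "\<pi> p = Some m" by blast
   then obtain x where x: "r m = Some x" using r(2) by blast
   have "(r \<circ>\<^sub>m \<pi>) p = Some x" using m x by simp
   then have qx: "q p = Some x" using \<pi>(2) by (metis domI map_le_def)
   then show ?case using elim m x r'val[OF x] by auto
  qed
 qed
 have \<pi>dom: "dominant \<pi> P2 M"
 proof -
  have "filterlim (%p. the (r' (the (q p)))) (generic M) (generic P2)" by (rule filterlim_compose[OF r'dom qdom])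
  moreover have "eventually (%p. the (r' (the (q p))) = the (\<pi> p)) (generic P2)" using E1 by eventually_elim auto
  ultimately show ?thesis by (subst filterlim_cong[OF refl refl]) (auto elim: eventually_mono)
 qed
 have abc: "eventually (%p. peval p (pa * pb * pc) ~= 0) (generic P2)"
 proof (rule generic_P2_nz)
  show "homogeneous (Suc 0 + Suc 0 + Suc 0) (pa * pb * pc)" by (intro homogeneous_mult homogeneous_abc)
  have "pa ~= 0" "pb ~= 0" "pc ~= 0" using peval_abc[of "vec3 1 0 0"] by auto
  then show "pa * pb * pc ~= 0" by simp
 qed simp
 let ?f = "rmap P2 invariants"
 let ?u = "%p. to_point (evals cov p)"
 have f: "?f \<in> rational_maps P2 (proj_space 3)" "dom ?f = P2" using invariants_regular(1) by (simp_all add: regular_maps_def)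
 obtain W where W: "irr W" "proj_closed W" "W \<subseteq> proj_space 3" "?f \<in> rational_maps P2 W"
  by (rule image_closure[OF irr_P2 f(1) proj_closed_P2]) blast
 have "\<exists>!g. g \<in> regular_maps X W \<and> g \<circ>\<^sub>m q = ?f"
  using Q irr_proj_variety[OF W(1,2)] W(4) f(2) invariants_regular(2) unfolding quotient_by_def by (simp add: regular_maps_def)
 then obtain g where g: "g \<in> rational_maps X W" "g \<circ>\<^sub>m q = ?f" by (auto simp: regular_maps_def)
 \<comment> \<open>On (a^3, abc, b^3, c^3) this gives (a^4 bc, a^2 b^2 c^2, a^3 c^3), which is a^2 c
   times the cover.\<close>
 define prj where "prj = vec3 (Var 0 * Var 1) (Var 1 * Var 1) (Var 0 * Var 3)"
 have prj_form: "form_tuple (Suc 0 + Suc 0) prj" unfolding form_tuple_def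
 proof
  fix i
  have "homogeneous (Suc 0 + Suc 0) (Var j * Var k)" for j k by (intro homogeneous_mult homogeneous_Var)
  then show "homogeneous (Suc 0 + Suc 0) (prj i)" by (cases "i \<le> 2") (auto simp: prj_def dest!: cases_le2 simp del: add_Suc add_Suc_right)
 qed
 have pre: "evals prj y = vec3 (y 0 * y 1) (y 1 * y 1) (y 0 * y 3)" for y
  unfolding prj_def by (rule vec3_eqI) (simp_all add: evals_def)
 have prv: "evals prj (evals invariants p) = (%i. ((peval p pa)\<^sup>2 * peval p pc) * evals cov p i)" for p
 proof -
  have "a ^ 3 * (a * b * c) = a\<^sup>2 * c * (a\<^sup>2 * b)" "a * b * c * (a * b * c) = a\<^sup>2 * c * (b\<^sup>2 * c)" "a ^ 3 * c ^ 3 = a\<^sup>2 * c * (c\<^sup>2 * a)"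
   for a b c :: complex by algebra+
  then show ?thesis unfolding pre evals_invariants evals_cov scale_vec3 by simp
 qed
 have cn: "evals cov p 0 ~= 0" if "peval p (pa * pb * pc) ~= 0" for p using that by (simp add: evals_cov)
 have inz: "evals invariants p 1 ~= 0" if "peval p (pa * pb * pc) ~= 0" for p using that by (simp add: evals_invariants)
 have prn: "\<exists>c. c ~= 0 \<and> evals prj (to_point (evals invariants p)) = (%i. c * evals cov p i)" if n: "peval p (pa * pb * pc) ~= 0" for p
 proof -
  obtain c where c: "c ~= 0" "evals prj (to_point (evals invariants p)) = (%i. c * evals prj (evals invariants p) i)"
   using evals_to_point[OF prj_form, of "evals invariants p" 1] inz[OF n] by blast
  have "evals prj (to_point (evals invariants p)) = (%i. (c * ((peval p pa)\<^sup>2 * peval p pc)) * evals cov p i)" unfolding c(2) prv by (simp only: mult.assoc)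
  moreover have "c * ((peval p pa)\<^sup>2 * peval p pc) ~= 0" using c(1) n by simp
  ultimately show ?thesis by blast
 qed
 obtain p1 where p1: "p1 \<in> P2" "peval p1 (pa * pb * pc) ~= 0" using generic_ex[OF irr_P2 abc] by blast
 have prW: "tuple_on W prj"
 proof -
  have "to_point (evals invariants p1) \<in> W" using rational_value(2)[OF irr_P2 W(2,4) invariants_regular(3)[OF p1(1)]] .
  moreover obtain c where "c ~= 0" "evals prj (to_point (evals invariants p1)) = (%i. c * evals cov p1 i)" using prn[OF p1(2)] by blast
  then have "evals prj (to_point (evals invariants p1)) 0 ~= 0" using cn[OF p1(2)] by simp
  ultimately show ?thesis using prj_form unfolding tuple_on_def evals_def by blast
 qed
 let ?h = "rmap W prj"
 have hr: "?h \<in> rational_maps W P2"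
 proof -
  have "map_tuple W P2 prj" unfolding map_tuple_def
  proof (intro conjI ballI impI)
   show "\<exists>d. form_tuple d prj" using prj_form by blast
   show "\<exists>p\<in>W. \<exists>i. peval p (prj i) ~= 0" using prW unfolding tuple_on_def by blast
   fix p assume "\<exists>i. peval p (prj i) ~= 0"
   then obtain i where "evals prj p i ~= 0" by (auto simp: evals_def)
   then show "to_point (evals prj p) \<in> P2" by (rule to_point_P2[of "evals prj p" i]) (simp add: pre)
  qed
  then show ?thesis unfolding rational_maps_def by blast
 qed
 have hval: "?h (to_point (evals invariants p)) = Some (?u p)" if p: "p \<in> P2" "peval p (pa * pb * pc) ~= 0" for p
 proof -
  have "to_point (evals invariants p) \<in> W" using rational_value(2)[OF irr_P2 W(2,4) invariants_regular(3)[OF p(1)]] .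
  moreover obtain c where c: "c ~= 0" "evals prj (to_point (evals invariants p)) = (%i. c * evals cov p i)" using prn[OF p(2)] by blast
  moreover have "evals prj (to_point (evals invariants p)) 0 ~= 0" using c cn[OF p(2)] by simp
  ultimately show ?thesis using rmap_eval[OF W(1) prW, of "to_point (evals invariants p)" 0] by simp
 qed
 have gr0: "(g \<circ>\<^sub>m r) m = Some (to_point (evals invariants p))" if "p \<in> P2" "r m = Some x" "q p = Some x" for p m x
  using fun_cong[OF g(2), of p] invariants_regular(3)[OF that(1)] that by simp
 have E12: "eventually (%p. ?E p \<and> peval p (pa * pb * pc) ~= 0) (generic P2)"
  using E1 abc by eventually_elim blast
 obtain p0 m0 x0 where p0: "p0 \<in> P2" "r m0 = Some x0" "q p0 = Some x0" "peval p0 (pa * pb * pc) ~= 0" using generic_ex[OF irr_P2 E12] by blast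
 obtain gr where gr: "gr \<in> rational_maps M W" "g \<circ>\<^sub>m r \<subseteq>\<^sub>m gr"
  using rational_comp[OF M(1) X W(2) r(1) g(1) gr0[OF p0(1,2,3)]] by blast
 have grv: "gr m = Some (to_point (evals invariants p))" if "p \<in> P2" "r m = Some x" "q p = Some x" for p m x
  using gr(2) gr0[OF that] by (metis domI map_le_def)
 have "(?h \<circ>\<^sub>m gr) m0 = Some (?u p0)" using grv[OF p0(1,2,3)] hval[OF p0(1,4)] by simp
 then obtain \<psi> where \<psi>: "\<psi> \<in> rational_maps M P2" "?h \<circ>\<^sub>m gr \<subseteq>\<^sub>m \<psi>"
  using rational_comp[OF M(1) W(1,2) proj_closed_P2 gr(1) hr] by blast
 have E2: "eventually (%p. \<exists>m. \<pi> p = Some m \<and> \<psi> m = Some (?u p)) (generic P2)"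
  using E12
 proof eventually_elim
  case (elim p)
  then obtain m x where mx: "p \<in> P2" "\<pi> p = Some m" "r m = Some x" "q p = Some x" by blast
  have "(?h \<circ>\<^sub>m gr) m = Some (?u p)" using grv[OF mx(1,3,4)] hval[OF mx(1)] elim by simp
  then have "\<psi> m = Some (?u p)" using \<psi>(2) by (metis domI map_le_def)
  then show ?case using mx by blast
 qed
 obtain e F0 Z0 where F0: "form_tuple e F0" "\<pi> = rmap P2 F0" and Z0: "proj_closed Z0" "\<not> P2 \<subseteq> Z0"
  and pb0: "!!p. p \<in> P2 - Z0 ==> (\<exists>i. peval p (F0 i) ~= 0) \<and> (\<forall>v\<in>tangent P2 p. (p, v) \<in> E3 w \<longleftrightarrow> (to_point (evals F0 p), %j. dir_deriv p v (F0 j)) \<in> G)"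
  using pb unfolding pulls_back_def by blast
 define F where "F = (%i. psubst (trunc3 Var) (F0 i))"
 have F: "form_tuple e F" "!!i. vars_le 2 (F i)"
 proof -
  show "form_tuple e F" using F0(1) by (auto simp: form_tuple_def F_def intro: homogeneous_trunc3 simp del: insertion_psubst)
  show "vars_le 2 (F i)" for i unfolding F_def by (rule vars_le_psubst) (simp add: trunc3_def)
 qed
 have evF: "evals F p = evals F0 p" if "p \<in> P2" for p
  by (rule ext) (simp only: evals_def F_def peval_psubst_trunc3 P2_trunc3[OF that])
 have gZ: "eventually (%p. p \<in> P2 - Z0) (generic P2)"
  using generic_not_closed[OF irr_P2 Z0] generic_in[OF irr_P2] by eventually_elim simp
 have pbF: "eventually (%p. (\<exists>i. evals F p i ~= 0) \<and> (\<forall>u\<in>tangent P2 p. (p, u) \<in> E3 w \<longleftrightarrow> (to_point (evals F p), %j. dir_deriv p u (F j)) \<in> G)) (generic P2)"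
  using gZ
 proof eventually_elim
  case (elim p)
  then have p: "p \<in> P2" by simp
  have "(%j. dir_deriv p u (F j)) = (%j. dir_deriv p u (F0 j))" if "u \<in> tangent P2 p" for u
   unfolding F_def using that p by (intro ext dir_deriv_trunc3) (auto simp: tangent_P2)
  then show ?case using pb0[OF elim] unfolding evF[OF p] by (simp add: evals_def)
 qed
 obtain pz kz where pz: "pz \<in> P2" "evals F pz kz ~= 0" using generic_ex[OF irr_P2 pbF] by blast
 have tF: "tuple_on P2 F" using F(1) pz unfolding tuple_on_def evals_def by blast
 have tF0: "tuple_on P2 F0" using F0(1) pz evF[OF pz(1)] unfolding tuple_on_def evals_def by metis
 have \<pi>F: "\<pi> = rmap P2 F" unfolding F0(2)
  by (rule rmap_cong[OF irr_P2 tF0 tF], rule eventually_mono[OF generic_in[OF irr_P2]]) (simp add: evF)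
 have Fk: "F kz ~= 0" using pz(2) by (auto simp: evals_def)
 \<comment> \<open>The quotient map takes the same value at p and at its rotation, so \<pi> does
   too, generically. Proportionality of the tuples then extends to all vectors as an identity of
   forms.\<close>
 have rotF: "par (evals F (rot x)) (evals F x)" for x
 proof -
  have ev: "eventually (%p. par (evals F (rot p)) (evals F p)) (generic P2)"
  proof -
   have "eventually (%p. ?E (to_point (rot p))) (generic P2)"
    using E1 rot_dominant unfolding filterlim_iff by blast
   moreover have "eventually (%p. to_point (rot p) \<in> P2 \<and> (\<exists>i. evals F (to_point (rot p)) i ~= 0) \<and> rmap P2 F (to_point (rot p)) = Some (to_point (evals F (to_point (rot p))))) (generic P2)"
    by (rule rot_dominant[unfolded filterlim_iff, rule_format, OF generic_rmap[OF irr_P2 tF]])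
   ultimately show ?thesis using E1 generic_rmap[OF irr_P2 tF]
   proof eventually_elim
    case (elim p)
    obtain m x where m: "p \<in> P2" "\<pi> p = Some m" "q p = Some x" "r' x = Some m" using elim by blast
    obtain m2 x2 where m2: "\<pi> (to_point (rot p)) = Some m2" "q (to_point (rot p)) = Some x2" "r' x2 = Some m2" using elim by blast
    have "q p = q (to_point (rot p))" using fun_cong[OF q(3), of p] m(1) by (simp add: T3_eq)
    then have mm: "m2 = m" using m m2 by simp
    have 1: "to_point (evals F p) = m" "to_point (evals F (to_point (rot p))) = m" using elim(2,4) m(2) m2(1) unfolding mm \<pi>F by simp_all
    obtain k where k: "rot p k ~= 0" using rot_P2(1)[OF m(1)] by blast
    obtain c where c: "c ~= 0" "evals F (to_point (rot p)) = (%i. c * evals F (rot p) i)" using evals_to_point[OF F(1), of "rot p" k] k by blast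
    have 2: "to_point (evals F (rot p)) = m" using 1(2) c by simp
    obtain l where l: "evals F p l ~= 0" using elim by blast
    have "par (evals F (rot p)) m" "par m (evals F p)" using par_to_point(1)[of "evals F (rot p)"] par_to_point(2)[of "evals F p"] 1 2 by simp_all
    moreover have "m l ~= 0" using to_point_nz[of "evals F p" l] l 1 by simp
    ultimately show ?case by (rule par_trans)
   qed
  qed
  show ?thesis unfolding par_def
  proof (intro allI)
   fix i j
   have hF: "homogeneous e (F i)" for i using F(1) by (simp add: form_tuple_def)
   let ?R = "psubst (rot Var) (F i) * F j - psubst (rot Var) (F j) * F i"
   have "?R = 0"
   proof (rule generic_P2_zero)
    show "homogeneous (e + e) ?R" by (intro homogeneous_diff homogeneous_mult psubst_rot(1) hF F(2))
    show "vars_le 2 ?R" by (intro vars_le_diff vars_le_mult psubst_rot(2)[OF hF F(2)] F(2))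
    show "eventually (%p. peval p ?R = 0) (generic P2)"
     using ev
    proof eventually_elim
     case (elim p)
     then have "evals F (rot p) i * evals F p j = evals F (rot p) j * evals F p i" unfolding par_def by blast
     then show ?case unfolding insertion_minus[OF coeff_hom_id] insertion_mult[OF coeff_hom_id] psubst_rot(4)[OF hF F(2)] by (simp add: evals_def)
    qed
   qed
   then have "peval x ?R = 0" by (simp only: insertion_0)
   then show "evals F (rot x) i * evals F x j = evals F (rot x) j * evals F x i"
    unfolding insertion_minus[OF coeff_hom_id] insertion_mult[OF coeff_hom_id] psubst_rot(4)[OF hF F(2)] by (simp add: evals_def)
  qed
 qed
 obtain \<Psi> Dh h where \<Psi>: "form_tuple (9 * e) \<Psi>" "!!i. vars_le 2 (\<Psi> i)" and h: "homogeneous Dh h" "vars_le 2 h" "h ~= 0"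
  and eq: "!!q. evals \<Psi> (evals cov q) = (%i. peval q h * evals F q i)"
  by (rule invariant_map_descends[of e F kz, OF F Fk rotF]) blast
 let ?\<phi> = "rmap P2 \<Psi>"
 have cnz: "\<exists>i. evals cov p i ~= 0" if "peval p (pa * pb * pc) ~= 0" for p using cn[OF that] by blast
 have E3: "eventually (%p. p \<in> P2 \<and> ?u p \<in> P2 \<and> \<pi> p = Some (to_point (evals F p)) \<and> (\<exists>i. evals \<Psi> (?u p) i ~= 0) \<and> to_point (evals \<Psi> (?u p)) = to_point (evals F p)) (generic P2)"
  using generic_rmap[OF irr_P2 tF] abc generic_P2_nz[OF h]
 proof eventually_elim
  case (elim p)
  obtain i where i: "evals F p i ~= 0" using elim by blast
  obtain c where c: "c ~= 0" "evals \<Psi> (?u p) = (%i. c * evals \<Psi> (evals cov p) i)"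
   using evals_to_point[OF \<Psi>(1), of "evals cov p" 0] cn[OF elim(2)] by blast
  have k: "evals \<Psi> (?u p) = (%i. (c * peval p h) * evals F p i)" unfolding c(2) eq by (simp only: mult.assoc)
  have k0: "c * peval p h ~= 0" using c(1) elim(3) by simp
  have "to_point (evals \<Psi> (?u p)) = to_point (evals F p)" unfolding k by (rule to_point_scale[OF k0])
  moreover have "evals \<Psi> (?u p) i ~= 0" unfolding k using k0 i by simp
  moreover have "?u p \<in> P2" by (rule to_point_P2[of "evals cov p" 0, OF cn[OF elim(2)]]) (simp add: evals_cov)
  ultimately show ?case using elim(1) unfolding \<pi>F by blast
 qed
 have t\<Psi>: "tuple_on P2 \<Psi>" using generic_ex[OF irr_P2 E3] \<Psi>(1) unfolding tuple_on_def evals_def by blast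
 have mt: "map_tuple P2 M \<Psi>" unfolding map_tuple_def
 proof (intro conjI ballI impI)
  show "\<exists>d. form_tuple d \<Psi>" "\<exists>p\<in>P2. \<exists>i. peval p (\<Psi> i) ~= 0" using t\<Psi> unfolding tuple_on_def by blast+
  fix x assume "\<exists>i. peval x (\<Psi> i) ~= 0"
  then obtain i where i: "evals \<Psi> x i ~= 0" by (auto simp: evals_def)
  show "to_point (evals \<Psi> x) \<in> M"
  proof (rule ccontr)
   assume "to_point (evals \<Psi> x) \<notin> M"
   then obtain s k where s: "homogeneous k s" "!!z. z \<in> M ==> peval z s = 0" "peval (evals \<Psi> x) s ~= 0"
    using proj_closed_separate[OF M(2), of "evals \<Psi> x" i] i by blast
   \<comment> \<open>An equation of M vanishes along F, hence along \<Psi> after the cover.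
     Substitution of the cover is injective, so it vanishes along \<Psi>.\<close>
   have "psubst F s = 0"
   proof (rule generic_P2_zero[OF homogeneous_comp[OF s(1) F(1)]])
    show "vars_le 2 (psubst F s)" by (rule vars_le_psubst) (rule F)
    show "eventually (%p. peval p (psubst F s) = 0) (generic P2)"
     using generic_rmap[OF irr_P2 tF] generic_rational[OF irr_P2 \<pi>(1)]
    proof eventually_elim
     case (elim p)
     then obtain l where l: "evals F p l ~= 0" by blast
     have "to_point (evals F p) \<in> M" using elim by (auto simp: \<pi>F)
     then show ?case using s(2) peval_to_point_eq_0[OF s(1), of "evals F p" l] l unfolding peval_comp by blast
    qed
   qed
   then have Fs: "peval (evals F y) s = 0" for y unfolding peval_comp[symmetric] by (simp only: insertion_0)
   have v\<Psi>: "vars_le 2 (psubst \<Psi> s)" by (rule vars_le_psubst) (rule \<Psi>)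
   have "psubst cov (psubst \<Psi> s) = 0"
   proof (rule mpoly3_eq_0I)
    show "vars_le 2 (psubst cov (psubst \<Psi> s))" by (rule vars_le_psubst) simp
    show "peval y (psubst cov (psubst \<Psi> s)) = 0" for y
     unfolding peval_comp eq peval_scale[OF s(1)] Fs by simp
   qed
   then have "psubst \<Psi> s = 0" by (rule psubst_cov_eq_0[OF v\<Psi>])
   then have "peval x (psubst \<Psi> s) = 0" by (simp only: insertion_0)
   then show False using s(3) unfolding peval_comp by simp
  qed
 qed
 have \<phi>r: "?\<phi> \<in> rational_maps P2 M" using mt unfolding rational_maps_def by blast
 have E4: "eventually (%p. \<exists>m. \<pi> p = Some m \<and> \<psi> m = Some (?u p) \<and> ?\<phi> (?u p) = Some m) (generic P2)"
  using E2 E3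
 proof eventually_elim
  case (elim p)
  then obtain i where i: "evals \<Psi> (?u p) i ~= 0" by blast
  then have "?\<phi> (?u p) = Some (to_point (evals F p))" using rmap_eval[OF irr_P2 t\<Psi>, of "?u p" i] elim by simp
  then show ?case using elim by auto
 qed
 have bir: "?\<phi> \<in> birational_maps P2 M"
 proof (rule birational_mapsI[OF irr_P2 proj_closed_P2 M \<phi>r \<psi>(1) irr_P2 cov_dominant _ irr_P2 \<pi>dom])
  show "eventually (%p. \<exists>y. ?\<phi> (?u p) = Some y \<and> \<psi> y = Some (?u p)) (generic P2)" using E4 by eventually_elim blast
  show "eventually (%p. \<exists>x. \<psi> (the (\<pi> p)) = Some x \<and> ?\<phi> x = Some (the (\<pi> p))) (generic P2)" using E4 by eventually_elim auto
 qed
 moreover have "pulls_back ?\<phi> P2 J_fol G" by (rule pulls_back_descends[OF M(2) G F \<Psi> h eq pbF])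
 moreover have "proper_image ?\<phi> (plane_curve cubic) = brunella_link \<pi>"
 proof -
  obtain n where n: "M \<subseteq> proj_space n" using proj_closed_subset[OF M(2)] by blast
  have "\<exists>i. \<Psi> i ~= 0" using t\<Psi> unfolding tuple_on_def by (metis insertion_0)
  \<comment> \<open>Each side of the triangle separately imposes the same condition on a form as the
    cubic does, so the union of the three sides and the cubic have the same image closure.\<close>
  then have iff: "(\<forall>x\<in>plane_curve cubic. \<forall>y. ?\<phi> x = Some y \<longrightarrow> peval y s = 0) \<longleftrightarrow> (\<forall>x\<in>plane_curve (Var i). \<forall>y. \<pi> x = Some y \<longrightarrow> peval y s = 0)"
   if "homogeneous k s" "i \<le> 2" for k s i
   unfolding \<pi>F using cubic_image_iff[OF \<Psi> F _ _ _ that] Fk eq par_scale(2) by metis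
  show ?thesis unfolding brunella_link_def proper_image_def
  proof (rule zclosure_eqI)
   show "{y. \<exists>p\<in>plane_curve cubic. ?\<phi> p = Some y} \<subseteq> proj_space n" using rational_value(2)[OF irr_P2 M(2) \<phi>r] n by blast
   show "{y. \<exists>p\<in>triangle. \<pi> p = Some y} \<subseteq> proj_space n" using rational_value(2)[OF irr_P2 M(2) \<pi>(1)] n by blast
   fix k s assume s: "homogeneous k s"
   have "(\<forall>p\<in>{y. \<exists>p\<in>plane_curve cubic. ?\<phi> p = Some y}. peval p s = 0) \<longleftrightarrow> (\<forall>x\<in>plane_curve cubic. \<forall>y. ?\<phi> x = Some y \<longrightarrow> peval y s = 0)" by blast
   also have "\<dots> \<longleftrightarrow> (\<forall>i\<le>2. \<forall>x\<in>plane_curve (Var i). \<forall>y. \<pi> x = Some y \<longrightarrow> peval y s = 0)" using iff[OF s] by blast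
   also have "\<dots> \<longleftrightarrow> (\<forall>p\<in>{y. \<exists>p\<in>triangle. \<pi> p = Some y}. peval p s = 0)" using mem_triangle by blast
   finally show "(\<forall>p\<in>{y. \<exists>p\<in>plane_curve cubic. ?\<phi> p = Some y}. peval p s = 0) \<longleftrightarrow> (\<forall>p\<in>{y. \<exists>p\<in>triangle. \<pi> p = Some y}. peval p s = 0)" .
  qed
 qed
 ultimately show ?thesis by blast
qed

theorem theorem9:
  shows "plane_foliation_form 2 Omega \<and>
    (\<forall>M \<pi> F. brunella_very_special M \<pi> F \<longrightarrow>
       (\<exists>\<phi> \<in> birational_maps P2 M. pulls_back \<phi> P2 J_fol F \<and>
          proper_image \<phi> (plane_curve cubic) = brunella_link \<pi>)) \<and>
    {C. irreducible_plane_curve C \<and> invariant_curve J_fol C} = J_curves \<and>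
    nodal_cubic cubic \<and>
    (\<forall>i\<le>2. tangent_curves (plane_curve (Var i)) (plane_curve cubic)) \<and>
    (\<forall>A. plane_foliation_form 2 A \<and> (\<forall>C \<in> J_curves. invariant_curve (ker_form P2 A) C) \<longrightarrow>
       (\<exists>c. c \<noteq> 0 \<and> A = (\<lambda>i. Const c * Omega i))) \<and>
    de_jonquieres 4 J4 \<and>
    rmap P2 J4 \<noteq> \<one>\<^bsub>bir_group P2\<^esub> \<and>
    rmap P2 J4 \<otimes>\<^bsub>bir_group P2\<^esub> rmap P2 J4 = \<one>\<^bsub>bir_group P2\<^esub> \<and>
    bir_aut P2 J_fol = generate (bir_group P2) {rmap P2 J4, rmap P2 cyclic_perm}"
proof -
  obtain w where "(w::complex)\<^sup>2 + w + 1 = 0" by (rule cube_root_of_unity_exists)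
  then interpret cube_root_of_unity w by unfold_locales
  have "{C. irreducible_plane_curve C \<and> invariant_curve J_fol C} = J_curves"
    using invariant_curves J_curves_invariant by blast
  then show ?thesis
    using plane_foliation_Omega brunella_plane_model nodal_cubic_cubic tangent_Var_cubic foliation_unique de_jonquieres_J4
      J4_not_one J4_involution bir_aut_J_fol by blast
qed

end
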